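(* Let $Z$ be a geometrically integral scheme of finite type over $K$ and $P\in Z$ a closed point. Suppose that $x_1,\ldots,x_l\in\mathcal{O}_{Z,P}$ and $a_1,\ldots,a_l\in\mathbf{k}(Z,P)$ are such that the classes of $x_1-a_1,\ldots,x_l-a_l$ form a basis of the $\overline{K}$-vector space $$\frac{\mathfrak{m}_{Z^{\overline{K}},P^{\overline{K}}}}{\mathfrak{m}_{Z^{\overline{K}},P^{\overline{K}}}^2+\overline{K}\,\mathfrak{m}_{Z,P}}.$$ Then $\mathbf{k}(Z,P)=K(a_1,\ldots,a_l)$. Moreover $da_1,\ldots,da_l$ is a basis of $\Omega_{\mathbf{k}(Z,P)/K}$.
   Context: $K$ is a non-perfect, separably closed field of characteristic $p>0$ with algebraic closure $\overline{K}$. $\mathcal{O}_{Z,P}$, $\mathfrak{m}_{Z,P}$, $\mathbf{k}(Z,P)$ denote the local ring of $Z$ at $P$, its maximal ideal and its residue field. $Z^{\overline{K}}=Z\times_{\operatorname{Spec}K}\operatorname{Spec}\overline{K}$ and $P^{\overline{K}}$ is the unique point of $Z^{\overline{K}}$ lying over $P$; $\mathcal{O}_{Z^{\overline{K}},P^{\overline{K}}}=\overline{K}\mathcal{O}_{Z,P}$ (that is, $\mathcal{O}_{Z,P}\otimes_K\overline{K}$) contains $\mathcal{O}_{Z,P}$ and $\overline{K}$. The field $\mathbf{k}(Z,P)$ is regarded as a subfield of $\overline{K}$, the residue field at $P^{\overline{K}}$, so that $x_i-a_i$ makes sense in $\mathcal{O}_{Z^{\overline{K}},P^{\overline{K}}}$.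 *)

theory Defs
  imports "HOL-Algebra.Algebra" "HOL-Algebra.Algebraic_Closure" "HOL-Analysis.Abstract_Topology"
begin

section \<open>The ground field\<close>

definition separable_element :: "('l, 'm) ring_scheme \<Rightarrow> 'l set \<Rightarrow> 'l \<Rightarrow> bool" where
  "separable_element L K x \<longleftrightarrow>
     (\<forall>a\<in>carrier L. ring.alg_mult L (ring.Irr L K x) a \<le> 1)"

text \<open>For \<open>L\<close> an algebraic closure of \<open>K\<close>: the only separable algebraic extension of \<open>K\<close> is \<open>K\<close>.\<close>

definition separably_closed_in :: "('l, 'm) ring_scheme \<Rightarrow> 'l set \<Rightarrow> bool" where
  "separably_closed_in L K \<longleftrightarrow> (\<forall>x\<in>carrier L. separable_element L K x \<longrightarrow> x \<in> K)"

definition perfect_subfield :: "('l, 'm) ring_scheme \<Rightarrow> nat \<Rightarrow> 'l set \<Rightarrow> bool" where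
  "perfect_subfield L p K \<longleftrightarrow> (\<forall>c\<in>K. \<exists>b\<in>K. b [^]\<^bsub>L\<^esub> p = c)"

definition finitely_generated_algebra ::
    "('k, 'm) ring_scheme \<Rightarrow> ('a, 'n) ring_scheme \<Rightarrow> ('k \<Rightarrow> 'a) \<Rightarrow> bool" where
  "finitely_generated_algebra K A \<phi> \<longleftrightarrow>
     (\<exists>F. finite F \<and> F \<subseteq> carrier A \<and> generate_ring A (\<phi> ` carrier K \<union> F) = carrier A)"


section \<open>Modules\<close>

definition module_span :: "('r, 'm) ring_scheme \<Rightarrow> ('r, 'a, 'n) module_scheme \<Rightarrow> 'a set \<Rightarrow> 'a set" where
  "module_span R M E = \<Inter>{H. submodule H R M \<and> E \<subseteq> H}"

definition module_basis ::
    "('r, 'm) ring_scheme \<Rightarrow> ('r, 'a, 'n) module_scheme \<Rightarrow> nat \<Rightarrow> (nat \<Rightarrow> 'a) \<Rightarrow> bool" where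
  "module_basis R M l v \<longleftrightarrow>
     (\<forall>i<l. v i \<in> carrier M) \<and>
     (\<forall>c. (\<forall>i<l. c i \<in> carrier R) \<longrightarrow> (\<Oplus>\<^bsub>M\<^esub>i\<in>{..<l}. c i \<odot>\<^bsub>M\<^esub> v i) = \<zero>\<^bsub>M\<^esub>
            \<longrightarrow> (\<forall>i<l. c i = \<zero>\<^bsub>R\<^esub>)) \<and>
     (\<forall>m\<in>carrier M. \<exists>c. (\<forall>i<l. c i \<in> carrier R) \<and> m = (\<Oplus>\<^bsub>M\<^esub>i\<in>{..<l}. c i \<odot>\<^bsub>M\<^esub> v i))"

text \<open>The fields \<open>mult\<close> and \<open>one\<close> of a \<open>module\<close> record carry no meaning for a mere module.\<close>

definition quotient_module ::
    "('r, 'a, 'n) module_scheme \<Rightarrow> 'a set \<Rightarrow> ('r, 'a set) module" where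
  "quotient_module M N =
     \<lparr>carrier = a_rcosets\<^bsub>M\<^esub> N, monoid.mult = (\<lambda>_ _. undefined), monoid.one = undefined,
      ring.zero = N, ring.add = set_add M,
      smult = (\<lambda>r C. \<Union>y\<in>C. N +>\<^bsub>M\<^esub> (r \<odot>\<^bsub>M\<^esub> y))\<rparr>"

definition free_module :: "('r, 'm) ring_scheme \<Rightarrow> 'x set \<Rightarrow> ('r, 'x \<Rightarrow> 'r) module" where
  "free_module R E =
     \<lparr>carrier = {f. finite {x. f x \<noteq> \<zero>\<^bsub>R\<^esub>} \<and> (\<forall>x\<in>E. f x \<in> carrier R) \<and> (\<forall>x. x \<notin> E \<longrightarrow> f x = \<zero>\<^bsub>R\<^esub>)},
      monoid.mult = (\<lambda>_ _. undefined), monoid.one = undefined,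
      ring.zero = (\<lambda>_. \<zero>\<^bsub>R\<^esub>), ring.add = (\<lambda>f g x. f x \<oplus>\<^bsub>R\<^esub> g x),
      smult = (\<lambda>r f x. r \<otimes>\<^bsub>R\<^esub> f x)\<rparr>"

definition free_gen :: "('r, 'm) ring_scheme \<Rightarrow> 'x \<Rightarrow> 'x \<Rightarrow> 'r" where
  "free_gen R x = (\<lambda>y. if y = x then \<one>\<^bsub>R\<^esub> else \<zero>\<^bsub>R\<^esub>)"

text \<open>A ring \<open>S\<close> regarded as an \<open>R\<close>-module through a homomorphism \<open>\<psi>\<close> from \<open>R\<close> to \<open>S\<close>.\<close>

definition restrict_scalars :: "('s, 'n) ring_scheme \<Rightarrow> ('r \<Rightarrow> 's) \<Rightarrow> ('r, 's) module" where
  "restrict_scalars S \<psi> =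
     \<lparr>carrier = carrier S, monoid.mult = monoid.mult S, monoid.one = monoid.one S,
      ring.zero = ring.zero S, ring.add = ring.add S,
      smult = (\<lambda>r s. \<psi> r \<otimes>\<^bsub>S\<^esub> s)\<rparr>"


section \<open>Tensor products of algebras\<close>

text \<open>The product of the monoid algebra is convolution, so that generators multiply as in \<open>G\<close>.\<close>

definition monoid_algebra ::
    "('k, 'm) ring_scheme \<Rightarrow> ('g, 'n) monoid_scheme \<Rightarrow> ('k, 'g \<Rightarrow> 'k) module" where
  "monoid_algebra K G = (free_module K (carrier G))
     \<lparr>monoid.mult := (\<lambda>f g z. \<Oplus>\<^bsub>K\<^esub>q\<in>{(x, y). f x \<noteq> \<zero>\<^bsub>K\<^esub> \<and> g y \<noteq> \<zero>\<^bsub>K\<^esub> \<and> x \<otimes>\<^bsub>G\<^esub> y = z}.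
                 f (fst q) \<otimes>\<^bsub>K\<^esub> g (snd q)),
      monoid.one := free_gen K \<one>\<^bsub>G\<^esub>\<rparr>"

text \<open>For \<open>K\<close>-algebras \<open>A\<close>, \<open>B\<close> with structure homomorphisms \<open>\<phi>\<close>, \<open>\<psi>\<close>, the tensor product is the
  quotient of the free \<open>K\<close>-module on \<open>A \<times> B\<close> by the bilinearity relations. The relations are stable
  under multiplication by generators, so the ideal they generate is also their \<open>K\<close>-linear span.\<close>

definition tensor_relations ::
    "('k, 'm) ring_scheme \<Rightarrow> ('a, 'n) ring_scheme \<Rightarrow> ('k \<Rightarrow> 'a) \<Rightarrow> ('b, 'o) ring_scheme \<Rightarrow> ('k \<Rightarrow> 'b)
      \<Rightarrow> ('a \<times> 'b \<Rightarrow> 'k) set" where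
  "tensor_relations K A \<phi> B \<psi> =
     (let F = monoid_algebra K (A \<times>\<times> B); e = (\<lambda>a b. free_gen K (a, b)) in
        {e (a \<oplus>\<^bsub>A\<^esub> a') b \<ominus>\<^bsub>F\<^esub> (e a b \<oplus>\<^bsub>F\<^esub> e a' b) | a a' b.
            a \<in> carrier A \<and> a' \<in> carrier A \<and> b \<in> carrier B}
      \<union> {e a (b \<oplus>\<^bsub>B\<^esub> b') \<ominus>\<^bsub>F\<^esub> (e a b \<oplus>\<^bsub>F\<^esub> e a b') | a b b'.
            a \<in> carrier A \<and> b \<in> carrier B \<and> b' \<in> carrier B}
      \<union> {e (\<phi> c \<otimes>\<^bsub>A\<^esub> a) b \<ominus>\<^bsub>F\<^esub> (c \<odot>\<^bsub>F\<^esub> e a b) | a b c.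
            a \<in> carrier A \<and> b \<in> carrier B \<and> c \<in> carrier K}
      \<union> {e a (\<psi> c \<otimes>\<^bsub>B\<^esub> b) \<ominus>\<^bsub>F\<^esub> (c \<odot>\<^bsub>F\<^esub> e a b) | a b c.
            a \<in> carrier A \<and> b \<in> carrier B \<and> c \<in> carrier K})"

definition tensor_ideal ::
    "('k, 'm) ring_scheme \<Rightarrow> ('a, 'n) ring_scheme \<Rightarrow> ('k \<Rightarrow> 'a) \<Rightarrow> ('b, 'o) ring_scheme \<Rightarrow> ('k \<Rightarrow> 'b)
      \<Rightarrow> ('a \<times> 'b \<Rightarrow> 'k) set" where
  "tensor_ideal K A \<phi> B \<psi> = genideal (monoid_algebra K (A \<times>\<times> B)) (tensor_relations K A \<phi> B \<psi>)"

definition tensor_product ::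
    "('k, 'm) ring_scheme \<Rightarrow> ('a, 'n) ring_scheme \<Rightarrow> ('k \<Rightarrow> 'a) \<Rightarrow> ('b, 'o) ring_scheme \<Rightarrow> ('k \<Rightarrow> 'b)
      \<Rightarrow> (('a \<times> 'b \<Rightarrow> 'k) set) ring" where
  "tensor_product K A \<phi> B \<psi> = monoid_algebra K (A \<times>\<times> B) Quot tensor_ideal K A \<phi> B \<psi>"

definition pure_tensor ::
    "('k, 'm) ring_scheme \<Rightarrow> ('a, 'n) ring_scheme \<Rightarrow> ('k \<Rightarrow> 'a) \<Rightarrow> ('b, 'o) ring_scheme \<Rightarrow> ('k \<Rightarrow> 'b)
      \<Rightarrow> 'a \<Rightarrow> 'b \<Rightarrow> ('a \<times> 'b \<Rightarrow> 'k) set" where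
  "pure_tensor K A \<phi> B \<psi> a b =
     tensor_ideal K A \<phi> B \<psi> +>\<^bsub>monoid_algebra K (A \<times>\<times> B)\<^esub> free_gen K (a, b)"


section \<open>Kaehler differentials\<close>

text \<open>The \<open>B\<close>-module of differentials of \<open>B\<close> over \<open>A\<close> along \<open>\<phi>\<close>: generators \<open>d b\<close>, subject to
  additivity, the Leibniz rule and \<open>d (\<phi> a) = 0\<close>.\<close>

definition kaehler_relations ::
    "('a, 'm) ring_scheme \<Rightarrow> ('b, 'n) ring_scheme \<Rightarrow> ('a \<Rightarrow> 'b) \<Rightarrow> ('b \<Rightarrow> 'b) set" where
  "kaehler_relations A B \<phi> =
     (let F = free_module B (carrier B); e = free_gen B in
        {e (b \<oplus>\<^bsub>B\<^esub> b') \<ominus>\<^bsub>F\<^esub> (e b \<oplus>\<^bsub>F\<^esub> e b') | b b'. b \<in> carrier B \<and> b' \<in> carrier B}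
      \<union> {e (b \<otimes>\<^bsub>B\<^esub> b') \<ominus>\<^bsub>F\<^esub> (b \<odot>\<^bsub>F\<^esub> e b' \<oplus>\<^bsub>F\<^esub> b' \<odot>\<^bsub>F\<^esub> e b) | b b'.
            b \<in> carrier B \<and> b' \<in> carrier B}
      \<union> {e (\<phi> a) | a. a \<in> carrier A})"

definition kaehler_module ::
    "('a, 'm) ring_scheme \<Rightarrow> ('b, 'n) ring_scheme \<Rightarrow> ('a \<Rightarrow> 'b) \<Rightarrow> ('b, ('b \<Rightarrow> 'b) set) module" where
  "kaehler_module A B \<phi> =
     quotient_module (free_module B (carrier B))
       (module_span B (free_module B (carrier B)) (kaehler_relations A B \<phi>))"

definition kaehler_d ::
    "('a, 'm) ring_scheme \<Rightarrow> ('b, 'n) ring_scheme \<Rightarrow> ('a \<Rightarrow> 'b) \<Rightarrow> 'b \<Rightarrow> ('b \<Rightarrow> 'b) set" where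
  "kaehler_d A B \<phi> b =
     module_span B (free_module B (carrier B)) (kaehler_relations A B \<phi>)
       +>\<^bsub>free_module B (carrier B)\<^esub> free_gen B b"


section \<open>Local rings\<close>

definition local_ring :: "('a, 'm) ring_scheme \<Rightarrow> bool" where
  "local_ring R \<longleftrightarrow> cring R \<and> (\<exists>!m. maximalideal m R)"

definition max_ideal :: "('a, 'm) ring_scheme \<Rightarrow> 'a set" where
  "max_ideal R = (THE m. maximalideal m R)"

definition residue_field :: "('a, 'm) ring_scheme \<Rightarrow> ('a set) ring" where
  "residue_field R = R Quot max_ideal R"

definition residue_class :: "('a, 'm) ring_scheme \<Rightarrow> 'a \<Rightarrow> 'a set" where
  "residue_class R r = max_ideal R +>\<^bsub>R\<^esub> r"


section \<open>Ringed spaces\<close>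

record ('z, 'b) ringed_space =
  pts :: "'z topology"
  sections :: "'z set \<Rightarrow> 'b ring"
  restr :: "'z set \<Rightarrow> 'z set \<Rightarrow> 'b \<Rightarrow> 'b"  \<comment> \<open>\<open>restr Z U V\<close> restricts from \<open>U\<close> to \<open>V \<subseteq> U\<close>\<close>

abbreviation points :: "('z, 'b) ringed_space \<Rightarrow> 'z set" where
  "points Z \<equiv> topspace (pts Z)"

locale ringed_space =
  fixes Z :: "('z, 'b) ringed_space"
  assumes sections_cring: "openin (pts Z) U \<Longrightarrow> cring (sections Z U)"
    and restr_hom: "\<lbrakk>openin (pts Z) U; openin (pts Z) V; V \<subseteq> U\<rbrakk>
          \<Longrightarrow> restr Z U V \<in> ring_hom (sections Z U) (sections Z V)"
    and restr_refl: "\<lbrakk>openin (pts Z) U; s \<in> carrier (sections Z U)\<rbrakk> \<Longrightarrow> restr Z U U s = s"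
    and restr_trans: "\<lbrakk>openin (pts Z) U; openin (pts Z) V; openin (pts Z) W; W \<subseteq> V; V \<subseteq> U;
            s \<in> carrier (sections Z U)\<rbrakk>
          \<Longrightarrow> restr Z V W (restr Z U V s) = restr Z U W s"
    and locality: "\<lbrakk>\<forall>U\<in>\<U>. openin (pts Z) U;
            s \<in> carrier (sections Z (\<Union>\<U>)); t \<in> carrier (sections Z (\<Union>\<U>));
            \<forall>U\<in>\<U>. restr Z (\<Union>\<U>) U s = restr Z (\<Union>\<U>) U t\<rbrakk> \<Longrightarrow> s = t"
    and gluing: "\<lbrakk>\<forall>U\<in>\<U>. openin (pts Z) U; \<forall>U\<in>\<U>. f U \<in> carrier (sections Z U);
            \<forall>U\<in>\<U>. \<forall>V\<in>\<U>. restr Z U (U \<inter> V) (f U) = restr Z V (U \<inter> V) (f V)\<rbrakk>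
          \<Longrightarrow> \<exists>s\<in>carrier (sections Z (\<Union>\<U>)). \<forall>U\<in>\<U>. restr Z (\<Union>\<U>) U s = f U"

definition germ :: "('z, 'b) ringed_space \<Rightarrow> 'z \<Rightarrow> 'z set \<Rightarrow> 'b \<Rightarrow> ('z set \<times> 'b) set" where
  "germ Z P U s = {(V, t). openin (pts Z) V \<and> P \<in> V \<and> t \<in> carrier (sections Z V) \<and>
     (\<exists>W. openin (pts Z) W \<and> P \<in> W \<and> W \<subseteq> U \<inter> V \<and> restr Z U W s = restr Z V W t)}"

text \<open>In \<open>stalk\<close>, as in \<open>local_fractions\<close> below, an operation on equivalence classes is the union of
  the classes obtained from all choices of representatives, which all coincide.\<close>

definition stalk :: "('z, 'b) ringed_space \<Rightarrow> 'z \<Rightarrow> (('z set \<times> 'b) set) ring" where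
  "stalk Z P =
     \<lparr>carrier = {germ Z P U s | U s. openin (pts Z) U \<and> P \<in> U \<and> s \<in> carrier (sections Z U)},
      monoid.mult = (\<lambda>G H. \<Union>(U, s)\<in>G. \<Union>(V, t)\<in>H.
        germ Z P (U \<inter> V) (restr Z U (U \<inter> V) s \<otimes>\<^bsub>sections Z (U \<inter> V)\<^esub> restr Z V (U \<inter> V) t)),
      monoid.one = germ Z P (points Z) \<one>\<^bsub>sections Z (points Z)\<^esub>,
      ring.zero = germ Z P (points Z) \<zero>\<^bsub>sections Z (points Z)\<^esub>,
      ring.add = (\<lambda>G H. \<Union>(U, s)\<in>G. \<Union>(V, t)\<in>H.
        germ Z P (U \<inter> V) (restr Z U (U \<inter> V) s \<oplus>\<^bsub>sections Z (U \<inter> V)\<^esub> restr Z V (U \<inter> V) t))\<rparr>"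

definition open_subspace :: "('z, 'b) ringed_space \<Rightarrow> 'z set \<Rightarrow> ('z, 'b) ringed_space" where
  "open_subspace Z U = Z\<lparr>pts := subtopology (pts Z) U\<rparr>"

definition preimage :: "('y, 'c) ringed_space \<Rightarrow> ('y \<Rightarrow> 'z) \<Rightarrow> 'z set \<Rightarrow> 'y set" where
  "preimage Y h U = {y \<in> points Y. h y \<in> U}"

definition ringed_space_iso :: "('y, 'c) ringed_space \<Rightarrow> ('z, 'b) ringed_space \<Rightarrow> bool" where
  "ringed_space_iso Y Z \<longleftrightarrow>
     (\<exists>h \<theta>. homeomorphic_map (pts Y) (pts Z) h \<and>
        (\<forall>U. openin (pts Z) U \<longrightarrow>
           \<theta> U \<in> ring_iso (sections Z U) (sections Y (preimage Y h U))) \<and>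
        (\<forall>U V. openin (pts Z) U \<longrightarrow> openin (pts Z) V \<longrightarrow> V \<subseteq> U \<longrightarrow>
           (\<forall>s\<in>carrier (sections Z U).
              \<theta> V (restr Z U V s) = restr Y (preimage Y h U) (preimage Y h V) (\<theta> U s))))"

text \<open>A morphism of locally ringed spaces from \<open>Y\<close> to \<open>Z\<close>; the last condition says that the induced
  maps on stalks are local.\<close>

definition lrs_morphism ::
    "('y, 'c) ringed_space \<Rightarrow> ('z, 'b) ringed_space \<Rightarrow> ('y \<Rightarrow> 'z) \<Rightarrow> ('z set \<Rightarrow> 'b \<Rightarrow> 'c) \<Rightarrow> bool" where
  "lrs_morphism Y Z h \<theta> \<longleftrightarrow>
     continuous_map (pts Y) (pts Z) h \<and>
     (\<forall>U. openin (pts Z) U \<longrightarrow>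
        \<theta> U \<in> ring_hom (sections Z U) (sections Y (preimage Y h U))) \<and>
     (\<forall>U V. openin (pts Z) U \<longrightarrow> openin (pts Z) V \<longrightarrow> V \<subseteq> U \<longrightarrow>
        (\<forall>s\<in>carrier (sections Z U).
           \<theta> V (restr Z U V s) = restr Y (preimage Y h U) (preimage Y h V) (\<theta> U s))) \<and>
     (\<forall>y\<in>points Y. \<forall>U s. openin (pts Z) U \<longrightarrow> h y \<in> U \<longrightarrow> s \<in> carrier (sections Z U) \<longrightarrow>
        germ Y y (preimage Y h U) (\<theta> U s) \<in> Units (stalk Y y) \<longrightarrow>
        germ Z (h y) U s \<in> Units (stalk Z (h y)))"


section \<open>Schemes\<close>

text \<open>\<open>fraction A p a b\<close> is the class of \<open>a / b\<close> in the localization of \<open>A\<close> at the prime \<open>p\<close>.\<close>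

definition fraction :: "('a, 'm) ring_scheme \<Rightarrow> 'a set \<Rightarrow> 'a \<Rightarrow> 'a \<Rightarrow> ('a \<times> 'a) set" where
  "fraction A p a b = {(c, d). c \<in> carrier A \<and> d \<in> carrier A - p \<and>
     (\<exists>u\<in>carrier A - p. u \<otimes>\<^bsub>A\<^esub> (a \<otimes>\<^bsub>A\<^esub> d) = u \<otimes>\<^bsub>A\<^esub> (c \<otimes>\<^bsub>A\<^esub> b))}"

definition local_fractions :: "('a, 'm) ring_scheme \<Rightarrow> 'a set \<Rightarrow> (('a \<times> 'a) set) ring" where
  "local_fractions A p =
     \<lparr>carrier = {fraction A p a b | a b. a \<in> carrier A \<and> b \<in> carrier A - p},
      monoid.mult = (\<lambda>x y. \<Union>(a, b)\<in>x. \<Union>(c, d)\<in>y. fraction A p (a \<otimes>\<^bsub>A\<^esub> c) (b \<otimes>\<^bsub>A\<^esub> d)),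
      monoid.one = fraction A p \<one>\<^bsub>A\<^esub> \<one>\<^bsub>A\<^esub>,
      ring.zero = fraction A p \<zero>\<^bsub>A\<^esub> \<one>\<^bsub>A\<^esub>,
      ring.add = (\<lambda>x y. \<Union>(a, b)\<in>x. \<Union>(c, d)\<in>y.
        fraction A p (a \<otimes>\<^bsub>A\<^esub> d \<oplus>\<^bsub>A\<^esub> c \<otimes>\<^bsub>A\<^esub> b) (b \<otimes>\<^bsub>A\<^esub> d))\<rparr>"

definition zariski_topology :: "('a, 'm) ring_scheme \<Rightarrow> 'a set topology" where
  "zariski_topology A =
     topology (\<lambda>U. \<exists>S\<subseteq>carrier A. U = {p. primeideal p A \<and> \<not> S \<subseteq> p})"

definition Spec :: "'a ring \<Rightarrow> ('a set, 'a set \<Rightarrow> ('a \<times> 'a) set) ringed_space" where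
  "Spec A =
     \<lparr>pts = zariski_topology A,
      sections = (\<lambda>U.
        \<lparr>carrier = {s \<in> extensional U. \<forall>p\<in>U. \<exists>V a b.
             openin (zariski_topology A) V \<and> p \<in> V \<and> V \<subseteq> U \<and> a \<in> carrier A \<and> b \<in> carrier A \<and>
             (\<forall>q\<in>V. b \<notin> q \<and> s q = fraction A q a b)},
         monoid.mult = (\<lambda>s t. \<lambda>q\<in>U. s q \<otimes>\<^bsub>local_fractions A q\<^esub> t q),
         monoid.one = (\<lambda>q\<in>U. \<one>\<^bsub>local_fractions A q\<^esub>),
         ring.zero = (\<lambda>q\<in>U. \<zero>\<^bsub>local_fractions A q\<^esub>),
         ring.add = (\<lambda>s t. \<lambda>q\<in>U. s q \<oplus>\<^bsub>local_fractions A q\<^esub> t q)\<rparr>),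
      restr = (\<lambda>U V s. restrict s V)\<rparr>"

text \<open>A ring whose spectrum is isomorphic to the open subspace \<open>U\<close> is isomorphic to the ring of
  sections over \<open>U\<close>; so it is no restriction that it ranges over rings of the same type.\<close>

definition affine_open :: "('z, 'b) ringed_space \<Rightarrow> 'z set \<Rightarrow> bool" where
  "affine_open Z U \<longleftrightarrow>
     openin (pts Z) U \<and> (\<exists>A :: 'b ring. cring A \<and> ringed_space_iso (open_subspace Z U) (Spec A))"

definition scheme :: "('z, 'b) ringed_space \<Rightarrow> bool" where
  "scheme Z \<longleftrightarrow> ringed_space Z \<and> (\<forall>P\<in>points Z. local_ring (stalk Z P)) \<and>
     (\<forall>P\<in>points Z. \<exists>U. affine_open Z U \<and> P \<in> U)"

definition integral_scheme :: "('z, 'b) ringed_space \<Rightarrow> bool" where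
  "integral_scheme Z \<longleftrightarrow> scheme Z \<and> points Z \<noteq> {} \<and>
     (\<forall>U. openin (pts Z) U \<longrightarrow> U \<noteq> {} \<longrightarrow> domain (sections Z U))"

text \<open>A morphism from \<open>Z\<close> to the spectrum of \<open>K\<close> is given by a homomorphism \<open>\<kappa>\<close> from \<open>K\<close> to the ring
  of global sections.\<close>

definition scheme_over ::
    "('k, 'm) ring_scheme \<Rightarrow> ('z, 'b) ringed_space \<Rightarrow> ('k \<Rightarrow> 'b) \<Rightarrow> bool" where
  "scheme_over K Z \<kappa> \<longleftrightarrow> scheme Z \<and> \<kappa> \<in> ring_hom K (sections Z (points Z))"

definition structure_map :: "('z, 'b) ringed_space \<Rightarrow> ('k \<Rightarrow> 'b) \<Rightarrow> 'z set \<Rightarrow> 'k \<Rightarrow> 'b" where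
  "structure_map Z \<kappa> U c = restr Z (points Z) U (\<kappa> c)"

definition finite_type ::
    "('k, 'm) ring_scheme \<Rightarrow> ('z, 'b) ringed_space \<Rightarrow> ('k \<Rightarrow> 'b) \<Rightarrow> bool" where
  "finite_type K Z \<kappa> \<longleftrightarrow>
     (\<exists>\<U>. finite \<U> \<and> \<Union>\<U> = points Z \<and>
        (\<forall>U\<in>\<U>. affine_open Z U \<and>
           finitely_generated_algebra K (sections Z U) (structure_map Z \<kappa> U)))"

text \<open>\<open>Y\<close>, an \<open>L\<close>-scheme through \<open>\<kappa>'\<close>, with the projection \<open>(h, \<theta>)\<close> to \<open>Z\<close>, is the base change of the
  \<open>K\<close>-scheme \<open>Z\<close> to the extension field \<open>L\<close> of \<open>K\<close>: over each affine open \<open>U\<close> of \<open>Z\<close> it is the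
  spectrum of the tensor product of the ring of sections over \<open>U\<close> with \<open>L\<close>.
  \<open>K\<close> is a subfield of \<open>L\<close>, whence the identity as structure map of \<open>L\<close>.\<close>

definition base_change ::
    "('l, 'm) ring_scheme \<Rightarrow> ('z, 'b) ringed_space \<Rightarrow> ('l \<Rightarrow> 'b) \<Rightarrow> ('l, 'n) ring_scheme
      \<Rightarrow> ('y, 'c) ringed_space \<Rightarrow> ('l \<Rightarrow> 'c) \<Rightarrow> ('y \<Rightarrow> 'z) \<Rightarrow> ('z set \<Rightarrow> 'b \<Rightarrow> 'c) \<Rightarrow> bool" where
  "base_change K Z \<kappa> L Y \<kappa>' h \<theta> \<longleftrightarrow>
     scheme_over K Z \<kappa> \<and> scheme_over L Y \<kappa>' \<and> lrs_morphism Y Z h \<theta> \<and>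
     (\<forall>c\<in>carrier K. \<theta> (points Z) (\<kappa> c) = \<kappa>' c) \<and>
     (\<forall>U. affine_open Z U \<longrightarrow>
        affine_open Y (preimage Y h U) \<and>
        (\<exists>f \<in> ring_iso (tensor_product K (sections Z U) (structure_map Z \<kappa> U) L (\<lambda>c. c))
                       (sections Y (preimage Y h U)).
           \<forall>s\<in>carrier (sections Z U). \<forall>c\<in>carrier L.
             f (pure_tensor K (sections Z U) (structure_map Z \<kappa> U) L (\<lambda>c. c) s c)
               = \<theta> U s \<otimes>\<^bsub>sections Y (preimage Y h U)\<^esub>
                 structure_map Y \<kappa>' (preimage Y h U) c))"

definition closed_point :: "('z, 'b) ringed_space \<Rightarrow> 'z \<Rightarrow> bool" where
  "closed_point Z P \<longleftrightarrow> P \<in> points Z \<and> closedin (pts Z) {P}"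


section \<open>The local ring after base change\<close>

definition stalk_map :: "('z, 'b) ringed_space \<Rightarrow> ('k \<Rightarrow> 'b) \<Rightarrow> 'z \<Rightarrow> 'k \<Rightarrow> ('z set \<times> 'b) set" where
  "stalk_map Z \<kappa> P c = germ Z P (points Z) (\<kappa> c)"

definition residue_field_map ::
    "('z, 'b) ringed_space \<Rightarrow> ('k \<Rightarrow> 'b) \<Rightarrow> 'z \<Rightarrow> 'k \<Rightarrow> ('z set \<times> 'b) set set" where
  "residue_field_map Z \<kappa> P c = residue_class (stalk Z P) (stalk_map Z \<kappa> P c)"

text \<open>The local ring of the base change of \<open>Z\<close> at the unique point over \<open>P\<close> is taken to be the tensor
  product of the local ring of \<open>Z\<close> at \<open>P\<close> with \<open>L\<close>. (When \<open>K\<close> is separably closed and \<open>L\<close> is an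
  algebraic closure, this tensor product is a local ring.)\<close>

definition bc_stalk ::
    "('l, 'm) ring_scheme \<Rightarrow> ('z, 'b) ringed_space \<Rightarrow> ('l \<Rightarrow> 'b) \<Rightarrow> ('l, 'n) ring_scheme \<Rightarrow> 'z
      \<Rightarrow> ((('z set \<times> 'b) set \<times> 'l \<Rightarrow> 'l) set) ring" where
  "bc_stalk K Z \<kappa> L P = tensor_product K (stalk Z P) (stalk_map Z \<kappa> P) L (\<lambda>c. c)"

definition from_stalk ::
    "('l, 'm) ring_scheme \<Rightarrow> ('z, 'b) ringed_space \<Rightarrow> ('l \<Rightarrow> 'b) \<Rightarrow> ('l, 'n) ring_scheme \<Rightarrow> 'z
      \<Rightarrow> ('z set \<times> 'b) set \<Rightarrow> (('z set \<times> 'b) set \<times> 'l \<Rightarrow> 'l) set" where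
  "from_stalk K Z \<kappa> L P x = pure_tensor K (stalk Z P) (stalk_map Z \<kappa> P) L (\<lambda>c. c) x \<one>\<^bsub>L\<^esub>"

definition from_scalar ::
    "('l, 'm) ring_scheme \<Rightarrow> ('z, 'b) ringed_space \<Rightarrow> ('l \<Rightarrow> 'b) \<Rightarrow> ('l, 'n) ring_scheme \<Rightarrow> 'z
      \<Rightarrow> 'l \<Rightarrow> (('z set \<times> 'b) set \<times> 'l \<Rightarrow> 'l) set" where
  "from_scalar K Z \<kappa> L P c = pure_tensor K (stalk Z P) (stalk_map Z \<kappa> P) L (\<lambda>c. c) \<one>\<^bsub>stalk Z P\<^esub> c"

text \<open>\<open>\<sigma>\<close> is the inclusion of the residue field at \<open>P\<close> into \<open>L\<close>, the latter identified with the residue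
  field of \<open>bc_stalk\<close>: an element of the local ring at \<open>P\<close> and the image under \<open>\<sigma>\<close> of its residue
  class have the same residue class in \<open>bc_stalk\<close>.\<close>

definition residue_inclusion ::
    "('l, 'm) ring_scheme \<Rightarrow> ('z, 'b) ringed_space \<Rightarrow> ('l \<Rightarrow> 'b) \<Rightarrow> ('l, 'n) ring_scheme \<Rightarrow> 'z
      \<Rightarrow> (('z set \<times> 'b) set set \<Rightarrow> 'l) \<Rightarrow> bool" where
  "residue_inclusion K Z \<kappa> L P \<sigma> \<longleftrightarrow>
     \<sigma> \<in> ring_hom (residue_field (stalk Z P)) L \<and>
     (\<forall>x\<in>carrier (stalk Z P).
        residue_class (bc_stalk K Z \<kappa> L P) (from_stalk K Z \<kappa> L P x) =
        residue_class (bc_stalk K Z \<kappa> L P)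
          (from_scalar K Z \<kappa> L P (\<sigma> (residue_class (stalk Z P) x))))"

definition bc_module ::
    "('l, 'm) ring_scheme \<Rightarrow> ('z, 'b) ringed_space \<Rightarrow> ('l \<Rightarrow> 'b) \<Rightarrow> ('l, 'n) ring_scheme \<Rightarrow> 'z
      \<Rightarrow> ('l, (('z set \<times> 'b) set \<times> 'l \<Rightarrow> 'l) set) module" where
  "bc_module K Z \<kappa> L P = restrict_scalars (bc_stalk K Z \<kappa> L P) (from_scalar K Z \<kappa> L P)"

definition bc_max_ideal_module ::
    "('l, 'm) ring_scheme \<Rightarrow> ('z, 'b) ringed_space \<Rightarrow> ('l \<Rightarrow> 'b) \<Rightarrow> ('l, 'n) ring_scheme \<Rightarrow> 'z
      \<Rightarrow> ('l, (('z set \<times> 'b) set \<times> 'l \<Rightarrow> 'l) set) module" where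
  "bc_max_ideal_module K Z \<kappa> L P =
     (bc_module K Z \<kappa> L P)\<lparr>carrier := max_ideal (bc_stalk K Z \<kappa> L P)\<rparr>"

text \<open>The denominator: the square of the maximal ideal of \<open>bc_stalk\<close> plus the \<open>L\<close>-linear span of the
  maximal ideal of the local ring at \<open>P\<close>.\<close>

definition bc_denominator ::
    "('l, 'm) ring_scheme \<Rightarrow> ('z, 'b) ringed_space \<Rightarrow> ('l \<Rightarrow> 'b) \<Rightarrow> ('l, 'n) ring_scheme \<Rightarrow> 'z
      \<Rightarrow> (('z set \<times> 'b) set \<times> 'l \<Rightarrow> 'l) set set" where
  "bc_denominator K Z \<kappa> L P =
     (max_ideal (bc_stalk K Z \<kappa> L P) \<cdot>\<^bsub>bc_stalk K Z \<kappa> L P\<^esub> max_ideal (bc_stalk K Z \<kappa> L P))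
     <+>\<^bsub>bc_stalk K Z \<kappa> L P\<^esub>
     module_span L (bc_module K Z \<kappa> L P) (from_stalk K Z \<kappa> L P ` max_ideal (stalk Z P))"

definition relative_cotangent_space ::
    "('l, 'm) ring_scheme \<Rightarrow> ('z, 'b) ringed_space \<Rightarrow> ('l \<Rightarrow> 'b) \<Rightarrow> ('l, 'n) ring_scheme \<Rightarrow> 'z
      \<Rightarrow> ('l, (('z set \<times> 'b) set \<times> 'l \<Rightarrow> 'l) set set) module" where
  "relative_cotangent_space K Z \<kappa> L P =
     quotient_module (bc_max_ideal_module K Z \<kappa> L P) (bc_denominator K Z \<kappa> L P)"

definition cotangent_class ::
    "('l, 'm) ring_scheme \<Rightarrow> ('z, 'b) ringed_space \<Rightarrow> ('l \<Rightarrow> 'b) \<Rightarrow> ('l, 'n) ring_scheme \<Rightarrow> 'z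
      \<Rightarrow> (('z set \<times> 'b) set \<times> 'l \<Rightarrow> 'l) set \<Rightarrow> (('z set \<times> 'b) set \<times> 'l \<Rightarrow> 'l) set set" where
  "cotangent_class K Z \<kappa> L P y =
     bc_denominator K Z \<kappa> L P +>\<^bsub>bc_max_ideal_module K Z \<kappa> L P\<^esub> y"

end

theory Submission
  imports Defs
begin

text \<open>Let \<open>O\<close> be the local ring at \<open>P\<close>, with maximal ideal \<open>m\<close> and residue field \<open>k\<close>, regarded as a subfield of
  the algebraic closure \<open>L\<close> of \<open>K\<close>. Let \<open>B\<close> be the tensor product of \<open>O\<close> with \<open>L\<close> over \<open>K\<close>. As \<open>L\<close> is purely
  inseparable over \<open>K\<close>, some power with exponent \<open>p ^ j\<close> of any element of \<open>B\<close> comes from \<open>O\<close>, so \<open>B\<close> is local; let \<open>n\<close> be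
  its maximal ideal and \<open>D\<close> the sum of the square of \<open>n\<close> and the \<open>L\<close>-span of \<open>m\<close>. For \<open>x\<close> in \<open>O\<close> with residue
  \<open>r x\<close>, put \<open>\<delta> x = x - r x\<close>. The \<open>\<delta> x\<close> span \<open>n\<close> over \<open>L\<close>, and \<open>r x \<mapsto> \<delta> x\<close> is a \<open>K\<close>-derivation from \<open>k\<close> to
  \<open>n / D\<close>. The hypothesis forces \<open>a\<^sub>i = r x\<^sub>i\<close>, so the linear map from the differentials to \<open>n / D\<close> takes
  \<open>d a\<^sub>i\<close> to the class of \<open>\<delta> x\<^sub>i\<close>, and the \<open>d a\<^sub>i\<close> are independent.

  Conversely, modulo its square \<open>n\<close> is generated by \<open>m\<close> and the \<open>\<delta> x\<^sub>i\<close>. Since \<open>O\<close> is a localization of a finitely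
  generated \<open>K\<close>-algebra, \<open>n\<close> is finitely generated modulo \<open>m B\<close>, and Nakayama's lemma shows that \<open>m\<close> and the
  \<open>\<delta> x\<^sub>i\<close> generate the ideal \<open>n\<close>. A functional on \<open>L\<close> linear over \<open>k0 = K(a\<^sub>1, \<dots>, a\<^sub>l)\<close> then shows that
  \<open>k = k0\<close>: this is descent along the extension from \<open>k0\<close> to \<open>L\<close>. Hence the \<open>d a\<^sub>i\<close> span the differentials.\<close>

section \<open>Linear functionals\<close>

text \<open>The two summands of \<open>D\<close> are exactly the two defects of
  \<open>r x \<mapsto> \<delta> x\<close> as a derivation on \<open>k\<close>. On \<open>m\<close>,
  where \<open>r\<close> vanishes, \<open>\<delta> x\<close> is \<open>x\<close> itself and not
  zero; and the Leibniz rule fails by the product of \<open>\<delta> x\<close> and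
  \<open>\<delta> y\<close>, which lies in the square of \<open>n\<close>. The residue field acts on
  \<open>n / D\<close> through its embedding into \<open>L\<close>, so independence over
  \<open>L\<close> gives independence over \<open>k\<close>.

  For the descent, reduction modulo \<open>m\<close> turns \<open>B\<close> into the tensor product
  of \<open>k\<close> and \<open>L\<close> over \<open>K\<close>, and killing the ideal generated by
  the elements \<open>\<delta> x_i\<close> replaces \<open>K\<close> by \<open>k0\<close>. If these
  elements and \<open>m\<close> already generate \<open>n\<close>, the tensor product of
  \<open>k\<close> and \<open>L\<close> over \<open>k0\<close> is \<open>L\<close> itself, which
  forces \<open>k = k0\<close>. The functional expresses this with elements of \<open>B\<close>,
  which is accessible only through pure tensors and maps out of it.

  The finiteness in Nakayama's lemma rests on the sum, product and quotient rules for
  \<open>\<delta>\<close>: the values of \<open>\<delta>\<close> at algebra generators control its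
  values on the whole localization.\<close>

lemma submodule_zero_closed: "submodule N R M \<Longrightarrow> \<zero>\<^bsub>M\<^esub> \<in> N"
  using subgroup.one_closed[OF submodule.axioms(1)] by fastforce

text \<open>By Zorn's lemma there is a submodule \<open>V\<close> maximal among those containing
  \<open>W\<close> and missing \<open>y\<close>. It is a complement of the line through
  \<open>y\<close>, and the functional reads off the coefficient of \<open>y\<close> modulo
  \<open>V\<close>. It is used with \<open>W\<close> zero to separate \<open>1\<close> from
  \<open>0\<close>, and with \<open>W\<close> a subfield for the descent.\<close>

lemma exists_linear_functional:
  fixes R (structure) and M (structure)
  assumes R: "field R" and M: "module R M" and W: "submodule W R M"
    and y: "y \<in> carrier M" "y \<notin> W"
  shows "\<exists>f \<in> carrier M \<rightarrow> carrier R.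
     (\<forall>u\<in>carrier M. \<forall>v\<in>carrier M. f (u \<oplus>\<^bsub>M\<^esub> v) = f u \<oplus>\<^bsub>R\<^esub> f v) \<and>
     (\<forall>r\<in>carrier R. \<forall>u\<in>carrier M. f (r \<odot>\<^bsub>M\<^esub> u) = r \<otimes>\<^bsub>R\<^esub> f u) \<and>
     (\<forall>w\<in>W. f w = \<zero>\<^bsub>R\<^esub>) \<and> f y = \<one>\<^bsub>R\<^esub>"
proof -
  interpret field R by (rule R)
  interpret M: module R M by (rule M)
  define S where "S = {V. submodule V R M \<and> W \<subseteq> V \<and> y \<notin> V}"
  have "W \<in> S" using W y by (auto simp: S_def)
  moreover have "\<Union>C \<in> S" if C: "C \<noteq> {}" "subset.chain S C" for C
  proof -
    have sub: "submodule V R M" "W \<subseteq> V" "y \<notin> V" if "V \<in> C" for V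
      using C that by (auto simp: S_def subset.chain_def)
    have tot: "V \<subseteq> V' \<or> V' \<subseteq> V" if "V \<in> C" "V' \<in> C" for V V'
      using C that by (auto simp: subset.chain_def)
    have "submodule (\<Union>C) R M"
    proof (rule M.submoduleI)
      show "\<Union>C \<subseteq> carrier M" using sub(1) M.submoduleE(1) by blast
      obtain V where "V \<in> C" using C by blast
      then show "\<zero>\<^bsub>M\<^esub> \<in> \<Union>C" using sub(1) submodule_zero_closed by blast
      show "\<ominus>\<^bsub>M\<^esub> a \<in> \<Union>C" if "a \<in> \<Union>C" for a using that sub(1) M.submoduleE(3) by blast
      show "r \<odot>\<^bsub>M\<^esub> a \<in> \<Union>C" if "r \<in> carrier R" "a \<in> \<Union>C" for r a using that sub(1) M.submoduleE(4) by blast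
      show "a \<oplus>\<^bsub>M\<^esub> b \<in> \<Union>C" if "a \<in> \<Union>C" "b \<in> \<Union>C" for a b
      proof -
        obtain V V' where V: "a \<in> V" "V \<in> C" "b \<in> V'" "V' \<in> C" using \<open>a \<in> \<Union>C\<close> \<open>b \<in> \<Union>C\<close> by blast
        then consider "a \<in> V'" | "b \<in> V" using tot[of V V'] by blast
        then show ?thesis using V sub(1) M.submoduleE(5) by cases blast+
      qed
    qed
    then show ?thesis using C sub unfolding S_def by blast
  qed
  ultimately obtain V where V: "V \<in> S" and max: "\<And>T. T \<in> S \<Longrightarrow> V \<subseteq> T \<Longrightarrow> T = V"
    using subset_Zorn_nonempty[of S] by blast
  have sV: "submodule V R M" and WV: "W \<subseteq> V" and yV: "y \<notin> V" using V by (auto simp: S_def)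
  note VE = M.submoduleE[OF sV]
  have V0: "\<zero>\<^bsub>M\<^esub> \<in> V" using sV by (rule submodule_zero_closed)
  have m0 [simp]: "\<ominus>\<^bsub>M\<^esub> \<zero>\<^bsub>M\<^esub> = \<zero>\<^bsub>M\<^esub>"
    using M.M.r_neg[OF M.M.zero_closed] by simp
  \<comment> \<open>For \<open>z\<close> outside \<open>V\<close>, maximality puts \<open>y\<close>
    into \<open>V'\<close>, the sum of \<open>V\<close> and the line through \<open>z\<close>. The
    coefficient of \<open>z\<close> in \<open>y\<close> is nonzero because \<open>y\<close> is not
    in \<open>V\<close>, so the equation can be solved for \<open>z\<close>.\<close>
  have ex: "\<exists>r\<in>carrier R. z \<ominus>\<^bsub>M\<^esub> r \<odot>\<^bsub>M\<^esub> y \<in> V" if z: "z \<in> carrier M" for z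
  proof (cases "z \<in> V")
    case True
    then show ?thesis using y z by (intro bexI[of _ "\<zero>\<^bsub>R\<^esub>"]) (auto simp: a_minus_def)
  next
    case False
    define V' where "V' = {v \<oplus>\<^bsub>M\<^esub> r \<odot>\<^bsub>M\<^esub> z | v r. v \<in> V \<and> r \<in> carrier R}"
    have memV': "v \<oplus>\<^bsub>M\<^esub> r \<odot>\<^bsub>M\<^esub> z \<in> V'" if "v \<in> V" "r \<in> carrier R" for v r
      using that by (auto simp: V'_def)
    have "submodule V' R M"
    proof (rule M.submoduleI)
      show "V' \<subseteq> carrier M" using VE(1) z by (auto simp: V'_def)
      show "\<zero>\<^bsub>M\<^esub> \<in> V'" using memV'[OF V0 zero_closed] z by simp
      show "\<ominus>\<^bsub>M\<^esub> a \<in> V'" if a: "a \<in> V'" for a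
      proof -
        obtain v r where vr: "a = v \<oplus>\<^bsub>M\<^esub> r \<odot>\<^bsub>M\<^esub> z" "v \<in> V" "r \<in> carrier R" using a by (auto simp: V'_def)
        have "\<ominus>\<^bsub>M\<^esub> a = \<ominus>\<^bsub>M\<^esub> v \<oplus>\<^bsub>M\<^esub> (\<ominus> r) \<odot>\<^bsub>M\<^esub> z"
          using vr z VE(1) by (auto simp: M.minus_add M.smult_l_minus)
        then show ?thesis using memV' VE(3) vr by auto
      qed
      show "a \<oplus>\<^bsub>M\<^esub> b \<in> V'" if ab: "a \<in> V'" "b \<in> V'" for a b
      proof -
        obtain v r v' r' where vr: "a = v \<oplus>\<^bsub>M\<^esub> r \<odot>\<^bsub>M\<^esub> z" "v \<in> V" "r \<in> carrier R"
          "b = v' \<oplus>\<^bsub>M\<^esub> r' \<odot>\<^bsub>M\<^esub> z" "v' \<in> V" "r' \<in> carrier R" using ab by (auto simp: V'_def)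
        have "a \<oplus>\<^bsub>M\<^esub> b = (v \<oplus>\<^bsub>M\<^esub> v') \<oplus>\<^bsub>M\<^esub> (r \<oplus> r') \<odot>\<^bsub>M\<^esub> z"
          using vr z VE(1) by (simp add: M.smult_l_distr subset_iff M.a_ac)
        then show ?thesis using memV' VE(5) vr by auto
      qed
      show "c \<odot>\<^bsub>M\<^esub> a \<in> V'" if a: "c \<in> carrier R" "a \<in> V'" for c a
      proof -
        obtain v r where vr: "a = v \<oplus>\<^bsub>M\<^esub> r \<odot>\<^bsub>M\<^esub> z" "v \<in> V" "r \<in> carrier R" using a by (auto simp: V'_def)
        have "c \<odot>\<^bsub>M\<^esub> a = c \<odot>\<^bsub>M\<^esub> v \<oplus>\<^bsub>M\<^esub> (c \<otimes> r) \<odot>\<^bsub>M\<^esub> z"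
          using vr z VE(1) a by (auto simp: M.smult_r_distr M.smult_assoc1 subset_iff)
        then show ?thesis using memV' VE(4) vr a by auto
      qed
    qed
    moreover have "V \<subseteq> V'"
    proof
      fix v assume v: "v \<in> V"
      then have "v \<in> carrier M" using VE(1) by blast
      then show "v \<in> V'" using memV'[OF v zero_closed] z v by simp
    qed
    moreover have "z \<in> V'" using memV'[OF V0 one_closed] z by simp
    ultimately have "y \<in> V'" using max[of V'] False WV unfolding S_def by blast
    then obtain v r where vr: "y = v \<oplus>\<^bsub>M\<^esub> r \<odot>\<^bsub>M\<^esub> z" "v \<in> V" "r \<in> carrier R"
      by (auto simp: V'_def)
    have vM: "v \<in> carrier M" using vr VE(1) by blast
    have "r \<noteq> \<zero>" using vr yV z vM by auto
    then have r: "r \<in> Units R" using vr field_Units by blast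
    let ?s = "inv r"
    have s: "?s \<in> carrier R" using r by blast
    have "?s \<odot>\<^bsub>M\<^esub> y = ?s \<odot>\<^bsub>M\<^esub> v \<oplus>\<^bsub>M\<^esub> z"
      using vr s z vM r by (simp add: M.smult_r_distr M.smult_assoc1[symmetric])
    then have "z \<ominus>\<^bsub>M\<^esub> ?s \<odot>\<^bsub>M\<^esub> y = (\<ominus>\<^bsub>M\<^esub> (?s \<odot>\<^bsub>M\<^esub> v))"
      using z s vM by (simp add: a_minus_def M.minus_add M.a_ac M.r_neg1 M.r_neg2 M.r_neg)
    then show ?thesis using VE(3,4) s vr by (metis)
  qed
  have uniq: "r = r'" if "r \<in> carrier R" "r' \<in> carrier R" "z \<in> carrier M"
    "z \<ominus>\<^bsub>M\<^esub> r \<odot>\<^bsub>M\<^esub> y \<in> V" "z \<ominus>\<^bsub>M\<^esub> r' \<odot>\<^bsub>M\<^esub> y \<in> V" for r r' z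
  proof (rule ccontr)
    assume ne: "r \<noteq> r'"
    have "(z \<ominus>\<^bsub>M\<^esub> r' \<odot>\<^bsub>M\<^esub> y) \<oplus>\<^bsub>M\<^esub> \<ominus>\<^bsub>M\<^esub> (z \<ominus>\<^bsub>M\<^esub> r \<odot>\<^bsub>M\<^esub> y) \<in> V" using VE(3,5) that by blast
    also have "(z \<ominus>\<^bsub>M\<^esub> r' \<odot>\<^bsub>M\<^esub> y) \<oplus>\<^bsub>M\<^esub> \<ominus>\<^bsub>M\<^esub> (z \<ominus>\<^bsub>M\<^esub> r \<odot>\<^bsub>M\<^esub> y) = (r \<ominus> r') \<odot>\<^bsub>M\<^esub> y"
      using that y by (simp add: a_minus_def M.minus_add M.a_ac M.smult_l_distr M.smult_l_minus M.r_neg1 M.r_neg2 M.r_neg)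
    finally have *: "(r \<ominus> r') \<odot>\<^bsub>M\<^esub> y \<in> V" .
    have u: "r \<ominus> r' \<in> Units R" using ne that field_Units by auto
    then have "inv (r \<ominus> r') \<odot>\<^bsub>M\<^esub> ((r \<ominus> r') \<odot>\<^bsub>M\<^esub> y) \<in> V" using * VE(4) by blast
    then have "y \<in> V" using u y that by (simp add: M.smult_assoc1[symmetric])
    then show False using yV by blast
  qed
  obtain f where f: "\<And>z. z \<in> carrier M \<Longrightarrow> f z \<in> carrier R \<and> z \<ominus>\<^bsub>M\<^esub> f z \<odot>\<^bsub>M\<^esub> y \<in> V"
    using ex by metis
  have feq: "f z = r" if "r \<in> carrier R" "z \<in> carrier M" "z \<ominus>\<^bsub>M\<^esub> r \<odot>\<^bsub>M\<^esub> y \<in> V" for r z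
    using uniq f that by blast
  show ?thesis
  proof (intro bexI[of _ f] conjI ballI)
    show "f \<in> carrier M \<rightarrow> carrier R" using f by blast
    show "f (u \<oplus>\<^bsub>M\<^esub> v) = f u \<oplus> f v" if "u \<in> carrier M" "v \<in> carrier M" for u v
    proof (rule feq)
      have "(u \<oplus>\<^bsub>M\<^esub> v) \<ominus>\<^bsub>M\<^esub> (f u \<oplus> f v) \<odot>\<^bsub>M\<^esub> y = (u \<ominus>\<^bsub>M\<^esub> f u \<odot>\<^bsub>M\<^esub> y) \<oplus>\<^bsub>M\<^esub> (v \<ominus>\<^bsub>M\<^esub> f v \<odot>\<^bsub>M\<^esub> y)"
        using that f y by (simp add: a_minus_def M.minus_add M.a_ac M.smult_l_distr)
      then show "(u \<oplus>\<^bsub>M\<^esub> v) \<ominus>\<^bsub>M\<^esub> (f u \<oplus> f v) \<odot>\<^bsub>M\<^esub> y \<in> V" using f that VE(5) by auto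
    qed (use that f in auto)
    show "f (r \<odot>\<^bsub>M\<^esub> u) = r \<otimes> f u" if "r \<in> carrier R" "u \<in> carrier M" for r u
    proof (rule feq)
      have "(r \<odot>\<^bsub>M\<^esub> u) \<ominus>\<^bsub>M\<^esub> (r \<otimes> f u) \<odot>\<^bsub>M\<^esub> y = r \<odot>\<^bsub>M\<^esub> (u \<ominus>\<^bsub>M\<^esub> f u \<odot>\<^bsub>M\<^esub> y)"
        using that f y by (simp add: a_minus_def M.smult_r_distr M.smult_r_minus M.smult_assoc1)
      then show "(r \<odot>\<^bsub>M\<^esub> u) \<ominus>\<^bsub>M\<^esub> (r \<otimes> f u) \<odot>\<^bsub>M\<^esub> y \<in> V" using f that VE(4) by auto
    qed (use that f in auto)
    show "f w = \<zero>" if "w \<in> W" for w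
    proof (rule feq)
      have "w \<in> V" "w \<in> carrier M" using that WV VE(1) by blast+
      then show "w \<ominus>\<^bsub>M\<^esub> \<zero> \<odot>\<^bsub>M\<^esub> y \<in> V" "w \<in> carrier M" using y by (simp_all add: a_minus_def)
    qed simp
    show "f y = \<one>"
      by (rule feq) (use y V0 in \<open>auto simp: a_minus_def M.r_neg\<close>)
  qed
qed

section \<open>Algebraic elements over a separably closed field\<close>

text \<open>Polynomials are coefficient lists with the leading coefficient first; the head therefore
  belongs to the power whose exponent is the length of the tail.\<close>

lemma (in cring) eval_eq_finsum:
  assumes "set P \<subseteq> carrier R" "x \<in> carrier R"
  shows "eval P x = (\<Oplus>i\<in>{..<length P}. coeff P i \<otimes> x [^] i)"
  using assms(1)
proof (induction P)
  case Nil
  then show ?case by simp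
next
  case (Cons b P)
  have "(\<Oplus>i\<in>{..<length (b # P)}. coeff (b # P) i \<otimes> x [^] i)
      = (\<Oplus>i\<in>insert (length P) {..<length P}. coeff (b # P) i \<otimes> x [^] i)"
    by (simp add: lessThan_Suc)
  also have "\<dots> = b \<otimes> x [^] length P \<oplus> (\<Oplus>i\<in>{..<length P}. coeff (b # P) i \<otimes> x [^] i)"
    using Cons.prems assms(2) by (subst finsum_insert) auto
  also have "(\<Oplus>i\<in>{..<length P}. coeff (b # P) i \<otimes> x [^] i) = (\<Oplus>i\<in>{..<length P}. coeff P i \<otimes> x [^] i)"
    using Cons.prems assms(2) by (intro finsum_cong') auto
  finally show ?case using Cons by simp
qed

text \<open>The first factor is \<open>X - a\<close>. Only positive degrees are treated, since the
  derivative does not see the constant coefficient.\<close>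

lemma (in cring) coeff_linear_mult:
  assumes Q: "set Q \<subseteq> carrier R" and a: "a \<in> carrier R"
  shows "coeff (poly_mult [\<one>, \<ominus> a] Q) (Suc i) = coeff Q i \<ominus> a \<otimes> coeff Q (Suc i)"
proof -
  have c: "coeff (poly_mult [\<one>, \<ominus> a] Q) j = (\<Oplus>k\<in>{..j}. coeff [\<one>, \<ominus> a] k \<otimes> coeff Q (j - k))" for j
    using assms by (subst poly_mult_coeff) auto
  note cQ = coeff_in_carrier[OF Q]
  have "(\<Oplus>k\<in>{..Suc i}. coeff [\<one>, \<ominus> a] k \<otimes> coeff Q (Suc i - k))
      = (\<Oplus>k\<in>{0, 1}. coeff [\<one>, \<ominus> a] k \<otimes> coeff Q (Suc i - k))"
    using assms cQ by (intro add.finprod_mono_neutral_cong_right) auto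
  also have "\<dots> = coeff Q i \<ominus> a \<otimes> coeff Q (Suc i)"
    using assms cQ by (simp add: l_minus a_minus_def a_comm)
  finally show "coeff (poly_mult [\<one>, \<ominus> a] Q) (Suc i) = coeff Q i \<ominus> a \<otimes> coeff Q (Suc i)"
    unfolding c .
qed

text \<open>The sum is the formal derivative of \<open>P\<close> at \<open>a\<close>; at
  \<open>i = 0\<close> the truncated exponent \<open>i - 1\<close> is harmless because the term is
  multiplied by \<open>0\<close>. With \<open>P = (X - a) Q\<close> the derivative at
  \<open>a\<close> equals \<open>Q(a)\<close>, and this vanishes when the root is multiple.\<close>

lemma (in domain) multiple_root_imp_deriv_root:
  assumes P: "P \<in> carrier (poly_ring R)" and a: "a \<in> carrier R" and mult: "alg_mult P a > 1"
  shows "(\<Oplus>i\<in>{..<length P}. add_pow R i (coeff P i \<otimes> a [^] (i - 1))) = \<zero>"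
proof -
  interpret UP: domain "poly_ring R" using univ_poly_is_domain[OF carrier_is_subring] .
  let ?l = "[\<one>, \<ominus> a]"
  have l: "?l \<in> carrier (poly_ring R)" using a by (auto simp: univ_poly_carrier[symmetric] polynomial_def)
  have "(?l [^]\<^bsub>poly_ring R\<^esub> (2::nat)) pdivides P"
    using le_alg_mult_imp_pdivides[OF a P, of 2] mult by simp
  then obtain S where S: "S \<in> carrier (poly_ring R)" "P = (?l [^]\<^bsub>poly_ring R\<^esub> (2::nat)) \<otimes>\<^bsub>poly_ring R\<^esub> S"
    unfolding pdivides_def factor_def by blast
  define Q where "Q = ?l \<otimes>\<^bsub>poly_ring R\<^esub> S"
  have Qc: "Q \<in> carrier (poly_ring R)" using l S by (simp add: Q_def)
  have PQ: "P = ?l \<otimes>\<^bsub>poly_ring R\<^esub> Q"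
    using l S by (simp add: Q_def numeral_2_eq_2 UP.m_assoc)
  have setQ: "set Q \<subseteq> carrier R" and setP: "set P \<subseteq> carrier R"
    using Qc P by (auto simp: univ_poly_carrier[symmetric] polynomial_def)
  have "eval Q a = eval ?l a \<otimes> eval S a"
    using ring_hom_memE(2)[OF eval_is_hom[OF carrier_is_subring a] l S(1)] unfolding Q_def by simp
  also have "eval ?l a = \<zero>" using a by (simp add: r_neg)
  finally have Qa: "eval Q a = \<zero>"
    using S a eval_in_carrier[of S a] by (auto simp: univ_poly_carrier[symmetric] polynomial_def)
  note cQ [simp] = coeff_in_carrier[OF setQ] and cP [simp] = coeff_in_carrier[OF setP]
  have PS: "coeff P (Suc i) = coeff Q i \<ominus> a \<otimes> coeff Q (Suc i)" for i
    unfolding PQ univ_poly_mult using coeff_linear_mult[OF setQ a] by simp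
  let ?t = "\<lambda>i. add_pow R i (coeff P i \<otimes> a [^] (i - 1))"
  \<comment> \<open>Summation by parts: with \<open>q_i\<close> the coefficients of
    \<open>Q\<close>, the term of index \<open>i + 1\<close> is \<open>i + 1\<close> times the
    difference of \<open>q_i a^i\<close> and \<open>q_(i+1) a^(i+1)\<close>. What remains is a
    partial sum of \<open>Q(a)\<close> and one boundary term.\<close>
  have tele: "(\<Oplus>i\<in>{..<Suc n}. ?t i) =
      (\<Oplus>i\<in>{..<n}. coeff Q i \<otimes> a [^] i) \<ominus> add_pow R n (coeff Q n \<otimes> a [^] n)" for n
  proof (induction n)
    case 0
    show ?case using a by (simp add: a_minus_def lessThan_Suc)
  next
    case (Suc n)
    let ?u = "coeff Q n \<otimes> a [^] n" and ?v = "coeff Q (Suc n) \<otimes> a [^] Suc n"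
    have uv: "?u \<in> carrier R" "?v \<in> carrier R" "add_pow R n ?u \<in> carrier R"
       "add_pow R n ?v \<in> carrier R" using a by auto
    have "?t (Suc n) = add_pow R (Suc n) (?u \<ominus> ?v)"
      using a by (simp add: PS a_minus_def l_distr l_minus r_distr r_minus m_ac del: add.nat_pow_Suc)
    also have "\<dots> = add_pow R (Suc n) ?u \<oplus> add_pow R (Suc n) (\<ominus> ?v)"
      using uv unfolding a_minus_def by (intro add.nat_pow_distrib) auto
    also have "add_pow R (Suc n) (\<ominus> ?v) = \<ominus> add_pow R (Suc n) ?v"
      using uv by (simp only: add.nat_pow_inv)
    finally have t: "?t (Suc n) = add_pow R n ?u \<oplus> ?u \<ominus> add_pow R (Suc n) ?v"
      by (simp add: a_minus_def)
    have s: "(\<Oplus>i\<in>{..<n}. coeff Q i \<otimes> a [^] i) \<in> carrier R" "add_pow R (Suc n) ?v \<in> carrier R"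
      using a by (auto intro!: finsum_closed simp del: add.nat_pow_Suc)
    have *: "(s' \<ominus> x) \<oplus> (x \<oplus> u \<ominus> w) = u \<oplus> s' \<ominus> w"
      if "s' \<in> carrier R" "x \<in> carrier R" "u \<in> carrier R" "w \<in> carrier R" for s' x u w
      using that by algebra
    have "(\<Oplus>i\<in>{..<Suc (Suc n)}. ?t i) = ?t (Suc n) \<oplus> (\<Oplus>i\<in>{..<Suc n}. ?t i)"
      using a by (subst lessThan_Suc, subst finsum_insert) (auto simp del: add.nat_pow_Suc)
    also have "\<dots> = (\<Oplus>i\<in>{..<Suc n}. ?t i) \<oplus> ?t (Suc n)"
      using a by (intro a_comm finsum_closed) (auto simp del: add.nat_pow_Suc)
    also have "\<dots> = ?u \<oplus> (\<Oplus>i\<in>{..<n}. coeff Q i \<otimes> a [^] i) \<ominus> add_pow R (Suc n) ?v"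
      unfolding Suc t by (rule *) (use uv s in auto)
    also have "?u \<oplus> (\<Oplus>i\<in>{..<n}. coeff Q i \<otimes> a [^] i) = (\<Oplus>i\<in>{..<Suc n}. coeff Q i \<otimes> a [^] i)"
      using a by (subst lessThan_Suc, subst finsum_insert) auto
    finally show ?case .
  qed
  \<comment> \<open>Any bound beyond both lengths would do: all coefficients from there on are zero,
    so the boundary term disappears and both sums are complete.\<close>
  define n where "n = length P + length Q"
  have "(\<Oplus>i\<in>{..<length P}. ?t i) = (\<Oplus>i\<in>{..<Suc n}. ?t i)"
    using a coeff_length[of P] by (intro add.finprod_mono_neutral_cong_left) (auto simp: n_def)
  also have "\<dots> = (\<Oplus>i\<in>{..<n}. coeff Q i \<otimes> a [^] i)"
    unfolding tele using a coeff_length[of Q n] by (simp add: n_def a_minus_def)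
  also have "\<dots> = (\<Oplus>i\<in>{..<length Q}. coeff Q i \<otimes> a [^] i)"
    using a coeff_length[of Q] by (intro add.finprod_mono_neutral_cong_right) (auto simp: n_def)
  also have "\<dots> = \<zero>" using Qa eval_eq_finsum[OF setQ a] by simp
  finally show ?thesis .
qed

text \<open>By Bezout, \<open>1\<close> is an integer combination of \<open>i\<close> and
  \<open>p\<close>, and both of these multiples of \<open>x\<close> vanish.\<close>

lemma (in domain) add_pow_char_eq_zero:
  assumes p: "Factorial_Ring.prime (p::nat)" "add_pow R p \<one> = \<zero>"
    and x: "x \<in> carrier R" "add_pow R i x = \<zero>" and i: "\<not> p dvd i"
  shows "x = \<zero>"
proof -
  have "add_pow R p x = add_pow R p \<one> \<otimes> x" using x add_pow_ldistr[of \<one> x p] by simp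
  then have px: "add_pow R p x = \<zero>" using p x by simp
  have "coprime i p" using i p by (metis coprime_commute prime_imp_coprime)
  then obtain u v where uv: "u * i = v * p + 1"
    using coprime_bezout_strong[of i p] p by (metis not_prime_1 mult.commute)
  have "add_pow R (u * i) x = add_pow R u (add_pow R i x)"
    unfolding add.nat_pow_pow[OF x(1)] by (simp only: mult.commute)
  then have "add_pow R (u * i) x = \<zero>" unfolding x(2) by simp
  moreover have "add_pow R (p * v) x = \<zero>"
    unfolding add.nat_pow_pow[OF x(1), symmetric] px by (rule add.nat_pow_one)
  ultimately show ?thesis using x(1) uv by (simp add: mult.commute)
qed

lemma (in monoid) pow_Suc_mem:
  assumes "x \<in> carrier G" "\<exists>n. (x [^] (p::nat)) [^] (p ^ n) \<in> K"
  shows "\<exists>n. x [^] (p ^ n) \<in> K"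
proof -
  obtain n where "(x [^] p) [^] (p ^ n) \<in> K" using assms(2) by blast
  then have "x [^] (p ^ Suc n) \<in> K" using nat_pow_pow[OF assms(1), of p "p ^ n"] by simp
  then show ?thesis ..
qed

text \<open>Induction on the degree of the minimal polynomial \<open>f\<close> of \<open>x\<close>.
  If \<open>x\<close> is not in \<open>K\<close>, it is not separable, so \<open>f\<close> has a
  multiple root, at which the derivative vanishes too. Irreducibility then makes the derivative
  zero, so \<open>f\<close> is a polynomial in \<open>X^p\<close> and \<open>x^p\<close> has smaller
  degree than \<open>x\<close>.\<close>

lemma (in algebraic_closure) purely_inseparable:
  assumes p: "Factorial_Ring.prime (p::nat)" "add_pow L p \<one> = \<zero>"
    and sc: "separably_closed_in L K" and x: "x \<in> carrier L"
  shows "\<exists>n. x [^] (p ^ n) \<in> K"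
  using x
proof (induction "length (Irr K x)" arbitrary: x rule: less_induct)
  case less
  note K = subfield_axioms
  have alg: "(algebraic over K) y" if "y \<in> carrier L" for y using algebraic_extension that by auto
  note irr = IrrE[OF K _ alg]
  have KR: "P \<in> carrier (poly_ring L)" if "P \<in> carrier (K [X])" for P
    using that carrier_polynomial_shell[OF subfieldE(1)[OF K]] by blast
  interpret UP: domain "K [X]" using univ_poly_is_domain[OF subfieldE(1)[OF K]] .
  show ?case
  proof (cases "x \<in> K")
    case True
    then show ?thesis using less.prems by (intro exI[of _ 0]) auto
  next
    case False
    define f where "f = Irr K x"
    have lenf: "length f = length (Irr K x)" by (simp add: f_def)
    have f: "f \<in> carrier (K [X])" "pirreducible K f" "lead_coeff f = \<one>" "eval f x = \<zero>"
      using irr[OF less.prems less.prems] by (auto simp: f_def)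
    have fne: "f \<noteq> []" using f(2) pirreducibleE(1)[OF subfieldE(1)[OF K] f(1)] by blast
    have setf: "set f \<subseteq> K" using f(1) by (auto simp: univ_poly_carrier[symmetric] polynomial_def)
    have KL: "K \<subseteq> carrier L" using K by (rule subfieldE)
    have cK: "coeff f i \<in> K" for i
      using setf coeff_img_restrict[of f] coeff_length[of f i] subringE(2)[OF subfieldE(1)[OF K]]
      by (cases "i < length f") auto
    have cL [simp]: "coeff f i \<in> carrier L" for i using cK KL by blast
    obtain a where a: "a \<in> carrier L" "alg_mult f a > 1"
      using False sc less.prems unfolding separably_closed_in_def separable_element_def f_def by force
    have fa: "eval f a = \<zero>"
      using a alg_mult_gt_zero_iff_is_root[OF KR[OF f(1)], of a] by (auto simp: is_root_def)
    \<comment> \<open>The multiple root \<open>a\<close> need not be \<open>x\<close>. Its minimal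
      polynomial \<open>g\<close> divides the irreducible \<open>f\<close>, so the two are
      associated and have the same degree.\<close>
    define g where "g = Irr K a"
    have g: "g \<in> carrier (K [X])" "pirreducible K g" using irr[OF a(1) a(1)] by (auto simp: g_def)
    have "g divides\<^bsub>K [X]\<^esub> f"
      using Irr_minimal[OF K a(1) alg[OF a(1)] f(1) fa] pdivides_iff_shell[OF K g(1) f(1)] by (simp add: g_def)
    then have "g \<in> Units (K [X]) \<or> g \<sim>\<^bsub>K [X]\<^esub> f"
      by (rule divides_pirreducible_condition[OF f(2) g(1)])
    moreover have "g \<notin> Units (K [X])" using pirreducibleE(2)[OF subfieldE(1)[OF K] g] .
    ultimately have gf: "length g = length f"
      using associated_polynomials_imp_same_length[OF subfieldE(1)[OF K] g(1) f(1)] by blast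
    have powK: "add_pow L i c \<in> K" if "c \<in> K" for i :: nat and c
      using that subringE(2,7)[OF subfieldE(1)[OF K]] by (induction i) auto
    \<comment> \<open>The coefficient list of the derivative of \<open>f\<close>, reversed because
      the highest degree comes first. Leading entries may be zero in characteristic
      \<open>p\<close>, so it becomes a polynomial only after \<open>normalize\<close>.\<close>
    define D where "D = map (\<lambda>i. add_pow L (Suc i) (coeff f (Suc i))) (rev [0..<length f - 1])"
    have lenD: "length D = length f - 1" by (simp add: D_def)
    have setD: "set D \<subseteq> K" using powK cK by (auto simp: D_def simp del: add.nat_pow_Suc)
    have cD: "coeff D i = add_pow L (Suc i) (coeff f (Suc i))" if "i < length f - 1" for i
    proof -
      have "coeff D i = D ! (length D - 1 - i)" using that lenD by (intro coeff_nth) simp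
      also have "rev [0..<length f - 1] ! (length D - 1 - i) = i"
        using that lenD by (simp add: rev_nth)
      then have "D ! (length D - 1 - i) = add_pow L (Suc i) (coeff f (Suc i))"
        using that lenD unfolding D_def by (subst nth_map) (auto simp del: add.nat_pow_Suc)
      finally show ?thesis .
    qed
    have "eval D a = (\<Oplus>i\<in>{..<length f - 1}. coeff D i \<otimes> a [^] i)"
      using eval_eq_finsum[of D a] setD KL a lenD by auto
    also have "\<dots> = (\<Oplus>i\<in>{..<length f - 1}. add_pow L (Suc i) (coeff f (Suc i) \<otimes> a [^] i))"
      using a cD by (intro finsum_cong') (auto simp: add_pow_ldistr simp del: add.nat_pow_Suc)
    also have "\<dots> = (\<Oplus>i\<in>Suc ` {..<length f - 1}. add_pow L i (coeff f i \<otimes> a [^] (i - 1)))"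
      using a by (subst finsum_reindex) (auto simp del: add.nat_pow_Suc)
    also have "\<dots> = (\<Oplus>i\<in>{..<length f}. add_pow L i (coeff f i \<otimes> a [^] (i - 1)))"
    proof (rule add.finprod_mono_neutral_cong_left)
      show "Suc ` {..<length f - 1} \<subseteq> {..<length f}" using fne by auto
      show "add_pow L i (coeff f i \<otimes> a [^] (i - 1)) = \<zero>"
        if i: "i \<in> {..<length f} - Suc ` {..<length f - 1}" for i
      proof -
        from i have "i = 0" by (cases i) auto
        then show "add_pow L i (coeff f i \<otimes> a [^] (i - 1)) = \<zero>" by simp
      qed
    qed (use a in auto)
    also have "\<dots> = \<zero>" using multiple_root_imp_deriv_root[OF KR[OF f(1)] a] .
    finally have "eval (normalize D) a = \<zero>" using eval_normalize[of D a] setD KL a by auto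
    moreover have nD: "normalize D \<in> carrier (K [X])"
      using normalize_gives_polynomial[OF setD] by (simp add: univ_poly_carrier)
    ultimately have gD: "g pdivides (normalize D)" using Irr_minimal[OF K a(1) alg[OF a(1)]] by (simp add: g_def)
    \<comment> \<open>A nonzero derivative would be a multiple of \<open>g\<close>, whose degree is
      that of \<open>f\<close>, although its own degree is smaller.\<close>
    have "normalize D = []"
    proof (rule ccontr)
      assume ne: "normalize D \<noteq> []"
      then have "length f - 1 \<le> length (normalize D) - 1"
        using pdivides_imp_degree_le[OF subfieldE(1)[OF K] g(1) nD ne gD] gf by simp
      moreover have "length (normalize D) \<le> length f - 1" using normalize_length_le[of D] lenD by simp
      ultimately show False using ne by (cases "normalize D") auto
    qed
    then have D0: "coeff D i = \<zero>" for i using normalize_coeff[of D] by simp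
    have c0: "coeff f i = \<zero>" if pi: "\<not> p dvd i" for i
    proof (cases "i < length f")
      case True
      obtain j where j: "i = Suc j" using pi by (cases i) auto
      then have "add_pow L i (coeff f i) = \<zero>" using cD[of j] D0[of j] True by simp
      then show ?thesis using add_pow_char_eq_zero[OF p _ _ pi] by auto
    qed (simp add: coeff_length)
    let ?d = "length f - 1"
    have cd: "coeff f ?d = \<one>" using f(3) lead_coeff_simp[OF fne] by simp
    then have "p dvd ?d" using c0[of ?d] by auto
    then obtain e where e: "?d = p * e" by blast
    \<comment> \<open>The polynomial obtained from \<open>f\<close> by substituting \<open>X\<close>
      for \<open>X^p\<close>: monic of degree \<open>e\<close>, with \<open>x^p\<close> as a
      root.\<close>
    define G where "G = map (\<lambda>j. coeff f (p * j)) (rev [0..<Suc e])"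
    have p0: "p > 1" using p(1) prime_gt_1_nat by blast
    have lenG: "length G = Suc e" by (simp add: G_def)
    have cG: "coeff G j = coeff f (p * j)" if "j < Suc e" for j
      using that coeff_nth[of j G] by (simp add: G_def rev_nth del: upt_Suc)
    have setG: "set G \<subseteq> K" using cK by (auto simp: G_def)
    have hdG: "lead_coeff G = \<one>" using cd e by (simp add: G_def)
    have Gc: "G \<in> carrier (K [X])" using setG hdG by (auto simp: univ_poly_carrier[symmetric] polynomial_def)
    have inj: "inj_on (\<lambda>j. p * j) {..<Suc e}" using p0 by (auto simp: inj_on_def)
    have xp: "x [^] p \<in> carrier L" using less.prems by simp
    have "eval G (x [^] p) = (\<Oplus>j\<in>{..<Suc e}. coeff f (p * j) \<otimes> x [^] (p * j))"
      using eval_eq_finsum[of G "x [^] p"] setG KL lenG xp less.prems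
      by (auto simp: cG nat_pow_pow intro!: finsum_cong')
    also have "\<dots> = (\<Oplus>i\<in>(\<lambda>j. p * j) ` {..<Suc e}. coeff f i \<otimes> x [^] i)"
      using less.prems inj by (subst finsum_reindex) auto
    also have "\<dots> = (\<Oplus>i\<in>{..<length f}. coeff f i \<otimes> x [^] i)"
    proof (rule add.finprod_mono_neutral_cong_left)
      show "(\<lambda>j. p * j) ` {..<Suc e} \<subseteq> {..<length f}"
      proof clarsimp
        fix j assume "j < Suc e"
        then have "p * j \<le> p * e" by simp
        then have "p * j \<le> length f - 1" using e by simp
        then show "p * j < length f" using fne by (cases f) auto
      qed
      show "coeff f i \<otimes> x [^] i = \<zero>" if i: "i \<in> {..<length f} - (\<lambda>j. p * j) ` {..<Suc e}" for i
      proof -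
        have "\<not> p dvd i"
        proof
          assume "p dvd i"
          then obtain j where j: "i = p * j" by blast
          then have "p * j \<le> p * e" using i unfolding e[symmetric] by auto
          then have "j < Suc e" using p0 by simp
          then show False using i j by blast
        qed
        then show "coeff f i \<otimes> x [^] i = \<zero>" using c0 less.prems by simp
      qed
    qed (use less.prems in auto)
    also have "\<dots> = \<zero>" using f(4) eval_eq_finsum[of f x] setf KL less.prems by auto
    finally have "Irr K (x [^] p) pdivides G" by (rule Irr_minimal[OF K xp alg[OF xp] Gc])
    then have le: "length (Irr K (x [^] p)) - 1 \<le> e"
      using pdivides_imp_degree_le[OF subfieldE(1)[OF K] irr(1)[OF xp xp] Gc] lenG by fastforce
    \<comment> \<open>Positive degree gives \<open>e > 0\<close>, hence \<open>e < p * e\<close>,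
      which is the strict decrease needed for the induction.\<close>
    have "length f \<ge> 2"
      using pirreducible_degree[OF K f(1,2)] fne by (cases f) auto
    then have "e > 0" using e by (cases e) auto
    then have epe: "e < p * e" using p0 by simp
    have "length f = Suc (p * e)" using e fne by (cases f) auto
    moreover have "length (Irr K (x [^] p)) \<le> Suc e" using le by simp
    ultimately have "length (Irr K (x [^] p)) < length f" using epe by linarith
    then have "length (Irr K (x [^] p)) < length (Irr K x)" unfolding lenf .
    then have "\<exists>n. (x [^] p) [^] (p ^ n) \<in> K" by (rule less.hyps[OF _ xp])
    then show ?thesis by (rule pow_Suc_mem[OF less.prems])
  qed
qed

section \<open>Tensor products of algebras\<close>

lemma free_module_simps [simp]:
  "ring.zero (free_module R E) = (\<lambda>_. \<zero>\<^bsub>R\<^esub>)"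
  "ring.add (free_module R E) f g = (\<lambda>x. f x \<oplus>\<^bsub>R\<^esub> g x)"
  "smult (free_module R E) r f = (\<lambda>x. r \<otimes>\<^bsub>R\<^esub> f x)"
  by (simp_all add: free_module_def)

context cring
begin

lemma free_module_carrierD:
  assumes "f \<in> carrier (free_module R E)"
  shows "finite {x. f x \<noteq> \<zero>}" "f x \<in> carrier R" "f x \<noteq> \<zero> \<Longrightarrow> x \<in> E" "x \<notin> E \<Longrightarrow> f x = \<zero>"
  using assms by (cases "x \<in> E"; auto simp: free_module_def)+

lemma free_module_carrierI:
  assumes "finite {x. f x \<noteq> \<zero>}" "\<And>x. f x \<in> carrier R" "\<And>x. f x \<noteq> \<zero> \<Longrightarrow> x \<in> E"
  shows "f \<in> carrier (free_module R E)"
  using assms by (auto simp: free_module_def)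

lemma free_gen_closed [simp, intro]: "x \<in> E \<Longrightarrow> free_gen R x \<in> carrier (free_module R E)"
  by (auto simp: free_module_def free_gen_def)

lemma module_free_module: "module R (free_module R E)" (is "module R ?F")
proof (rule moduleI)
  note D = free_module_carrierD
  have add_closed: "f \<oplus>\<^bsub>?F\<^esub> g \<in> carrier ?F" if "f \<in> carrier ?F" "g \<in> carrier ?F" for f g
  proof (rule free_module_carrierI)
    have "{x. f x \<oplus> g x \<noteq> \<zero>} \<subseteq> {x. f x \<noteq> \<zero>} \<union> {x. g x \<noteq> \<zero>}" by auto
    then show "finite {x. (f \<oplus>\<^bsub>?F\<^esub> g) x \<noteq> \<zero>}"
      using D(1)[OF that(1)] D(1)[OF that(2)] finite_subset by (simp, blast)
    show "x \<in> E" if "(f \<oplus>\<^bsub>?F\<^esub> g) x \<noteq> \<zero>" for x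
      using D(4)[OF \<open>f \<in> _\<close>, of x] D(4)[OF \<open>g \<in> _\<close>, of x] that by (cases "x \<in> E") auto
  qed (use D(2)[OF that(1)] D(2)[OF that(2)] in auto)
  show smult_closed: "r \<odot>\<^bsub>?F\<^esub> f \<in> carrier ?F" if "r \<in> carrier R" "f \<in> carrier ?F" for r f
  proof (rule free_module_carrierI)
    have "{x. r \<otimes> f x \<noteq> \<zero>} \<subseteq> {x. f x \<noteq> \<zero>}" using that by auto
    then show "finite {x. (r \<odot>\<^bsub>?F\<^esub> f) x \<noteq> \<zero>}"
      using D(1)[OF that(2)] finite_subset by (simp, blast)
    show "x \<in> E" if "(r \<odot>\<^bsub>?F\<^esub> f) x \<noteq> \<zero>" for x
      using D(4)[OF \<open>f \<in> _\<close>, of x] that \<open>r \<in> _\<close> by (cases "x \<in> E") auto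
  qed (use that D(2)[OF that(2)] in auto)
  show "abelian_group ?F"
  proof (rule abelian_groupI)
    show "\<zero>\<^bsub>?F\<^esub> \<in> carrier ?F" by (simp add: free_module_def)
    show "\<exists>g\<in>carrier ?F. g \<oplus>\<^bsub>?F\<^esub> f = \<zero>\<^bsub>?F\<^esub>" if "f \<in> carrier ?F" for f
    proof (intro bexI[of _ "(\<ominus> \<one>) \<odot>\<^bsub>?F\<^esub> f"])
      show "(\<ominus> \<one>) \<odot>\<^bsub>?F\<^esub> f \<oplus>\<^bsub>?F\<^esub> f = \<zero>\<^bsub>?F\<^esub>" using D(2)[OF that] by (auto simp: l_minus l_neg)
    qed (use smult_closed that in auto)
  qed (use add_closed D(2)[of _ E] in \<open>auto simp: a_ac fun_eq_iff\<close>)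
qed (use free_module_carrierD(2)[of _ E] in \<open>auto simp: l_distr r_distr m_assoc is_cring fun_eq_iff\<close>)

lemma free_module_induct [consumes 1, case_names zero add]:
  assumes "f \<in> carrier (free_module R E)"
    and "P (\<lambda>_. \<zero>)"
    and "\<And>r x f. r \<in> carrier R \<Longrightarrow> x \<in> E \<Longrightarrow> f \<in> carrier (free_module R E) \<Longrightarrow> P f \<Longrightarrow>
           P (r \<odot>\<^bsub>free_module R E\<^esub> free_gen R x \<oplus>\<^bsub>free_module R E\<^esub> f)"
  shows "P f"
  using assms(1)
proof (induction "{x. f x \<noteq> \<zero>}" arbitrary: f rule: infinite_finite_induct)
  case infinite
  then show ?case using free_module_carrierD(1) by blast
next
  case empty
  then have "f = (\<lambda>_. \<zero>)" by auto
  then show ?case using assms(2) by simp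
next
  case (insert x S)
  note D = free_module_carrierD[OF insert.prems]
  define g where "g = f(x := \<zero>)"
  have S: "S = {y. g y \<noteq> \<zero>}" using insert.hyps(2,4) by (auto simp: g_def)
  have g: "g \<in> carrier (free_module R E)"
    using D S insert.hyps(1) by (intro free_module_carrierI) (auto simp: g_def split: if_splits)
  have x: "x \<in> E" using D(3)[of x] insert.hyps(4) by blast
  have "P (f x \<odot>\<^bsub>free_module R E\<^esub> free_gen R x \<oplus>\<^bsub>free_module R E\<^esub> g)"
    using D(2) x g insert.hyps(3)[OF S g] by (intro assms(3))
  also have "f x \<odot>\<^bsub>free_module R E\<^esub> free_gen R x \<oplus>\<^bsub>free_module R E\<^esub> g = f"
    using D(2) by (auto simp: g_def free_gen_def fun_eq_iff)
  finally show ?case .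
qed

end

text \<open>The sum runs over the support of \<open>f\<close>, so no generating set has to be
  mentioned; finiteness of the support comes from membership in the free module.\<close>

definition lin_ext ::
    "('r, 'm) ring_scheme \<Rightarrow> ('r, 'a, 'n) module_scheme \<Rightarrow> ('x \<Rightarrow> 'a) \<Rightarrow> ('x \<Rightarrow> 'r) \<Rightarrow> 'a" where
  "lin_ext R M g f = (\<Oplus>\<^bsub>M\<^esub>x\<in>{x. f x \<noteq> \<zero>\<^bsub>R\<^esub>}. f x \<odot>\<^bsub>M\<^esub> g x)"

context module
begin

text \<open>Terms off the support vanish. Two elements can thus be summed over one finite set
  containing both supports, which is how additivity is proved.\<close>

lemma lin_ext_eq:
  assumes f: "f \<in> carrier (free_module R E)" and g: "g \<in> E \<rightarrow> carrier M"
    and S: "finite S" "{x. f x \<noteq> \<zero>} \<subseteq> S" "S \<subseteq> E"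
  shows "lin_ext R M g f = (\<Oplus>\<^bsub>M\<^esub>x\<in>S. f x \<odot>\<^bsub>M\<^esub> g x)"
  unfolding lin_ext_def
proof (rule M.add.finprod_mono_neutral_cong_left)
  note D = R.free_module_carrierD[OF f]
  show "(\<lambda>x. f x \<odot>\<^bsub>M\<^esub> g x) \<in> S \<rightarrow> carrier M" using D(2) funcset_mem[OF g] S(3) by (intro Pi_I smult_closed) auto
  show "f x \<odot>\<^bsub>M\<^esub> g x = \<zero>\<^bsub>M\<^esub>" if "x \<in> S - {x. f x \<noteq> \<zero>}" for x
    using that funcset_mem[OF g, of x] S(3) by auto
qed (use S in auto)

lemma lin_ext_closed:
  assumes f: "f \<in> carrier (free_module R E)" and g: "g \<in> E \<rightarrow> carrier M"
  shows "lin_ext R M g f \<in> carrier M"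
  unfolding lin_ext_def using R.free_module_carrierD[OF f] funcset_mem[OF g] by (intro M.finsum_closed) auto

lemma lin_ext_add:
  assumes f: "f \<in> carrier (free_module R E)" "f' \<in> carrier (free_module R E)"
    and g: "g \<in> E \<rightarrow> carrier M"
  shows "lin_ext R M g (f \<oplus>\<^bsub>free_module R E\<^esub> f') = lin_ext R M g f \<oplus>\<^bsub>M\<^esub> lin_ext R M g f'"
proof -
  interpret F: module R "free_module R E" by (rule module_free_module)
  note D = R.free_module_carrierD[OF f(1)] and D' = R.free_module_carrierD[OF f(2)]
  let ?S = "{x. f x \<noteq> \<zero>} \<union> {x. f' x \<noteq> \<zero>}"
  have S: "finite ?S" "?S \<subseteq> E" using D(1,3) D'(1,3) by auto
  have gS: "g x \<in> carrier M" if "x \<in> ?S" for x using that S(2) by (intro funcset_mem[OF g]) blast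
  have ff: "f \<oplus>\<^bsub>free_module R E\<^esub> f' \<in> carrier (free_module R E)" using f by (rule F.M.a_closed)
  have "lin_ext R M g (f \<oplus>\<^bsub>free_module R E\<^esub> f') = (\<Oplus>\<^bsub>M\<^esub>x\<in>?S. (f x \<oplus> f' x) \<odot>\<^bsub>M\<^esub> g x)"
    by (subst lin_ext_eq[OF ff g S(1) _ S(2)]) auto
  also have "\<dots> = (\<Oplus>\<^bsub>M\<^esub>x\<in>?S. f x \<odot>\<^bsub>M\<^esub> g x \<oplus>\<^bsub>M\<^esub> f' x \<odot>\<^bsub>M\<^esub> g x)"
    using D(2) D'(2) gS by (intro M.finsum_cong') (auto simp: smult_l_distr)
  also have "\<dots> = (\<Oplus>\<^bsub>M\<^esub>x\<in>?S. f x \<odot>\<^bsub>M\<^esub> g x) \<oplus>\<^bsub>M\<^esub> (\<Oplus>\<^bsub>M\<^esub>x\<in>?S. f' x \<odot>\<^bsub>M\<^esub> g x)"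
    using D(2) D'(2) gS by (intro M.finsum_addf) auto
  also have "\<dots> = lin_ext R M g f \<oplus>\<^bsub>M\<^esub> lin_ext R M g f'"
    using lin_ext_eq[OF f(1) g S(1) Un_upper1 S(2)] lin_ext_eq[OF f(2) g S(1) Un_upper2 S(2)] by simp
  finally show ?thesis .
qed

lemma lin_ext_smult:
  assumes r: "r \<in> carrier R" and f: "f \<in> carrier (free_module R E)" and g: "g \<in> E \<rightarrow> carrier M"
  shows "lin_ext R M g (r \<odot>\<^bsub>free_module R E\<^esub> f) = r \<odot>\<^bsub>M\<^esub> lin_ext R M g f"
proof -
  interpret F: module R "free_module R E" by (rule module_free_module)
  note D = R.free_module_carrierD[OF f]
  let ?S = "{x. f x \<noteq> \<zero>}"
  have S: "finite ?S" "?S \<subseteq> E" using D(1,3) by auto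
  have gS: "g x \<in> carrier M" if "x \<in> ?S" for x using that S(2) by (intro funcset_mem[OF g]) blast
  have rf: "r \<odot>\<^bsub>free_module R E\<^esub> f \<in> carrier (free_module R E)" using r f by (rule F.smult_closed)
  have "lin_ext R M g (r \<odot>\<^bsub>free_module R E\<^esub> f) = (\<Oplus>\<^bsub>M\<^esub>x\<in>?S. (r \<otimes> f x) \<odot>\<^bsub>M\<^esub> g x)"
    using r by (subst lin_ext_eq[OF rf g S(1) _ S(2)]) auto
  also have "\<dots> = (\<Oplus>\<^bsub>M\<^esub>x\<in>?S. r \<odot>\<^bsub>M\<^esub> (f x \<odot>\<^bsub>M\<^esub> g x))"
    using D(2) gS r by (intro M.finsum_cong') (auto simp: smult_assoc1)
  also have "\<dots> = r \<odot>\<^bsub>M\<^esub> (\<Oplus>\<^bsub>M\<^esub>x\<in>?S. f x \<odot>\<^bsub>M\<^esub> g x)"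
    using D(2) S(1) gS r by (intro finsum_smult_ldistr[symmetric]) auto
  finally show ?thesis by (simp add: lin_ext_def)
qed

lemma lin_ext_gen:
  assumes x: "x \<in> E" and g: "g \<in> E \<rightarrow> carrier M"
  shows "lin_ext R M g (free_gen R x) = g x"
  using x funcset_mem[OF g x]
  by (subst lin_ext_eq[OF R.free_gen_closed[OF x] g, of "{x}"]) (auto simp: free_gen_def)

lemma lin_ext_minus:
  assumes f: "f \<in> carrier (free_module R E)" "f' \<in> carrier (free_module R E)"
    and g: "g \<in> E \<rightarrow> carrier M"
  shows "lin_ext R M g (f \<ominus>\<^bsub>free_module R E\<^esub> f') = lin_ext R M g f \<ominus>\<^bsub>M\<^esub> lin_ext R M g f'"
proof -
  interpret F: module R "free_module R E" by (rule module_free_module)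
  have c: "lin_ext R M g h \<in> carrier M" if "h \<in> carrier (free_module R E)" for h
    using lin_ext_closed[OF that g] .
  have "\<ominus>\<^bsub>free_module R E\<^esub> f' = (\<ominus> \<one>) \<odot>\<^bsub>free_module R E\<^esub> f'"
    using F.smult_l_minus[OF R.one_closed f(2)] F.smult_one[OF f(2)] by simp
  then have "lin_ext R M g (\<ominus>\<^bsub>free_module R E\<^esub> f') = \<ominus>\<^bsub>M\<^esub> lin_ext R M g f'"
    using lin_ext_smult[OF _ f(2) g, of "\<ominus> \<one>"] smult_l_minus[OF R.one_closed c[OF f(2)]] c[OF f(2)] by simp
  then show ?thesis
    unfolding a_minus_def using lin_ext_add[OF f(1) F.M.a_inv_closed[OF f(2)] g] by simp
qed

end

section \<open>Monoid algebras of commutative monoids\<close>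

lemma monoid_algebra_simps [simp]:
  "carrier (monoid_algebra R G) = carrier (free_module R (carrier G))"
  "ring.zero (monoid_algebra R G) = ring.zero (free_module R (carrier G))"
  "ring.add (monoid_algebra R G) = ring.add (free_module R (carrier G))"
  "smult (monoid_algebra R G) = smult (free_module R (carrier G))"
  "monoid.one (monoid_algebra R G) = free_gen R \<one>\<^bsub>G\<^esub>"
  by (simp_all add: monoid_algebra_def free_module_def)

lemma monoid_algebra_a_inv [simp]:
  "a_inv (monoid_algebra R G) = a_inv (free_module R (carrier G))"
  "a_minus (monoid_algebra R G) = a_minus (free_module R (carrier G))"
proof -
  have *: "add_monoid (monoid_algebra R G) = add_monoid (free_module R (carrier G))" by simp
  show **: "a_inv (monoid_algebra R G) = a_inv (free_module R (carrier G))"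
    unfolding a_inv_def * ..
  show "a_minus (monoid_algebra R G) = a_minus (free_module R (carrier G))"
    by (intro ext) (simp only: a_minus_def ** monoid_algebra_simps)
qed

text \<open>Pairs outside the supports contribute zero, so the index set of the convolution may be
  enlarged. Distributivity relies on this, because the support of a sum can be smaller than the
  union of the supports.\<close>

lemma (in cring) monoid_algebra_mult_eq:
  fixes G (structure)
  assumes f: "f \<in> carrier (monoid_algebra R G)" and g: "g \<in> carrier (monoid_algebra R G)"
    and W: "finite W" "\<And>q. q \<in> W \<Longrightarrow> fst q \<otimes>\<^bsub>G\<^esub> snd q = z"
      "\<And>x y. f x \<noteq> \<zero> \<Longrightarrow> g y \<noteq> \<zero> \<Longrightarrow> x \<otimes>\<^bsub>G\<^esub> y = z \<Longrightarrow> (x, y) \<in> W"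
  shows "(f \<otimes>\<^bsub>monoid_algebra R G\<^esub> g) z = (\<Oplus>q\<in>W. f (fst q) \<otimes> g (snd q))"
proof -
  note D = free_module_carrierD[OF f[simplified]] free_module_carrierD[OF g[simplified]]
  have "(f \<otimes>\<^bsub>monoid_algebra R G\<^esub> g) z =
     (\<Oplus>q\<in>{(x, y). f x \<noteq> \<zero> \<and> g y \<noteq> \<zero> \<and> x \<otimes>\<^bsub>G\<^esub> y = z}. f (fst q) \<otimes> g (snd q))"
    by (simp add: monoid_algebra_def)
  also have "\<dots> = (\<Oplus>q\<in>W. f (fst q) \<otimes> g (snd q))"
  proof (rule add.finprod_mono_neutral_cong_left)
    show "f (fst q) \<otimes> g (snd q) = \<zero>"
      if q: "q \<in> W - {(x, y). f x \<noteq> \<zero> \<and> g y \<noteq> \<zero> \<and> x \<otimes>\<^bsub>G\<^esub> y = z}" for q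
    proof -
      have "f (fst q) = \<zero> \<or> g (snd q) = \<zero>" using q W(2)[of q] by (cases q) simp
      then show ?thesis using D(2)[of "fst q"] D(6)[of "snd q"] by (elim disjE) simp_all
    qed
    show "{(x, y). f x \<noteq> \<zero> \<and> g y \<noteq> \<zero> \<and> x \<otimes>\<^bsub>G\<^esub> y = z} \<subseteq> W" using W(3) by blast
    show "(\<lambda>q. f (fst q) \<otimes> g (snd q)) \<in> W \<rightarrow> carrier R" using D(2,6) by (intro Pi_I m_closed)
  qed (use W(1) in simp_all)
  finally show ?thesis .
qed

context cring
begin

context
  fixes G (structure) and A
  assumes G: "comm_monoid G"
  defines "A \<equiv> monoid_algebra R G"
begin

interpretation G: comm_monoid G by (rule G)
interpretation F: module R "free_module R (carrier G)" by (rule module_free_module)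

lemma monoid_algebra_supp:
  fixes f g z
  assumes "f \<in> carrier A" "g \<in> carrier A"
  defines "W \<equiv> {q \<in> {x. f x \<noteq> \<zero>} \<times> {x. g x \<noteq> \<zero>}. fst q \<otimes>\<^bsub>G\<^esub> snd q = z}"
  shows "finite W" "(f \<otimes>\<^bsub>A\<^esub> g) z = (\<Oplus>q\<in>W. f (fst q) \<otimes> g (snd q))"
proof -
  have f: "f \<in> carrier (free_module R (carrier G))" "g \<in> carrier (free_module R (carrier G))"
    using assms by (simp_all add: A_def)
  show W: "finite W" unfolding W_def
    using free_module_carrierD(1)[OF f(1)] free_module_carrierD(1)[OF f(2)] by auto
  show "(f \<otimes>\<^bsub>A\<^esub> g) z = (\<Oplus>q\<in>W. f (fst q) \<otimes> g (snd q))" unfolding A_def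
    by (rule monoid_algebra_mult_eq) (use W f in \<open>auto simp: W_def\<close>)
qed

lemma monoid_algebra_mult_closed:
  assumes "f \<in> carrier A" "g \<in> carrier A"
  shows "f \<otimes>\<^bsub>A\<^esub> g \<in> carrier A"
proof -
  have f: "f \<in> carrier (free_module R (carrier G))" "g \<in> carrier (free_module R (carrier G))"
    using assms by (simp_all add: A_def)
  note D = free_module_carrierD[OF f(1)] and D' = free_module_carrierD[OF f(2)]
  have ne: "\<exists>x y. f x \<noteq> \<zero> \<and> g y \<noteq> \<zero> \<and> x \<otimes>\<^bsub>G\<^esub> y = z" if "(f \<otimes>\<^bsub>A\<^esub> g) z \<noteq> \<zero>" for z
  proof (rule ccontr)
    assume *: "\<not> ?thesis"
    then have "{q \<in> {x. f x \<noteq> \<zero>} \<times> {x. g x \<noteq> \<zero>}. fst q \<otimes>\<^bsub>G\<^esub> snd q = z} = {}" by auto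
    then show False using that monoid_algebra_supp(2)[OF assms, of z] by (metis finsum_empty)
  qed
  have "f \<otimes>\<^bsub>A\<^esub> g \<in> carrier (free_module R (carrier G))"
  proof (rule free_module_carrierI)
    have "{z. (f \<otimes>\<^bsub>A\<^esub> g) z \<noteq> \<zero>} \<subseteq> (\<lambda>(x, y). x \<otimes>\<^bsub>G\<^esub> y) ` ({x. f x \<noteq> \<zero>} \<times> {x. g x \<noteq> \<zero>})"
      using ne by fastforce
    then show "finite {z. (f \<otimes>\<^bsub>A\<^esub> g) z \<noteq> \<zero>}" using D(1) D'(1) by (meson finite_SigmaI finite_imageI finite_subset)
    show "(f \<otimes>\<^bsub>A\<^esub> g) z \<in> carrier R" for z
      unfolding monoid_algebra_supp(2)[OF assms, of z] using D(2) D'(2) by (intro finsum_closed) auto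
    show "z \<in> carrier G" if "(f \<otimes>\<^bsub>A\<^esub> g) z \<noteq> \<zero>" for z using ne[OF that] D(3) D'(3) by auto
  qed
  then show ?thesis by (simp add: A_def)
qed

lemma monoid_algebra_l_distr:
  assumes "f \<in> carrier A" "f' \<in> carrier A" "g \<in> carrier A"
  shows "(f \<oplus>\<^bsub>A\<^esub> f') \<otimes>\<^bsub>A\<^esub> g = f \<otimes>\<^bsub>A\<^esub> g \<oplus>\<^bsub>A\<^esub> f' \<otimes>\<^bsub>A\<^esub> g"
proof
  fix z
  have c: "f \<in> carrier (free_module R (carrier G))" "f' \<in> carrier (free_module R (carrier G))"
      "g \<in> carrier (free_module R (carrier G))"
    using assms by (simp_all add: A_def)
  note D = free_module_carrierD[OF c(1)] free_module_carrierD[OF c(2)] free_module_carrierD[OF c(3)]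
  let ?W = "{q \<in> ({x. f x \<noteq> \<zero>} \<union> {x. f' x \<noteq> \<zero>}) \<times> {x. g x \<noteq> \<zero>}. fst q \<otimes>\<^bsub>G\<^esub> snd q = z}"
  have W: "finite ?W" using D(1,5,9) by simp
  have W2: "fst q \<otimes>\<^bsub>G\<^esub> snd q = z" if "q \<in> ?W" for q using that by simp
  have ff: "f \<oplus>\<^bsub>A\<^esub> f' \<in> carrier A" using c F.M.a_closed by (simp add: A_def)
  have "((f \<oplus>\<^bsub>A\<^esub> f') \<otimes>\<^bsub>A\<^esub> g) z = (\<Oplus>q\<in>?W. (f \<oplus>\<^bsub>A\<^esub> f') (fst q) \<otimes> g (snd q))"
    unfolding A_def
  proof (rule monoid_algebra_mult_eq[OF _ _ W W2])
    show "(x, y) \<in> ?W" if "(f \<oplus>\<^bsub>monoid_algebra R G\<^esub> f') x \<noteq> \<zero>" "g y \<noteq> \<zero>" "x \<otimes>\<^bsub>G\<^esub> y = z" for x y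
      using that by (cases "f x = \<zero>"; cases "f' x = \<zero>") simp_all
  qed (use assms ff in \<open>simp_all only: A_def\<close>)
  also have "\<dots> = (\<Oplus>q\<in>?W. f (fst q) \<otimes> g (snd q) \<oplus> f' (fst q) \<otimes> g (snd q))"
    using D(2,6,10) by (intro finsum_cong') (auto simp: A_def l_distr)
  also have "\<dots> = (\<Oplus>q\<in>?W. f (fst q) \<otimes> g (snd q)) \<oplus> (\<Oplus>q\<in>?W. f' (fst q) \<otimes> g (snd q))"
    using D(2,6,10) by (intro finsum_addf) auto
  also have "(\<Oplus>q\<in>?W. f (fst q) \<otimes> g (snd q)) = (f \<otimes>\<^bsub>A\<^esub> g) z"
    unfolding A_def
    by (rule monoid_algebra_mult_eq[symmetric, OF _ _ W W2]) (use assms in \<open>simp_all add: A_def\<close>)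
  also have "(\<Oplus>q\<in>?W. f' (fst q) \<otimes> g (snd q)) = (f' \<otimes>\<^bsub>A\<^esub> g) z"
    unfolding A_def
    by (rule monoid_algebra_mult_eq[symmetric, OF _ _ W W2]) (use assms in \<open>simp_all add: A_def\<close>)
  finally show "((f \<oplus>\<^bsub>A\<^esub> f') \<otimes>\<^bsub>A\<^esub> g) z = (f \<otimes>\<^bsub>A\<^esub> g \<oplus>\<^bsub>A\<^esub> f' \<otimes>\<^bsub>A\<^esub> g) z" by (simp add: A_def)
qed

lemma monoid_algebra_smult_mult:
  assumes "r \<in> carrier R" "f \<in> carrier A" "g \<in> carrier A"
  shows "(r \<odot>\<^bsub>A\<^esub> f) \<otimes>\<^bsub>A\<^esub> g = r \<odot>\<^bsub>A\<^esub> (f \<otimes>\<^bsub>A\<^esub> g)"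
proof
  fix z
  have c: "f \<in> carrier (free_module R (carrier G))" "g \<in> carrier (free_module R (carrier G))"
    using assms by (simp_all add: A_def)
  note D = free_module_carrierD[OF c(1)] free_module_carrierD[OF c(2)]
  let ?W = "{q \<in> {x. f x \<noteq> \<zero>} \<times> {x. g x \<noteq> \<zero>}. fst q \<otimes>\<^bsub>G\<^esub> snd q = z}"
  have W: "finite ?W" using D(1,5) by simp
  have W2: "fst q \<otimes>\<^bsub>G\<^esub> snd q = z" if "q \<in> ?W" for q using that by simp
  have ff: "r \<odot>\<^bsub>A\<^esub> f \<in> carrier A" using c F.smult_closed assms by (simp add: A_def)
  have "((r \<odot>\<^bsub>A\<^esub> f) \<otimes>\<^bsub>A\<^esub> g) z = (\<Oplus>q\<in>?W. (r \<odot>\<^bsub>A\<^esub> f) (fst q) \<otimes> g (snd q))"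
    unfolding A_def
  proof (rule monoid_algebra_mult_eq[OF _ _ W W2])
    show "(x, y) \<in> ?W" if "(r \<odot>\<^bsub>monoid_algebra R G\<^esub> f) x \<noteq> \<zero>" "g y \<noteq> \<zero>" "x \<otimes>\<^bsub>G\<^esub> y = z" for x y
      using that assms(1) by (cases "f x = \<zero>") simp_all
  qed (use assms ff in \<open>simp_all only: A_def\<close>)
  also have "\<dots> = (\<Oplus>q\<in>?W. r \<otimes> (f (fst q) \<otimes> g (snd q)))"
    using D(2,6) assms by (intro finsum_cong') (auto simp: A_def m_assoc)
  also have "\<dots> = r \<otimes> (\<Oplus>q\<in>?W. f (fst q) \<otimes> g (snd q))"
    using D(2,6) W assms by (intro finsum_rdistr[symmetric]) auto
  also have "(\<Oplus>q\<in>?W. f (fst q) \<otimes> g (snd q)) = (f \<otimes>\<^bsub>A\<^esub> g) z"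
    unfolding A_def
    by (rule monoid_algebra_mult_eq[symmetric, OF _ _ W W2]) (use assms in \<open>simp_all add: A_def\<close>)
  finally show "((r \<odot>\<^bsub>A\<^esub> f) \<otimes>\<^bsub>A\<^esub> g) z = (r \<odot>\<^bsub>A\<^esub> (f \<otimes>\<^bsub>A\<^esub> g)) z" by (simp add: A_def)
qed

lemma monoid_algebra_m_comm:
  assumes "f \<in> carrier A" "g \<in> carrier A"
  shows "f \<otimes>\<^bsub>A\<^esub> g = g \<otimes>\<^bsub>A\<^esub> f"
proof
  fix z
  have c: "f \<in> carrier (free_module R (carrier G))" "g \<in> carrier (free_module R (carrier G))"
    using assms by (simp_all add: A_def)
  note D = free_module_carrierD[OF c(1)] and D' = free_module_carrierD[OF c(2)]
  let ?W = "{q \<in> {x. f x \<noteq> \<zero>} \<times> {x. g x \<noteq> \<zero>}. fst q \<otimes>\<^bsub>G\<^esub> snd q = z}"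
  have W: "finite ?W" using D(1) D'(1) by simp
  have swap: "prod.swap ` ?W = {q \<in> {x. g x \<noteq> \<zero>} \<times> {x. f x \<noteq> \<zero>}. fst q \<otimes>\<^bsub>G\<^esub> snd q = z}"
  proof -
    have c: "x \<otimes>\<^bsub>G\<^esub> y = y \<otimes>\<^bsub>G\<^esub> x" if "f x \<noteq> \<zero>" "g y \<noteq> \<zero>" for x y
      using that D(3) D'(3) by (intro G.m_comm)
    show ?thesis
    proof (intro equalityI subsetI)
      fix q assume "q \<in> prod.swap ` ?W"
      then show "q \<in> {q \<in> {x. g x \<noteq> \<zero>} \<times> {x. f x \<noteq> \<zero>}. fst q \<otimes>\<^bsub>G\<^esub> snd q = z}"
        using c by (cases q) fastforce
    next
      fix q assume "q \<in> {q \<in> {x. g x \<noteq> \<zero>} \<times> {x. f x \<noteq> \<zero>}. fst q \<otimes>\<^bsub>G\<^esub> snd q = z}"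
      then show "q \<in> prod.swap ` ?W"
        using c by (intro image_eqI[of _ _ "prod.swap q"]; cases q) simp_all
    qed
  qed
  have "(g \<otimes>\<^bsub>A\<^esub> f) z = (\<Oplus>q\<in>prod.swap ` ?W. g (fst q) \<otimes> f (snd q))"
    unfolding swap by (rule monoid_algebra_supp(2)[OF assms(2,1)])
  also have "\<dots> = (\<Oplus>q\<in>?W. g (snd q) \<otimes> f (fst q))"
    using D(2) D'(2) by (subst finsum_reindex) (auto simp: inj_on_def)
  also have "\<dots> = (\<Oplus>q\<in>?W. f (fst q) \<otimes> g (snd q))"
    using D(2) D'(2) by (intro finsum_cong') (auto simp: m_comm)
  also have "\<dots> = (f \<otimes>\<^bsub>A\<^esub> g) z" by (rule monoid_algebra_supp(2)[OF assms, symmetric])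
  finally show "(f \<otimes>\<^bsub>A\<^esub> g) z = (g \<otimes>\<^bsub>A\<^esub> f) z" ..
qed

lemma monoid_algebra_gen_mult:
  assumes "x \<in> carrier G" "y \<in> carrier G"
  shows "free_gen R x \<otimes>\<^bsub>A\<^esub> free_gen R y = free_gen R (x \<otimes>\<^bsub>G\<^esub> y)"
proof
  fix z
  let ?W = "if x \<otimes>\<^bsub>G\<^esub> y = z then {(x, y)} else {}"
  have "(free_gen R x \<otimes>\<^bsub>A\<^esub> free_gen R y) z = (\<Oplus>q\<in>?W. free_gen R x (fst q) \<otimes> free_gen R y (snd q))"
    unfolding A_def
  proof (rule monoid_algebra_mult_eq)
    show "(u, v) \<in> ?W" if "free_gen R x u \<noteq> \<zero>" "free_gen R y v \<noteq> \<zero>" "u \<otimes>\<^bsub>G\<^esub> v = z" for u v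
      using that by (simp add: free_gen_def split: if_splits)
  qed (use assms in \<open>simp_all add: free_gen_closed split: if_splits\<close>)
  also have "\<dots> = free_gen R (x \<otimes>\<^bsub>G\<^esub> y) z" by (auto simp: free_gen_def)
  finally show "(free_gen R x \<otimes>\<^bsub>A\<^esub> free_gen R y) z = free_gen R (x \<otimes>\<^bsub>G\<^esub> y) z" .
qed

lemma monoid_algebra_induct [consumes 1, case_names zero add]:
  assumes "f \<in> carrier A" "P \<zero>\<^bsub>A\<^esub>"
    "\<And>r x f. r \<in> carrier R \<Longrightarrow> x \<in> carrier G \<Longrightarrow> f \<in> carrier A \<Longrightarrow> P f \<Longrightarrow> P (r \<odot>\<^bsub>A\<^esub> free_gen R x \<oplus>\<^bsub>A\<^esub> f)"
  shows "P f"
  by (rule free_module_induct[of f "carrier G"]) (use assms in \<open>auto simp: A_def\<close>)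

text \<open>The unit law and associativity hold on generators because they hold in \<open>G\<close>,
  and they spread by linearity. For associativity this is done in one argument at a time
  (\<open>assoc1\<close>, \<open>assoc2\<close>, \<open>assoc\<close>), so no triple convolution sum
  appears.\<close>

lemma monoid_algebra_cring: "cring A"
proof -
  have mod: "abelian_group A"
    using F.M.abelian_group_axioms unfolding abelian_group_def abelian_monoid_def
      abelian_group_axioms_def A_def by (simp add: A_def)
  interpret A: abelian_group A by (rule mod)
  have gen: "free_gen R x \<in> carrier A" if "x \<in> carrier G" for x using that by (simp add: A_def)
  have sm: "r \<odot>\<^bsub>A\<^esub> f \<in> carrier A" if "r \<in> carrier R" "f \<in> carrier A" for r f
    using that F.smult_closed by (simp add: A_def)
  note cl = monoid_algebra_mult_closed gen sm
  have z: "\<zero>\<^bsub>A\<^esub> \<otimes>\<^bsub>A\<^esub> f = \<zero>\<^bsub>A\<^esub>" if "f \<in> carrier A" for f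
  proof -
    have "\<zero>\<^bsub>A\<^esub> \<otimes>\<^bsub>A\<^esub> f \<oplus>\<^bsub>A\<^esub> \<zero>\<^bsub>A\<^esub> \<otimes>\<^bsub>A\<^esub> f = \<zero>\<^bsub>A\<^esub> \<otimes>\<^bsub>A\<^esub> f"
      using monoid_algebra_l_distr[OF A.zero_closed A.zero_closed that] by simp
    then show ?thesis using cl(1)[OF A.zero_closed that] by (metis A.add.r_cancel_one')
  qed
  have zr: "f \<otimes>\<^bsub>A\<^esub> \<zero>\<^bsub>A\<^esub> = \<zero>\<^bsub>A\<^esub>" if "f \<in> carrier A" for f
    unfolding monoid_algebra_m_comm[OF that A.zero_closed] by (rule z[OF that])
  have r_distr': "g \<otimes>\<^bsub>A\<^esub> (f \<oplus>\<^bsub>A\<^esub> f') = g \<otimes>\<^bsub>A\<^esub> f \<oplus>\<^bsub>A\<^esub> g \<otimes>\<^bsub>A\<^esub> f'"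
    if "f \<in> carrier A" "f' \<in> carrier A" "g \<in> carrier A" for f f' g
    using monoid_algebra_l_distr[OF that] that
      monoid_algebra_m_comm[OF that(1,3)] monoid_algebra_m_comm[OF that(2,3)]
      monoid_algebra_m_comm[OF A.a_closed[OF that(1,2)] that(3)] by simp
  have sm_r: "g \<otimes>\<^bsub>A\<^esub> (r \<odot>\<^bsub>A\<^esub> f) = r \<odot>\<^bsub>A\<^esub> (g \<otimes>\<^bsub>A\<^esub> f)"
    if "r \<in> carrier R" "f \<in> carrier A" "g \<in> carrier A" for r f g
    using monoid_algebra_smult_mult[OF that] monoid_algebra_m_comm[OF that(2,3)]
      monoid_algebra_m_comm[OF sm[OF that(1,2)] that(3)] by simp
  have one: "\<one>\<^bsub>A\<^esub> \<in> carrier A" using gen by (simp add: A_def)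
  have l_one': "\<one>\<^bsub>A\<^esub> \<otimes>\<^bsub>A\<^esub> f = f" if "f \<in> carrier A" for f
    using that
  proof (induction f rule: monoid_algebra_induct)
    case zero
    show ?case by (rule zr[OF one])
  next
    case (add r x f)
    have "\<one>\<^bsub>A\<^esub> \<otimes>\<^bsub>A\<^esub> free_gen R x = free_gen R x"
      using monoid_algebra_gen_mult[OF G.one_closed add(2)] add(2) by (simp add: A_def)
    then show ?case using add one by (simp add: r_distr' cl sm_r)
  qed
  have assoc1: "(free_gen R x \<otimes>\<^bsub>A\<^esub> free_gen R y) \<otimes>\<^bsub>A\<^esub> h = free_gen R x \<otimes>\<^bsub>A\<^esub> (free_gen R y \<otimes>\<^bsub>A\<^esub> h)"
    if xy: "x \<in> carrier G" "y \<in> carrier G" and "h \<in> carrier A" for x y h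
    using that(3)
  proof (induction h rule: monoid_algebra_induct)
    case zero
    show ?case using xy by (simp only: zr cl)
  next
    case (add s w h)
    have "(free_gen R x \<otimes>\<^bsub>A\<^esub> free_gen R y) \<otimes>\<^bsub>A\<^esub> free_gen R w = free_gen R x \<otimes>\<^bsub>A\<^esub> (free_gen R y \<otimes>\<^bsub>A\<^esub> free_gen R w)"
      using xy add(2) by (simp only: monoid_algebra_gen_mult G.m_assoc G.m_closed)
    with add xy show ?case by (simp only: r_distr' cl sm_r)
  qed
  have assoc2: "(free_gen R x \<otimes>\<^bsub>A\<^esub> g) \<otimes>\<^bsub>A\<^esub> h = free_gen R x \<otimes>\<^bsub>A\<^esub> (g \<otimes>\<^bsub>A\<^esub> h)"
    if x: "x \<in> carrier G" and h: "h \<in> carrier A" and "g \<in> carrier A" for x g h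
    using that(3)
  proof (induction g rule: monoid_algebra_induct)
    case zero
    show ?case using x h by (simp only: z zr cl)
  next
    case (add r y g)
    with x h assoc1[OF x add(2) h] show ?case
      by (simp only: r_distr' monoid_algebra_l_distr cl sm_r monoid_algebra_smult_mult)
  qed
  have assoc: "(f \<otimes>\<^bsub>A\<^esub> g) \<otimes>\<^bsub>A\<^esub> h = f \<otimes>\<^bsub>A\<^esub> (g \<otimes>\<^bsub>A\<^esub> h)"
    if "f \<in> carrier A" and gh: "g \<in> carrier A" "h \<in> carrier A" for f g h
    using that(1)
  proof (induction f rule: monoid_algebra_induct)
    case zero
    show ?case using gh by (simp only: z cl)
  next
    case (add r x f)
    with gh assoc2[OF add(2) gh(2,1)] show ?case
      by (simp only: monoid_algebra_l_distr cl monoid_algebra_smult_mult)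
  qed
  show ?thesis
  proof (rule cringI[OF mod])
    show "comm_monoid A"
      by (rule comm_monoidI) (use cl one l_one' assoc monoid_algebra_m_comm in auto)
  qed (use monoid_algebra_l_distr in auto)
qed

end

end

lemmas [simp del] = free_module_simps monoid_algebra_simps monoid_algebra_a_inv

section \<open>Tensor products: pure tensors, induction and the universal property\<close>

lemma comm_monoid_DirProd:
  assumes "comm_monoid G" "comm_monoid H"
  shows "comm_monoid (G \<times>\<times> H)"
proof -
  interpret G: comm_monoid G by (rule assms(1))
  interpret H: comm_monoid H by (rule assms(2))
  show ?thesis
    by (rule comm_monoidI) (auto simp: DirProd_def G.m_ac H.m_ac)
qed

locale algebra_pair =
  K: cring K + A: cring A + B: cring B
  for K :: "('k, 'm) ring_scheme" and A :: "('a, 'n) ring_scheme" and B :: "('b, 'o) ring_scheme" +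
  fixes \<phi> :: "'k \<Rightarrow> 'a" and \<psi> :: "'k \<Rightarrow> 'b"
  assumes \<phi>: "\<phi> \<in> ring_hom K A" and \<psi>: "\<psi> \<in> ring_hom K B"
begin

abbreviation F where "F \<equiv> monoid_algebra K (A \<times>\<times> B)"
abbreviation I where "I \<equiv> tensor_ideal K A \<phi> B \<psi>"
abbreviation T where "T \<equiv> tensor_product K A \<phi> B \<psi>"
abbreviation e where "e a b \<equiv> free_gen K (a, b)"
abbreviation pure (infixl "\<otimes>\<^sub>T" 75) where "pure \<equiv> pure_tensor K A \<phi> B \<psi>"

lemma \<phi>_closed [simp]: "c \<in> carrier K \<Longrightarrow> \<phi> c \<in> carrier A"
  and \<psi>_closed [simp]: "c \<in> carrier K \<Longrightarrow> \<psi> c \<in> carrier B"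
  using \<phi> \<psi> by (auto dest: ring_hom_closed)

lemma G_comm_monoid: "comm_monoid (A \<times>\<times> B)"
  by (rule comm_monoid_DirProd) unfold_locales

lemma F_cring: "cring F"
  by (rule K.monoid_algebra_cring[OF G_comm_monoid])

sublocale F: cring F by (rule F_cring)

lemma F_module: "module K F"
proof -
  interpret M: module K "free_module K (carrier (A \<times>\<times> B))" by (rule K.module_free_module)
  show ?thesis
    by (rule moduleI)
      (use M.smult_closed M.smult_l_distr M.smult_r_distr M.smult_assoc1 M.smult_one in
        \<open>simp_all add: monoid_algebra_simps K.is_cring F.abelian_group_axioms\<close>)
qed

sublocale FM: module K F by (rule F_module)

lemma gen_closed [simp]: "a \<in> carrier A \<Longrightarrow> b \<in> carrier B \<Longrightarrow> e a b \<in> carrier F"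
  by (simp add: monoid_algebra_simps K.free_gen_closed DirProd_def)

lemma gen_mult:
  "a \<in> carrier A \<Longrightarrow> b \<in> carrier B \<Longrightarrow> a' \<in> carrier A \<Longrightarrow> b' \<in> carrier B \<Longrightarrow>
    e a b \<otimes>\<^bsub>F\<^esub> e a' b' = e (a \<otimes>\<^bsub>A\<^esub> a') (b \<otimes>\<^bsub>B\<^esub> b')"
  by (subst K.monoid_algebra_gen_mult[OF G_comm_monoid]) (auto simp: DirProd_def)

lemma smult_mult: "c \<in> carrier K \<Longrightarrow> f \<in> carrier F \<Longrightarrow> g \<in> carrier F \<Longrightarrow>
    (c \<odot>\<^bsub>F\<^esub> f) \<otimes>\<^bsub>F\<^esub> g = c \<odot>\<^bsub>F\<^esub> (f \<otimes>\<^bsub>F\<^esub> g)"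
  by (rule K.monoid_algebra_smult_mult[OF G_comm_monoid])

lemma F_induct [consumes 1, case_names zero add]:
  assumes "f \<in> carrier F" "P \<zero>\<^bsub>F\<^esub>"
    "\<And>c a b f. c \<in> carrier K \<Longrightarrow> a \<in> carrier A \<Longrightarrow> b \<in> carrier B \<Longrightarrow> f \<in> carrier F \<Longrightarrow> P f \<Longrightarrow>
       P (c \<odot>\<^bsub>F\<^esub> e a b \<oplus>\<^bsub>F\<^esub> f)"
  shows "P f"
  by (rule K.monoid_algebra_induct[OF G_comm_monoid, of f]) (use assms in \<open>auto simp: DirProd_def\<close>)

lemma relations_closed: "tensor_relations K A \<phi> B \<psi> \<subseteq> carrier F"
  by (auto simp: tensor_relations_def Let_def intro!: F.minus_closed FM.smult_closed)

lemma I_ideal: "ideal I F"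
  unfolding tensor_ideal_def by (rule F.genideal_ideal[OF relations_closed])

sublocale I: ideal I F by (rule I_ideal)

lemma T_rep: "t \<in> carrier T \<Longrightarrow> \<exists>f\<in>carrier F. t = I +>\<^bsub>F\<^esub> f"
  unfolding tensor_product_def FactRing_def A_RCOSETS_def' partial_object.simps by blast

lemma T_cring: "cring T"
  unfolding tensor_product_def by (rule I.quotient_is_cring[OF F_cring])

sublocale T: cring T by (rule T_cring)

lemma proj_hom: "(\<lambda>f. I +>\<^bsub>F\<^esub> f) \<in> ring_hom F T"
  unfolding tensor_product_def by (rule I.rcos_ring_hom)

sublocale proj: ring_hom_cring F T "\<lambda>f. I +>\<^bsub>F\<^esub> f"
  by unfold_locales (rule proj_hom)

lemma pure_closed [simp]: "a \<in> carrier A \<Longrightarrow> b \<in> carrier B \<Longrightarrow> a \<otimes>\<^sub>T b \<in> carrier T"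
  unfolding pure_tensor_def by (rule proj.hom_closed) simp

lemma pure_mult:
  "a \<in> carrier A \<Longrightarrow> b \<in> carrier B \<Longrightarrow> a' \<in> carrier A \<Longrightarrow> b' \<in> carrier B \<Longrightarrow>
    a \<otimes>\<^sub>T b \<otimes>\<^bsub>T\<^esub> (a' \<otimes>\<^sub>T b') = (a \<otimes>\<^bsub>A\<^esub> a') \<otimes>\<^sub>T (b \<otimes>\<^bsub>B\<^esub> b')"
  unfolding pure_tensor_def by (subst proj.hom_mult[symmetric]) (auto simp: gen_mult)

lemma proj_eqI: "f \<in> carrier F \<Longrightarrow> g \<in> carrier F \<Longrightarrow> f \<ominus>\<^bsub>F\<^esub> g \<in> I \<Longrightarrow> I +>\<^bsub>F\<^esub> f = I +>\<^bsub>F\<^esub> g"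
  using F.quotient_eq_iff_same_a_r_cos[OF I_ideal] by blast

lemma relation_mem: "r \<in> tensor_relations K A \<phi> B \<psi> \<Longrightarrow> r \<in> I"
  unfolding tensor_ideal_def using F.genideal_self[OF relations_closed] by blast

lemma relation_memI:
  "a \<in> carrier A \<Longrightarrow> a' \<in> carrier A \<Longrightarrow> b \<in> carrier B \<Longrightarrow>
    e (a \<oplus>\<^bsub>A\<^esub> a') b \<ominus>\<^bsub>F\<^esub> (e a b \<oplus>\<^bsub>F\<^esub> e a' b) \<in> I"
  "a \<in> carrier A \<Longrightarrow> b \<in> carrier B \<Longrightarrow> b' \<in> carrier B \<Longrightarrow>
    e a (b \<oplus>\<^bsub>B\<^esub> b') \<ominus>\<^bsub>F\<^esub> (e a b \<oplus>\<^bsub>F\<^esub> e a b') \<in> I"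
  "a \<in> carrier A \<Longrightarrow> b \<in> carrier B \<Longrightarrow> c \<in> carrier K \<Longrightarrow>
    e (\<phi> c \<otimes>\<^bsub>A\<^esub> a) b \<ominus>\<^bsub>F\<^esub> (c \<odot>\<^bsub>F\<^esub> e a b) \<in> I"
  "a \<in> carrier A \<Longrightarrow> b \<in> carrier B \<Longrightarrow> c \<in> carrier K \<Longrightarrow>
    e a (\<psi> c \<otimes>\<^bsub>B\<^esub> b) \<ominus>\<^bsub>F\<^esub> (c \<odot>\<^bsub>F\<^esub> e a b) \<in> I"
  by (rule relation_mem, unfold tensor_relations_def Let_def,
      ((rule UnI1, rule UnI1, rule UnI1, intro CollectI exI conjI, rule refl; assumption)
      | (rule UnI1, rule UnI1, rule UnI2, intro CollectI exI conjI, rule refl; assumption)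
      | (rule UnI1, rule UnI2, intro CollectI exI conjI, rule refl; assumption)
      | (rule UnI2, intro CollectI exI conjI, rule refl; assumption)))+

lemma pure_add_l:
  assumes "a \<in> carrier A" "a' \<in> carrier A" "b \<in> carrier B"
  shows "(a \<oplus>\<^bsub>A\<^esub> a') \<otimes>\<^sub>T b = a \<otimes>\<^sub>T b \<oplus>\<^bsub>T\<^esub> a' \<otimes>\<^sub>T b"
proof -
  have "e (a \<oplus>\<^bsub>A\<^esub> a') b \<ominus>\<^bsub>F\<^esub> (e a b \<oplus>\<^bsub>F\<^esub> e a' b) \<in> I"
    using assms by (intro relation_memI)
  then have "I +>\<^bsub>F\<^esub> e (a \<oplus>\<^bsub>A\<^esub> a') b = I +>\<^bsub>F\<^esub> (e a b \<oplus>\<^bsub>F\<^esub> e a' b)"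
    using assms by (intro proj_eqI) auto
  then show ?thesis unfolding pure_tensor_def using assms by (subst proj.hom_add[symmetric]) auto
qed

lemma pure_add_r:
  assumes "a \<in> carrier A" "b \<in> carrier B" "b' \<in> carrier B"
  shows "a \<otimes>\<^sub>T (b \<oplus>\<^bsub>B\<^esub> b') = a \<otimes>\<^sub>T b \<oplus>\<^bsub>T\<^esub> a \<otimes>\<^sub>T b'"
proof -
  have "e a (b \<oplus>\<^bsub>B\<^esub> b') \<ominus>\<^bsub>F\<^esub> (e a b \<oplus>\<^bsub>F\<^esub> e a b') \<in> I"
    using assms by (intro relation_memI)
  then have "I +>\<^bsub>F\<^esub> e a (b \<oplus>\<^bsub>B\<^esub> b') = I +>\<^bsub>F\<^esub> (e a b \<oplus>\<^bsub>F\<^esub> e a b')"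
    using assms by (intro proj_eqI) auto
  then show ?thesis unfolding pure_tensor_def using assms by (subst proj.hom_add[symmetric]) auto
qed

text \<open>A scalar in front of a generator may be absorbed into either factor. Comparing the two
  ways identifies the two images of \<open>K\<close> in the tensor product.\<close>

lemma proj_smult_gen:
  assumes "a \<in> carrier A" "b \<in> carrier B" "c \<in> carrier K"
  shows "I +>\<^bsub>F\<^esub> (c \<odot>\<^bsub>F\<^esub> e a b) = (\<phi> c \<otimes>\<^bsub>A\<^esub> a) \<otimes>\<^sub>T b"
    and "I +>\<^bsub>F\<^esub> (c \<odot>\<^bsub>F\<^esub> e a b) = a \<otimes>\<^sub>T (\<psi> c \<otimes>\<^bsub>B\<^esub> b)"
proof -
  have "e (\<phi> c \<otimes>\<^bsub>A\<^esub> a) b \<ominus>\<^bsub>F\<^esub> (c \<odot>\<^bsub>F\<^esub> e a b) \<in> I" "e a (\<psi> c \<otimes>\<^bsub>B\<^esub> b) \<ominus>\<^bsub>F\<^esub> (c \<odot>\<^bsub>F\<^esub> e a b) \<in> I"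
    using relation_memI(3,4)[OF assms] by simp_all
  then show "I +>\<^bsub>F\<^esub> (c \<odot>\<^bsub>F\<^esub> e a b) = (\<phi> c \<otimes>\<^bsub>A\<^esub> a) \<otimes>\<^sub>T b"
    "I +>\<^bsub>F\<^esub> (c \<odot>\<^bsub>F\<^esub> e a b) = a \<otimes>\<^sub>T (\<psi> c \<otimes>\<^bsub>B\<^esub> b)"
    unfolding pure_tensor_def using assms by (intro proj_eqI[symmetric]; auto)+
qed

lemma pure_one: "\<one>\<^bsub>A\<^esub> \<otimes>\<^sub>T \<one>\<^bsub>B\<^esub> = \<one>\<^bsub>T\<^esub>"
proof -
  have "\<one>\<^bsub>F\<^esub> = e \<one>\<^bsub>A\<^esub> \<one>\<^bsub>B\<^esub>" by (simp add: monoid_algebra_simps(5) DirProd_def)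
  then show ?thesis unfolding pure_tensor_def using proj.hom_one by (simp only:)
qed

lemma inl_hom: "(\<lambda>a. a \<otimes>\<^sub>T \<one>\<^bsub>B\<^esub>) \<in> ring_hom A T"
  by (rule ring_hom_memI)
    (simp_all only: pure_closed pure_mult pure_add_l pure_one A.one_closed B.one_closed B.r_one)

lemma inr_hom: "(\<lambda>b. \<one>\<^bsub>A\<^esub> \<otimes>\<^sub>T b) \<in> ring_hom B T"
  by (rule ring_hom_memI)
    (simp_all only: pure_closed pure_mult pure_add_r pure_one A.one_closed B.one_closed A.r_one)

lemma pure_eq_mult: "a \<in> carrier A \<Longrightarrow> b \<in> carrier B \<Longrightarrow>
    a \<otimes>\<^sub>T b = a \<otimes>\<^sub>T \<one>\<^bsub>B\<^esub> \<otimes>\<^bsub>T\<^esub> (\<one>\<^bsub>A\<^esub> \<otimes>\<^sub>T b)"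
  by (simp only: pure_mult A.one_closed B.one_closed A.r_one B.l_one)

lemma pure_scalar: "c \<in> carrier K \<Longrightarrow> \<phi> c \<otimes>\<^sub>T \<one>\<^bsub>B\<^esub> = \<one>\<^bsub>A\<^esub> \<otimes>\<^sub>T \<psi> c"
  using proj_smult_gen[OF A.one_closed B.one_closed, of c] by simp

text \<open>Scalars are absorbed into the left factor, so every tensor is a sum of pure tensors
  without coefficients.\<close>

lemma tensor_induct [consumes 1, case_names zero add]:
  assumes "t \<in> carrier T" "P \<zero>\<^bsub>T\<^esub>"
    "\<And>a b t. a \<in> carrier A \<Longrightarrow> b \<in> carrier B \<Longrightarrow> t \<in> carrier T \<Longrightarrow> P t \<Longrightarrow> P (a \<otimes>\<^sub>T b \<oplus>\<^bsub>T\<^esub> t)"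
  shows "P t"
proof -
  obtain f where f: "f \<in> carrier F" "t = I +>\<^bsub>F\<^esub> f"
    using T_rep[OF assms(1)] by blast
  have "P (I +>\<^bsub>F\<^esub> f)" using f(1)
  proof (induction f rule: F_induct)
    case zero
    then show ?case using assms(2) by (simp only: proj.hom_zero)
  next
    case (add c a b f)
    have ca: "\<phi> c \<otimes>\<^bsub>A\<^esub> a \<in> carrier A" using add by simp
    have "I +>\<^bsub>F\<^esub> (c \<odot>\<^bsub>F\<^esub> e a b \<oplus>\<^bsub>F\<^esub> f) = (I +>\<^bsub>F\<^esub> (c \<odot>\<^bsub>F\<^esub> e a b)) \<oplus>\<^bsub>T\<^esub> (I +>\<^bsub>F\<^esub> f)"
      by (rule proj.hom_add) (use add in \<open>simp_all only: FM.smult_closed gen_closed\<close>)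
    also have "\<dots> = (\<phi> c \<otimes>\<^bsub>A\<^esub> a) \<otimes>\<^sub>T b \<oplus>\<^bsub>T\<^esub> (I +>\<^bsub>F\<^esub> f)"
      by (simp only: proj_smult_gen(1)[OF add(2,3,1)])
    finally show ?case
      using assms(3)[OF ca add(3) proj.hom_closed[OF add(4)] add(5)] by (simp only:)
  qed
  then show ?thesis using f by simp
qed

text \<open>The linear extension \<open>\<Lambda>\<close> of \<open>\<beta>\<close> must be shown to
  vanish on \<open>I\<close>. As \<open>I\<close> is the ideal generated by the relations while
  \<open>M\<close> is only a module, the kernel of \<open>\<Lambda>\<close> is not visibly an ideal,
  and vanishing on the relations alone does not suffice.\<close>

lemma tensor_universal:
  fixes M :: "('k, 'c, 'q) module_scheme" and \<beta> :: "'a \<Rightarrow> 'b \<Rightarrow> 'c"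
  assumes M: "module K M"
    and cl: "\<And>a b. a \<in> carrier A \<Longrightarrow> b \<in> carrier B \<Longrightarrow> \<beta> a b \<in> carrier M"
    and add_l: "\<And>a a' b. a \<in> carrier A \<Longrightarrow> a' \<in> carrier A \<Longrightarrow> b \<in> carrier B \<Longrightarrow>
        \<beta> (a \<oplus>\<^bsub>A\<^esub> a') b = \<beta> a b \<oplus>\<^bsub>M\<^esub> \<beta> a' b"
    and add_r: "\<And>a b b'. a \<in> carrier A \<Longrightarrow> b \<in> carrier B \<Longrightarrow> b' \<in> carrier B \<Longrightarrow>
        \<beta> a (b \<oplus>\<^bsub>B\<^esub> b') = \<beta> a b \<oplus>\<^bsub>M\<^esub> \<beta> a b'"
    and smult_l: "\<And>c a b. c \<in> carrier K \<Longrightarrow> a \<in> carrier A \<Longrightarrow> b \<in> carrier B \<Longrightarrow>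
        \<beta> (\<phi> c \<otimes>\<^bsub>A\<^esub> a) b = c \<odot>\<^bsub>M\<^esub> \<beta> a b"
    and smult_r: "\<And>c a b. c \<in> carrier K \<Longrightarrow> a \<in> carrier A \<Longrightarrow> b \<in> carrier B \<Longrightarrow>
        \<beta> a (\<psi> c \<otimes>\<^bsub>B\<^esub> b) = c \<odot>\<^bsub>M\<^esub> \<beta> a b"
  shows "\<exists>\<Phi>. (\<forall>t\<in>carrier T. \<Phi> t \<in> carrier M) \<and>
    (\<forall>t\<in>carrier T. \<forall>u\<in>carrier T. \<Phi> (t \<oplus>\<^bsub>T\<^esub> u) = \<Phi> t \<oplus>\<^bsub>M\<^esub> \<Phi> u) \<and>
    (\<forall>a\<in>carrier A. \<forall>b\<in>carrier B. \<Phi> (a \<otimes>\<^sub>T b) = \<beta> a b)"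
proof -
  interpret M: module K M by (rule M)
  define \<Lambda> where "\<Lambda> = lin_ext K M (\<lambda>q. \<beta> (fst q) (snd q))"
  have g: "(\<lambda>q. \<beta> (fst q) (snd q)) \<in> carrier (A \<times>\<times> B) \<rightarrow> carrier M" using cl by (auto simp: DirProd_def)
  have L_closed: "\<Lambda> f \<in> carrier M" if "f \<in> carrier F" for f
    unfolding \<Lambda>_def using that by (intro M.lin_ext_closed[OF _ g]) (simp only: monoid_algebra_simps)
  have L_add: "\<Lambda> (f \<oplus>\<^bsub>F\<^esub> f') = \<Lambda> f \<oplus>\<^bsub>M\<^esub> \<Lambda> f'" if "f \<in> carrier F" "f' \<in> carrier F" for f f'
    using M.lin_ext_add[OF that[unfolded monoid_algebra_simps] g]
    by (simp only: \<Lambda>_def monoid_algebra_simps)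
  have L_minus: "\<Lambda> (f \<ominus>\<^bsub>F\<^esub> f') = \<Lambda> f \<ominus>\<^bsub>M\<^esub> \<Lambda> f'" if "f \<in> carrier F" "f' \<in> carrier F" for f f'
    using M.lin_ext_minus[OF that[unfolded monoid_algebra_simps] g]
    by (simp only: \<Lambda>_def monoid_algebra_a_inv)
  have L_smult: "\<Lambda> (c \<odot>\<^bsub>F\<^esub> f) = c \<odot>\<^bsub>M\<^esub> \<Lambda> f" if "c \<in> carrier K" "f \<in> carrier F" for c f
    using M.lin_ext_smult[OF that(1) that(2)[unfolded monoid_algebra_simps] g]
    by (simp only: \<Lambda>_def monoid_algebra_simps)
  have L_gen: "\<Lambda> (e a b) = \<beta> a b" if "a \<in> carrier A" "b \<in> carrier B" for a b
    using M.lin_ext_gen[OF _ g, of "(a, b)"] that by (simp add: \<Lambda>_def DirProd_def)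
  have L0: "\<Lambda> \<zero>\<^bsub>F\<^esub> = \<zero>\<^bsub>M\<^esub>"
    using L_smult[OF K.zero_closed F.zero_closed] L_closed[OF F.zero_closed]
    by (simp only: FM.smult_r_null K.zero_closed M.smult_l_null)
  \<comment> \<open>The largest ideal inside the kernel of \<open>\<Lambda>\<close>. The relations
    belong to it because a relation multiplied by a generator \<open>e x y\<close> is again a
    relation of the same kind.\<close>
  define N where "N = {f \<in> carrier F. \<forall>g\<in>carrier F. \<Lambda> (g \<otimes>\<^bsub>F\<^esub> f) = \<zero>\<^bsub>M\<^esub>}"
  have N_ideal: "ideal N F"
  proof (rule idealI[OF F.ring_axioms])
    show "subgroup N (add_monoid F)"
    proof (rule group.subgroupI)
      show "group (add_monoid F)" by (rule F.a_group)
      have "\<zero>\<^bsub>F\<^esub> \<in> N" by (simp add: N_def L0)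
      then show "N \<noteq> {}" by blast
      show "inv\<^bsub>add_monoid F\<^esub> f \<in> N" if f: "f \<in> N" for f
      proof -
        have fc: "f \<in> carrier F" using f by (simp add: N_def)
        have "\<Lambda> (g \<otimes>\<^bsub>F\<^esub> (\<ominus>\<^bsub>F\<^esub> f)) = \<zero>\<^bsub>M\<^esub>" if g: "g \<in> carrier F" for g
        proof -
          have "g \<otimes>\<^bsub>F\<^esub> (\<ominus>\<^bsub>F\<^esub> f) = (\<ominus>\<^bsub>F\<^esub> g) \<otimes>\<^bsub>F\<^esub> f" using fc g by (simp add: F.l_minus F.r_minus)
          then show ?thesis using f g by (simp add: N_def)
        qed
        then show ?thesis using fc by (simp add: N_def a_inv_def[symmetric])
      qed
    qed (auto simp: N_def F.r_distr L_add)
    show "g \<otimes>\<^bsub>F\<^esub> f \<in> N" if "f \<in> N" "g \<in> carrier F" for f g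
      using that by (simp add: N_def F.m_assoc[symmetric])
    then show "f \<otimes>\<^bsub>F\<^esub> g \<in> N" if "f \<in> N" "g \<in> carrier F" for f g
      using that F.m_comm[of f g] by (simp add: N_def)
  qed
  have N_I: "f \<in> N" if f: "f \<in> carrier F"
    and gen: "\<And>a b. a \<in> carrier A \<Longrightarrow> b \<in> carrier B \<Longrightarrow> \<Lambda> (e a b \<otimes>\<^bsub>F\<^esub> f) = \<zero>\<^bsub>M\<^esub>" for f
  proof -
    have "\<Lambda> (g \<otimes>\<^bsub>F\<^esub> f) = \<zero>\<^bsub>M\<^esub>" if "g \<in> carrier F" for g
      using that
    proof (induction g rule: F_induct)
      case zero
      then show ?case using f L0 by simp
    next
      case (add c a b g)
      then show ?case using f gen by (simp add: F.l_distr L_add L_smult smult_mult)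
    qed
    then show ?thesis using f by (simp add: N_def)
  qed
  have minus_eq: "u \<ominus>\<^bsub>M\<^esub> u = \<zero>\<^bsub>M\<^esub>" if "u \<in> carrier M" for u
    using that by (simp add: a_minus_def M.M.r_neg)
  have r_minus': "x \<otimes>\<^bsub>F\<^esub> (y \<ominus>\<^bsub>F\<^esub> z) = x \<otimes>\<^bsub>F\<^esub> y \<ominus>\<^bsub>F\<^esub> x \<otimes>\<^bsub>F\<^esub> z"
    if "x \<in> carrier F" "y \<in> carrier F" "z \<in> carrier F" for x y z
    using that by (simp add: a_minus_def F.r_distr F.r_minus)
  have mult_smult: "x \<otimes>\<^bsub>F\<^esub> (c \<odot>\<^bsub>F\<^esub> y) = c \<odot>\<^bsub>F\<^esub> (x \<otimes>\<^bsub>F\<^esub> y)"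
    if "x \<in> carrier F" "y \<in> carrier F" "c \<in> carrier K" for x y c
    using smult_mult[OF that(3,2,1)] F.m_comm[OF that(1,2)] F.m_comm[OF that(1) FM.smult_closed[OF that(3,2)]]
    by simp
  have n1: "e (a \<oplus>\<^bsub>A\<^esub> a') b \<ominus>\<^bsub>F\<^esub> (e a b \<oplus>\<^bsub>F\<^esub> e a' b) \<in> N"
    if "a \<in> carrier A" "a' \<in> carrier A" "b \<in> carrier B" for a a' b
    using that
    by (intro N_I)
      (simp_all add: r_minus' F.r_distr gen_mult L_minus L_add L_gen A.r_distr add_l cl minus_eq)
  have n2: "e a (b \<oplus>\<^bsub>B\<^esub> b') \<ominus>\<^bsub>F\<^esub> (e a b \<oplus>\<^bsub>F\<^esub> e a b') \<in> N"
    if "a \<in> carrier A" "b \<in> carrier B" "b' \<in> carrier B" for a b b'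
    using that
    by (intro N_I)
      (simp_all add: r_minus' F.r_distr gen_mult L_minus L_add L_gen B.r_distr add_r cl minus_eq)
  have n3: "e (\<phi> c \<otimes>\<^bsub>A\<^esub> a) b \<ominus>\<^bsub>F\<^esub> (c \<odot>\<^bsub>F\<^esub> e a b) \<in> N"
    if abc: "a \<in> carrier A" "b \<in> carrier B" "c \<in> carrier K" for a b c
  proof (rule N_I)
    fix x y assume xy: "x \<in> carrier A" "y \<in> carrier B"
    have "x \<otimes>\<^bsub>A\<^esub> (\<phi> c \<otimes>\<^bsub>A\<^esub> a) = \<phi> c \<otimes>\<^bsub>A\<^esub> (x \<otimes>\<^bsub>A\<^esub> a)"
      using xy abc by (intro A.m_lcomm) simp_all
    then have "e x y \<otimes>\<^bsub>F\<^esub> (e (\<phi> c \<otimes>\<^bsub>A\<^esub> a) b \<ominus>\<^bsub>F\<^esub> (c \<odot>\<^bsub>F\<^esub> e a b)) =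
        e (\<phi> c \<otimes>\<^bsub>A\<^esub> (x \<otimes>\<^bsub>A\<^esub> a)) (y \<otimes>\<^bsub>B\<^esub> b) \<ominus>\<^bsub>F\<^esub> c \<odot>\<^bsub>F\<^esub> e (x \<otimes>\<^bsub>A\<^esub> a) (y \<otimes>\<^bsub>B\<^esub> b)"
      using xy abc by (simp add: r_minus' gen_mult mult_smult)
    then show "\<Lambda> (e x y \<otimes>\<^bsub>F\<^esub> (e (\<phi> c \<otimes>\<^bsub>A\<^esub> a) b \<ominus>\<^bsub>F\<^esub> (c \<odot>\<^bsub>F\<^esub> e a b))) = \<zero>\<^bsub>M\<^esub>"
      using xy abc by (simp add: L_minus L_smult L_gen smult_l cl minus_eq)
  qed (use abc in simp)
  have n4: "e a (\<psi> c \<otimes>\<^bsub>B\<^esub> b) \<ominus>\<^bsub>F\<^esub> (c \<odot>\<^bsub>F\<^esub> e a b) \<in> N"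
    if abc: "a \<in> carrier A" "b \<in> carrier B" "c \<in> carrier K" for a b c
  proof (rule N_I)
    fix x y assume xy: "x \<in> carrier A" "y \<in> carrier B"
    have "y \<otimes>\<^bsub>B\<^esub> (\<psi> c \<otimes>\<^bsub>B\<^esub> b) = \<psi> c \<otimes>\<^bsub>B\<^esub> (y \<otimes>\<^bsub>B\<^esub> b)"
      using xy abc by (intro B.m_lcomm) simp_all
    then have "e x y \<otimes>\<^bsub>F\<^esub> (e a (\<psi> c \<otimes>\<^bsub>B\<^esub> b) \<ominus>\<^bsub>F\<^esub> (c \<odot>\<^bsub>F\<^esub> e a b)) =
        e (x \<otimes>\<^bsub>A\<^esub> a) (\<psi> c \<otimes>\<^bsub>B\<^esub> (y \<otimes>\<^bsub>B\<^esub> b)) \<ominus>\<^bsub>F\<^esub> c \<odot>\<^bsub>F\<^esub> e (x \<otimes>\<^bsub>A\<^esub> a) (y \<otimes>\<^bsub>B\<^esub> b)"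
      using xy abc by (simp add: r_minus' gen_mult mult_smult)
    then show "\<Lambda> (e x y \<otimes>\<^bsub>F\<^esub> (e a (\<psi> c \<otimes>\<^bsub>B\<^esub> b) \<ominus>\<^bsub>F\<^esub> (c \<odot>\<^bsub>F\<^esub> e a b))) = \<zero>\<^bsub>M\<^esub>"
      using xy abc by (simp add: L_minus L_smult L_gen smult_r cl minus_eq)
  qed (use abc in simp)
  have "tensor_relations K A \<phi> B \<psi> \<subseteq> N"
    unfolding tensor_relations_def Let_def
    by (intro Un_least subsetI; elim CollectE exE conjE; hypsubst; rule n1 n2 n3 n4; assumption)
  then have IN: "I \<subseteq> N" unfolding tensor_ideal_def by (rule F.genideal_minimal[OF N_ideal])
  have LI: "\<Lambda> f = \<zero>\<^bsub>M\<^esub>" if "f \<in> I" for f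
  proof -
    have "f \<in> carrier F" "\<Lambda> (\<one>\<^bsub>F\<^esub> \<otimes>\<^bsub>F\<^esub> f) = \<zero>\<^bsub>M\<^esub>" using that IN F.one_closed unfolding N_def by blast+
    then show ?thesis by simp
  qed
  have Leq: "\<Lambda> f = \<Lambda> g" if "f \<in> carrier F" "g \<in> carrier F" "I +>\<^bsub>F\<^esub> f = I +>\<^bsub>F\<^esub> g" for f g
  proof -
    have "f \<ominus>\<^bsub>F\<^esub> g \<in> I" using F.quotient_eq_iff_same_a_r_cos[OF I_ideal that(1,2)] that(3) by blast
    then have "\<Lambda> f \<ominus>\<^bsub>M\<^esub> \<Lambda> g = \<zero>\<^bsub>M\<^esub>" using LI L_minus[OF that(1,2)] by simp
    moreover have "\<Lambda> f = (\<Lambda> f \<ominus>\<^bsub>M\<^esub> \<Lambda> g) \<oplus>\<^bsub>M\<^esub> \<Lambda> g"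
      using L_closed that by (simp add: a_minus_def M.M.a_assoc M.M.l_neg)
    ultimately show ?thesis using L_closed that by simp
  qed
  \<comment> \<open>By \<open>Leq\<close> the value of \<open>\<Lambda>\<close> depends only on the
    coset, so an arbitrary representative serves.\<close>
  define \<Phi> where "\<Phi> t = \<Lambda> (SOME f. f \<in> carrier F \<and> t = I +>\<^bsub>F\<^esub> f)" for t
  have Phi: "\<Phi> (I +>\<^bsub>F\<^esub> f) = \<Lambda> f" if "f \<in> carrier F" for f
  proof -
    let ?g = "SOME g. g \<in> carrier F \<and> I +>\<^bsub>F\<^esub> f = I +>\<^bsub>F\<^esub> g"
    have g: "?g \<in> carrier F \<and> I +>\<^bsub>F\<^esub> f = I +>\<^bsub>F\<^esub> ?g"
      by (rule someI[of _ f]) (simp add: that)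
    show ?thesis unfolding \<Phi>_def by (rule Leq[symmetric]) (use g that in auto)
  qed
  show ?thesis
  proof (intro exI[of _ \<Phi>] conjI ballI)
    show "\<Phi> t \<in> carrier M" if "t \<in> carrier T" for t using T_rep[OF that] Phi L_closed by fastforce
    show "\<Phi> (t \<oplus>\<^bsub>T\<^esub> u) = \<Phi> t \<oplus>\<^bsub>M\<^esub> \<Phi> u" if tu: "t \<in> carrier T" "u \<in> carrier T" for t u
    proof -
      obtain f g where fg: "f \<in> carrier F" "t = I +>\<^bsub>F\<^esub> f" "g \<in> carrier F" "u = I +>\<^bsub>F\<^esub> g" using T_rep[OF tu(1)] T_rep[OF tu(2)] by blast
      have "t \<oplus>\<^bsub>T\<^esub> u = I +>\<^bsub>F\<^esub> (f \<oplus>\<^bsub>F\<^esub> g)" using fg by simp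
      then have "\<Phi> (t \<oplus>\<^bsub>T\<^esub> u) = \<Lambda> (f \<oplus>\<^bsub>F\<^esub> g)" using Phi[OF F.a_closed[OF fg(1,3)]] by (simp only:)
      then show ?thesis using fg(1,3) by (simp only: fg(2,4) Phi L_add)
    qed
    show "\<Phi> (a \<otimes>\<^sub>T b) = \<beta> a b" if "a \<in> carrier A" "b \<in> carrier B" for a b
      unfolding pure_tensor_def using that by (simp add: Phi L_gen)
  qed
qed

end

section \<open>Quotient modules\<close>

locale module_with_submodule = module R M + submodule N R M for R (structure) and M (structure) and N
begin

abbreviation Q where "Q \<equiv> quotient_module M N"

lemma N_subset: "N \<subseteq> carrier M" and N_zero: "\<zero>\<^bsub>M\<^esub> \<in> N"
  and N_add: "a \<in> N \<Longrightarrow> b \<in> N \<Longrightarrow> a \<oplus>\<^bsub>M\<^esub> b \<in> N" and N_neg: "a \<in> N \<Longrightarrow> \<ominus>\<^bsub>M\<^esub> a \<in> N"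
  and N_smult: "r \<in> carrier R \<Longrightarrow> a \<in> N \<Longrightarrow> r \<odot>\<^bsub>M\<^esub> a \<in> N"
proof -
  have *: "submodule N R M" by unfold_locales
  show "N \<subseteq> carrier M" "\<zero>\<^bsub>M\<^esub> \<in> N" using submoduleE(1)[OF *] submodule_zero_closed[OF *] by auto
  show "a \<oplus>\<^bsub>M\<^esub> b \<in> N" if "a \<in> N" "b \<in> N" using submoduleE(5)[OF * that] .
  show "\<ominus>\<^bsub>M\<^esub> a \<in> N" if "a \<in> N" using submoduleE(3)[OF * that] .
  show "r \<odot>\<^bsub>M\<^esub> a \<in> N" if "r \<in> carrier R" "a \<in> N" using submoduleE(4)[OF * that] .
qed

lemma coset_eq: "N +>\<^bsub>M\<^esub> a = {n \<oplus>\<^bsub>M\<^esub> a | n. n \<in> N}"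
  unfolding a_r_coset_def' by blast

lemma coset_self: "a \<in> carrier M \<Longrightarrow> a \<in> N +>\<^bsub>M\<^esub> a"
  unfolding coset_eq by (intro CollectI exI[of _ "\<zero>\<^bsub>M\<^esub>"] conjI N_zero) (simp only: M.l_zero)

lemma coset_eq_iff:
  assumes "a \<in> carrier M" "b \<in> carrier M"
  shows "N +>\<^bsub>M\<^esub> a = N +>\<^bsub>M\<^esub> b \<longleftrightarrow> a \<ominus>\<^bsub>M\<^esub> b \<in> N"
proof
  assume "N +>\<^bsub>M\<^esub> a = N +>\<^bsub>M\<^esub> b"
  moreover have "a \<in> N +>\<^bsub>M\<^esub> a" by (rule coset_self[OF assms(1)])
  ultimately obtain n where n: "n \<in> N" "a = n \<oplus>\<^bsub>M\<^esub> b" unfolding coset_eq by blast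
  then have "a \<ominus>\<^bsub>M\<^esub> b = n"
    using assms subsetD[OF N_subset n(1)] by (simp only: a_minus_def M.a_assoc M.r_neg M.a_inv_closed M.r_zero)
  then show "a \<ominus>\<^bsub>M\<^esub> b \<in> N" using n by simp
next
  have sub: "N +>\<^bsub>M\<^esub> a \<subseteq> N +>\<^bsub>M\<^esub> b"
    if "a \<in> carrier M" "b \<in> carrier M" "a \<ominus>\<^bsub>M\<^esub> b \<in> N" for a b
  proof
    fix u assume "u \<in> N +>\<^bsub>M\<^esub> a"
    then obtain n where n: "n \<in> N" "u = n \<oplus>\<^bsub>M\<^esub> a" unfolding coset_eq by blast
    then have "n \<in> carrier M" using N_subset by blast
    then have "u = (n \<oplus>\<^bsub>M\<^esub> (a \<ominus>\<^bsub>M\<^esub> b)) \<oplus>\<^bsub>M\<^esub> b"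
      using n that by (simp add: a_minus_def M.a_assoc M.l_neg)
    then show "u \<in> N +>\<^bsub>M\<^esub> b"
      unfolding coset_eq using N_add[OF n(1) that(3)] by (intro CollectI exI conjI)
  qed
  assume ab: "a \<ominus>\<^bsub>M\<^esub> b \<in> N"
  have "\<ominus>\<^bsub>M\<^esub> (a \<ominus>\<^bsub>M\<^esub> b) = b \<ominus>\<^bsub>M\<^esub> a"
    using assms by (simp add: a_minus_def M.minus_add M.a_comm)
  then have "b \<ominus>\<^bsub>M\<^esub> a \<in> N" using N_neg[OF ab] by simp
  then show "N +>\<^bsub>M\<^esub> a = N +>\<^bsub>M\<^esub> b" using sub[OF assms ab] sub[OF assms(2,1)] by blast
qed

lemma coset_zero: "N +>\<^bsub>M\<^esub> \<zero>\<^bsub>M\<^esub> = N"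
proof (intro equalityI subsetI)
  fix u assume "u \<in> N +>\<^bsub>M\<^esub> \<zero>\<^bsub>M\<^esub>"
  then obtain n where n: "n \<in> N" "u = n \<oplus>\<^bsub>M\<^esub> \<zero>\<^bsub>M\<^esub>" unfolding coset_eq by blast
  then show "u \<in> N" by (simp only: M.r_zero[OF subsetD[OF N_subset n(1)]])
next
  fix u assume u: "u \<in> N"
  then have "u \<in> carrier M" by (rule subsetD[OF N_subset])
  then show "u \<in> N +>\<^bsub>M\<^esub> \<zero>\<^bsub>M\<^esub>"
    unfolding coset_eq by (intro CollectI exI[of _ u] conjI u) (simp only: M.r_zero)
qed

lemma coset_mem_iff: "a \<in> carrier M \<Longrightarrow> N +>\<^bsub>M\<^esub> a = N \<longleftrightarrow> a \<in> N"
proof -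
  assume a: "a \<in> carrier M"
  have "\<ominus>\<^bsub>M\<^esub> \<zero>\<^bsub>M\<^esub> = \<zero>\<^bsub>M\<^esub>" using M.r_neg[OF M.zero_closed] by simp
  then have "a \<ominus>\<^bsub>M\<^esub> \<zero>\<^bsub>M\<^esub> = a" using a by (simp add: a_minus_def)
  then show ?thesis using coset_eq_iff[OF a M.zero_closed] by (simp only: coset_zero)
qed

lemma Q_carrier: "carrier Q = (\<lambda>a. N +>\<^bsub>M\<^esub> a) ` carrier M"
  by (auto simp: quotient_module_def A_RCOSETS_def')

lemma Q_zero: "\<zero>\<^bsub>Q\<^esub> = N"
  by (simp add: quotient_module_def)

lemma Q_add:
  assumes "a \<in> carrier M" "b \<in> carrier M"
  shows "(N +>\<^bsub>M\<^esub> a) \<oplus>\<^bsub>Q\<^esub> (N +>\<^bsub>M\<^esub> b) = N +>\<^bsub>M\<^esub> (a \<oplus>\<^bsub>M\<^esub> b)"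
proof -
  have c: "n \<in> carrier M" if "n \<in> N" for n using that N_subset by blast
  have "{u \<oplus>\<^bsub>M\<^esub> v | u v. u \<in> N +>\<^bsub>M\<^esub> a \<and> v \<in> N +>\<^bsub>M\<^esub> b} = N +>\<^bsub>M\<^esub> (a \<oplus>\<^bsub>M\<^esub> b)" (is "?L = ?R")
  proof (intro equalityI subsetI)
    fix w assume "w \<in> ?L"
    then obtain n n' where n: "n \<in> N" "n' \<in> N" "w = (n \<oplus>\<^bsub>M\<^esub> a) \<oplus>\<^bsub>M\<^esub> (n' \<oplus>\<^bsub>M\<^esub> b)"
      unfolding coset_eq by blast
    then have "w = (n \<oplus>\<^bsub>M\<^esub> n') \<oplus>\<^bsub>M\<^esub> (a \<oplus>\<^bsub>M\<^esub> b)" using assms c by (simp add: M.a_ac)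
    then show "w \<in> ?R" unfolding coset_eq using N_add[OF n(1,2)] by (intro CollectI exI conjI)
  next
    fix w assume "w \<in> ?R"
    then obtain n where n: "n \<in> N" "w = n \<oplus>\<^bsub>M\<^esub> (a \<oplus>\<^bsub>M\<^esub> b)" unfolding coset_eq by blast
    then have w: "w = (n \<oplus>\<^bsub>M\<^esub> a) \<oplus>\<^bsub>M\<^esub> (\<zero>\<^bsub>M\<^esub> \<oplus>\<^bsub>M\<^esub> b)" using assms c by (simp add: M.a_assoc)
    have "n \<oplus>\<^bsub>M\<^esub> a \<in> N +>\<^bsub>M\<^esub> a" "\<zero>\<^bsub>M\<^esub> \<oplus>\<^bsub>M\<^esub> b \<in> N +>\<^bsub>M\<^esub> b"
      unfolding coset_eq using n(1) N_zero by blast+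
    then show "w \<in> ?L" using w by blast
  qed
  moreover have "(N +>\<^bsub>M\<^esub> a) \<oplus>\<^bsub>Q\<^esub> (N +>\<^bsub>M\<^esub> b) = {u \<oplus>\<^bsub>M\<^esub> v | u v. u \<in> N +>\<^bsub>M\<^esub> a \<and> v \<in> N +>\<^bsub>M\<^esub> b}"
    unfolding quotient_module_def set_add_def' ring.simps by blast
  ultimately show ?thesis by simp
qed

text \<open>Every representative of the coset yields the same coset, so the union in the definition
  of the scalar action collapses to one set.\<close>

lemma Q_smult:
  assumes "r \<in> carrier R" "a \<in> carrier M"
  shows "r \<odot>\<^bsub>Q\<^esub> (N +>\<^bsub>M\<^esub> a) = N +>\<^bsub>M\<^esub> (r \<odot>\<^bsub>M\<^esub> a)"
proof -
  have "N +>\<^bsub>M\<^esub> (r \<odot>\<^bsub>M\<^esub> y) = N +>\<^bsub>M\<^esub> (r \<odot>\<^bsub>M\<^esub> a)" if y: "y \<in> N +>\<^bsub>M\<^esub> a" for y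
  proof -
    obtain n where n: "n \<in> N" "y = n \<oplus>\<^bsub>M\<^esub> a" using y unfolding coset_eq by blast
    then have nM: "n \<in> carrier M" using N_subset by blast
    have "r \<odot>\<^bsub>M\<^esub> y \<ominus>\<^bsub>M\<^esub> r \<odot>\<^bsub>M\<^esub> a = r \<odot>\<^bsub>M\<^esub> n"
      using n nM assms by (simp add: smult_r_distr a_minus_def M.a_assoc M.r_neg)
    then show ?thesis using n nM assms N_smult by (subst coset_eq_iff) auto
  qed
  moreover have "a \<in> N +>\<^bsub>M\<^esub> a" by (rule coset_self[OF assms(2)])
  ultimately have "(\<Union>y\<in>N +>\<^bsub>M\<^esub> a. N +>\<^bsub>M\<^esub> (r \<odot>\<^bsub>M\<^esub> y)) = N +>\<^bsub>M\<^esub> (r \<odot>\<^bsub>M\<^esub> a)" by blast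
  then show ?thesis by (simp add: quotient_module_def)
qed

lemma Q_abelian_group: "abelian_group Q"
proof (rule abelian_groupI)
  show "\<exists>y\<in>carrier Q. y \<oplus>\<^bsub>Q\<^esub> x = \<zero>\<^bsub>Q\<^esub>" if "x \<in> carrier Q" for x
  proof -
    obtain a where a: "a \<in> carrier M" "x = N +>\<^bsub>M\<^esub> a" using \<open>x \<in> carrier Q\<close> unfolding Q_carrier by blast
    have "(N +>\<^bsub>M\<^esub> (\<ominus>\<^bsub>M\<^esub> a)) \<oplus>\<^bsub>Q\<^esub> x = \<zero>\<^bsub>Q\<^esub>" using a by (simp add: Q_add M.l_neg coset_zero Q_zero)
    then show ?thesis unfolding Q_carrier using M.a_inv_closed[OF a(1)] by blast
  qed
  show "\<zero>\<^bsub>Q\<^esub> \<in> carrier Q" unfolding Q_zero Q_carrier using coset_zero M.zero_closed by blast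
  show "\<zero>\<^bsub>Q\<^esub> \<oplus>\<^bsub>Q\<^esub> x = x" if x: "x \<in> carrier Q" for x
  proof -
    obtain a where a: "a \<in> carrier M" "x = N +>\<^bsub>M\<^esub> a" using x unfolding Q_carrier by blast
    show ?thesis using Q_add[OF M.zero_closed a(1)] a by (simp add: coset_zero Q_zero)
  qed
  show "x \<oplus>\<^bsub>Q\<^esub> y \<in> carrier Q" if "x \<in> carrier Q" "y \<in> carrier Q" for x y
    using that unfolding Q_carrier by (elim imageE) (simp add: Q_add)
  show "x \<oplus>\<^bsub>Q\<^esub> y \<oplus>\<^bsub>Q\<^esub> z = x \<oplus>\<^bsub>Q\<^esub> (y \<oplus>\<^bsub>Q\<^esub> z)"
    if "x \<in> carrier Q" "y \<in> carrier Q" "z \<in> carrier Q" for x y z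
    using that unfolding Q_carrier by (elim imageE) (simp add: Q_add M.a_assoc)
  show "x \<oplus>\<^bsub>Q\<^esub> y = y \<oplus>\<^bsub>Q\<^esub> x" if "x \<in> carrier Q" "y \<in> carrier Q" for x y
    using that unfolding Q_carrier by (elim imageE) (simp add: Q_add M.a_comm)
qed

sublocale Q: abelian_group Q by (rule Q_abelian_group)

lemma Q_finsum:
  assumes "finite A" "f \<in> A \<rightarrow> carrier M"
  shows "(\<Oplus>\<^bsub>Q\<^esub>i\<in>A. N +>\<^bsub>M\<^esub> f i) = N +>\<^bsub>M\<^esub> (\<Oplus>\<^bsub>M\<^esub>i\<in>A. f i)"
  using assms
proof (induction A rule: finite_induct)
  case empty
  then show ?case by (simp add: coset_zero Q_zero)
next
  case (insert j A)
  have "(\<Oplus>\<^bsub>Q\<^esub>i\<in>insert j A. N +>\<^bsub>M\<^esub> f i) = (N +>\<^bsub>M\<^esub> f j) \<oplus>\<^bsub>Q\<^esub> (\<Oplus>\<^bsub>Q\<^esub>i\<in>A. N +>\<^bsub>M\<^esub> f i)"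
    by (rule Q.finsum_insert) (use insert in \<open>auto simp: Q_carrier\<close>)
  also have "\<dots> = N +>\<^bsub>M\<^esub> (f j \<oplus>\<^bsub>M\<^esub> (\<Oplus>\<^bsub>M\<^esub>i\<in>A. f i))"
    using insert by (simp add: Q_add M.finsum_closed)
  also have "f j \<oplus>\<^bsub>M\<^esub> (\<Oplus>\<^bsub>M\<^esub>i\<in>A. f i) = (\<Oplus>\<^bsub>M\<^esub>i\<in>insert j A. f i)"
    by (rule M.finsum_insert[symmetric]) (use insert in auto)
  finally show ?case .
qed

text \<open>Moves both halves of the basis property from cosets to representatives. It serves in
  both directions: to read the hypothesis on the cotangent space and to produce the basis of the
  differentials.\<close>

lemma module_basis_quotient_iff:
  fixes l :: nat
  assumes y: "\<And>i. i < l \<Longrightarrow> y i \<in> carrier M"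
  shows "module_basis R Q l (\<lambda>i. N +>\<^bsub>M\<^esub> y i) \<longleftrightarrow>
    (\<forall>c. (\<forall>i<l. c i \<in> carrier R) \<longrightarrow> (\<Oplus>\<^bsub>M\<^esub>i\<in>{..<l}. c i \<odot>\<^bsub>M\<^esub> y i) \<in> N \<longrightarrow> (\<forall>i<l. c i = \<zero>)) \<and>
    (\<forall>m\<in>carrier M. \<exists>c. (\<forall>i<l. c i \<in> carrier R) \<and> m \<ominus>\<^bsub>M\<^esub> (\<Oplus>\<^bsub>M\<^esub>i\<in>{..<l}. c i \<odot>\<^bsub>M\<^esub> y i) \<in> N)"
proof -
  have closed: "(\<Oplus>\<^bsub>M\<^esub>i\<in>{..<l}. c i \<odot>\<^bsub>M\<^esub> y i) \<in> carrier M" if "\<forall>i<l. c i \<in> carrier R" for c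
    using that y by (intro M.finsum_closed) auto
  have sum: "(\<Oplus>\<^bsub>Q\<^esub>i\<in>{..<l}. c i \<odot>\<^bsub>Q\<^esub> (N +>\<^bsub>M\<^esub> y i)) = N +>\<^bsub>M\<^esub> (\<Oplus>\<^bsub>M\<^esub>i\<in>{..<l}. c i \<odot>\<^bsub>M\<^esub> y i)"
    if c: "\<forall>i<l. c i \<in> carrier R" for c
  proof -
    have "(\<Oplus>\<^bsub>Q\<^esub>i\<in>{..<l}. c i \<odot>\<^bsub>Q\<^esub> (N +>\<^bsub>M\<^esub> y i)) = (\<Oplus>\<^bsub>Q\<^esub>i\<in>{..<l}. N +>\<^bsub>M\<^esub> (c i \<odot>\<^bsub>M\<^esub> y i))"
      using c y by (intro Q.finsum_cong') (auto simp: Q_smult Q_carrier)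
    then show ?thesis using c y by (subst (asm) Q_finsum) auto
  qed
  have c1: "(\<forall>i<l. N +>\<^bsub>M\<^esub> y i \<in> carrier Q) \<longleftrightarrow> True" using y unfolding Q_carrier by blast
  have c2: "((\<forall>i<l. c i \<in> carrier R) \<longrightarrow> (\<Oplus>\<^bsub>Q\<^esub>i\<in>{..<l}. c i \<odot>\<^bsub>Q\<^esub> (N +>\<^bsub>M\<^esub> y i)) = \<zero>\<^bsub>Q\<^esub> \<longrightarrow> S) \<longleftrightarrow>
      ((\<forall>i<l. c i \<in> carrier R) \<longrightarrow> (\<Oplus>\<^bsub>M\<^esub>i\<in>{..<l}. c i \<odot>\<^bsub>M\<^esub> y i) \<in> N \<longrightarrow> S)" for c S
  proof (cases "\<forall>i<l. c i \<in> carrier R")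
    case True
    show ?thesis unfolding sum[OF True] Q_zero coset_mem_iff[OF closed[OF True]] by (rule refl)
  next
    case False
    then show ?thesis by blast
  qed
  have c3: "((\<forall>i<l. c i \<in> carrier R) \<and> N +>\<^bsub>M\<^esub> m = (\<Oplus>\<^bsub>Q\<^esub>i\<in>{..<l}. c i \<odot>\<^bsub>Q\<^esub> (N +>\<^bsub>M\<^esub> y i))) \<longleftrightarrow>
      ((\<forall>i<l. c i \<in> carrier R) \<and> m \<ominus>\<^bsub>M\<^esub> (\<Oplus>\<^bsub>M\<^esub>i\<in>{..<l}. c i \<odot>\<^bsub>M\<^esub> y i) \<in> N)" if m: "m \<in> carrier M" for c m
  proof (cases "\<forall>i<l. c i \<in> carrier R")
    case True
    show ?thesis unfolding sum[OF True] coset_eq_iff[OF m closed[OF True]] by (rule refl)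
  next
    case False
    then show ?thesis by blast
  qed
  have c4: "(\<forall>m\<in>carrier Q. \<exists>c. (\<forall>i<l. c i \<in> carrier R) \<and> m = (\<Oplus>\<^bsub>Q\<^esub>i\<in>{..<l}. c i \<odot>\<^bsub>Q\<^esub> (N +>\<^bsub>M\<^esub> y i))) \<longleftrightarrow>
     (\<forall>m\<in>carrier M. \<exists>c. (\<forall>i<l. c i \<in> carrier R) \<and> m \<ominus>\<^bsub>M\<^esub> (\<Oplus>\<^bsub>M\<^esub>i\<in>{..<l}. c i \<odot>\<^bsub>M\<^esub> y i) \<in> N)"
    unfolding Q_carrier ball_simps(9) by (intro ball_cong refl ex_cong1 c3)
  show ?thesis unfolding module_basis_def c1 c2 c4 by (simp only: simp_thms)
qed

end

lemma module_span_incl: "E \<subseteq> module_span R M E"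
  unfolding module_span_def by (rule Inter_greatest) simp

lemma module_span_minimal: "submodule H R M \<Longrightarrow> E \<subseteq> H \<Longrightarrow> module_span R M E \<subseteq> H"
  unfolding module_span_def by (rule Inter_lower) simp

lemma module_spanI:
  "(\<And>H. submodule H R M \<Longrightarrow> E \<subseteq> H \<Longrightarrow> a \<in> H) \<Longrightarrow> a \<in> module_span R M E"
  unfolding module_span_def by (rule InterI) simp

lemma (in module) module_span_submodule:
  assumes "E \<subseteq> carrier M"
  shows "submodule (module_span R M E) R M"
proof (rule submoduleI)
  note D = subsetD[OF module_span_minimal]
  show "module_span R M E \<subseteq> carrier M" by (rule module_span_minimal[OF carrier_is_submodule assms])
  show "\<zero>\<^bsub>M\<^esub> \<in> module_span R M E" by (rule module_spanI) (rule submodule_zero_closed)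
  show "\<ominus>\<^bsub>M\<^esub> a \<in> module_span R M E" if a: "a \<in> module_span R M E" for a
    by (rule module_spanI) (rule submoduleE(3)[OF _ D[OF _ _ a]])
  show "a \<oplus>\<^bsub>M\<^esub> b \<in> module_span R M E" if ab: "a \<in> module_span R M E" "b \<in> module_span R M E" for a b
    by (rule module_spanI) (rule submoduleE(5)[OF _ D[OF _ _ ab(1)] D[OF _ _ ab(2)]])
  show "r \<odot>\<^bsub>M\<^esub> a \<in> module_span R M E" if r: "r \<in> carrier R" and a: "a \<in> module_span R M E" for r a
    by (rule module_spanI) (rule submoduleE(4)[OF _ r D[OF _ _ a]])
qed

section \<open>Local rings\<close>

lemma (in cring) binomial_expansion:
  assumes x: "x \<in> carrier R" and y: "y \<in> carrier R"
  shows "(x \<oplus> y) [^] n = (\<Oplus>k\<in>{..n}. add_pow R (n choose k) (x [^] k \<otimes> y [^] (n - k)))"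
proof (induction n)
  case 0
  then show ?case using x y by simp
next
  case (Suc n)
  let ?t = "\<lambda>k. x [^] k \<otimes> y [^] (Suc n - k)"
  let ?s = "\<lambda>k. x [^] k \<otimes> y [^] (n - k)"
  have t: "?t k \<in> carrier R" and s: "?s k \<in> carrier R" for k using x y by auto
  have c: "add_pow R m u \<in> carrier R" if "u \<in> carrier R" for m :: nat and u
    using that by (rule add.nat_pow_closed)
  have "(x \<oplus> y) [^] Suc n = (\<Oplus>k\<in>{..n}. add_pow R (n choose k) (?s k)) \<otimes> x
      \<oplus> (\<Oplus>k\<in>{..n}. add_pow R (n choose k) (?s k)) \<otimes> y"
    using x y c[OF s] by (simp only: nat_pow_Suc Suc) (intro r_distr finsum_closed, auto)
  also have "(\<Oplus>k\<in>{..n}. add_pow R (n choose k) (?s k)) \<otimes> x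
      = (\<Oplus>k\<in>{..n}. add_pow R (n choose k) (?s k) \<otimes> x)"
    using x c[OF s] by (intro finsum_ldistr) auto
  also have "(\<Oplus>k\<in>{..n}. add_pow R (n choose k) (?s k) \<otimes> x)
      = (\<Oplus>k\<in>{..n}. add_pow R (n choose k) (?t (Suc k)))"
  proof (rule finsum_cong')
    show "(\<lambda>k. add_pow R (n choose k) (?t (Suc k))) \<in> {..n} \<rightarrow> carrier R" using c[OF t] by blast
    show "add_pow R (n choose k) (?s k) \<otimes> x = add_pow R (n choose k) (?t (Suc k))" for k
    proof -
      have "?s k \<otimes> x = ?t (Suc k)" using x y by (simp add: m_ac)
      then show ?thesis using add_pow_ldistr[OF s x] by (simp only:)
    qed
  qed (rule refl)
  \<comment> \<open>Index shift. The \<open>if\<close> supplies the value \<open>0\<close> for the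
    missing term at \<open>k = 0\<close>, where the natural number \<open>k - 1\<close> would give
    the wrong coefficient \<open>n choose 0\<close>.\<close>
  also have "(\<Oplus>k\<in>{..n}. add_pow R (n choose k) (?t (Suc k)))
      = (\<Oplus>k\<in>{..Suc n}. add_pow R (if k = 0 then 0 else n choose (k - 1)) (?t k))"
  proof -
    let ?F = "\<lambda>k. add_pow R (if k = 0 then 0 else n choose (k - 1)) (?t k)"
    have "(\<Oplus>k\<in>{..Suc n}. ?F k) = (\<Oplus>k\<in>{..n}. ?F (Suc k)) \<oplus> ?F 0"
      by (rule finsum_Suc2) (use c[OF t] in blast)
    also have "?F 0 = \<zero>" by simp
    also have "(\<Oplus>k\<in>{..n}. ?F (Suc k)) \<oplus> \<zero> = (\<Oplus>k\<in>{..n}. ?F (Suc k))"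
      by (intro r_zero finsum_closed) (use c[OF t] in blast)
    finally show ?thesis by simp
  qed
  also have "(\<Oplus>k\<in>{..n}. add_pow R (n choose k) (?s k)) \<otimes> y
      = (\<Oplus>k\<in>{..n}. add_pow R (n choose k) (?s k) \<otimes> y)"
    using y c[OF s] by (intro finsum_ldistr) auto
  also have "\<dots> = (\<Oplus>k\<in>{..n}. add_pow R (n choose k) (?t k))"
  proof (rule finsum_cong')
    show "add_pow R (n choose k) (?s k) \<otimes> y = add_pow R (n choose k) (?t k)" if "k \<in> {..n}" for k
    proof -
      have "?s k \<otimes> y = ?t k" using x y that by (simp add: m_assoc Suc_diff_le)
      then show ?thesis using add_pow_ldistr[OF s y] by (simp only:)
    qed
  qed (use c[OF t] in auto)
  also have "\<dots> = (\<Oplus>k\<in>{..Suc n}. add_pow R (n choose k) (?t k))"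
    by (intro add.finprod_mono_neutral_cong_left)
      (use c[OF t] in \<open>auto simp: not_le binomial_eq_0 simp del: nat_pow_Suc diff_Suc_Suc\<close>)
  also have "(\<Oplus>k\<in>{..Suc n}. add_pow R (if k = 0 then 0 else n choose (k - 1)) (?t k)) \<oplus>
      (\<Oplus>k\<in>{..Suc n}. add_pow R (n choose k) (?t k)) =
      (\<Oplus>k\<in>{..Suc n}. add_pow R (if k = 0 then 0 else n choose (k - 1)) (?t k) \<oplus> add_pow R (n choose k) (?t k))"
    using c[OF t] by (intro finsum_addf[symmetric]) auto
  also have "\<dots> = (\<Oplus>k\<in>{..Suc n}. add_pow R (Suc n choose k) (?t k))"
  proof (rule finsum_cong')
    show "add_pow R (if k = 0 then 0 else n choose (k - 1)) (?t k) \<oplus> add_pow R (n choose k) (?t k)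
        = add_pow R (Suc n choose k) (?t k)" for k
    proof -
      have "(if k = 0 then 0 else n choose (k - 1)) + (n choose k) = Suc n choose k"
        by (cases k) simp_all
      then show ?thesis using add.nat_pow_mult[OF t] by (simp only:)
    qed
  qed (use c[OF t] in auto)
  finally show ?case .
qed

lemma (in cring) freshmans_dream:
  assumes p: "Factorial_Ring.prime (p::nat)" "add_pow R p \<one> = \<zero>"
    and x: "x \<in> carrier R" and y: "y \<in> carrier R"
  shows "(x \<oplus> y) [^] p = x [^] p \<oplus> y [^] p"
proof -
  let ?f = "\<lambda>k. add_pow R (p choose k) (x [^] k \<otimes> y [^] (p - k))"
  have p0: "0 < p" using p(1) prime_gt_0_nat by blast
  have "(x \<oplus> y) [^] p = (\<Oplus>k\<in>{..p}. ?f k)" by (rule binomial_expansion[OF x y])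
  also have "\<dots> = (\<Oplus>k\<in>{0, p}. ?f k)"
  proof (rule add.finprod_mono_neutral_cong_right)
    show "?f k = \<zero>" if k: "k \<in> {..p} - {0, p}" for k
    proof -
      let ?u = "x [^] k \<otimes> y [^] (p - k)"
      have u: "?u \<in> carrier R" using x y by simp
      have "p dvd (p choose k)" using k p(1) by (intro dvd_choose_prime) auto
      then obtain m where m: "p choose k = p * m" by blast
      have "add_pow R p ?u = \<zero>" using add_pow_ldistr[OF one_closed u, of p] p(2) u by simp
      then show ?thesis
        unfolding m add.nat_pow_pow[OF u, symmetric] by (simp only: add.nat_pow_one)
    qed
  qed (use x y in auto)
  also have "\<dots> = ?f 0 \<oplus> ?f p" using p0 x y by (subst finsum_insert) auto
  also have "\<dots> = x [^] p \<oplus> y [^] p" using x y by (simp add: a_comm)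
  finally show ?thesis .
qed

lemma (in cring) freshmans_dream_iter:
  assumes p: "Factorial_Ring.prime (p::nat)" "add_pow R p \<one> = \<zero>"
    and x: "x \<in> carrier R" and y: "y \<in> carrier R"
  shows "(x \<oplus> y) [^] (p ^ n) = x [^] (p ^ n) \<oplus> y [^] (p ^ n)"
proof (induction n)
  case 0
  then show ?case using x y by simp
next
  case (Suc n)
  have e: "u [^] (p ^ Suc n) = (u [^] (p ^ n)) [^] p" if "u \<in> carrier R" for u
    unfolding nat_pow_pow[OF that] by (simp only: power_Suc mult.commute)
  show ?case
    unfolding e[OF x] e[OF y] e[OF a_closed[OF x y]] Suc
    by (rule freshmans_dream[OF p]) (use x y in auto)
qed

section \<open>Maximal ideals and criteria for local rings\<close>

lemma (in cring) exists_maximalideal: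
  assumes I: "ideal I R" "\<one> \<notin> I"
  shows "\<exists>M. maximalideal M R \<and> I \<subseteq> M"
proof -
  define S where "S = {J. ideal J R \<and> I \<subseteq> J \<and> \<one> \<notin> J}"
  have "\<Union>C \<in> S" if C: "C \<noteq> {}" "subset.chain S C" for C
  proof -
    have sub: "ideal J R" "I \<subseteq> J" "\<one> \<notin> J" if "J \<in> C" for J
      using C that unfolding S_def subset.chain_def by blast+
    have "subset.chain {J. ideal J R} C"
      using C(2) unfolding S_def subset.chain_def by blast
    then have "ideal (if C = {} then {\<zero>} else \<Union>C) R" by (rule chain_Union_is_ideal)
    then have idl: "ideal (\<Union>C) R" using C(1) by simp
    obtain J where "J \<in> C" using C(1) by blast
    then have "I \<subseteq> \<Union>C" using sub(2) by blast
    then show ?thesis using idl sub(3) unfolding S_def by blast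
  qed
  moreover have "S \<noteq> {}" using I unfolding S_def by blast
  ultimately obtain M where M: "M \<in> S" and max: "\<And>J. J \<in> S \<Longrightarrow> M \<subseteq> J \<Longrightarrow> J = M"
    using subset_Zorn_nonempty[of S] by blast
  have MS: "ideal M R" "I \<subseteq> M" "\<one> \<notin> M" using M unfolding S_def by blast+
  have "maximalideal M R"
  proof (rule maximalidealI[OF MS(1)])
    show "carrier R \<noteq> M" using MS(3) one_closed by blast
    show "J = M \<or> J = carrier R" if J: "ideal J R" "M \<subseteq> J" "J \<subseteq> carrier R" for J
    proof (cases "\<one> \<in> J")
      case True
      then show ?thesis using ideal.one_imp_carrier[OF J(1)] by blast
    next
      case False
      then have "J \<in> S" using J MS(2) unfolding S_def by blast
      then show ?thesis using max J(2) by blast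
    qed
  qed
  then show ?thesis using MS(2) by blast
qed

lemma (in cring) maximalideal_nonunit:
  assumes "maximalideal M R" "x \<in> M"
  shows "x \<notin> Units R"
proof
  interpret M: maximalideal M R by (rule assms(1))
  assume x: "x \<in> Units R"
  then have "inv x \<otimes> x \<in> M" using assms(2) M.I_l_closed Units_inv_closed by blast
  then have "\<one> \<in> M" using x by simp
  then show False using M.one_imp_carrier M.I_notcarr by blast
qed

text \<open>A nonunit generates a proper principal ideal, which lies in some maximal ideal, hence in
  the only one.\<close>

lemma local_ring_max_ideal:
  fixes R (structure)
  assumes "local_ring R"
  shows "maximalideal (max_ideal R) R" "max_ideal R = carrier R - Units R"
proof -
  interpret cring R using assms by (simp add: local_ring_def)
  have ex1: "\<exists>!m. maximalideal m R" using assms by (simp add: local_ring_def)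
  show max: "maximalideal (max_ideal R) R" unfolding max_ideal_def by (rule theI'[OF ex1])
  interpret M: maximalideal "max_ideal R" R by (rule max)
  have "x \<in> max_ideal R" if x: "x \<in> carrier R" "x \<notin> Units R" for x
  proof -
    have "\<one> \<notin> PIdl x"
    proof
      assume "\<one> \<in> PIdl x"
      then obtain y where "y \<in> carrier R" "\<one> = y \<otimes> x" unfolding cgenideal_def by blast
      then have "x \<in> Units R" using x(1) m_comm[of y x] unfolding Units_def by auto
      then show False using x(2) by blast
    qed
    then obtain M where M: "maximalideal M R" "PIdl x \<subseteq> M"
      using exists_maximalideal[OF cgenideal_ideal[OF x(1)]] by blast
    then have "M = max_ideal R" using ex1 max by blast
    then show ?thesis using M(2) cgenideal_self[OF x(1)] by blast
  qed
  then show "max_ideal R = carrier R - Units R"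
    using M.a_subset maximalideal_nonunit[OF max] by blast
qed

text \<open>Multiples of nonunits are nonunits in any commutative ring, so closure under addition
  turns the nonunits into an ideal. Every proper ideal is contained in it.\<close>

lemma local_ringI:
  fixes R (structure)
  assumes R: "cring R" and ne: "\<one>\<^bsub>R\<^esub> \<noteq> \<zero>\<^bsub>R\<^esub>"
    and add: "\<And>x y. x \<in> carrier R - Units R \<Longrightarrow> y \<in> carrier R - Units R \<Longrightarrow> x \<oplus>\<^bsub>R\<^esub> y \<notin> Units R"
  shows "local_ring R"
proof -
  interpret cring R by (rule R)
  let ?N = "carrier R - Units R"
  have mult: "x \<otimes> y \<in> ?N" if "x \<in> carrier R" "y \<in> ?N" for x y
  proof -
    have "y \<in> Units R" if "x \<otimes> y \<in> Units R"
      using unit_factor[of y x] that \<open>x \<in> carrier R\<close> \<open>y \<in> ?N\<close> m_comm by auto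
    then show ?thesis using that by auto
  qed
  have zero: "\<zero> \<in> ?N"
  proof -
    have "\<zero> \<notin> Units R"
    proof
      assume "\<zero> \<in> Units R"
      then obtain u where "u \<in> carrier R" "u \<otimes> \<zero> = \<one>" unfolding Units_def by blast
      then show False using ne by simp
    qed
    then show ?thesis by simp
  qed
  have idl: "ideal ?N R"
  proof (rule idealI[OF ring_axioms])
    show "subgroup ?N (add_monoid R)"
    proof (rule group.subgroupI[OF a_group])
      show "?N \<noteq> {}" using zero by blast
      show "inv\<^bsub>add_monoid R\<^esub> y \<in> ?N" if y: "y \<in> ?N" for y
      proof -
        have "(\<ominus> \<one>) \<otimes> y \<in> ?N" using mult[OF _ y] by simp
        also have "(\<ominus> \<one>) \<otimes> y = \<ominus> y" using y by (simp add: l_minus)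
        finally show ?thesis by (simp add: a_inv_def)
      qed
    qed (use add in auto)
    show "x \<otimes> y \<in> ?N" if "y \<in> ?N" "x \<in> carrier R" for x y using mult[OF that(2,1)] .
    show "y \<otimes> x \<in> ?N" if "y \<in> ?N" "x \<in> carrier R" for x y
      using mult[OF that(2,1)] m_comm[of x y] that by simp
  qed
  have max: "maximalideal ?N R"
  proof (rule maximalidealI[OF idl])
    show "carrier R \<noteq> ?N" using Units_one_closed one_closed by blast
    show "J = ?N \<or> J = carrier R" if J: "ideal J R" "?N \<subseteq> J" "J \<subseteq> carrier R" for J
    proof (cases "J \<subseteq> ?N")
      case False
      then obtain u where u: "u \<in> J" "u \<in> Units R" using J(3) by blast
      then have "inv u \<otimes> u \<in> J" using ideal.I_l_closed[OF J(1)] by blast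
      then have "\<one> \<in> J" using u by simp
      then show ?thesis using ideal.one_imp_carrier[OF J(1)] by blast
    qed (use J in blast)
  qed
  moreover have "M = ?N" if M: "maximalideal M R" for M
  proof -
    interpret M: maximalideal M R by (rule M)
    have "M \<subseteq> ?N" using maximalideal_nonunit[OF M] M.a_subset by blast
    then show ?thesis using M.I_maximal[OF idl] calculation
      by (metis Diff_subset maximalideal.I_notcarr)
  qed
  ultimately show ?thesis unfolding local_ring_def using R by blast
qed

text \<open>Nakayama's lemma for the maximal ideal itself.\<close>

lemma (in cring) maximal_ideal_eq_of_generators:
  assumes n: "ideal n R" and unit: "\<And>t. t \<in> n \<Longrightarrow> \<one> \<ominus> t \<in> Units R"
    and J: "ideal J R" and G: "finite G" "G \<subseteq> carrier R"
    and gen: "n = genideal R (J \<union> G)"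
    and sq: "\<And>t. t \<in> n \<Longrightarrow> \<exists>j\<in>J. \<exists>u\<in>ideal_prod R n n. t = j \<oplus> u"
  shows "n = J"
  using G gen
proof (induction G rule: finite_induct)
  case empty
  then show ?case using genideal_minimal[OF J, of J] genideal_self[of J] ideal.Icarr[OF J] by auto
next
  case (insert g G)
  interpret n: ideal n R by (rule n)
  have gR: "g \<in> carrier R" and GR: "G \<subseteq> carrier R" using insert.prems by auto
  have JR: "J \<subseteq> carrier R" using ideal.Icarr[OF J] by blast
  define I where "I = genideal R (J \<union> G)"
  have I: "ideal I R" unfolding I_def by (rule genideal_ideal) (use JR GR in blast)
  interpret I: ideal I R by (rule I)
  have JI: "J \<subseteq> I" and GI: "G \<subseteq> I" unfolding I_def using genideal_self[of "J \<union> G"] JR GR by auto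
  have gn: "g \<in> n" unfolding insert.prems(2) using genideal_self[of "J \<union> insert g G"] JR insert.prems(1) by auto
  have In: "I \<subseteq> n" unfolding I_def
  proof (rule genideal_minimal[OF n])
    show "J \<union> G \<subseteq> n" unfolding insert.prems(2) using genideal_self[of "J \<union> insert g G"] JR insert.prems(1) by auto
  qed
  define H where "H = {i \<oplus> r \<otimes> g | i r. i \<in> I \<and> r \<in> carrier R}"
  have HI: "ideal H R"
  proof -
    have "H = I <+>\<^bsub>R\<^esub> PIdl g" unfolding H_def set_add_def' cgenideal_def by blast
    then show ?thesis using add_ideals[OF I cgenideal_ideal[OF gR]] by simp
  qed
  have nH: "n \<subseteq> H"
  proof -
    have IH: "i \<in> H" if "i \<in> I" for i
    proof -
      have "i = i \<oplus> \<zero> \<otimes> g" using I.Icarr[OF that] gR by simp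
      then show ?thesis unfolding H_def using that zero_closed by blast
    qed
    have "g = \<zero> \<oplus> \<one> \<otimes> g" using gR by simp
    then have gH: "g \<in> H" unfolding H_def using additive_subgroup.zero_closed[OF ideal.axioms(1)[OF I]] one_closed by blast
    show ?thesis unfolding insert.prems(2)
      by (rule genideal_minimal[OF HI]) (use IH gH JI GI in blast)
  qed
  \<comment> \<open>The square of \<open>n\<close> lies in \<open>I + n g\<close>: only the second
    factor of a product is expanded in \<open>H = I + R g\<close>, while the first factor supplies
    the coefficient in \<open>n\<close>.\<close>
  define H2 where "H2 = {i \<oplus> t \<otimes> g | i t. i \<in> I \<and> t \<in> n}"
  have prodH2: "u \<in> H2" if "u \<in> ideal_prod R n n" for u
    using that
  proof (induction u rule: ideal_prod.induct)
    case (prod s t)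
    obtain i r where ir: "t = i \<oplus> r \<otimes> g" "i \<in> I" "r \<in> carrier R"
      using nH prod(2) unfolding H_def by blast
    have c: "s \<in> carrier R" "i \<in> carrier R" using n.Icarr[OF prod(1)] I.Icarr[OF ir(2)] by auto
    have "s \<otimes> t = s \<otimes> i \<oplus> (s \<otimes> r) \<otimes> g" using ir c gR by (simp add: r_distr m_assoc)
    moreover have "s \<otimes> i \<in> I" using I.I_l_closed[OF ir(2) c(1)] .
    moreover have "s \<otimes> r \<in> n" using n.I_r_closed[OF prod(1) ir(3)] .
    ultimately show ?case unfolding H2_def by blast
  next
    case (sum u v)
    obtain i t i' t' where it: "u = i \<oplus> t \<otimes> g" "i \<in> I" "t \<in> n" "v = i' \<oplus> t' \<otimes> g" "i' \<in> I" "t' \<in> n"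
      using sum.IH unfolding H2_def by blast
    have c: "i \<in> carrier R" "i' \<in> carrier R" "t \<in> carrier R" "t' \<in> carrier R"
      using I.Icarr[OF it(2)] I.Icarr[OF it(5)] n.Icarr[OF it(3)] n.Icarr[OF it(6)] by auto
    have "u \<oplus> v = (i \<oplus> i') \<oplus> (t \<oplus> t') \<otimes> g" using it c gR by (simp add: l_distr a_ac)
    moreover have "i \<oplus> i' \<in> I" "t \<oplus> t' \<in> n"
      using I.a_closed[OF it(2,5)] n.a_closed[OF it(3,6)] .
    ultimately show ?case unfolding H2_def by blast
  qed
  obtain j u where ju: "j \<in> J" "u \<in> ideal_prod R n n" "g = j \<oplus> u" using sq[OF gn] by blast
  obtain i t where it: "u = i \<oplus> t \<otimes> g" "i \<in> I" "t \<in> n" using prodH2[OF ju(2)] unfolding H2_def by blast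
  have c: "i \<in> carrier R" "t \<in> carrier R" "j \<in> carrier R"
    using I.Icarr[OF it(2)] n.Icarr[OF it(3)] JR ju(1) by auto
  have ut: "\<one> \<ominus> t \<in> Units R" by (rule unit[OF it(3)])
  have g_eq: "g = (j \<oplus> i) \<oplus> t \<otimes> g" using ju(3) it(1) c gR by (simp add: a_assoc)
  have "(\<one> \<ominus> t) \<otimes> g = g \<ominus> t \<otimes> g" using c gR by (simp add: a_minus_def l_distr l_minus)
  also have "\<dots> = ((j \<oplus> i) \<oplus> t \<otimes> g) \<ominus> t \<otimes> g" using g_eq by simp
  also have "\<dots> = j \<oplus> i" using c gR by (simp add: a_minus_def a_assoc r_neg)
  finally have eq: "(\<one> \<ominus> t) \<otimes> g = j \<oplus> i" .
  have "j \<oplus> i \<in> I" using I.a_closed it(2) ju(1) JI by blast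
  then have "inv (\<one> \<ominus> t) \<otimes> ((\<one> \<ominus> t) \<otimes> g) \<in> I"
    unfolding eq using I.I_l_closed Units_inv_closed[OF ut] by blast
  then have gI: "g \<in> I"
    using ut gR Units_closed[OF ut] by (simp add: m_assoc[symmetric])
  have "n \<subseteq> I" unfolding insert.prems(2)
    by (rule genideal_minimal[OF I]) (use gI JI GI in blast)
  then have "n = I" using In by blast
  then show ?case using insert.IH GR unfolding I_def by blast
qed

section \<open>Purely inseparable base change of a local ring\<close>

lemma module_restrict_scalars:
  assumes "cring R" "cring S" "\<psi> \<in> ring_hom R S"
  shows "module R (restrict_scalars S \<psi>)"
proof -
  interpret R: cring R by (rule assms(1))
  interpret S: cring S by (rule assms(2))
  note h = ring_hom_closed[OF assms(3)] ring_hom_mult[OF assms(3)] ring_hom_add[OF assms(3)] ring_hom_one[OF assms(3)]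
  have ag: "abelian_group (restrict_scalars S \<psi>)"
    by (rule abelian_groupI) (auto simp: restrict_scalars_def S.a_ac intro!: bexI[of _ "\<ominus>\<^bsub>S\<^esub> _"] S.l_neg)
  show ?thesis
    by (rule moduleI[OF assms(1) ag])
      (auto simp: restrict_scalars_def h S.l_distr S.r_distr S.m_assoc)
qed

lemma restrict_scalars_simps:
  "carrier (restrict_scalars S \<psi>) = carrier S"
  "ring.zero (restrict_scalars S \<psi>) = ring.zero S"
  "ring.add (restrict_scalars S \<psi>) = ring.add S"
  "smult (restrict_scalars S \<psi>) r x = \<psi> r \<otimes>\<^bsub>S\<^esub> x"
  by (simp_all add: restrict_scalars_def)

lemma restrict_scalars_a_inv:
  "a_inv (restrict_scalars S \<psi>) = a_inv S" "a_minus (restrict_scalars S \<psi>) = a_minus S"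
  "finsum (restrict_scalars S \<psi>) = finsum S"
proof -
  show *: "a_inv (restrict_scalars S \<psi>) = a_inv S"
    by (intro ext) (simp add: a_inv_def m_inv_def restrict_scalars_def)
  show "a_minus (restrict_scalars S \<psi>) = a_minus S"
    by (intro ext) (simp only: a_minus_def * restrict_scalars_simps)
  show "finsum (restrict_scalars S \<psi>) = finsum S"
    by (intro ext) (simp add: finsum_def finprod_def restrict_scalars_def)
qed

lemma ring_hom_nat_pow:
  assumes "cring R" "cring S" "h \<in> ring_hom R S" "x \<in> carrier R"
  shows "h (x [^]\<^bsub>R\<^esub> (n::nat)) = h x [^]\<^bsub>S\<^esub> n"
proof -
  interpret ring_hom_cring R S h
    using assms by (intro ring_hom_cring.intro ring_hom_cring_axioms.intro)
  show ?thesis by (induction n) (use assms(4) in simp_all)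
qed

lemma ring_hom_add_pow:
  assumes "cring R" "cring S" "h \<in> ring_hom R S" "x \<in> carrier R"
  shows "h (add_pow R (n::nat) x) = add_pow S n (h x)"
proof -
  interpret R: cring R by (rule assms(1))
  interpret S: cring S by (rule assms(2))
  have h0: "h \<zero>\<^bsub>R\<^esub> = \<zero>\<^bsub>S\<^esub>" using ring_hom_zero[OF assms(3) R.ring_axioms S.ring_axioms] .
  show ?thesis
    by (induction n) (use assms(4) in \<open>simp_all add: h0 ring_hom_add[OF assms(3)]\<close>)
qed

lemma ring_hom_Units:
  assumes "cring R" "cring S" "h \<in> ring_hom R S" "x \<in> Units R"
  shows "h x \<in> Units S" "h (inv\<^bsub>R\<^esub> x) = inv\<^bsub>S\<^esub> (h x)"
proof -
  interpret R: cring R by (rule assms(1))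
  interpret S: cring S by (rule assms(2))
  have c: "x \<in> carrier R" "inv\<^bsub>R\<^esub> x \<in> carrier R" using assms(4) by auto
  have "h (inv\<^bsub>R\<^esub> x) \<otimes>\<^bsub>S\<^esub> h x = \<one>\<^bsub>S\<^esub>" "h x \<otimes>\<^bsub>S\<^esub> h (inv\<^bsub>R\<^esub> x) = \<one>\<^bsub>S\<^esub>"
    using ring_hom_mult[OF assms(3) c] ring_hom_mult[OF assms(3) c(2,1)] ring_hom_one[OF assms(3)] assms(4)
    by simp_all
  moreover have hc: "h x \<in> carrier S" "h (inv\<^bsub>R\<^esub> x) \<in> carrier S" using ring_hom_closed[OF assms(3)] c by auto
  ultimately show "h x \<in> Units S" unfolding Units_def by blast
  show "h (inv\<^bsub>R\<^esub> x) = inv\<^bsub>S\<^esub> (h x)"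
    using S.comm_inv_char[OF hc] \<open>h x \<otimes>\<^bsub>S\<^esub> h (inv\<^bsub>R\<^esub> x) = \<one>\<^bsub>S\<^esub>\<close> by simp
qed

text \<open>\<open>B\<close> is the tensor product of \<open>Ob\<close> and \<open>L\<close> over \<open>K\<close>, of which only generation by pure tensors and
  the extension of \<open>K\<close>-linear maps from \<open>Ob\<close> to \<open>L\<close> are retained.\<close>

locale insep_base_change =
  L: field L + Ob: cring Ob + B: cring B
  for L :: "('l, 'p) ring_scheme" and Ob :: "('a, 'q) ring_scheme" and B :: "('b, 'r) ring_scheme" +
  fixes K :: "'l set" and p :: nat and \<phi> :: "'l \<Rightarrow> 'a" and \<iota> :: "'a \<Rightarrow> 'b" and s :: "'l \<Rightarrow> 'b"
  assumes K: "subfield K L"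
    and p: "Factorial_Ring.prime p" "add_pow L p \<one>\<^bsub>L\<^esub> = \<zero>\<^bsub>L\<^esub>"
    and insep: "c \<in> carrier L \<Longrightarrow> \<exists>n. c [^]\<^bsub>L\<^esub> (p ^ n) \<in> K"
    and local_Ob: "local_ring Ob"
    and \<phi>: "\<phi> \<in> ring_hom (L\<lparr>carrier := K\<rparr>) Ob"
    and \<iota>: "\<iota> \<in> ring_hom Ob B" and s: "s \<in> ring_hom L B"
    and \<iota>_\<phi>: "c \<in> K \<Longrightarrow> \<iota> (\<phi> c) = s c"
    and B_induct: "t \<in> carrier B \<Longrightarrow> Q \<zero>\<^bsub>B\<^esub> \<Longrightarrow>
      (\<And>x c t. x \<in> carrier Ob \<Longrightarrow> c \<in> carrier L \<Longrightarrow> t \<in> carrier B \<Longrightarrow> Q t \<Longrightarrow> Q (\<iota> x \<otimes>\<^bsub>B\<^esub> s c \<oplus>\<^bsub>B\<^esub> t)) \<Longrightarrow> Q t"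
    and B_universal: "(\<And>x. x \<in> carrier Ob \<Longrightarrow> g x \<in> carrier L) \<Longrightarrow>
      (\<And>x y. x \<in> carrier Ob \<Longrightarrow> y \<in> carrier Ob \<Longrightarrow> g (x \<oplus>\<^bsub>Ob\<^esub> y) = g x \<oplus>\<^bsub>L\<^esub> g y) \<Longrightarrow>
      (\<And>c x. c \<in> K \<Longrightarrow> x \<in> carrier Ob \<Longrightarrow> g (\<phi> c \<otimes>\<^bsub>Ob\<^esub> x) = c \<otimes>\<^bsub>L\<^esub> g x) \<Longrightarrow>
      \<exists>\<Phi>. (\<forall>t\<in>carrier B. \<Phi> t \<in> carrier L) \<and>
        (\<forall>t\<in>carrier B. \<forall>u\<in>carrier B. \<Phi> (t \<oplus>\<^bsub>B\<^esub> u) = \<Phi> t \<oplus>\<^bsub>L\<^esub> \<Phi> u) \<and>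
        (\<forall>x\<in>carrier Ob. \<forall>c\<in>carrier L. \<Phi> (\<iota> x \<otimes>\<^bsub>B\<^esub> s c) = g x \<otimes>\<^bsub>L\<^esub> c)"
begin

section \<open>Nontriviality and locality of the base change\<close>

abbreviation m where "m \<equiv> max_ideal Ob"
abbreviation KR where "KR \<equiv> L\<lparr>carrier := K\<rparr>"

sublocale \<iota>: ring_hom_cring Ob B \<iota> by unfold_locales (rule \<iota>)
sublocale s: ring_hom_cring L B s by unfold_locales (rule s)

lemma K_closed [simp]: "c \<in> K \<Longrightarrow> c \<in> carrier L"
  using subfieldE(3)[OF K] by blast

lemma \<phi>_closed [simp]: "c \<in> K \<Longrightarrow> \<phi> c \<in> carrier Ob"
  using ring_hom_closed[OF \<phi>] by simp

lemma KR_field: "field KR"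
  using L.subfield_iff(2)[OF K] .

lemma KR_cring: "cring KR"
  using KR_field by (simp add: field_def domain_def)

lemma m_maximal: "maximalideal m Ob" and m_eq: "m = carrier Ob - Units Ob"
  using local_ring_max_ideal[OF local_Ob] by auto

lemma Ob_nontrivial: "\<one>\<^bsub>Ob\<^esub> \<noteq> \<zero>\<^bsub>Ob\<^esub>"
proof
  interpret m: maximalideal m Ob by (rule m_maximal)
  assume "\<one>\<^bsub>Ob\<^esub> = \<zero>\<^bsub>Ob\<^esub>"
  then have "\<one>\<^bsub>Ob\<^esub> \<in> m" using additive_subgroup.zero_closed[OF ideal.axioms(1)[OF m.is_ideal]] by simp
  then show False using m.one_imp_carrier m.I_notcarr by blast
qed

lemma additive_zero:
  assumes "\<And>t. t \<in> carrier B \<Longrightarrow> \<Phi> t \<in> carrier L"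
    and "\<And>t u. t \<in> carrier B \<Longrightarrow> u \<in> carrier B \<Longrightarrow> \<Phi> (t \<oplus>\<^bsub>B\<^esub> u) = \<Phi> t \<oplus>\<^bsub>L\<^esub> \<Phi> u"
  shows "\<Phi> \<zero>\<^bsub>B\<^esub> = \<zero>\<^bsub>L\<^esub>"
    and "\<And>t u. t \<in> carrier B \<Longrightarrow> u \<in> carrier B \<Longrightarrow> \<Phi> (t \<ominus>\<^bsub>B\<^esub> u) = \<Phi> t \<ominus>\<^bsub>L\<^esub> \<Phi> u"
proof -
  have "\<Phi> \<zero>\<^bsub>B\<^esub> \<oplus>\<^bsub>L\<^esub> \<Phi> \<zero>\<^bsub>B\<^esub> = \<Phi> \<zero>\<^bsub>B\<^esub>"
    using assms(2)[OF B.zero_closed B.zero_closed] by simp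
  then show z: "\<Phi> \<zero>\<^bsub>B\<^esub> = \<zero>\<^bsub>L\<^esub>" using assms(1)[OF B.zero_closed] by simp
  fix t u assume tu: "t \<in> carrier B" "u \<in> carrier B"
  have "(t \<ominus>\<^bsub>B\<^esub> u) \<oplus>\<^bsub>B\<^esub> u = t" using tu by (simp add: a_minus_def B.a_assoc B.l_neg)
  then have "\<Phi> t = \<Phi> (t \<ominus>\<^bsub>B\<^esub> u) \<oplus>\<^bsub>L\<^esub> \<Phi> u" using assms(2)[OF B.minus_closed[OF tu] tu(2)] by simp
  then show "\<Phi> (t \<ominus>\<^bsub>B\<^esub> u) = \<Phi> t \<ominus>\<^bsub>L\<^esub> \<Phi> u"
    using assms(1)[OF tu(2)] assms(1)[OF B.minus_closed[OF tu]] by (simp add: a_minus_def L.a_assoc L.r_neg)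
qed

text \<open>Since \<open>B\<close> is known only through maps out of it, \<open>1\<close> and
  \<open>0\<close> are separated by one: a \<open>K\<close>-linear functional on \<open>Ob\<close>
  with value \<open>1\<close> at \<open>1\<close>, extended to \<open>B\<close> by
  \<open>B_universal\<close>.\<close>

lemma B_nontrivial: "\<one>\<^bsub>B\<^esub> \<noteq> \<zero>\<^bsub>B\<^esub>"
proof
  assume eq: "\<one>\<^bsub>B\<^esub> = \<zero>\<^bsub>B\<^esub>"
  let ?M = "restrict_scalars Ob \<phi>"
  interpret M: module KR ?M by (rule module_restrict_scalars[OF KR_cring Ob.is_cring \<phi>])
  have "submodule {\<zero>\<^bsub>?M\<^esub>} KR ?M"
  proof (rule M.submoduleI)
    show "\<ominus>\<^bsub>?M\<^esub> a \<in> {\<zero>\<^bsub>?M\<^esub>}" if "a \<in> {\<zero>\<^bsub>?M\<^esub>}" for a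
      using that by (simp add: restrict_scalars_simps restrict_scalars_a_inv)
  qed (use M.M.l_zero[OF M.M.zero_closed] M.smult_r_null in simp_all)
  then obtain f where f: "f \<in> carrier ?M \<rightarrow> carrier KR"
    "\<forall>u\<in>carrier ?M. \<forall>v\<in>carrier ?M. f (u \<oplus>\<^bsub>?M\<^esub> v) = f u \<oplus>\<^bsub>KR\<^esub> f v"
    "\<forall>r\<in>carrier KR. \<forall>u\<in>carrier ?M. f (r \<odot>\<^bsub>?M\<^esub> u) = r \<otimes>\<^bsub>KR\<^esub> f u" "f \<one>\<^bsub>Ob\<^esub> = \<one>\<^bsub>KR\<^esub>"
    using exists_linear_functional[OF KR_field M.module_axioms, of "{\<zero>\<^bsub>?M\<^esub>}" "\<one>\<^bsub>Ob\<^esub>"] Ob_nontrivial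
    unfolding restrict_scalars_simps by auto
  have f': "f x \<in> carrier L" if "x \<in> carrier Ob" for x
    using funcset_mem[OF f(1), of x] that K_closed by (simp add: restrict_scalars_simps)
  have "\<exists>\<Phi>. (\<forall>t\<in>carrier B. \<Phi> t \<in> carrier L) \<and>
        (\<forall>t\<in>carrier B. \<forall>u\<in>carrier B. \<Phi> (t \<oplus>\<^bsub>B\<^esub> u) = \<Phi> t \<oplus>\<^bsub>L\<^esub> \<Phi> u) \<and>
        (\<forall>x\<in>carrier Ob. \<forall>c\<in>carrier L. \<Phi> (\<iota> x \<otimes>\<^bsub>B\<^esub> s c) = f x \<otimes>\<^bsub>L\<^esub> c)"
    by (rule B_universal) (use f' f(2,3) in \<open>simp_all add: restrict_scalars_simps\<close>)
  then obtain \<Phi> where \<Phi>: "\<And>t. t \<in> carrier B \<Longrightarrow> \<Phi> t \<in> carrier L"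
      "\<And>t u. t \<in> carrier B \<Longrightarrow> u \<in> carrier B \<Longrightarrow> \<Phi> (t \<oplus>\<^bsub>B\<^esub> u) = \<Phi> t \<oplus>\<^bsub>L\<^esub> \<Phi> u"
      "\<And>x c. x \<in> carrier Ob \<Longrightarrow> c \<in> carrier L \<Longrightarrow> \<Phi> (\<iota> x \<otimes>\<^bsub>B\<^esub> s c) = f x \<otimes>\<^bsub>L\<^esub> c"
    by blast
  have "\<Phi> \<one>\<^bsub>B\<^esub> = \<one>\<^bsub>L\<^esub>" using \<Phi>(3)[OF Ob.one_closed L.one_closed] f(4) by simp
  moreover have "\<Phi> \<zero>\<^bsub>B\<^esub> = \<zero>\<^bsub>L\<^esub>" by (rule additive_zero(1)[OF \<Phi>(1,2)])
  ultimately show False using eq by simp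
qed

lemma p_B: "add_pow B p \<one>\<^bsub>B\<^esub> = \<zero>\<^bsub>B\<^esub>"
  using ring_hom_add_pow[OF L.is_cring B.is_cring s L.one_closed, of p] p(2) by simp

lemma pow_pow: "(y [^]\<^bsub>B\<^esub> (p ^ n)) [^]\<^bsub>B\<^esub> (p ^ n') = y [^]\<^bsub>B\<^esub> (p ^ (n + n'))" if "y \<in> carrier B"
  using B.nat_pow_pow[OF that, of "p ^ n" "p ^ n'"] by (simp only: power_add)

text \<open>Raising to a power with exponent \<open>p ^ n\<close> is additive in characteristic
  \<open>p\<close>, so the pure tensors can be treated one by one. A high enough power of a scalar
  lies in \<open>K\<close>, and there \<open>s\<close> factors through
  \<open>\<iota>\<close>.\<close>

lemma pow_mem_\<iota>:
  assumes "y \<in> carrier B"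
  shows "\<exists>n. \<exists>x\<in>carrier Ob. y [^]\<^bsub>B\<^esub> (p ^ n) = \<iota> x"
  using assms
proof (rule B_induct)
  show "\<exists>n. \<exists>x\<in>carrier Ob. \<zero>\<^bsub>B\<^esub> [^]\<^bsub>B\<^esub> (p ^ n) = \<iota> x"
    by (intro exI[of _ 0] bexI[of _ "\<zero>\<^bsub>Ob\<^esub>"]) simp_all
  fix x c t
  assume xct: "x \<in> carrier Ob" "c \<in> carrier L" "t \<in> carrier B"
  assume "\<exists>n. \<exists>x\<in>carrier Ob. t [^]\<^bsub>B\<^esub> (p ^ n) = \<iota> x"
  then obtain n y where ny: "y \<in> carrier Ob" "t [^]\<^bsub>B\<^esub> (p ^ n) = \<iota> y" by blast
  obtain n' where n': "c [^]\<^bsub>L\<^esub> (p ^ n') \<in> K" using insep[OF xct(2)] by blast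
  \<comment> \<open>A common exponent for both summands: \<open>K\<close> and the image of
    \<open>\<iota>\<close> are stable under further powers.\<close>
  let ?N = "n + n'"
  have t: "t [^]\<^bsub>B\<^esub> (p ^ ?N) = \<iota> (y [^]\<^bsub>Ob\<^esub> (p ^ n'))"
    unfolding pow_pow[OF xct(3), symmetric] ny(2)
    by (rule ring_hom_nat_pow[OF Ob.is_cring B.is_cring \<iota> ny(1), symmetric])
  have "c [^]\<^bsub>L\<^esub> (p ^ ?N) = (c [^]\<^bsub>L\<^esub> (p ^ n')) [^]\<^bsub>L\<^esub> (p ^ n)"
    using L.nat_pow_pow[OF xct(2), of "p ^ n'" "p ^ n"] by (simp only: power_add mult.commute)
  moreover have "d [^]\<^bsub>L\<^esub> (i::nat) \<in> K" if "d \<in> K" for d i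
    using that subringE(3,6)[OF subfieldE(1)[OF K]] by (induction i) auto
  ultimately have cK: "c [^]\<^bsub>L\<^esub> (p ^ ?N) \<in> K" using n' by simp
  have "(\<iota> x \<otimes>\<^bsub>B\<^esub> s c) [^]\<^bsub>B\<^esub> (p ^ ?N) = \<iota> x [^]\<^bsub>B\<^esub> (p ^ ?N) \<otimes>\<^bsub>B\<^esub> s c [^]\<^bsub>B\<^esub> (p ^ ?N)"
    using xct by (intro B.nat_pow_distrib) auto
  also have "\<dots> = \<iota> (x [^]\<^bsub>Ob\<^esub> (p ^ ?N)) \<otimes>\<^bsub>B\<^esub> s (c [^]\<^bsub>L\<^esub> (p ^ ?N))"
    using ring_hom_nat_pow[OF Ob.is_cring B.is_cring \<iota> xct(1)] ring_hom_nat_pow[OF L.is_cring B.is_cring s xct(2)]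
    by simp
  also have "\<dots> = \<iota> (x [^]\<^bsub>Ob\<^esub> (p ^ ?N) \<otimes>\<^bsub>Ob\<^esub> \<phi> (c [^]\<^bsub>L\<^esub> (p ^ ?N)))"
    using xct cK by (simp add: \<iota>_\<phi>)
  finally have xc: "(\<iota> x \<otimes>\<^bsub>B\<^esub> s c) [^]\<^bsub>B\<^esub> (p ^ ?N) = \<iota> (x [^]\<^bsub>Ob\<^esub> (p ^ ?N) \<otimes>\<^bsub>Ob\<^esub> \<phi> (c [^]\<^bsub>L\<^esub> (p ^ ?N)))" .
  have "(\<iota> x \<otimes>\<^bsub>B\<^esub> s c \<oplus>\<^bsub>B\<^esub> t) [^]\<^bsub>B\<^esub> (p ^ ?N) = (\<iota> x \<otimes>\<^bsub>B\<^esub> s c) [^]\<^bsub>B\<^esub> (p ^ ?N) \<oplus>\<^bsub>B\<^esub> t [^]\<^bsub>B\<^esub> (p ^ ?N)"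
    using xct by (intro B.freshmans_dream_iter[OF p(1) p_B]) auto
  also have "\<dots> = \<iota> (x [^]\<^bsub>Ob\<^esub> (p ^ ?N) \<otimes>\<^bsub>Ob\<^esub> \<phi> (c [^]\<^bsub>L\<^esub> (p ^ ?N)) \<oplus>\<^bsub>Ob\<^esub> y [^]\<^bsub>Ob\<^esub> (p ^ n'))"
    unfolding xc t using xct cK ny by simp
  finally have "(\<iota> x \<otimes>\<^bsub>B\<^esub> s c \<oplus>\<^bsub>B\<^esub> t) [^]\<^bsub>B\<^esub> (p ^ ?N) =
      \<iota> (x [^]\<^bsub>Ob\<^esub> (p ^ ?N) \<otimes>\<^bsub>Ob\<^esub> \<phi> (c [^]\<^bsub>L\<^esub> (p ^ ?N)) \<oplus>\<^bsub>Ob\<^esub> y [^]\<^bsub>Ob\<^esub> (p ^ n'))" .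
  moreover have "x [^]\<^bsub>Ob\<^esub> (p ^ ?N) \<otimes>\<^bsub>Ob\<^esub> \<phi> (c [^]\<^bsub>L\<^esub> (p ^ ?N)) \<oplus>\<^bsub>Ob\<^esub> y [^]\<^bsub>Ob\<^esub> (p ^ n') \<in> carrier Ob"
    using xct cK ny by simp
  ultimately show "\<exists>n. \<exists>z\<in>carrier Ob. (\<iota> x \<otimes>\<^bsub>B\<^esub> s c \<oplus>\<^bsub>B\<^esub> t) [^]\<^bsub>B\<^esub> (p ^ n) = \<iota> z" by blast
qed

lemma Units_pow_iff:
  assumes "y \<in> carrier B"
  shows "y [^]\<^bsub>B\<^esub> (p ^ n) \<in> Units B \<longleftrightarrow> y \<in> Units B"
proof
  have "p ^ n > 0" using p(1) prime_gt_0_nat by simp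
  then obtain j where j: "p ^ n = Suc j" by (cases "p ^ n") auto
  assume "y [^]\<^bsub>B\<^esub> (p ^ n) \<in> Units B"
  then have "y \<otimes>\<^bsub>B\<^esub> y [^]\<^bsub>B\<^esub> j \<in> Units B" unfolding j using assms by (simp add: B.m_comm)
  then show "y \<in> Units B" using B.unit_factor[of y "y [^]\<^bsub>B\<^esub> j"] assms by simp
qed (rule B.Units_pow_closed)

text \<open>Some power with exponent \<open>p ^ n\<close> of the inverse of \<open>\<iota> x\<close>
  comes from an element \<open>z\<close> of \<open>Ob\<close>, so \<open>v = x^(p^n) z\<close>
  satisfies \<open>\<iota> v = 1\<close>. If \<open>x\<close> were in \<open>m\<close>, so would be
  \<open>v\<close>, and \<open>1 - v\<close> would be a unit of \<open>Ob\<close> with image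
  \<open>0\<close> in the nonzero ring \<open>B\<close>.\<close>

lemma \<iota>_Units_iff:
  assumes "x \<in> carrier Ob"
  shows "\<iota> x \<in> Units B \<longleftrightarrow> x \<in> Units Ob"
proof
  assume u: "\<iota> x \<in> Units B"
  let ?w = "inv\<^bsub>B\<^esub> (\<iota> x)"
  have w: "?w \<in> carrier B" using u by simp
  obtain n z where z: "z \<in> carrier Ob" "?w [^]\<^bsub>B\<^esub> (p ^ n) = \<iota> z" using pow_mem_\<iota>[OF w] by blast
  let ?v = "x [^]\<^bsub>Ob\<^esub> (p ^ n) \<otimes>\<^bsub>Ob\<^esub> z"
  have "\<iota> ?v = \<iota> x [^]\<^bsub>B\<^esub> (p ^ n) \<otimes>\<^bsub>B\<^esub> ?w [^]\<^bsub>B\<^esub> (p ^ n)"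
    using assms z ring_hom_nat_pow[OF Ob.is_cring B.is_cring \<iota> assms] by simp
  also have "\<dots> = (\<iota> x \<otimes>\<^bsub>B\<^esub> ?w) [^]\<^bsub>B\<^esub> (p ^ n)"
    using assms w by (intro B.nat_pow_distrib[symmetric]) auto
  also have "\<dots> = \<one>\<^bsub>B\<^esub>" using u by simp
  finally have v1: "\<iota> ?v = \<one>\<^bsub>B\<^esub>" .
  interpret m: maximalideal m Ob by (rule m_maximal)
  have "x \<notin> m"
  proof
    assume "x \<in> m"
    have "p ^ n > 0" using p(1) prime_gt_0_nat by simp
    then obtain j where j: "p ^ n = Suc j" by (cases "p ^ n") auto
    have "x [^]\<^bsub>Ob\<^esub> (p ^ n) \<in> m" unfolding j nat_pow_Suc using m.I_l_closed[OF \<open>x \<in> m\<close>] assms by simp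
    then have vm: "?v \<in> m" using m.I_r_closed z(1) by blast
    have vc: "?v \<in> carrier Ob" using assms z by simp
    have "\<one>\<^bsub>Ob\<^esub> \<ominus>\<^bsub>Ob\<^esub> ?v \<notin> m"
    proof
      assume "\<one>\<^bsub>Ob\<^esub> \<ominus>\<^bsub>Ob\<^esub> ?v \<in> m"
      then have "(\<one>\<^bsub>Ob\<^esub> \<ominus>\<^bsub>Ob\<^esub> ?v) \<oplus>\<^bsub>Ob\<^esub> ?v \<in> m" using vm m.a_closed by blast
      moreover have "(\<one>\<^bsub>Ob\<^esub> \<ominus>\<^bsub>Ob\<^esub> ?v) \<oplus>\<^bsub>Ob\<^esub> ?v = \<one>\<^bsub>Ob\<^esub>"
        using vc by (simp add: a_minus_def Ob.a_assoc Ob.l_neg)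
      ultimately show False using m.one_imp_carrier m.I_notcarr by simp
    qed
    then have "\<one>\<^bsub>Ob\<^esub> \<ominus>\<^bsub>Ob\<^esub> ?v \<in> Units Ob" using m_eq vc by simp
    then have "\<iota> (\<one>\<^bsub>Ob\<^esub> \<ominus>\<^bsub>Ob\<^esub> ?v) \<in> Units B" by (rule ring_hom_Units(1)[OF Ob.is_cring B.is_cring \<iota>])
    also have "\<iota> (\<one>\<^bsub>Ob\<^esub> \<ominus>\<^bsub>Ob\<^esub> ?v) = \<zero>\<^bsub>B\<^esub>"
      using vc v1 by (simp add: a_minus_def B.r_neg del: \<iota>.hom_mult)
    finally obtain u where "u \<in> carrier B" "u \<otimes>\<^bsub>B\<^esub> \<zero>\<^bsub>B\<^esub> = \<one>\<^bsub>B\<^esub>" unfolding Units_def by blast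
    then show False using B_nontrivial by simp
  qed
  then show "x \<in> Units Ob" using m_eq assms by blast
qed (rule ring_hom_Units(1)[OF Ob.is_cring B.is_cring \<iota>])

text \<open>By \<open>Units_pow_iff\<close> and \<open>\<iota>_Units_iff\<close> a nonunit has a
  power with exponent \<open>p ^ n\<close> in the image of \<open>m\<close>. For two nonunits a
  common exponent exists, the powers add, and \<open>m\<close> is closed under addition.\<close>

lemma local_B: "local_ring B"
proof (rule local_ringI[OF B.is_cring B_nontrivial])
  fix x y assume xy: "x \<in> carrier B - Units B" "y \<in> carrier B - Units B"
  obtain n u where u: "u \<in> carrier Ob" "x [^]\<^bsub>B\<^esub> (p ^ n) = \<iota> u" using pow_mem_\<iota> xy by blast
  obtain n' v where v: "v \<in> carrier Ob" "y [^]\<^bsub>B\<^esub> (p ^ n') = \<iota> v" using pow_mem_\<iota> xy by blast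
  interpret m: maximalideal m Ob by (rule m_maximal)
  have um: "u \<in> m" using u xy(1) Units_pow_iff[of x n] \<iota>_Units_iff[OF u(1)] m_eq by auto
  have vm: "v \<in> m" using v xy(2) Units_pow_iff[of y n'] \<iota>_Units_iff[OF v(1)] m_eq by auto
  have pos: "p ^ i > 0" for i using p(1) prime_gt_0_nat by simp
  have pm: "w [^]\<^bsub>Ob\<^esub> (p ^ i) \<in> m" if "w \<in> m" for w i
  proof -
    obtain j where j: "p ^ i = Suc j" using pos[of i] by (cases "p ^ i") auto
    show ?thesis unfolding j nat_pow_Suc using m.I_l_closed[OF that] m.Icarr[OF that] by simp
  qed
  have c: "x \<in> carrier B" "y \<in> carrier B" using xy by auto
  have "(x \<oplus>\<^bsub>B\<^esub> y) [^]\<^bsub>B\<^esub> (p ^ (n + n')) = x [^]\<^bsub>B\<^esub> (p ^ (n + n')) \<oplus>\<^bsub>B\<^esub> y [^]\<^bsub>B\<^esub> (p ^ (n' + n))"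
    unfolding add.commute[of n' n] by (rule B.freshmans_dream_iter[OF p(1) p_B c])
  also have "\<dots> = \<iota> (u [^]\<^bsub>Ob\<^esub> (p ^ n')) \<oplus>\<^bsub>B\<^esub> \<iota> (v [^]\<^bsub>Ob\<^esub> (p ^ n))"
    unfolding pow_pow[OF c(1), symmetric] pow_pow[OF c(2), symmetric] u(2) v(2)
      ring_hom_nat_pow[OF Ob.is_cring B.is_cring \<iota> u(1)] ring_hom_nat_pow[OF Ob.is_cring B.is_cring \<iota> v(1)] ..
  also have "\<dots> = \<iota> (u [^]\<^bsub>Ob\<^esub> (p ^ n') \<oplus>\<^bsub>Ob\<^esub> v [^]\<^bsub>Ob\<^esub> (p ^ n))" using u(1) v(1) by simp
  finally have e: "(x \<oplus>\<^bsub>B\<^esub> y) [^]\<^bsub>B\<^esub> (p ^ (n + n')) = \<iota> (u [^]\<^bsub>Ob\<^esub> (p ^ n') \<oplus>\<^bsub>Ob\<^esub> v [^]\<^bsub>Ob\<^esub> (p ^ n))" .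
  have "u [^]\<^bsub>Ob\<^esub> (p ^ n') \<oplus>\<^bsub>Ob\<^esub> v [^]\<^bsub>Ob\<^esub> (p ^ n) \<in> m" using m.a_closed[OF pm[OF um] pm[OF vm]] .
  then show "x \<oplus>\<^bsub>B\<^esub> y \<notin> Units B"
    using Units_pow_iff[of "x \<oplus>\<^bsub>B\<^esub> y" "n + n'"] \<iota>_Units_iff[of "u [^]\<^bsub>Ob\<^esub> (p ^ n') \<oplus>\<^bsub>Ob\<^esub> v [^]\<^bsub>Ob\<^esub> (p ^ n)"] c u v m_eq
    unfolding e by auto
qed

end

section \<open>The residue field inside \<open>L\<close> and the elements
  \<open>\<delta> x\<close>\<close>

locale insep_residue = insep_base_change L Ob B K p \<phi> \<iota> s
  for L :: "('l, 'p) ring_scheme" and Ob :: "('a, 'q) ring_scheme" and B :: "('b, 'r) ring_scheme"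
    and K p \<phi> \<iota> s +
  fixes \<sigma> :: "'a set \<Rightarrow> 'l"
  assumes \<sigma>: "\<sigma> \<in> ring_hom (residue_field Ob) L"
    and residue_eq: "x \<in> carrier Ob \<Longrightarrow>
      residue_class B (\<iota> x) = residue_class B (s (\<sigma> (residue_class Ob x)))"
begin

abbreviation n where "n \<equiv> max_ideal B"
abbreviation k where "k \<equiv> residue_field Ob"
abbreviation res where "res \<equiv> residue_class Ob"

definition r where "r x = \<sigma> (res x)"
definition \<delta> where "\<delta> x = \<iota> x \<ominus>\<^bsub>B\<^esub> s (r x)"

lemma n_maximal: "maximalideal n B" and n_eq: "n = carrier B - Units B"
  using local_ring_max_ideal[OF local_B] by auto

sublocale n: maximalideal n B by (rule n_maximal)
sublocale m: maximalideal m Ob by (rule m_maximal)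

lemma k_field: "field k"
  unfolding residue_field_def by (rule m.quotient_is_field[OF Ob.is_cring])

lemma res_hom: "res \<in> ring_hom Ob k"
  using m.rcos_ring_hom unfolding residue_field_def residue_class_def[abs_def] .

lemma res_surj: "u \<in> carrier k \<Longrightarrow> \<exists>x\<in>carrier Ob. u = res x"
  unfolding residue_field_def residue_class_def FactRing_def A_RCOSETS_def' partial_object.simps by blast

lemma res_eq_iff: "x \<in> carrier Ob \<Longrightarrow> y \<in> carrier Ob \<Longrightarrow> res x = res y \<longleftrightarrow> x \<ominus>\<^bsub>Ob\<^esub> y \<in> m"
  unfolding residue_class_def using Ob.quotient_eq_iff_same_a_r_cos[OF m.is_ideal] by blast

lemma r_hom: "r \<in> ring_hom Ob L"
  using ring_hom_trans[OF res_hom \<sigma>] unfolding r_def[abs_def] comp_def .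

sublocale r: ring_hom_cring Ob L r by unfold_locales (rule r_hom)

lemma \<sigma>_inj: "inj_on \<sigma> (carrier k)"
proof -
  interpret k: field k by (rule k_field)
  interpret \<sigma>: ring_hom_ring k L \<sigma>
    by (rule ring_hom_ringI2[OF k.ring_axioms L.ring_axioms \<sigma>])
  show ?thesis
  proof (rule inj_onI)
    fix u v assume uv: "u \<in> carrier k" "v \<in> carrier k" "\<sigma> u = \<sigma> v"
    show "u = v"
    proof (rule ccontr)
      assume "u \<noteq> v"
      then have "u \<ominus>\<^bsub>k\<^esub> v \<in> Units k" using uv k.field_Units by auto
      then have "\<sigma> (u \<ominus>\<^bsub>k\<^esub> v) \<in> Units L" by (rule ring_hom_Units(1)[OF k.is_cring L.is_cring \<sigma>])
      moreover have "\<sigma> (u \<ominus>\<^bsub>k\<^esub> v) = \<zero>\<^bsub>L\<^esub>" using uv by (simp add: a_minus_def L.r_neg)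
      ultimately show False using L.field_Units by auto
    qed
  qed
qed

lemma r_eq_iff: "x \<in> carrier Ob \<Longrightarrow> y \<in> carrier Ob \<Longrightarrow> r x = r y \<longleftrightarrow> res x = res y"
  unfolding r_def by (rule inj_on_eq_iff[OF \<sigma>_inj]) (rule ring_hom_closed[OF res_hom], assumption)+

lemma r_zero_iff: "x \<in> carrier Ob \<Longrightarrow> r x = \<zero>\<^bsub>L\<^esub> \<longleftrightarrow> x \<in> m"
proof -
  assume x: "x \<in> carrier Ob"
  have "x \<ominus>\<^bsub>Ob\<^esub> \<zero>\<^bsub>Ob\<^esub> = x" using x by (simp add: a_minus_def)
  then show ?thesis
    using r_eq_iff[OF x Ob.zero_closed] res_eq_iff[OF x Ob.zero_closed] by (simp only: r.hom_zero)
qed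

lemma \<delta>_closed [simp]: "x \<in> carrier Ob \<Longrightarrow> \<delta> x \<in> carrier B"
  by (simp add: \<delta>_def)

lemma \<delta>_mem: "x \<in> carrier Ob \<Longrightarrow> \<delta> x \<in> n"
  using residue_eq[of x] B.quotient_eq_iff_same_a_r_cos[OF n.is_ideal, of "\<iota> x" "s (r x)"]
    r.hom_closed[of x]
  unfolding \<delta>_def r_def residue_class_def[of B] by simp

lemma s_mem_n_iff: "c \<in> carrier L \<Longrightarrow> s c \<in> n \<longleftrightarrow> c = \<zero>\<^bsub>L\<^esub>"
proof
  assume c: "c \<in> carrier L" "s c \<in> n"
  show "c = \<zero>\<^bsub>L\<^esub>"
  proof (rule ccontr)
    assume "c \<noteq> \<zero>\<^bsub>L\<^esub>"
    then have "s c \<in> Units B" using c L.field_Units by (intro ring_hom_Units(1)[OF L.is_cring B.is_cring s]) simp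
    then show False using c n_eq by blast
  qed
qed (simp add: additive_subgroup.zero_closed[OF ideal.axioms(1)[OF n.is_ideal]])

text \<open>Compatibility of \<open>\<sigma>\<close> with \<open>K\<close> is derived from
  \<open>residue_eq\<close>: the difference of \<open>c\<close> and \<open>r (\<phi> c)\<close> is a
  scalar whose image lies in \<open>n\<close>, whereas nonzero scalars become units.\<close>

lemma r_\<phi>: "c \<in> K \<Longrightarrow> r (\<phi> c) = c"
proof -
  assume c: "c \<in> K"
  have "\<delta> (\<phi> c) = s (c \<ominus>\<^bsub>L\<^esub> r (\<phi> c))"
    unfolding \<delta>_def using c by (simp add: \<iota>_\<phi> a_minus_def)
  then have "s (c \<ominus>\<^bsub>L\<^esub> r (\<phi> c)) \<in> n" using \<delta>_mem[of "\<phi> c"] c by simp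
  moreover have "c \<ominus>\<^bsub>L\<^esub> r (\<phi> c) \<in> carrier L" using c by simp
  ultimately have "c \<ominus>\<^bsub>L\<^esub> r (\<phi> c) = \<zero>\<^bsub>L\<^esub>" using s_mem_n_iff by blast
  then show ?thesis using c by simp
qed

lemma \<delta>_\<phi>: "c \<in> K \<Longrightarrow> \<delta> (\<phi> c) = \<zero>\<^bsub>B\<^esub>"
  unfolding \<delta>_def by (simp add: r_\<phi> \<iota>_\<phi> a_minus_def B.r_neg)

lemma \<delta>_m: "x \<in> m \<Longrightarrow> \<delta> x = \<iota> x"
proof -
  assume x: "x \<in> m"
  then have c: "x \<in> carrier Ob" by (rule m.Icarr)
  show ?thesis unfolding \<delta>_def using r_zero_iff[OF c] x c by (simp add: a_minus_def)
qed

lemma \<delta>_add: "x \<in> carrier Ob \<Longrightarrow> y \<in> carrier Ob \<Longrightarrow> \<delta> (x \<oplus>\<^bsub>Ob\<^esub> y) = \<delta> x \<oplus>\<^bsub>B\<^esub> \<delta> y"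
  unfolding \<delta>_def by (simp add: a_minus_def B.minus_add B.a_ac)

lemma \<delta>_neg: "x \<in> carrier Ob \<Longrightarrow> \<delta> (\<ominus>\<^bsub>Ob\<^esub> x) = \<ominus>\<^bsub>B\<^esub> \<delta> x"
  unfolding \<delta>_def by (simp add: a_minus_def B.minus_add B.a_ac)

lemma \<delta>_minus: "x \<in> carrier Ob \<Longrightarrow> y \<in> carrier Ob \<Longrightarrow> \<delta> (x \<ominus>\<^bsub>Ob\<^esub> y) = \<delta> x \<ominus>\<^bsub>B\<^esub> \<delta> y"
  unfolding a_minus_def by (simp add: \<delta>_add \<delta>_neg)

text \<open>This asymmetric product rule keeps \<open>\<iota> y\<close> as a coefficient in
  \<open>B\<close> and is the form suited to membership in ideals.\<close>

lemma \<delta>_mult: "x \<in> carrier Ob \<Longrightarrow> y \<in> carrier Ob \<Longrightarrow>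
    \<delta> (x \<otimes>\<^bsub>Ob\<^esub> y) = \<delta> x \<otimes>\<^bsub>B\<^esub> \<iota> y \<oplus>\<^bsub>B\<^esub> s (r x) \<otimes>\<^bsub>B\<^esub> \<delta> y"
proof -
  assume xy: "x \<in> carrier Ob" "y \<in> carrier Ob"
  have *: "a \<otimes>\<^bsub>B\<^esub> b \<ominus>\<^bsub>B\<^esub> c \<otimes>\<^bsub>B\<^esub> d = (a \<ominus>\<^bsub>B\<^esub> c) \<otimes>\<^bsub>B\<^esub> b \<oplus>\<^bsub>B\<^esub> c \<otimes>\<^bsub>B\<^esub> (b \<ominus>\<^bsub>B\<^esub> d)"
    if "a \<in> carrier B" "b \<in> carrier B" "c \<in> carrier B" "d \<in> carrier B" for a b c d
    using that by algebra
  show ?thesis unfolding \<delta>_def using xy *[of "\<iota> x" "\<iota> y" "s (r x)" "s (r y)"] by simp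
qed

text \<open>This symmetric form exhibits the failure of the Leibniz rule as a product of two
  elements of \<open>n\<close>, which vanishes modulo \<open>D\<close>.\<close>

lemma \<delta>_mult': "x \<in> carrier Ob \<Longrightarrow> y \<in> carrier Ob \<Longrightarrow>
    \<delta> (x \<otimes>\<^bsub>Ob\<^esub> y) = \<delta> x \<otimes>\<^bsub>B\<^esub> \<delta> y \<oplus>\<^bsub>B\<^esub> (s (r x) \<otimes>\<^bsub>B\<^esub> \<delta> y \<oplus>\<^bsub>B\<^esub> s (r y) \<otimes>\<^bsub>B\<^esub> \<delta> x)"
proof -
  assume xy: "x \<in> carrier Ob" "y \<in> carrier Ob"
  have *: "a \<otimes>\<^bsub>B\<^esub> b \<ominus>\<^bsub>B\<^esub> c \<otimes>\<^bsub>B\<^esub> d = (a \<ominus>\<^bsub>B\<^esub> c) \<otimes>\<^bsub>B\<^esub> (b \<ominus>\<^bsub>B\<^esub> d) \<oplus>\<^bsub>B\<^esub> (c \<otimes>\<^bsub>B\<^esub> (b \<ominus>\<^bsub>B\<^esub> d) \<oplus>\<^bsub>B\<^esub> d \<otimes>\<^bsub>B\<^esub> (a \<ominus>\<^bsub>B\<^esub> c))"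
    if "a \<in> carrier B" "b \<in> carrier B" "c \<in> carrier B" "d \<in> carrier B" for a b c d
    using that by algebra
  show ?thesis unfolding \<delta>_def using xy *[of "\<iota> x" "\<iota> y" "s (r x)" "s (r y)"] by simp
qed

text \<open>Modulo a multiple of \<open>\<delta> x\<close>, the tensor \<open>\<iota> x \<otimes> s c\<close> is the scalar \<open>s (r x \<otimes> c)\<close>; a scalar in \<open>n\<close> vanishes.\<close>

lemma n_subsetI:
  assumes H: "H \<subseteq> n" "\<zero>\<^bsub>B\<^esub> \<in> H" and add: "\<And>t u. t \<in> H \<Longrightarrow> u \<in> H \<Longrightarrow> t \<oplus>\<^bsub>B\<^esub> u \<in> H"
    and \<delta>H: "\<And>x c. x \<in> carrier Ob \<Longrightarrow> c \<in> carrier L \<Longrightarrow> s c \<otimes>\<^bsub>B\<^esub> \<delta> x \<in> H"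
  shows "n \<subseteq> H"
proof
  fix t assume t: "t \<in> n"
  have HB: "h \<in> carrier B" if "h \<in> H" for h using that H(1) n.Icarr by blast
  have "\<exists>c\<in>carrier L. \<exists>h\<in>H. t = h \<oplus>\<^bsub>B\<^esub> s c"
  proof (rule B_induct[OF n.Icarr[OF t]])
    show "\<exists>c\<in>carrier L. \<exists>h\<in>H. \<zero>\<^bsub>B\<^esub> = h \<oplus>\<^bsub>B\<^esub> s c"
      using H(2) by (intro bexI[of _ "\<zero>\<^bsub>L\<^esub>"] bexI[of _ "\<zero>\<^bsub>B\<^esub>"]) simp_all
    fix x c t assume xct: "x \<in> carrier Ob" "c \<in> carrier L" "t \<in> carrier B"
    assume "\<exists>c\<in>carrier L. \<exists>h\<in>H. t = h \<oplus>\<^bsub>B\<^esub> s c"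
    then obtain d h where dh: "d \<in> carrier L" "h \<in> H" "t = h \<oplus>\<^bsub>B\<^esub> s d" by blast
    have *: "u \<otimes>\<^bsub>B\<^esub> c \<oplus>\<^bsub>B\<^esub> (h \<oplus>\<^bsub>B\<^esub> d) = (c \<otimes>\<^bsub>B\<^esub> (u \<ominus>\<^bsub>B\<^esub> v) \<oplus>\<^bsub>B\<^esub> h) \<oplus>\<^bsub>B\<^esub> (v \<otimes>\<^bsub>B\<^esub> c \<oplus>\<^bsub>B\<^esub> d)"
      if "u \<in> carrier B" "v \<in> carrier B" "h \<in> carrier B" "c \<in> carrier B" "d \<in> carrier B" for u v h c d
      using that by algebra
    have "\<iota> x \<otimes>\<^bsub>B\<^esub> s c \<oplus>\<^bsub>B\<^esub> t = (s c \<otimes>\<^bsub>B\<^esub> \<delta> x \<oplus>\<^bsub>B\<^esub> h) \<oplus>\<^bsub>B\<^esub> s (r x \<otimes>\<^bsub>L\<^esub> c \<oplus>\<^bsub>L\<^esub> d)"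
      unfolding dh(3) \<delta>_def using xct dh HB[OF dh(2)] *[of "\<iota> x" "s (r x)" h "s c" "s d"] by simp
    moreover have "r x \<otimes>\<^bsub>L\<^esub> c \<oplus>\<^bsub>L\<^esub> d \<in> carrier L" using xct dh by simp
    ultimately show "\<exists>c'\<in>carrier L. \<exists>h\<in>H. \<iota> x \<otimes>\<^bsub>B\<^esub> s c \<oplus>\<^bsub>B\<^esub> t = h \<oplus>\<^bsub>B\<^esub> s c'"
      using add[OF \<delta>H[OF xct(1,2)] dh(2)] by blast
  qed
  then obtain c h where ch: "c \<in> carrier L" "h \<in> H" "t = h \<oplus>\<^bsub>B\<^esub> s c" by blast
  have "(h \<oplus>\<^bsub>B\<^esub> u) \<ominus>\<^bsub>B\<^esub> h = u" if "u \<in> carrier B" for u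
    using that HB[OF ch(2)] by algebra
  then have "s c = t \<ominus>\<^bsub>B\<^esub> h" using ch by simp
  moreover have "t \<ominus>\<^bsub>B\<^esub> h \<in> n" unfolding a_minus_def using t H(1) ch(2) n.a_closed n.a_inv_closed by blast
  ultimately have "c = \<zero>\<^bsub>L\<^esub>" using s_mem_n_iff[OF ch(1)] by simp
  then show "t \<in> H" using ch HB[OF ch(2)] by simp
qed

lemma \<iota>_m_n: "x \<in> m \<Longrightarrow> \<iota> x \<in> n"
  using \<delta>_mem[OF m.Icarr] \<delta>_m by simp

section \<open>The \<open>L\<close>-subspace \<open>D\<close> of \<open>n\<close>\<close>

abbreviation BM where "BM \<equiv> restrict_scalars B s"
abbreviation D where "D \<equiv> (n \<cdot>\<^bsub>B\<^esub> n) <+>\<^bsub>B\<^esub> module_span L BM (\<iota> ` m)"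

lemma BM_module: "module L BM"
  by (rule module_restrict_scalars[OF L.is_cring B.is_cring s])

lemma ideal_submodule:
  assumes "ideal I B"
  shows "submodule I L BM"
proof -
  interpret BM: module L BM by (rule BM_module)
  interpret I: ideal I B by (rule assms)
  show ?thesis
  proof (rule BM.submoduleI, unfold restrict_scalars_simps restrict_scalars_a_inv)
    show "\<zero>\<^bsub>B\<^esub> \<in> I" by (rule additive_subgroup.zero_closed[OF ideal.axioms(1)[OF assms]])
    show "s c \<otimes>\<^bsub>B\<^esub> t \<in> I" if "c \<in> carrier L" "t \<in> I" for c t
      by (rule I.I_l_closed[OF that(2) s.hom_closed[OF that(1)]])
  qed (rule I.a_subset I.a_inv_closed I.a_closed; assumption)+
qed

lemmas n_submodule = ideal_submodule[OF n.is_ideal]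

lemma span_submodule: "submodule (module_span L BM (\<iota> ` m)) L BM"
  by (rule module.module_span_submodule[OF BM_module])
    (use m.Icarr in \<open>auto simp: restrict_scalars_simps\<close>)

lemma span_subset_n: "module_span L BM (\<iota> ` m) \<subseteq> n"
  by (rule module_span_minimal[OF n_submodule]) (use \<iota>_m_n in blast)

lemma nn_ideal: "ideal (n \<cdot>\<^bsub>B\<^esub> n) B"
  by (rule B.ideal_prod_is_ideal[OF n.is_ideal n.is_ideal])

lemma nn_subset: "n \<cdot>\<^bsub>B\<^esub> n \<subseteq> n"
  using B.ideal_prod_inter[OF n.is_ideal n.is_ideal] by blast

lemma D_memE: "t \<in> D \<Longrightarrow> \<exists>u\<in>n \<cdot>\<^bsub>B\<^esub> n. \<exists>v\<in>module_span L BM (\<iota> ` m). t = u \<oplus>\<^bsub>B\<^esub> v"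
  unfolding set_add_def' by blast

lemma D_memI: "u \<in> n \<cdot>\<^bsub>B\<^esub> n \<Longrightarrow> v \<in> module_span L BM (\<iota> ` m) \<Longrightarrow> u \<oplus>\<^bsub>B\<^esub> v \<in> D"
  unfolding set_add_def' by blast

lemma D_submodule: "submodule D L BM"
proof -
  interpret BM: module L BM by (rule BM_module)
  interpret nn: ideal "n \<cdot>\<^bsub>B\<^esub> n" B by (rule nn_ideal)
  let ?S = "module_span L BM (\<iota> ` m)"
  note S = BM.submoduleE[OF span_submodule, unfolded restrict_scalars_simps restrict_scalars_a_inv]
  have S0: "\<zero>\<^bsub>B\<^esub> \<in> ?S" using submodule_zero_closed[OF span_submodule] by (simp only: restrict_scalars_simps)
  have SB: "v \<in> carrier B" if "v \<in> ?S" for v using that S(1) by blast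
  note nnB = nn.Icarr
  show ?thesis
  proof (rule BM.submoduleI, unfold restrict_scalars_simps restrict_scalars_a_inv)
    show "D \<subseteq> carrier B"
    proof
      fix t assume "t \<in> D"
      then obtain u v where uv: "u \<in> n \<cdot>\<^bsub>B\<^esub> n" "v \<in> ?S" "t = u \<oplus>\<^bsub>B\<^esub> v" using D_memE by blast
      show "t \<in> carrier B" unfolding uv(3) by (rule B.a_closed[OF nnB[OF uv(1)] SB[OF uv(2)]])
    qed
    show "\<zero>\<^bsub>B\<^esub> \<in> D"
      using D_memI[OF additive_subgroup.zero_closed[OF nn.additive_subgroup_axioms] S0] by simp
    show "\<ominus>\<^bsub>B\<^esub> t \<in> D" if "t \<in> D" for t
    proof -
      obtain u v where uv: "u \<in> n \<cdot>\<^bsub>B\<^esub> n" "v \<in> ?S" "t = u \<oplus>\<^bsub>B\<^esub> v" using D_memE[OF \<open>t \<in> D\<close>] by blast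
      have "\<ominus>\<^bsub>B\<^esub> t = \<ominus>\<^bsub>B\<^esub> u \<oplus>\<^bsub>B\<^esub> \<ominus>\<^bsub>B\<^esub> v" using uv nnB SB by (simp add: B.minus_add)
      then show ?thesis using D_memI[OF nn.a_inv_closed[OF uv(1)] S(3)[OF uv(2)]] by simp
    qed
    show "t \<oplus>\<^bsub>B\<^esub> t' \<in> D" if "t \<in> D" "t' \<in> D" for t t'
    proof -
      obtain u v where uv: "u \<in> n \<cdot>\<^bsub>B\<^esub> n" "v \<in> ?S" "t = u \<oplus>\<^bsub>B\<^esub> v" using D_memE[OF \<open>t \<in> D\<close>] by blast
      obtain u' v' where uv': "u' \<in> n \<cdot>\<^bsub>B\<^esub> n" "v' \<in> ?S" "t' = u' \<oplus>\<^bsub>B\<^esub> v'" using D_memE[OF \<open>t' \<in> D\<close>] by blast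
      have "t \<oplus>\<^bsub>B\<^esub> t' = (u \<oplus>\<^bsub>B\<^esub> u') \<oplus>\<^bsub>B\<^esub> (v \<oplus>\<^bsub>B\<^esub> v')" using uv uv' nnB SB by (simp add: B.a_ac)
      then show ?thesis using D_memI[OF nn.a_closed[OF uv(1) uv'(1)] S(5)[OF uv(2) uv'(2)]] by simp
    qed
    show "s c \<otimes>\<^bsub>B\<^esub> t \<in> D" if "c \<in> carrier L" "t \<in> D" for c t
    proof -
      obtain u v where uv: "u \<in> n \<cdot>\<^bsub>B\<^esub> n" "v \<in> ?S" "t = u \<oplus>\<^bsub>B\<^esub> v" using D_memE[OF \<open>t \<in> D\<close>] by blast
      have sc: "s c \<in> carrier B" using that by simp
      have "s c \<otimes>\<^bsub>B\<^esub> t = s c \<otimes>\<^bsub>B\<^esub> u \<oplus>\<^bsub>B\<^esub> s c \<otimes>\<^bsub>B\<^esub> v" using uv nnB SB sc by (simp add: B.r_distr)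
      then show ?thesis using D_memI[OF nn.I_l_closed[OF uv(1) sc] S(4)[OF that(1) uv(2)]] by simp
    qed
  qed
qed

lemma D_subset_n: "D \<subseteq> n"
proof
  fix t assume "t \<in> D"
  then obtain u v where uv: "u \<in> n \<cdot>\<^bsub>B\<^esub> n" "v \<in> module_span L BM (\<iota> ` m)" "t = u \<oplus>\<^bsub>B\<^esub> v"
    using D_memE by blast
  show "t \<in> n" unfolding uv(3)
    by (rule n.a_closed[OF subsetD[OF nn_subset uv(1)] subsetD[OF span_subset_n uv(2)]])
qed

lemma nn_subset_D: "n \<cdot>\<^bsub>B\<^esub> n \<subseteq> D"
proof
  fix t assume t: "t \<in> n \<cdot>\<^bsub>B\<^esub> n"
  have "\<zero>\<^bsub>B\<^esub> \<in> module_span L BM (\<iota> ` m)"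
    using submodule_zero_closed[OF span_submodule] by (simp only: restrict_scalars_simps)
  from D_memI[OF t this] show "t \<in> D" using ideal.Icarr[OF nn_ideal t] by simp
qed

lemma \<iota>_m_mem_D: "x \<in> m \<Longrightarrow> \<iota> x \<in> D"
proof -
  assume x: "x \<in> m"
  have "\<iota> x \<in> module_span L BM (\<iota> ` m)" by (rule subsetD[OF module_span_incl imageI[OF x]])
  from D_memI[OF additive_subgroup.zero_closed[OF ideal.axioms(1)[OF nn_ideal]] this]
  show "\<iota> x \<in> D" using m.Icarr[OF x] by simp
qed

end

lemma (in ideal) finsum_mem:
  assumes "finite A" "\<And>i. i \<in> A \<Longrightarrow> f i \<in> I"
  shows "(\<Oplus>i\<in>A. f i) \<in> I"
  using assms
proof (induction A rule: finite_induct)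
  case empty
  then show ?case by (simp add: additive_subgroup.zero_closed[OF additive_subgroup_axioms])
next
  case (insert a A)
  have "(\<Oplus>i\<in>insert a A. f i) = f a \<oplus> (\<Oplus>i\<in>A. f i)"
    using insert Icarr by (intro finsum_insert) auto
  then show ?case using insert a_closed by simp
qed

section \<open>Generators of the ideal \<open>n\<close> and descent to the residue field\<close>

context insep_residue
begin

lemma n_one_minus_unit: "t \<in> n \<Longrightarrow> \<one>\<^bsub>B\<^esub> \<ominus>\<^bsub>B\<^esub> t \<in> Units B"
proof (rule ccontr)
  assume t: "t \<in> n" and "\<one>\<^bsub>B\<^esub> \<ominus>\<^bsub>B\<^esub> t \<notin> Units B"
  then have "\<one>\<^bsub>B\<^esub> \<ominus>\<^bsub>B\<^esub> t \<in> n" using n_eq n.Icarr[OF t] by auto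
  from n.a_closed[OF this t] have "\<one>\<^bsub>B\<^esub> \<in> n"
    using n.Icarr[OF t] by (simp add: a_minus_def B.a_assoc B.l_neg)
  then show False using n.one_imp_carrier n.I_notcarr by blast
qed

lemma \<delta>_one: "\<delta> \<one>\<^bsub>Ob\<^esub> = \<zero>\<^bsub>B\<^esub>"
  using \<delta>_\<phi>[OF subringE(3)[OF subfieldE(1)[OF K]]] ring_hom_one[OF \<phi>] by simp

text \<open>The quotient rule: \<open>\<delta>\<close> vanishes at \<open>1 = u v\<close>, where
  \<open>v\<close> is the inverse of \<open>u\<close>, so the product rule puts the multiple of
  \<open>\<delta> v\<close> by \<open>s (r u)\<close> into \<open>I\<close>. The factor
  \<open>r u\<close> is invertible in \<open>L\<close>. Inverses have to be covered because
  \<open>Ob\<close> is a localization.\<close>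

lemma \<delta>_inv:
  assumes I: "ideal I B" and u: "u \<in> Units Ob" "\<delta> u \<in> I"
  shows "\<delta> (inv\<^bsub>Ob\<^esub> u) \<in> I"
proof -
  interpret I: ideal I B by (rule I)
  let ?v = "inv\<^bsub>Ob\<^esub> u"
  have c: "u \<in> carrier Ob" "?v \<in> carrier Ob" using u by auto
  have ru: "r u \<in> Units L" by (rule ring_hom_Units(1)[OF Ob.is_cring L.is_cring r_hom u(1)])
  let ?w = "s (inv\<^bsub>L\<^esub> (r u))"
  have w: "?w \<in> carrier B" "?w \<otimes>\<^bsub>B\<^esub> s (r u) = \<one>\<^bsub>B\<^esub>"
    using ru s.hom_mult[of "inv\<^bsub>L\<^esub> (r u)" "r u", symmetric] by auto
  have "\<zero>\<^bsub>B\<^esub> = \<delta> u \<otimes>\<^bsub>B\<^esub> \<iota> ?v \<oplus>\<^bsub>B\<^esub> s (r u) \<otimes>\<^bsub>B\<^esub> \<delta> ?v"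
    using \<delta>_mult[OF c] u(1) by (simp add: \<delta>_one)
  moreover have "z = \<ominus>\<^bsub>B\<^esub> y" if "\<zero>\<^bsub>B\<^esub> = y \<oplus>\<^bsub>B\<^esub> z" "y \<in> carrier B" "z \<in> carrier B" for y z
    using that B.minus_equality[of z y] B.a_comm[of y z] by simp
  ultimately have "s (r u) \<otimes>\<^bsub>B\<^esub> \<delta> ?v = \<ominus>\<^bsub>B\<^esub> (\<delta> u \<otimes>\<^bsub>B\<^esub> \<iota> ?v)" using c by simp
  moreover have "\<delta> u \<otimes>\<^bsub>B\<^esub> \<iota> ?v \<in> I" using I.I_r_closed[OF u(2)] c by simp
  ultimately have "s (r u) \<otimes>\<^bsub>B\<^esub> \<delta> ?v \<in> I" using I.a_inv_closed by simp
  from I.I_l_closed[OF this w(1)] have "?w \<otimes>\<^bsub>B\<^esub> (s (r u) \<otimes>\<^bsub>B\<^esub> \<delta> ?v) \<in> I" .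
  moreover have "?w \<otimes>\<^bsub>B\<^esub> (s (r u) \<otimes>\<^bsub>B\<^esub> \<delta> ?v) = \<delta> ?v"
    using B.m_assoc[OF w(1), of "s (r u)" "\<delta> ?v"] c w by simp
  ultimately show ?thesis by simp
qed

text \<open>The assumption \<open>fg\<close> says that \<open>Ob\<close> is obtained from
  \<open>K\<close> and the finite set \<open>G\<close> by ring operations and inversion of units.
  The elements \<open>u\<close> with \<open>\<delta> u\<close> in the ideal generated by
  \<open>J\<close> and \<open>\<delta>\<close> of \<open>G\<close> are closed under all of these, so
  finitely many elements generate \<open>n\<close> modulo \<open>J\<close>. The assumption
  \<open>span\<close> writes each element of \<open>n\<close> as one of \<open>J\<close> plus one of
  the square of \<open>n\<close>, and Nakayama's lemma applies.\<close>

lemma n_eq_ideal_of_generators: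
  fixes l :: nat and x :: "nat \<Rightarrow> 'a"
  assumes x: "\<And>i. i < l \<Longrightarrow> x i \<in> carrier Ob"
    and span: "\<And>t. t \<in> n \<Longrightarrow> \<exists>c. (\<forall>i<l. c i \<in> carrier L) \<and>
        t \<ominus>\<^bsub>B\<^esub> (\<Oplus>\<^bsub>B\<^esub>i\<in>{..<l}. s (c i) \<otimes>\<^bsub>B\<^esub> \<delta> (x i)) \<in> D"
    and G: "finite G" "G \<subseteq> carrier Ob"
    and fg: "\<And>S. S \<subseteq> carrier Ob \<Longrightarrow> \<phi> ` K \<subseteq> S \<Longrightarrow> G \<subseteq> S \<Longrightarrow>
      (\<And>u v. u \<in> S \<Longrightarrow> v \<in> S \<Longrightarrow> u \<oplus>\<^bsub>Ob\<^esub> v \<in> S) \<Longrightarrow> (\<And>u v. u \<in> S \<Longrightarrow> v \<in> S \<Longrightarrow> u \<otimes>\<^bsub>Ob\<^esub> v \<in> S) \<Longrightarrow>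
      (\<And>u. u \<in> S \<Longrightarrow> \<ominus>\<^bsub>Ob\<^esub> u \<in> S) \<Longrightarrow> (\<And>u. u \<in> S \<Longrightarrow> u \<in> Units Ob \<Longrightarrow> inv\<^bsub>Ob\<^esub> u \<in> S) \<Longrightarrow>
      carrier Ob \<subseteq> S"
  shows "n = genideal B (\<iota> ` m \<union> (\<lambda>i. \<delta> (x i)) ` {..<l})"
proof -
  let ?E = "\<iota> ` m \<union> (\<lambda>i. \<delta> (x i)) ` {..<l}"
  define J where "J = genideal B ?E"
  have EB: "?E \<subseteq> carrier B" using m.Icarr x by auto
  have J: "ideal J B" unfolding J_def by (rule B.genideal_ideal[OF EB])
  interpret J: ideal J B by (rule J)
  have EJ: "?E \<subseteq> J" unfolding J_def by (rule B.genideal_self[OF EB])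
  have Jn: "J \<subseteq> n" unfolding J_def
    by (rule B.genideal_minimal[OF n.is_ideal]) (use \<iota>_m_n \<delta>_mem x in auto)
  have JB: "J \<subseteq> carrier B" by (rule J.a_subset)
  have GB: "\<delta> ` G \<subseteq> carrier B" using G by auto
  have GB': "J \<union> \<delta> ` G \<subseteq> carrier B" using GB JB by blast
  define I where "I = genideal B (J \<union> \<delta> ` G)"
  have I: "ideal I B" unfolding I_def by (rule B.genideal_ideal[OF GB'])
  interpret I: ideal I B by (rule I)
  have JGI: "J \<union> \<delta> ` G \<subseteq> I" unfolding I_def by (rule B.genideal_self[OF GB'])
  have In: "I \<subseteq> n" unfolding I_def
    by (rule B.genideal_minimal[OF n.is_ideal]) (use Jn \<delta>_mem G in auto)
  have I0: "\<zero>\<^bsub>B\<^esub> \<in> I" by (rule additive_subgroup.zero_closed[OF ideal.axioms(1)[OF I]])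
  let ?S = "{u \<in> carrier Ob. \<delta> u \<in> I}"
  have "carrier Ob \<subseteq> ?S"
  proof (rule fg)
    show "\<phi> ` K \<subseteq> ?S" using I0 by (auto simp: \<delta>_\<phi>)
    show "G \<subseteq> ?S" using G JGI by blast
    show "u \<oplus>\<^bsub>Ob\<^esub> v \<in> ?S" if "u \<in> ?S" "v \<in> ?S" for u v
      using that I.a_closed by (simp add: \<delta>_add)
    show "u \<otimes>\<^bsub>Ob\<^esub> v \<in> ?S" if uv: "u \<in> ?S" "v \<in> ?S" for u v
    proof -
      have c: "u \<in> carrier Ob" "v \<in> carrier Ob" "\<delta> u \<in> I" "\<delta> v \<in> I" using uv by auto
      have "\<delta> u \<otimes>\<^bsub>B\<^esub> \<iota> v \<oplus>\<^bsub>B\<^esub> s (r u) \<otimes>\<^bsub>B\<^esub> \<delta> v \<in> I"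
        using c by (intro I.a_closed I.I_r_closed I.I_l_closed) auto
      then show ?thesis using c by (simp add: \<delta>_mult)
    qed
    show "\<ominus>\<^bsub>Ob\<^esub> u \<in> ?S" if "u \<in> ?S" for u
      using that I.a_inv_closed by (simp add: \<delta>_neg)
    show "inv\<^bsub>Ob\<^esub> u \<in> ?S" if "u \<in> ?S" "u \<in> Units Ob" for u
      using \<delta>_inv[OF I that(2)] that by auto
  qed blast
  then have \<delta>I: "\<delta> u \<in> I" if "u \<in> carrier Ob" for u using that by blast
  have "n \<subseteq> I"
    by (rule n_subsetI[OF In I0 I.a_closed I.I_l_closed[OF \<delta>I s.hom_closed]])
  then have nI: "n = genideal B (J \<union> \<delta> ` G)" using In unfolding I_def by blast
  have "n = J"
  proof (rule B.maximal_ideal_eq_of_generators[OF n.is_ideal n_one_minus_unit J _ GB nI])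
    show "finite (\<delta> ` G)" using G by simp
    fix t assume t: "t \<in> n"
    obtain c where c: "\<forall>i<l. c i \<in> carrier L"
        "t \<ominus>\<^bsub>B\<^esub> (\<Oplus>\<^bsub>B\<^esub>i\<in>{..<l}. s (c i) \<otimes>\<^bsub>B\<^esub> \<delta> (x i)) \<in> D" using span[OF t] by blast
    let ?w = "\<Oplus>\<^bsub>B\<^esub>i\<in>{..<l}. s (c i) \<otimes>\<^bsub>B\<^esub> \<delta> (x i)"
    have w: "?w \<in> J" using c(1) EJ by (intro J.finsum_mem J.I_l_closed) auto
    obtain u v where uv: "u \<in> n \<cdot>\<^bsub>B\<^esub> n" "v \<in> module_span L BM (\<iota> ` m)" "t \<ominus>\<^bsub>B\<^esub> ?w = u \<oplus>\<^bsub>B\<^esub> v"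
      using D_memE[OF c(2)] by blast
    have v: "v \<in> J"
      by (rule subsetD[OF module_span_minimal[OF ideal_submodule[OF J]] uv(2)]) (use EJ in blast)
    have cl: "t \<in> carrier B" "?w \<in> carrier B" "u \<in> carrier B" "v \<in> carrier B"
      using n.Icarr[OF t] J.Icarr[OF w] J.Icarr[OF v] ideal.Icarr[OF nn_ideal uv(1)] by auto
    have *: "(t \<ominus>\<^bsub>B\<^esub> w) \<oplus>\<^bsub>B\<^esub> w = t" if "w \<in> carrier B" for w using cl(1) that by algebra
    have "t = (u \<oplus>\<^bsub>B\<^esub> v) \<oplus>\<^bsub>B\<^esub> ?w" using *[OF cl(2)] unfolding uv(3) by simp
    then have "t = (v \<oplus>\<^bsub>B\<^esub> ?w) \<oplus>\<^bsub>B\<^esub> u" using cl(2-4) by (simp add: B.a_ac)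
    then show "\<exists>j\<in>J. \<exists>u\<in>n \<cdot>\<^bsub>B\<^esub> n. t = j \<oplus>\<^bsub>B\<^esub> u" using uv(1) J.a_closed[OF v w] by blast
  qed
  then show ?thesis unfolding J_def .
qed

text \<open>If \<open>r y \<notin> k0\<close>, take a \<open>k0\<close>-linear \<open>f\<close> from \<open>L\<close> to \<open>k0\<close> with \<open>f 1 = 0\<close> and \<open>f (r y) = 1\<close>. The map on \<open>B\<close>
  sending \<open>\<iota> x \<otimes> s c\<close> to \<open>f (r x) \<otimes> c\<close> vanishes on the generators of \<open>n\<close> and their multiples, but not
  at \<open>\<delta> y\<close>.\<close>

lemma residue_mem_subfield:
  assumes k0: "subfield k0 L" "K \<subseteq> k0" and x: "\<And>i. i \<in> A \<Longrightarrow> x i \<in> carrier Ob \<and> r (x i) \<in> k0"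
    and n_gen: "n = genideal B (\<iota> ` m \<union> (\<lambda>i. \<delta> (x i)) ` A)"
    and y: "y \<in> carrier Ob"
  shows "r y \<in> k0"
proof (rule ccontr)
  assume ry: "r y \<notin> k0"
  let ?R = "L\<lparr>carrier := k0\<rparr>" and ?M = "restrict_scalars L (\<lambda>c. c)"
  have k0L: "k0 \<subseteq> carrier L" by (rule subfieldE(3)[OF k0(1)])
  note k0E = subringE[OF subfieldE(1)[OF k0(1)]]
  have Rf: "field ?R" using L.subfield_iff(2)[OF k0(1)] .
  then have Rc: "cring ?R" by (simp add: field_def domain_def)
  have id: "(\<lambda>c. c) \<in> ring_hom ?R L" by (rule ring_hom_memI) (use k0L in auto)
  have mod: "module ?R ?M" by (rule module_restrict_scalars[OF Rc L.is_cring id])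
  interpret M: module ?R ?M by (rule mod)
  have "submodule k0 ?R ?M"
    by (rule M.submoduleI, unfold restrict_scalars_simps restrict_scalars_a_inv)
      (use k0E in auto)
  from exists_linear_functional[OF Rf mod this, of "r y"] obtain f where
    f: "f \<in> carrier ?M \<rightarrow> carrier ?R"
      "\<forall>u\<in>carrier ?M. \<forall>v\<in>carrier ?M. f (u \<oplus>\<^bsub>?M\<^esub> v) = f u \<oplus>\<^bsub>?R\<^esub> f v"
      "\<forall>c\<in>carrier ?R. \<forall>u\<in>carrier ?M. f (c \<odot>\<^bsub>?M\<^esub> u) = c \<otimes>\<^bsub>?R\<^esub> f u"
      "\<forall>w\<in>k0. f w = \<zero>\<^bsub>?R\<^esub>" "f (r y) = \<one>\<^bsub>?R\<^esub>"
    using y ry unfolding restrict_scalars_simps by auto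
  have fL: "f u \<in> carrier L" if "u \<in> carrier L" for u
    using funcset_mem[OF f(1), of u] that k0L unfolding restrict_scalars_simps by auto
  have f_add: "f (u \<oplus>\<^bsub>L\<^esub> v) = f u \<oplus>\<^bsub>L\<^esub> f v" if "u \<in> carrier L" "v \<in> carrier L" for u v
    using f(2) that unfolding restrict_scalars_simps by simp
  have f_mult: "f (c \<otimes>\<^bsub>L\<^esub> u) = c \<otimes>\<^bsub>L\<^esub> f u" if "c \<in> k0" "u \<in> carrier L" for c u
    using f(3) that unfolding restrict_scalars_simps by simp
  have f_one: "f \<one>\<^bsub>L\<^esub> = \<zero>\<^bsub>L\<^esub>" using f(4) k0E(3) by simp
  \<comment> \<open>The composite of \<open>f\<close> and \<open>r\<close> is
    \<open>K\<close>-linear because \<open>K\<close> is contained in \<open>k0\<close> and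
    \<open>r\<close> is the identity on \<open>K\<close>.\<close>
  have "\<exists>\<Phi>. (\<forall>t\<in>carrier B. \<Phi> t \<in> carrier L) \<and>
        (\<forall>t\<in>carrier B. \<forall>u\<in>carrier B. \<Phi> (t \<oplus>\<^bsub>B\<^esub> u) = \<Phi> t \<oplus>\<^bsub>L\<^esub> \<Phi> u) \<and>
        (\<forall>x\<in>carrier Ob. \<forall>c\<in>carrier L. \<Phi> (\<iota> x \<otimes>\<^bsub>B\<^esub> s c) = f (r x) \<otimes>\<^bsub>L\<^esub> c)"
    by (rule B_universal) (use k0(2) in \<open>auto simp: fL f_add f_mult r_\<phi>\<close>)
  then obtain \<Phi> where \<Phi>: "\<And>t. t \<in> carrier B \<Longrightarrow> \<Phi> t \<in> carrier L"
      "\<And>t u. t \<in> carrier B \<Longrightarrow> u \<in> carrier B \<Longrightarrow> \<Phi> (t \<oplus>\<^bsub>B\<^esub> u) = \<Phi> t \<oplus>\<^bsub>L\<^esub> \<Phi> u"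
      "\<And>x c. x \<in> carrier Ob \<Longrightarrow> c \<in> carrier L \<Longrightarrow> \<Phi> (\<iota> x \<otimes>\<^bsub>B\<^esub> s c) = f (r x) \<otimes>\<^bsub>L\<^esub> c"
    by blast
  note \<Phi>0 = additive_zero(1)[of \<Phi>, OF \<Phi>(1,2)] and \<Phi>_minus = additive_zero(2)[of \<Phi>, OF \<Phi>(1,2)]
  have \<Phi>\<delta>: "\<Phi> ((\<iota> z \<otimes>\<^bsub>B\<^esub> s c) \<otimes>\<^bsub>B\<^esub> \<delta> x) = f (r z \<otimes>\<^bsub>L\<^esub> r x) \<otimes>\<^bsub>L\<^esub> c \<ominus>\<^bsub>L\<^esub> f (r z) \<otimes>\<^bsub>L\<^esub> (r x \<otimes>\<^bsub>L\<^esub> c)"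
    if zcx: "z \<in> carrier Ob" "c \<in> carrier L" "x \<in> carrier Ob" for z c x
  proof -
    have *: "(a \<otimes>\<^bsub>B\<^esub> b) \<otimes>\<^bsub>B\<^esub> (u \<ominus>\<^bsub>B\<^esub> v) = (a \<otimes>\<^bsub>B\<^esub> u) \<otimes>\<^bsub>B\<^esub> b \<ominus>\<^bsub>B\<^esub> a \<otimes>\<^bsub>B\<^esub> (v \<otimes>\<^bsub>B\<^esub> b)"
      if "a \<in> carrier B" "b \<in> carrier B" "u \<in> carrier B" "v \<in> carrier B" for a b u v
      using that by algebra
    have "(\<iota> z \<otimes>\<^bsub>B\<^esub> s c) \<otimes>\<^bsub>B\<^esub> \<delta> x = \<iota> (z \<otimes>\<^bsub>Ob\<^esub> x) \<otimes>\<^bsub>B\<^esub> s c \<ominus>\<^bsub>B\<^esub> \<iota> z \<otimes>\<^bsub>B\<^esub> s (r x \<otimes>\<^bsub>L\<^esub> c)"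
      unfolding \<delta>_def using zcx *[of "\<iota> z" "s c" "\<iota> x" "s (r x)"] by simp
    also have "\<Phi> \<dots> = \<Phi> (\<iota> (z \<otimes>\<^bsub>Ob\<^esub> x) \<otimes>\<^bsub>B\<^esub> s c) \<ominus>\<^bsub>L\<^esub> \<Phi> (\<iota> z \<otimes>\<^bsub>B\<^esub> s (r x \<otimes>\<^bsub>L\<^esub> c))"
      using zcx by (intro \<Phi>_minus B.m_closed \<iota>.hom_closed s.hom_closed Ob.m_closed L.m_closed r.hom_closed)
    also have "\<dots> = f (r (z \<otimes>\<^bsub>Ob\<^esub> x)) \<otimes>\<^bsub>L\<^esub> c \<ominus>\<^bsub>L\<^esub> f (r z) \<otimes>\<^bsub>L\<^esub> (r x \<otimes>\<^bsub>L\<^esub> c)"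
      using zcx by (simp only: \<Phi>(3) Ob.m_closed L.m_closed r.hom_closed)
    finally show ?thesis using zcx by simp
  qed
  \<comment> \<open>As \<open>\<Phi>\<close> is only additive, its kernel is replaced by the largest
    ideal inside it; then it suffices to test the generators of \<open>n\<close>.\<close>
  define N where "N = {t \<in> carrier B. \<forall>w\<in>carrier B. \<Phi> (w \<otimes>\<^bsub>B\<^esub> t) = \<zero>\<^bsub>L\<^esub>}"
  have N_ideal: "ideal N B"
  proof (rule idealI[OF B.ring_axioms])
    show "subgroup N (add_monoid B)"
    proof (rule group.subgroupI[OF B.a_group])
      have "\<zero>\<^bsub>B\<^esub> \<in> N" by (simp add: N_def \<Phi>0)
      then show "N \<noteq> {}" by blast
      show "inv\<^bsub>add_monoid B\<^esub> t \<in> N" if t: "t \<in> N" for t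
      proof -
        have tc: "t \<in> carrier B" using t by (simp add: N_def)
        have "\<Phi> (w \<otimes>\<^bsub>B\<^esub> (\<ominus>\<^bsub>B\<^esub> t)) = \<zero>\<^bsub>L\<^esub>" if w: "w \<in> carrier B" for w
        proof -
          have "w \<otimes>\<^bsub>B\<^esub> (\<ominus>\<^bsub>B\<^esub> t) = (\<ominus>\<^bsub>B\<^esub> w) \<otimes>\<^bsub>B\<^esub> t" using tc w by (simp add: B.l_minus B.r_minus)
          then show ?thesis using t w by (simp add: N_def)
        qed
        then show ?thesis using tc by (simp add: N_def a_inv_def[symmetric])
      qed
    qed (auto simp: N_def B.r_distr \<Phi>(2))
    show "w \<otimes>\<^bsub>B\<^esub> t \<in> N" if "t \<in> N" "w \<in> carrier B" for t w
      using that by (simp add: N_def B.m_assoc[symmetric])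
    then show "t \<otimes>\<^bsub>B\<^esub> w \<in> N" if "t \<in> N" "w \<in> carrier B" for t w
      using that B.m_comm[of t w] by (simp add: N_def)
  qed
  have N_I: "\<delta> x \<in> N" if xc: "x \<in> carrier Ob" and rx: "r x \<in> k0" for x
  proof -
    have "\<Phi> (w \<otimes>\<^bsub>B\<^esub> \<delta> x) = \<zero>\<^bsub>L\<^esub>" if "w \<in> carrier B" for w
      using that
    proof (rule B_induct)
      show "\<Phi> (\<zero>\<^bsub>B\<^esub> \<otimes>\<^bsub>B\<^esub> \<delta> x) = \<zero>\<^bsub>L\<^esub>" using xc by (simp add: \<Phi>0)
      fix z c w assume zcw: "z \<in> carrier Ob" "c \<in> carrier L" "w \<in> carrier B" and IH: "\<Phi> (w \<otimes>\<^bsub>B\<^esub> \<delta> x) = \<zero>\<^bsub>L\<^esub>"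
      \<comment> \<open>Here \<open>r x\<close> lies in \<open>k0\<close>, so it can be taken out of
        \<open>f\<close>, and the two terms of the formula for \<open>\<Phi>\<close> cancel.\<close>
      have "f (r z \<otimes>\<^bsub>L\<^esub> r x) = r x \<otimes>\<^bsub>L\<^esub> f (r z)"
        using f_mult[OF rx, of "r z"] L.m_comm[of "r z" "r x"] zcw xc by simp
      moreover have "(a \<otimes>\<^bsub>L\<^esub> b) \<otimes>\<^bsub>L\<^esub> c \<ominus>\<^bsub>L\<^esub> b \<otimes>\<^bsub>L\<^esub> (a \<otimes>\<^bsub>L\<^esub> c) = \<zero>\<^bsub>L\<^esub>"
        if "a \<in> carrier L" "b \<in> carrier L" "c \<in> carrier L" for a b c using that by algebra
      ultimately have "\<Phi> ((\<iota> z \<otimes>\<^bsub>B\<^esub> s c) \<otimes>\<^bsub>B\<^esub> \<delta> x) = \<zero>\<^bsub>L\<^esub>"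
        unfolding \<Phi>\<delta>[OF zcw(1,2) xc] using zcw xc fL by simp
      moreover have "(\<iota> z \<otimes>\<^bsub>B\<^esub> s c \<oplus>\<^bsub>B\<^esub> w) \<otimes>\<^bsub>B\<^esub> \<delta> x = (\<iota> z \<otimes>\<^bsub>B\<^esub> s c) \<otimes>\<^bsub>B\<^esub> \<delta> x \<oplus>\<^bsub>B\<^esub> w \<otimes>\<^bsub>B\<^esub> \<delta> x"
        using zcw xc by (intro B.l_distr) auto
      ultimately show "\<Phi> ((\<iota> z \<otimes>\<^bsub>B\<^esub> s c \<oplus>\<^bsub>B\<^esub> w) \<otimes>\<^bsub>B\<^esub> \<delta> x) = \<zero>\<^bsub>L\<^esub>"
        using zcw xc IH by (simp add: \<Phi>(2))
    qed
    then show ?thesis using xc by (simp add: N_def)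
  qed
  have "\<iota> z \<in> N" if z: "z \<in> m" for z
    using N_I[OF m.Icarr[OF z]] r_zero_iff[OF m.Icarr[OF z]] z k0E(2) \<delta>_m[OF z] by simp
  then have "\<iota> ` m \<union> (\<lambda>i. \<delta> (x i)) ` A \<subseteq> N" using N_I x by auto
  then have "n \<subseteq> N" unfolding n_gen by (rule B.genideal_minimal[OF N_ideal])
  then have "\<delta> y \<in> N" using \<delta>_mem[OF y] by blast
  then have "\<Phi> (\<one>\<^bsub>B\<^esub> \<otimes>\<^bsub>B\<^esub> \<delta> y) = \<zero>\<^bsub>L\<^esub>" unfolding N_def by blast
  \<comment> \<open>With \<open>z = 1\<close> and \<open>c = 1\<close> the formula reads
    \<open>f (r y)\<close> minus a multiple of \<open>f 1\<close>, that is,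
    \<open>1 - 0\<close>.\<close>
  moreover have "\<Phi> (\<one>\<^bsub>B\<^esub> \<otimes>\<^bsub>B\<^esub> \<delta> y) = \<one>\<^bsub>L\<^esub>"
    using \<Phi>\<delta>[OF Ob.one_closed L.one_closed y] f(5) y by (simp add: f_one a_minus_def)
  ultimately show False by simp
qed

end

section \<open>Differentials of the residue field\<close>

text \<open>The preimage in \<open>M\<close> of the span of the classes of the \<open>y i\<close>.
  That it is a submodule lets the spanning of the differentials be proved by closure arguments in
  the free module.\<close>

lemma (in module_with_submodule) combinations_submodule:
  fixes l :: nat
  assumes y: "\<And>i. i < l \<Longrightarrow> y i \<in> carrier M"
  shows "submodule {u \<oplus>\<^bsub>M\<^esub> (\<Oplus>\<^bsub>M\<^esub>i\<in>{..<l}. c i \<odot>\<^bsub>M\<^esub> y i) | u c. u \<in> N \<and> (\<forall>i<l. c i \<in> carrier R)} R M"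
    (is "submodule ?S R M")
proof -
  define comb where "comb c = (\<Oplus>\<^bsub>M\<^esub>i\<in>{..<l}. c i \<odot>\<^bsub>M\<^esub> y i)" for c
  have S: "?S = {u \<oplus>\<^bsub>M\<^esub> comb c | u c. u \<in> N \<and> (\<forall>i<l. c i \<in> carrier R)}" by (simp only: comb_def)
  have NM: "u \<in> carrier M" if "u \<in> N" for u using that N_subset by blast
  have comb_closed: "comb c \<in> carrier M" if "\<forall>i<l. c i \<in> carrier R" for c
    unfolding comb_def using that y by (intro M.finsum_closed) auto
  have comb_add: "comb (\<lambda>i. c i \<oplus> d i) = comb c \<oplus>\<^bsub>M\<^esub> comb d"
    if "\<forall>i<l. c i \<in> carrier R" "\<forall>i<l. d i \<in> carrier R" for c d
  proof -
    have "comb (\<lambda>i. c i \<oplus> d i) = (\<Oplus>\<^bsub>M\<^esub>i\<in>{..<l}. c i \<odot>\<^bsub>M\<^esub> y i \<oplus>\<^bsub>M\<^esub> d i \<odot>\<^bsub>M\<^esub> y i)"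
      unfolding comb_def using that y by (intro M.finsum_cong') (auto simp: smult_l_distr)
    also have "\<dots> = comb c \<oplus>\<^bsub>M\<^esub> comb d"
      unfolding comb_def using that y by (intro M.finsum_addf) auto
    finally show ?thesis .
  qed
  have comb_smult: "comb (\<lambda>i. r \<otimes> c i) = r \<odot>\<^bsub>M\<^esub> comb c"
    if "r \<in> carrier R" "\<forall>i<l. c i \<in> carrier R" for r c
  proof -
    have "comb (\<lambda>i. r \<otimes> c i) = (\<Oplus>\<^bsub>M\<^esub>i\<in>{..<l}. r \<odot>\<^bsub>M\<^esub> (c i \<odot>\<^bsub>M\<^esub> y i))"
      unfolding comb_def using that y by (intro M.finsum_cong') (auto simp: smult_assoc1)
    also have "\<dots> = r \<odot>\<^bsub>M\<^esub> comb c"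
      unfolding comb_def using that y by (intro finsum_smult_ldistr[symmetric]) auto
    finally show ?thesis .
  qed
  have SI: "u \<oplus>\<^bsub>M\<^esub> comb c \<in> ?S" if "u \<in> N" "\<forall>i<l. c i \<in> carrier R" for u c
    unfolding S by (intro CollectI exI[of _ u] exI[of _ c] conjI refl that)
  have SE: "\<exists>u c. u \<in> N \<and> (\<forall>i<l. c i \<in> carrier R) \<and> t = u \<oplus>\<^bsub>M\<^esub> comb c" if "t \<in> ?S" for t
    using that unfolding S by (elim CollectE exE conjE) (intro exI conjI)
  have smult: "r \<odot>\<^bsub>M\<^esub> t \<in> ?S" if r: "r \<in> carrier R" and t: "t \<in> ?S" for r t
  proof -
    obtain u c where uc: "u \<in> N" "\<forall>i<l. c i \<in> carrier R" "t = u \<oplus>\<^bsub>M\<^esub> comb c" using SE[OF t] by blast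
    have "r \<odot>\<^bsub>M\<^esub> t = r \<odot>\<^bsub>M\<^esub> u \<oplus>\<^bsub>M\<^esub> comb (\<lambda>i. r \<otimes> c i)"
      using uc r NM comb_closed by (simp add: smult_r_distr comb_smult)
    moreover have "\<forall>i<l. r \<otimes> c i \<in> carrier R" using r uc(2) by simp
    ultimately show ?thesis using SI[OF N_smult[OF r uc(1)]] by simp
  qed
  have sub: "?S \<subseteq> carrier M"
  proof
    fix t assume t: "t \<in> ?S"
    obtain u c where uc: "u \<in> N" "\<forall>i<l. c i \<in> carrier R" "t = u \<oplus>\<^bsub>M\<^esub> comb c" using SE[OF t] by blast
    show "t \<in> carrier M" unfolding uc(3) by (intro M.a_closed NM comb_closed uc)
  qed
  show ?thesis
  proof (rule submoduleI[OF sub _ _ _ smult])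
    have c0: "\<forall>i<l. (\<lambda>_::nat. \<zero>) i \<in> carrier R" by simp
    have "comb (\<lambda>_. \<zero>) = \<zero>\<^bsub>M\<^esub>"
      using comb_smult[OF R.zero_closed c0] smult_l_null[OF comb_closed[OF c0]]
      by (simp only: R.r_null R.zero_closed)
    then show "\<zero>\<^bsub>M\<^esub> \<in> ?S" using SI[OF N_zero c0] by (simp only: M.l_zero M.zero_closed)
    show "\<ominus>\<^bsub>M\<^esub> t \<in> ?S" if t: "t \<in> ?S" for t
    proof -
      have tM: "t \<in> carrier M" by (rule subsetD[OF sub t])
      have "(\<ominus> \<one>) \<odot>\<^bsub>M\<^esub> t \<in> ?S" by (rule smult[OF _ t]) simp
      then show ?thesis unfolding smult_l_minus[OF R.one_closed tM] smult_one[OF tM] .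
    qed
    show "t \<oplus>\<^bsub>M\<^esub> t' \<in> ?S" if t: "t \<in> ?S" "t' \<in> ?S" for t t'
    proof -
      obtain u c where uc: "u \<in> N" "\<forall>i<l. c i \<in> carrier R" "t = u \<oplus>\<^bsub>M\<^esub> comb c" using SE[OF t(1)] by blast
      obtain v d where vd: "v \<in> N" "\<forall>i<l. d i \<in> carrier R" "t' = v \<oplus>\<^bsub>M\<^esub> comb d" using SE[OF t(2)] by blast
      have "t \<oplus>\<^bsub>M\<^esub> t' = (u \<oplus>\<^bsub>M\<^esub> v) \<oplus>\<^bsub>M\<^esub> comb (\<lambda>i. c i \<oplus> d i)"
        using uc vd NM comb_closed by (simp add: comb_add M.a_ac)
      moreover have "\<forall>i<l. c i \<oplus> d i \<in> carrier R" using uc(2) vd(2) by simp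
      ultimately show ?thesis using SI[OF N_add[OF uc(1) vd(1)]] by simp
    qed
  qed
qed

section \<open>Differentials of a field by generators and relations\<close>

locale kaehler_differentials = A: cring A + B: field B
  for A :: "('a, 'm) ring_scheme" and B :: "('b, 'n) ring_scheme" and \<rho> :: "'a \<Rightarrow> 'b" +
  assumes \<rho>: "\<rho> \<in> ring_hom A B"
begin

abbreviation F where "F \<equiv> free_module B (carrier B)"
abbreviation e where "e \<equiv> free_gen B"
abbreviation N where "N \<equiv> module_span B F (kaehler_relations A B \<rho>)"

sublocale F: module B F by (rule B.module_free_module)

lemma e_closed [simp]: "b \<in> carrier B \<Longrightarrow> e b \<in> carrier F"
  by (rule B.free_gen_closed)

lemma relations_closed: "kaehler_relations A B \<rho> \<subseteq> carrier F"
  unfolding kaehler_relations_def Let_def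
proof (intro Un_least subsetI; elim CollectE exE conjE; hypsubst)
  show "e (\<rho> a) \<in> carrier F" if "a \<in> carrier A" for a using ring_hom_closed[OF \<rho> that] by simp
  show "e (b \<oplus>\<^bsub>B\<^esub> b') \<ominus>\<^bsub>F\<^esub> (e b \<oplus>\<^bsub>F\<^esub> e b') \<in> carrier F"
    if "b \<in> carrier B" "b' \<in> carrier B" for b b'
    by (intro F.M.minus_closed F.M.a_closed e_closed B.a_closed that)
  show "e (b \<otimes>\<^bsub>B\<^esub> b') \<ominus>\<^bsub>F\<^esub> (b \<odot>\<^bsub>F\<^esub> e b' \<oplus>\<^bsub>F\<^esub> b' \<odot>\<^bsub>F\<^esub> e b) \<in> carrier F"
    if "b \<in> carrier B" "b' \<in> carrier B" for b b'
    by (intro F.M.minus_closed F.M.a_closed F.smult_closed e_closed B.m_closed that)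
qed

lemma N_submodule: "submodule N B F"
  by (rule F.module_span_submodule[OF relations_closed])

sublocale QF: module_with_submodule B F N
  by (intro module_with_submodule.intro F.module_axioms N_submodule)

lemma relation_mem_relations:
  "b \<in> carrier B \<Longrightarrow> b' \<in> carrier B \<Longrightarrow>
    e (b \<oplus>\<^bsub>B\<^esub> b') \<ominus>\<^bsub>F\<^esub> (e b \<oplus>\<^bsub>F\<^esub> e b') \<in> kaehler_relations A B \<rho>"
  "b \<in> carrier B \<Longrightarrow> b' \<in> carrier B \<Longrightarrow>
    e (b \<otimes>\<^bsub>B\<^esub> b') \<ominus>\<^bsub>F\<^esub> (b \<odot>\<^bsub>F\<^esub> e b' \<oplus>\<^bsub>F\<^esub> b' \<odot>\<^bsub>F\<^esub> e b) \<in> kaehler_relations A B \<rho>"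
  "a \<in> carrier A \<Longrightarrow> e (\<rho> a) \<in> kaehler_relations A B \<rho>"
  by (unfold kaehler_relations_def Let_def,
      (rule UnI1, rule UnI1, intro CollectI exI conjI, rule refl; assumption),
      (rule UnI1, rule UnI2, intro CollectI exI conjI, rule refl; assumption),
      (rule UnI2, intro CollectI exI conjI, rule refl; assumption))

lemmas relation_memI = relation_mem_relations[THEN subsetD[OF module_span_incl]]

text \<open>As \<open>S\<close> contains the relations, the elements \<open>u\<close> with
  \<open>e u\<close> in \<open>S\<close> form a field: sums and products by additivity and the
  Leibniz rule, opposites and inverses by applying these to \<open>h - h = 0\<close> and to the
  product of \<open>h\<close> with its inverse. So it suffices to know the field generators.\<close>

lemma gen_mem_of_generate_field:
  assumes S: "submodule S B F" "N \<subseteq> S" and H: "H \<subseteq> carrier B" "\<And>h. h \<in> H \<Longrightarrow> e h \<in> S"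
    and u: "u \<in> generate_field B (\<rho> ` carrier A \<union> H)"
  shows "e u \<in> S"
proof -
  note SE = F.submoduleE[OF S(1)]
  have HB: "\<rho> ` carrier A \<union> H \<subseteq> carrier B" using ring_hom_closed[OF \<rho>] H(1) by auto
  have swap: "t \<in> S" if "t \<ominus>\<^bsub>F\<^esub> v \<in> S" "v \<in> S" "t \<in> carrier F" for t v
  proof -
    have "(t \<ominus>\<^bsub>F\<^esub> v) \<oplus>\<^bsub>F\<^esub> v = t"
      using that SE(1) by (simp add: a_minus_def F.M.a_assoc F.M.l_neg subset_iff)
    then show ?thesis using SE(5)[OF that(1,2)] by simp
  qed
  have swap': "v \<in> S" if "t \<ominus>\<^bsub>F\<^esub> v \<in> S" "t \<in> S" "v \<in> carrier F" for t v
  proof -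
    have t: "t \<in> carrier F" by (rule subsetD[OF SE(1) that(2)])
    have "\<ominus>\<^bsub>F\<^esub> (t \<ominus>\<^bsub>F\<^esub> v) = v \<oplus>\<^bsub>F\<^esub> \<ominus>\<^bsub>F\<^esub> t"
      using t that(3) by (simp add: a_minus_def F.M.minus_add F.M.a_comm)
    then have "\<ominus>\<^bsub>F\<^esub> (t \<ominus>\<^bsub>F\<^esub> v) \<oplus>\<^bsub>F\<^esub> t = v"
      using t that(3) by (simp add: F.M.a_assoc F.M.l_neg)
    then show ?thesis using SE(5)[OF SE(3)[OF that(1)] that(2)] by simp
  qed
  have cancel: "v \<in> S" if "t \<oplus>\<^bsub>F\<^esub> v \<in> S" "t \<in> S" "v \<in> carrier F" for t v
  proof -
    have "\<ominus>\<^bsub>F\<^esub> t \<oplus>\<^bsub>F\<^esub> (t \<oplus>\<^bsub>F\<^esub> v) = v"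
      using that SE(1) by (simp add: F.M.r_neg1 subset_iff)
    then show ?thesis using SE(5)[OF SE(3)[OF that(2)] that(1)] by simp
  qed
  have rel: "e (b \<oplus>\<^bsub>B\<^esub> b') \<ominus>\<^bsub>F\<^esub> (e b \<oplus>\<^bsub>F\<^esub> e b') \<in> S"
      "e (b \<otimes>\<^bsub>B\<^esub> b') \<ominus>\<^bsub>F\<^esub> (b \<odot>\<^bsub>F\<^esub> e b' \<oplus>\<^bsub>F\<^esub> b' \<odot>\<^bsub>F\<^esub> e b) \<in> S"
    if "b \<in> carrier B" "b' \<in> carrier B" for b b'
    by (rule subsetD[OF S(2) relation_memI(1)[OF that]], rule subsetD[OF S(2) relation_memI(2)[OF that]])
  have rel3: "e (\<rho> a) \<in> S" if "a \<in> carrier A" for a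
    by (rule subsetD[OF S(2) relation_memI(3)[OF that]])
  have e1: "e \<one>\<^bsub>B\<^esub> \<in> S" using rel3[OF A.one_closed] ring_hom_one[OF \<rho>] by simp
  have e0: "e \<zero>\<^bsub>B\<^esub> \<in> S"
    using rel3[OF A.zero_closed] ring_hom_zero[OF \<rho> A.ring_axioms B.ring_axioms] by simp
  have "u \<in> carrier B \<and> e u \<in> S" using u
  proof (induction u rule: generate_field.induct)
    case one
    show ?case using e1 by simp
  next
    case (incl h)
    then have hB: "h \<in> carrier B" using HB by blast
    from incl consider a where "a \<in> carrier A" "h = \<rho> a" | "h \<in> H" by blast
    then have "e h \<in> S" using rel3 H(2) by cases simp_all
    then show ?case using hB by simp
  next
    case (a_inv h)
    then have h: "h \<in> carrier B" "e h \<in> S" by auto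
    have "e (h \<oplus>\<^bsub>B\<^esub> \<ominus>\<^bsub>B\<^esub> h) \<in> S" using e0 h by (simp add: B.r_neg)
    then have "e h \<oplus>\<^bsub>F\<^esub> e (\<ominus>\<^bsub>B\<^esub> h) \<in> S"
      using h by (intro swap'[OF rel(1)]) auto
    then show ?case using cancel h by simp
  next
    case (m_inv h)
    then have h: "h \<in> carrier B" "e h \<in> S" by auto
    then have hU: "h \<in> Units B" using m_inv(2) B.field_Units by blast
    then have v: "inv\<^bsub>B\<^esub> h \<in> carrier B" by simp
    \<comment> \<open>The Leibniz rule for the product \<open>1\<close> of \<open>h\<close> and its
      inverse gives \<open>h\<close> times \<open>e\<close> of the inverse in \<open>S\<close>;
      multiplication by the inverse of \<open>h\<close> then isolates that generator.\<close>
    have "e (h \<otimes>\<^bsub>B\<^esub> inv\<^bsub>B\<^esub> h) \<in> S" using e1 hU by simp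
    then have "h \<odot>\<^bsub>F\<^esub> e (inv\<^bsub>B\<^esub> h) \<oplus>\<^bsub>F\<^esub> inv\<^bsub>B\<^esub> h \<odot>\<^bsub>F\<^esub> e h \<in> S"
      using h v by (intro swap'[OF rel(2)]) auto
    then have "inv\<^bsub>B\<^esub> h \<odot>\<^bsub>F\<^esub> e h \<oplus>\<^bsub>F\<^esub> h \<odot>\<^bsub>F\<^esub> e (inv\<^bsub>B\<^esub> h) \<in> S"
      using h v F.M.a_comm[of "h \<odot>\<^bsub>F\<^esub> e (inv\<^bsub>B\<^esub> h)" "inv\<^bsub>B\<^esub> h \<odot>\<^bsub>F\<^esub> e h"] by simp
    from cancel[OF this SE(4)[OF v h(2)]] have "h \<odot>\<^bsub>F\<^esub> e (inv\<^bsub>B\<^esub> h) \<in> S" using h v by simp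
    from SE(4)[OF v this] have "inv\<^bsub>B\<^esub> h \<odot>\<^bsub>F\<^esub> (h \<odot>\<^bsub>F\<^esub> e (inv\<^bsub>B\<^esub> h)) \<in> S" .
    also have "inv\<^bsub>B\<^esub> h \<odot>\<^bsub>F\<^esub> (h \<odot>\<^bsub>F\<^esub> e (inv\<^bsub>B\<^esub> h)) = e (inv\<^bsub>B\<^esub> h)"
      using F.smult_assoc1[OF v h(1) e_closed[OF v]] hU F.smult_one[OF e_closed[OF v]] by simp
    finally show ?case using v by simp
  next
    case (eng_add b b')
    then have b: "b \<in> carrier B" "b' \<in> carrier B" "e b \<in> S" "e b' \<in> S" by auto
    have "e (b \<oplus>\<^bsub>B\<^esub> b') \<in> S"
      by (rule swap[OF rel(1)[OF b(1,2)] SE(5)[OF b(3,4)]]) (use b in simp)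
    then show ?case using b by simp
  next
    case (eng_mult b b')
    then have b: "b \<in> carrier B" "b' \<in> carrier B" "e b \<in> S" "e b' \<in> S" by auto
    have "e (b \<otimes>\<^bsub>B\<^esub> b') \<in> S"
      by (rule swap[OF rel(2)[OF b(1,2)] SE(5)[OF SE(4)[OF b(1,4)] SE(4)[OF b(2,3)]]]) (use b in simp)
    then show ?case using b by simp
  qed
  then show ?thesis by blast
qed

text \<open>Spanning is a consequence of field generation: the differentials of field generators
  over \<open>A\<close> span all differentials, since their span is stable under the rules of
  differentiation. Independence is taken as a premise.\<close>

lemma kaehler_basisI:
  fixes l :: nat
  assumes a: "\<And>i. i < l \<Longrightarrow> a i \<in> carrier B"
    and gen: "carrier B = generate_field B (\<rho> ` carrier A \<union> a ` {..<l})"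
    and indep: "\<And>c. (\<forall>i<l. c i \<in> carrier B) \<Longrightarrow> (\<Oplus>\<^bsub>F\<^esub>i\<in>{..<l}. c i \<odot>\<^bsub>F\<^esub> e (a i)) \<in> N \<Longrightarrow>
      \<forall>i<l. c i = \<zero>\<^bsub>B\<^esub>"
  shows "module_basis B (kaehler_module A B \<rho>) l (\<lambda>i. kaehler_d A B \<rho> (a i))"
proof -
  let ?S = "{u \<oplus>\<^bsub>F\<^esub> (\<Oplus>\<^bsub>F\<^esub>i\<in>{..<l}. c i \<odot>\<^bsub>F\<^esub> e (a i)) | u c. u \<in> N \<and> (\<forall>i<l. c i \<in> carrier B)}"
  have ea: "e (a i) \<in> carrier F" if "i < l" for i using a that by simp
  have comb_closed: "(\<Oplus>\<^bsub>F\<^esub>i\<in>{..<l}. c i \<odot>\<^bsub>F\<^esub> e (a i)) \<in> carrier F" if "\<forall>i<l. c i \<in> carrier B" for c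
    using that ea by (intro F.M.finsum_closed) auto
  have S: "submodule ?S B F" by (rule QF.combinations_submodule[OF ea])
  have NS: "N \<subseteq> ?S"
  proof
    fix u assume u: "u \<in> N"
    have "(\<Oplus>\<^bsub>F\<^esub>i\<in>{..<l}. \<zero>\<^bsub>B\<^esub> \<odot>\<^bsub>F\<^esub> e (a i)) = (\<Oplus>\<^bsub>F\<^esub>i\<in>{..<l}. \<zero>\<^bsub>F\<^esub>)"
      using ea by (intro F.M.finsum_cong') auto
    also have "\<dots> = \<zero>\<^bsub>F\<^esub>" by (rule F.M.finsum_zero)
    finally have "u \<oplus>\<^bsub>F\<^esub> (\<Oplus>\<^bsub>F\<^esub>i\<in>{..<l}. \<zero>\<^bsub>B\<^esub> \<odot>\<^bsub>F\<^esub> e (a i)) = u"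
      using subsetD[OF QF.N_subset u] by simp
    then show "u \<in> ?S" using u B.zero_closed by (intro CollectI exI[of _ u] exI[of _ "\<lambda>_. \<zero>\<^bsub>B\<^esub>"]) simp
  qed
  have aS: "e h \<in> ?S" if h: "h \<in> a ` {..<l}" for h
  proof -
    obtain j where j: "j < l" "h = a j" using h by blast
    let ?c = "\<lambda>i. if i = j then \<one>\<^bsub>B\<^esub> else \<zero>\<^bsub>B\<^esub>"
    have "(\<Oplus>\<^bsub>F\<^esub>i\<in>{..<l}. ?c i \<odot>\<^bsub>F\<^esub> e (a i)) = (\<Oplus>\<^bsub>F\<^esub>i\<in>{j}. e (a i))"
      using ea j by (intro F.M.add.finprod_mono_neutral_cong_right) auto
    also have "\<dots> = e h" using ea j by simp
    finally have "\<zero>\<^bsub>F\<^esub> \<oplus>\<^bsub>F\<^esub> (\<Oplus>\<^bsub>F\<^esub>i\<in>{..<l}. ?c i \<odot>\<^bsub>F\<^esub> e (a i)) = e h" using ea j by simp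
    then show ?thesis using QF.N_zero
      by (intro CollectI exI[of _ "\<zero>\<^bsub>F\<^esub>"] exI[of _ ?c]) simp
  qed
  have eS: "e u \<in> ?S" if "u \<in> carrier B" for u
  proof (rule gen_mem_of_generate_field[OF S NS _ aS])
    show "a ` {..<l} \<subseteq> carrier B" using a by blast
    show "u \<in> generate_field B (\<rho> ` carrier A \<union> a ` {..<l})" using that gen by blast
  qed
  have FS: "f \<in> ?S" if "f \<in> carrier F" for f
    using that
  proof (induction f rule: B.free_module_induct)
    case zero
    show ?case using submodule_zero_closed[OF S] by (simp only: free_module_simps)
  next
    case (add c b f)
    then show ?case by (intro F.submoduleE(5)[OF S] F.submoduleE(4)[OF S] eS)
  qed
  show ?thesis
    unfolding kaehler_module_def kaehler_d_def
  proof (subst QF.module_basis_quotient_iff[OF ea], assumption, intro conjI ballI allI impI)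
    fix c i assume "\<forall>i<l. c i \<in> carrier B" "(\<Oplus>\<^bsub>F\<^esub>i\<in>{..<l}. c i \<odot>\<^bsub>F\<^esub> e (a i)) \<in> N" "i < l"
    then show "c i = \<zero>\<^bsub>B\<^esub>" using indep by blast
  next
    fix f assume "f \<in> carrier F"
    from FS[OF this] obtain u c where uc: "u \<in> N" "\<forall>i<l. c i \<in> carrier B"
      "f = u \<oplus>\<^bsub>F\<^esub> (\<Oplus>\<^bsub>F\<^esub>i\<in>{..<l}. c i \<odot>\<^bsub>F\<^esub> e (a i))" by blast
    have "f \<ominus>\<^bsub>F\<^esub> (\<Oplus>\<^bsub>F\<^esub>i\<in>{..<l}. c i \<odot>\<^bsub>F\<^esub> e (a i)) = u"
      using uc comb_closed[OF uc(2)] subsetD[OF QF.N_subset uc(1)]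
      by (simp add: a_minus_def F.M.a_assoc F.M.r_neg)
    then show "\<exists>c. (\<forall>i<l. c i \<in> carrier B) \<and> f \<ominus>\<^bsub>F\<^esub> (\<Oplus>\<^bsub>F\<^esub>i\<in>{..<l}. c i \<odot>\<^bsub>F\<^esub> e (a i)) \<in> N"
      using uc(1,2) by (intro exI[of _ c]) simp
  qed
qed

end

section \<open>The derivation of the residue field into \<open>n / D\<close>\<close>

context insep_residue
begin

abbreviation \<rho> where "\<rho> \<equiv> \<lambda>c. res (\<phi> c)"

lemma \<rho>_hom: "\<rho> \<in> ring_hom KR k"
  using ring_hom_trans[OF \<phi> res_hom] unfolding comp_def .

sublocale \<Omega>: kaehler_differentials KR k \<rho>
  by (intro kaehler_differentials.intro kaehler_differentials_axioms.intro KR_cring k_field \<rho>_hom)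

text \<open>The derivation \<open>res x \<mapsto> \<delta> x\<close> into the \<open>k\<close>-module \<open>n / D\<close> extends linearly to the differentials.\<close>

lemma kaehler_independent:
  fixes l :: nat and x :: "nat \<Rightarrow> 'a"
  assumes x: "\<And>i. i < l \<Longrightarrow> x i \<in> carrier Ob"
    and indep: "\<And>c. (\<forall>i<l. c i \<in> carrier L) \<Longrightarrow> (\<Oplus>\<^bsub>B\<^esub>i\<in>{..<l}. s (c i) \<otimes>\<^bsub>B\<^esub> \<delta> (x i)) \<in> D \<Longrightarrow>
      \<forall>i<l. c i = \<zero>\<^bsub>L\<^esub>"
    and c: "\<forall>i<l. c i \<in> carrier k"
    and sum: "(\<Oplus>\<^bsub>\<Omega>.F\<^esub>i\<in>{..<l}. c i \<odot>\<^bsub>\<Omega>.F\<^esub> \<Omega>.e (res (x i))) \<in> \<Omega>.N"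
  shows "\<forall>i<l. c i = \<zero>\<^bsub>k\<^esub>"
proof -
  \<comment> \<open>An arbitrary section of the residue map. It respects neither sums nor products,
    but each failure lies in \<open>m\<close>, and \<open>\<delta>\<close> maps \<open>m\<close>
    into \<open>D\<close>.\<close>
  define lift where "lift b = (SOME y. y \<in> carrier Ob \<and> b = res y)" for b
  have lift: "lift b \<in> carrier Ob" "res (lift b) = b" if "b \<in> carrier k" for b
    using someI_ex[of "\<lambda>y. y \<in> carrier Ob \<and> b = res y"] res_surj[OF that] unfolding lift_def by auto
  have r_lift: "r (lift b) = \<sigma> b" if "b \<in> carrier k" for b
    unfolding r_def lift(2)[OF that] ..
  have k_ring: "ring k" by (rule \<Omega>.B.ring_axioms)
  let ?\<tau> = "\<lambda>b. s (\<sigma> b)"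
  have \<tau>: "?\<tau> \<in> ring_hom k B" using ring_hom_trans[OF \<sigma> s] unfolding comp_def .
  \<comment> \<open>The linear extension takes values in \<open>B\<close> rather than in
    \<open>n / D\<close>; congruence modulo \<open>D\<close> is tested afterwards.\<close>
  let ?M = "restrict_scalars B ?\<tau>"
  have M_mod: "module k ?M" by (rule module_restrict_scalars[OF \<Omega>.B.is_cring B.is_cring \<tau>])
  interpret M: module k ?M by (rule M_mod)
  let ?g = "\<lambda>b. \<delta> (lift b)"
  have g: "?g \<in> carrier k \<rightarrow> carrier ?M" using lift(1) by (auto simp: restrict_scalars_simps)
  define \<Lambda> where "\<Lambda> = lin_ext k ?M ?g"
  note \<Lambda>_closed = M.lin_ext_closed[OF _ g, folded \<Lambda>_def, unfolded restrict_scalars_simps]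
  note \<Lambda>_add = M.lin_ext_add[OF _ _ g, folded \<Lambda>_def, unfolded restrict_scalars_simps]
  note \<Lambda>_minus = M.lin_ext_minus[OF _ _ g, folded \<Lambda>_def, unfolded restrict_scalars_simps restrict_scalars_a_inv]
  note \<Lambda>_smult = M.lin_ext_smult[OF _ _ g, folded \<Lambda>_def, unfolded restrict_scalars_simps]
  note \<Lambda>_gen = M.lin_ext_gen[OF _ g, folded \<Lambda>_def]
  interpret BM: module L BM by (rule BM_module)
  note DE = BM.submoduleE[OF D_submodule, unfolded restrict_scalars_simps restrict_scalars_a_inv]
  have D0: "\<zero>\<^bsub>B\<^esub> \<in> D" using submodule_zero_closed[OF D_submodule] by (simp only: restrict_scalars_simps)
  have \<sigma>_closed: "\<sigma> b \<in> carrier L" if "b \<in> carrier k" for b by (rule ring_hom_closed[OF \<sigma> that])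
  \<comment> \<open>The preimage of \<open>D\<close> under \<open>\<Lambda>\<close>. It is a
    submodule over \<open>k\<close>, so once it contains the relations it contains
    \<open>\<Omega>.N\<close>.\<close>
  define T where "T = {f \<in> carrier \<Omega>.F. \<Lambda> f \<in> D}"
  have \<Lambda>0: "\<Lambda> \<zero>\<^bsub>\<Omega>.F\<^esub> = \<zero>\<^bsub>B\<^esub>"
    using \<Lambda>_add[OF \<Omega>.F.M.zero_closed \<Omega>.F.M.zero_closed] \<Lambda>_closed[OF \<Omega>.F.M.zero_closed]
    by (simp only: \<Omega>.F.M.l_zero[OF \<Omega>.F.M.zero_closed] B.add.r_cancel_one')
  have neg: "\<Lambda> (\<ominus>\<^bsub>\<Omega>.F\<^esub> f) = \<ominus>\<^bsub>B\<^esub> \<Lambda> f" if f: "f \<in> carrier \<Omega>.F" for f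
  proof -
    have "\<zero>\<^bsub>\<Omega>.F\<^esub> \<ominus>\<^bsub>\<Omega>.F\<^esub> f = \<ominus>\<^bsub>\<Omega>.F\<^esub> f" using f by (simp add: a_minus_def)
    then show ?thesis using \<Lambda>_minus[OF \<Omega>.F.M.zero_closed f] \<Lambda>_closed[OF f] \<Lambda>0 by (simp add: a_minus_def)
  qed
  have T: "submodule T k \<Omega>.F"
  proof (rule \<Omega>.F.submoduleI)
    show "T \<subseteq> carrier \<Omega>.F" unfolding T_def by blast
    show "\<zero>\<^bsub>\<Omega>.F\<^esub> \<in> T" unfolding T_def using D0 by (simp add: \<Lambda>0)
    show "\<ominus>\<^bsub>\<Omega>.F\<^esub> f \<in> T" if "f \<in> T" for f using that DE(3) unfolding T_def by (simp add: neg)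
    show "f \<oplus>\<^bsub>\<Omega>.F\<^esub> f' \<in> T" if "f \<in> T" "f' \<in> T" for f f'
      using that DE(5) unfolding T_def by (simp add: \<Lambda>_add)
    show "b \<odot>\<^bsub>\<Omega>.F\<^esub> f \<in> T" if "b \<in> carrier k" "f \<in> T" for b f
      using that DE(4)[OF \<sigma>_closed[OF that(1)]] unfolding T_def by (simp add: \<Lambda>_smult)
  qed
  have \<delta>_D: "\<delta> y \<in> D" if "y \<in> carrier Ob" "res y = \<zero>\<^bsub>k\<^esub>" for y
  proof -
    have "res y = res \<zero>\<^bsub>Ob\<^esub>" using that ring_hom_zero[OF res_hom Ob.ring_axioms k_ring] by simp
    then have "y \<in> m" using res_eq_iff[OF that(1) Ob.zero_closed] that(1) by (simp add: a_minus_def)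
    then show ?thesis using \<delta>_m \<iota>_m_mem_D by simp
  qed
  note res_simps = ring_hom_add[OF res_hom] ring_hom_mult[OF res_hom]
  have res_minus: "res (y \<ominus>\<^bsub>Ob\<^esub> z) = res y \<ominus>\<^bsub>k\<^esub> res z" if "y \<in> carrier Ob" "z \<in> carrier Ob" for y z
  proof -
    interpret h: ring_hom_ring Ob k res by (rule ring_hom_ringI2[OF Ob.ring_axioms k_ring res_hom])
    show ?thesis using that by (simp add: a_minus_def)
  qed
  have self_minus: "b \<ominus>\<^bsub>k\<^esub> b = \<zero>\<^bsub>k\<^esub>" if "b \<in> carrier k" for b using that by (simp add: a_minus_def \<Omega>.B.r_neg)
  have rel1: "\<Omega>.e (b \<oplus>\<^bsub>k\<^esub> b') \<ominus>\<^bsub>\<Omega>.F\<^esub> (\<Omega>.e b \<oplus>\<^bsub>\<Omega>.F\<^esub> \<Omega>.e b') \<in> T"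
    if b: "b \<in> carrier k" "b' \<in> carrier k" for b b'
  proof -
    let ?y = "lift (b \<oplus>\<^bsub>k\<^esub> b') \<ominus>\<^bsub>Ob\<^esub> (lift b \<oplus>\<^bsub>Ob\<^esub> lift b')"
    have "\<Lambda> (\<Omega>.e (b \<oplus>\<^bsub>k\<^esub> b') \<ominus>\<^bsub>\<Omega>.F\<^esub> (\<Omega>.e b \<oplus>\<^bsub>\<Omega>.F\<^esub> \<Omega>.e b')) = \<delta> ?y"
      using b lift(1) by (simp add: \<Lambda>_minus \<Lambda>_add \<Lambda>_gen \<delta>_minus \<delta>_add)
    moreover have "\<delta> ?y \<in> D"
      using b lift by (intro \<delta>_D) (simp_all add: res_minus res_simps self_minus)
    ultimately show ?thesis unfolding T_def using b by simp
  qed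
  have rel2: "\<Omega>.e (b \<otimes>\<^bsub>k\<^esub> b') \<ominus>\<^bsub>\<Omega>.F\<^esub> (b \<odot>\<^bsub>\<Omega>.F\<^esub> \<Omega>.e b' \<oplus>\<^bsub>\<Omega>.F\<^esub> b' \<odot>\<^bsub>\<Omega>.F\<^esub> \<Omega>.e b) \<in> T"
    if b: "b \<in> carrier k" "b' \<in> carrier k" for b b'
  proof -
    let ?z = "lift b \<otimes>\<^bsub>Ob\<^esub> lift b'"
    let ?y = "lift (b \<otimes>\<^bsub>k\<^esub> b') \<ominus>\<^bsub>Ob\<^esub> ?z"
    let ?w = "s (\<sigma> b) \<otimes>\<^bsub>B\<^esub> \<delta> (lift b') \<oplus>\<^bsub>B\<^esub> s (\<sigma> b') \<otimes>\<^bsub>B\<^esub> \<delta> (lift b)"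
    have cl: "?z \<in> carrier Ob" "lift (b \<otimes>\<^bsub>k\<^esub> b') \<in> carrier Ob" "lift b \<in> carrier Ob" "lift b' \<in> carrier Ob"
      "?w \<in> carrier B" "\<delta> (lift b) \<otimes>\<^bsub>B\<^esub> \<delta> (lift b') \<in> carrier B"
      using b lift(1) \<sigma>_closed by simp_all
    have "\<Lambda> (\<Omega>.e (b \<otimes>\<^bsub>k\<^esub> b') \<ominus>\<^bsub>\<Omega>.F\<^esub> (b \<odot>\<^bsub>\<Omega>.F\<^esub> \<Omega>.e b' \<oplus>\<^bsub>\<Omega>.F\<^esub> b' \<odot>\<^bsub>\<Omega>.F\<^esub> \<Omega>.e b)) =
        \<delta> (lift (b \<otimes>\<^bsub>k\<^esub> b')) \<ominus>\<^bsub>B\<^esub> ?w"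
      using b by (simp add: \<Lambda>_minus \<Lambda>_add \<Lambda>_gen \<Lambda>_smult)
    \<comment> \<open>The defect splits into two parts matching the two summands of
      \<open>D\<close>: \<open>?y\<close> has residue zero and hence lies in \<open>m\<close>, and
      the product of two values of \<open>\<delta>\<close> lies in the square of
      \<open>n\<close>.\<close>
    also have "\<dots> = \<delta> ?y \<oplus>\<^bsub>B\<^esub> \<delta> (lift b) \<otimes>\<^bsub>B\<^esub> \<delta> (lift b')"
    proof -
      have "\<delta> ?z = \<delta> (lift b) \<otimes>\<^bsub>B\<^esub> \<delta> (lift b') \<oplus>\<^bsub>B\<^esub> ?w"
        using \<delta>_mult'[OF cl(3,4)] b by (simp add: r_lift)
      moreover have *: "u \<ominus>\<^bsub>B\<^esub> w = (u \<ominus>\<^bsub>B\<^esub> (v \<oplus>\<^bsub>B\<^esub> w)) \<oplus>\<^bsub>B\<^esub> v"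
        if "u \<in> carrier B" "v \<in> carrier B" "w \<in> carrier B" for u v w using that by algebra
      ultimately show ?thesis
        unfolding \<delta>_minus[OF cl(2,1)] by (simp only: *[OF \<delta>_closed[OF cl(2)] cl(6,5)])
    qed
    also have "\<dots> \<in> D"
    proof (rule DE(5))
      show "\<delta> ?y \<in> D" using b lift by (intro \<delta>_D) (simp_all add: res_minus res_simps self_minus)
      show "\<delta> (lift b) \<otimes>\<^bsub>B\<^esub> \<delta> (lift b') \<in> D"
        by (rule subsetD[OF nn_subset_D]) (intro ideal_prod.prod \<delta>_mem cl)
    qed
    finally show ?thesis unfolding T_def using b by simp
  qed
  have rel3: "\<Omega>.e (\<rho> d) \<in> T" if "d \<in> carrier KR" for d
  proof -
    have d: "d \<in> K" "\<rho> d \<in> carrier k" using that ring_hom_closed[OF \<rho>_hom that] by auto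
    have "\<delta> (lift (\<rho> d)) = \<delta> (lift (\<rho> d) \<ominus>\<^bsub>Ob\<^esub> \<phi> d)"
      unfolding \<delta>_minus[OF lift(1)[OF d(2)] \<phi>_closed[OF d(1)]] \<delta>_\<phi>[OF d(1)]
      using lift(1)[OF d(2)] by (simp add: a_minus_def)
    also have "\<dots> \<in> D"
      using d lift[OF d(2)] by (intro \<delta>_D) (simp_all add: res_minus self_minus)
    finally show ?thesis unfolding T_def using d by (simp add: \<Lambda>_gen)
  qed
  have "kaehler_relations KR k \<rho> \<subseteq> T"
    unfolding kaehler_relations_def Let_def
    by (intro Un_least subsetI; elim CollectE exE conjE; hypsubst; rule rel1 rel2 rel3; assumption)
  then have "\<Omega>.N \<subseteq> T" by (rule module_span_minimal[OF T])
  then have \<Lambda>D: "\<Lambda> (\<Oplus>\<^bsub>\<Omega>.F\<^esub>i\<in>{..<l}. c i \<odot>\<^bsub>\<Omega>.F\<^esub> \<Omega>.e (res (x i))) \<in> D"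
    using sum unfolding T_def by blast
  have rx: "res (x i) \<in> carrier k" if "i < l" for i using ring_hom_closed[OF res_hom x[OF that]] .
  have \<Lambda>_finsum: "\<Lambda> (\<Oplus>\<^bsub>\<Omega>.F\<^esub>i\<in>A. c i \<odot>\<^bsub>\<Omega>.F\<^esub> \<Omega>.e (res (x i)))
      = (\<Oplus>\<^bsub>B\<^esub>i\<in>A. s (\<sigma> (c i)) \<otimes>\<^bsub>B\<^esub> \<delta> (lift (res (x i))))" if "finite A" "A \<subseteq> {..<l}" for A
    using that
  proof (induction A rule: finite_induct)
    case empty
    then show ?case by (simp add: \<Lambda>0)
  next
    case (insert j A)
    have j: "c j \<in> carrier k" "res (x j) \<in> carrier k" and A: "\<And>i. i \<in> A \<Longrightarrow> c i \<in> carrier k \<and> res (x i) \<in> carrier k"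
      using insert.prems c rx by auto
    have cl: "(\<Oplus>\<^bsub>\<Omega>.F\<^esub>i\<in>A. c i \<odot>\<^bsub>\<Omega>.F\<^esub> \<Omega>.e (res (x i))) \<in> carrier \<Omega>.F"
      using A by (intro \<Omega>.F.M.finsum_closed) auto
    have "(\<Oplus>\<^bsub>\<Omega>.F\<^esub>i\<in>insert j A. c i \<odot>\<^bsub>\<Omega>.F\<^esub> \<Omega>.e (res (x i))) =
        c j \<odot>\<^bsub>\<Omega>.F\<^esub> \<Omega>.e (res (x j)) \<oplus>\<^bsub>\<Omega>.F\<^esub> (\<Oplus>\<^bsub>\<Omega>.F\<^esub>i\<in>A. c i \<odot>\<^bsub>\<Omega>.F\<^esub> \<Omega>.e (res (x i)))"
      using insert A j by (intro \<Omega>.F.M.finsum_insert) auto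
    then have "\<Lambda> (\<Oplus>\<^bsub>\<Omega>.F\<^esub>i\<in>insert j A. c i \<odot>\<^bsub>\<Omega>.F\<^esub> \<Omega>.e (res (x i))) =
        s (\<sigma> (c j)) \<otimes>\<^bsub>B\<^esub> \<delta> (lift (res (x j))) \<oplus>\<^bsub>B\<^esub> (\<Oplus>\<^bsub>B\<^esub>i\<in>A. s (\<sigma> (c i)) \<otimes>\<^bsub>B\<^esub> \<delta> (lift (res (x i))))"
      using insert j cl by (simp add: \<Lambda>_add \<Lambda>_smult \<Lambda>_gen)
    also have "\<dots> = (\<Oplus>\<^bsub>B\<^esub>i\<in>insert j A. s (\<sigma> (c i)) \<otimes>\<^bsub>B\<^esub> \<delta> (lift (res (x i))))"
      using insert A j \<sigma>_closed lift(1) by (intro B.finsum_insert[symmetric]) auto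
    finally show ?case .
  qed
  \<comment> \<open>The chosen lift of the residue of \<open>x i\<close> differs from
    \<open>x i\<close> by an element of \<open>m\<close>, so replacing one by the other changes the
    sum only by an element of \<open>D\<close>.\<close>
  have "(\<Oplus>\<^bsub>B\<^esub>i\<in>A. s (\<sigma> (c i)) \<otimes>\<^bsub>B\<^esub> \<delta> (x i)) \<ominus>\<^bsub>B\<^esub> (\<Oplus>\<^bsub>B\<^esub>i\<in>A. s (\<sigma> (c i)) \<otimes>\<^bsub>B\<^esub> \<delta> (lift (res (x i)))) \<in> D"
    if "finite A" "A \<subseteq> {..<l}" for A
    using that
  proof (induction A rule: finite_induct)
    case empty
    then show ?case using D0 by (simp add: a_minus_def)
  next
    case (insert j A)
    have j: "\<sigma> (c j) \<in> carrier L" "lift (res (x j)) \<in> carrier Ob" "x j \<in> carrier Ob" "j < l"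
      using insert.prems c rx \<sigma>_closed lift(1) x by auto
    have A: "\<sigma> (c i) \<in> carrier L \<and> lift (res (x i)) \<in> carrier Ob \<and> x i \<in> carrier Ob" if "i \<in> A" for i
      using insert.prems c rx \<sigma>_closed lift(1) x that by auto
    let ?f = "\<lambda>i. s (\<sigma> (c i)) \<otimes>\<^bsub>B\<^esub> \<delta> (x i)" and ?h = "\<lambda>i. s (\<sigma> (c i)) \<otimes>\<^bsub>B\<^esub> \<delta> (lift (res (x i)))"
    have f: "(\<Oplus>\<^bsub>B\<^esub>i\<in>insert j A. ?f i) = ?f j \<oplus>\<^bsub>B\<^esub> (\<Oplus>\<^bsub>B\<^esub>i\<in>A. ?f i)"
      using insert A j by (intro B.finsum_insert) auto
    have h: "(\<Oplus>\<^bsub>B\<^esub>i\<in>insert j A. ?h i) = ?h j \<oplus>\<^bsub>B\<^esub> (\<Oplus>\<^bsub>B\<^esub>i\<in>A. ?h i)"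
      using insert A j by (intro B.finsum_insert) auto
    have cl: "(\<Oplus>\<^bsub>B\<^esub>i\<in>A. ?f i) \<in> carrier B" "(\<Oplus>\<^bsub>B\<^esub>i\<in>A. ?h i) \<in> carrier B"
      using A by (intro B.finsum_closed; auto)+
    have *: "(u \<otimes>\<^bsub>B\<^esub> a \<oplus>\<^bsub>B\<^esub> b) \<ominus>\<^bsub>B\<^esub> (u \<otimes>\<^bsub>B\<^esub> a' \<oplus>\<^bsub>B\<^esub> b') = u \<otimes>\<^bsub>B\<^esub> (a \<ominus>\<^bsub>B\<^esub> a') \<oplus>\<^bsub>B\<^esub> (b \<ominus>\<^bsub>B\<^esub> b')"
      if "u \<in> carrier B" "a \<in> carrier B" "b \<in> carrier B" "a' \<in> carrier B" "b' \<in> carrier B" for u a b a' b'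
      using that by algebra
    have "\<delta> (x j \<ominus>\<^bsub>Ob\<^esub> lift (res (x j))) \<in> D"
      using j lift(2)[OF rx[OF j(4)]] rx[OF j(4)] by (intro \<delta>_D) (simp_all add: res_minus self_minus)
    then have "\<delta> (x j) \<ominus>\<^bsub>B\<^esub> \<delta> (lift (res (x j))) \<in> D" using j by (simp add: \<delta>_minus)
    then have "s (\<sigma> (c j)) \<otimes>\<^bsub>B\<^esub> (\<delta> (x j) \<ominus>\<^bsub>B\<^esub> \<delta> (lift (res (x j)))) \<in> D" by (rule DE(4)[OF j(1)])
    moreover have "(\<Oplus>\<^bsub>B\<^esub>i\<in>A. ?f i) \<ominus>\<^bsub>B\<^esub> (\<Oplus>\<^bsub>B\<^esub>i\<in>A. ?h i) \<in> D" using insert by simp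
    ultimately show ?case unfolding f h
        *[OF s.hom_closed[OF j(1)] \<delta>_closed[OF j(3)] cl(1) \<delta>_closed[OF j(2)] cl(2)]
      by (rule DE(5))
  qed
  from this[of "{..<l}"] have diff: "(\<Oplus>\<^bsub>B\<^esub>i\<in>{..<l}. s (\<sigma> (c i)) \<otimes>\<^bsub>B\<^esub> \<delta> (x i)) \<ominus>\<^bsub>B\<^esub>
      (\<Oplus>\<^bsub>B\<^esub>i\<in>{..<l}. s (\<sigma> (c i)) \<otimes>\<^bsub>B\<^esub> \<delta> (lift (res (x i)))) \<in> D" by simp
  have \<sigma>c: "\<forall>i<l. \<sigma> (c i) \<in> carrier L" using c \<sigma>_closed by blast
  have cl: "(\<Oplus>\<^bsub>B\<^esub>i\<in>{..<l}. s (\<sigma> (c i)) \<otimes>\<^bsub>B\<^esub> \<delta> (x i)) \<in> carrier B"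
    "(\<Oplus>\<^bsub>B\<^esub>i\<in>{..<l}. s (\<sigma> (c i)) \<otimes>\<^bsub>B\<^esub> \<delta> (lift (res (x i)))) \<in> carrier B"
    using \<sigma>c x lift(1)[OF rx] by (intro B.finsum_closed; auto)+
  have "(u \<ominus>\<^bsub>B\<^esub> v) \<oplus>\<^bsub>B\<^esub> v = u" if "u \<in> carrier B" "v \<in> carrier B" for u v using that by algebra
  from this[OF cl] have "(\<Oplus>\<^bsub>B\<^esub>i\<in>{..<l}. s (\<sigma> (c i)) \<otimes>\<^bsub>B\<^esub> \<delta> (x i)) \<in> D"
    using DE(5)[OF diff \<Lambda>D[unfolded \<Lambda>_finsum[OF finite_lessThan subset_refl]]] by (simp only:)
  from indep[OF \<sigma>c this] have \<sigma>0: "\<forall>i<l. \<sigma> (c i) = \<zero>\<^bsub>L\<^esub>" .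
  have "\<sigma> \<zero>\<^bsub>k\<^esub> = \<zero>\<^bsub>L\<^esub>" by (rule ring_hom_zero[OF \<sigma> k_ring L.ring_axioms])
  then have "c i = \<zero>\<^bsub>k\<^esub>" if "i < l" for i
    using inj_onD[OF \<sigma>_inj, of "c i" "\<zero>\<^bsub>k\<^esub>"] \<sigma>0 c that by simp
  then show ?thesis by blast
qed

text \<open>The descent takes place in \<open>L\<close>, with \<open>k0\<close> the image under
  \<open>\<sigma>\<close> of the subfield \<open>?F0\<close> of \<open>k\<close>; injectivity of
  \<open>\<sigma>\<close> carries the result back. Generation as a field is then also what makes the
  differentials span.\<close>

lemma residue_field_generated_and_basis:
  fixes l :: nat and x :: "nat \<Rightarrow> 'a"
  assumes x: "\<And>i. i < l \<Longrightarrow> x i \<in> carrier Ob"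
    and indep: "\<And>c. (\<forall>i<l. c i \<in> carrier L) \<Longrightarrow> (\<Oplus>\<^bsub>B\<^esub>i\<in>{..<l}. s (c i) \<otimes>\<^bsub>B\<^esub> \<delta> (x i)) \<in> D \<Longrightarrow>
      \<forall>i<l. c i = \<zero>\<^bsub>L\<^esub>"
    and span: "\<And>t. t \<in> n \<Longrightarrow> \<exists>c. (\<forall>i<l. c i \<in> carrier L) \<and>
        t \<ominus>\<^bsub>B\<^esub> (\<Oplus>\<^bsub>B\<^esub>i\<in>{..<l}. s (c i) \<otimes>\<^bsub>B\<^esub> \<delta> (x i)) \<in> D"
    and G: "finite G" "G \<subseteq> carrier Ob"
    and fg: "\<And>S. S \<subseteq> carrier Ob \<Longrightarrow> \<phi> ` K \<subseteq> S \<Longrightarrow> G \<subseteq> S \<Longrightarrow>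
      (\<And>u v. u \<in> S \<Longrightarrow> v \<in> S \<Longrightarrow> u \<oplus>\<^bsub>Ob\<^esub> v \<in> S) \<Longrightarrow> (\<And>u v. u \<in> S \<Longrightarrow> v \<in> S \<Longrightarrow> u \<otimes>\<^bsub>Ob\<^esub> v \<in> S) \<Longrightarrow>
      (\<And>u. u \<in> S \<Longrightarrow> \<ominus>\<^bsub>Ob\<^esub> u \<in> S) \<Longrightarrow> (\<And>u. u \<in> S \<Longrightarrow> u \<in> Units Ob \<Longrightarrow> inv\<^bsub>Ob\<^esub> u \<in> S) \<Longrightarrow>
      carrier Ob \<subseteq> S"
  shows "carrier k = generate_field k (\<rho> ` K \<union> (\<lambda>i. res (x i)) ` {..<l})"
    and "module_basis k (kaehler_module KR k \<rho>) l (\<lambda>i. kaehler_d KR k \<rho> (res (x i)))"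
proof -
  let ?H = "\<rho> ` K \<union> (\<lambda>i. res (x i)) ` {..<l}"
  have H: "?H \<subseteq> carrier k" using ring_hom_closed[OF res_hom] x by auto
  let ?F0 = "generate_field k ?H"
  have F0: "subfield ?F0 k" by (rule \<Omega>.B.generate_field_is_subfield[OF H])
  have F0k: "?F0 \<subseteq> carrier k" by (rule \<Omega>.B.generate_field_incl[OF H])
  interpret \<sigma>: ring_hom_ring k L \<sigma> by (rule ring_hom_ringI2[OF \<Omega>.B.ring_axioms L.ring_axioms \<sigma>])
  have k0: "subfield (\<sigma> ` ?F0) L" by (rule \<sigma>.img_is_subfield(2)[OF F0]) simp
  have Kk0: "K \<subseteq> \<sigma> ` ?F0"
  proof
    fix c assume c: "c \<in> K"
    then have "\<rho> c \<in> ?F0" by (intro generate_field.incl) blast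
    moreover have "\<sigma> (\<rho> c) = c" using r_\<phi>[OF c] unfolding r_def .
    ultimately show "c \<in> \<sigma> ` ?F0" by (metis imageI)
  qed
  have xk0: "x i \<in> carrier Ob \<and> r (x i) \<in> \<sigma> ` ?F0" if "i \<in> {..<l}" for i
    using that x generate_field.incl[of "res (x i)" ?H k] unfolding r_def by auto
  have gen: "n = genideal B (\<iota> ` m \<union> (\<lambda>i. \<delta> (x i)) ` {..<l})"
    by (rule n_eq_ideal_of_generators[OF x span G fg])
  have "u \<in> ?F0" if u: "u \<in> carrier k" for u
  proof -
    obtain y where y: "y \<in> carrier Ob" "u = res y" using res_surj[OF u] by blast
    have "r y \<in> \<sigma> ` ?F0" by (rule residue_mem_subfield[OF k0 Kk0 xk0 gen y(1)])
    then obtain v where v: "v \<in> ?F0" "\<sigma> u = \<sigma> v" unfolding r_def y(2) by blast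
    then have "u = v" using inj_onD[OF \<sigma>_inj v(2) u] F0k by blast
    then show ?thesis using v(1) by simp
  qed
  then show g: "carrier k = ?F0" using F0k by blast
  show "module_basis k (kaehler_module KR k \<rho>) l (\<lambda>i. kaehler_d KR k \<rho> (res (x i)))"
  proof (rule \<Omega>.kaehler_basisI)
    show "res (x i) \<in> carrier k" if "i < l" for i using ring_hom_closed[OF res_hom x[OF that]] .
    show "carrier k = generate_field k (\<rho> ` carrier KR \<union> (\<lambda>i. res (x i)) ` {..<l})" using g by simp
  qed (rule kaehler_independent[OF x indep])
qed

end

section \<open>Stalks of schemes of finite type\<close>

context ringed_space
begin

lemma restr_closed:
  "openin (pts Z) U \<Longrightarrow> openin (pts Z) V \<Longrightarrow> V \<subseteq> U \<Longrightarrow> s \<in> carrier (sections Z U) \<Longrightarrow>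
    restr Z U V s \<in> carrier (sections Z V)"
  using ring_hom_closed[OF restr_hom] .

lemma germ_self:
  assumes "openin (pts Z) U" "P \<in> U" "s \<in> carrier (sections Z U)"
  shows "(U, s) \<in> germ Z P U s"
  unfolding germ_def using assms by (intro CollectI case_prodI conjI exI[of _ U]) auto

lemma germ_eqI:
  assumes U: "openin (pts Z) U" "P \<in> U" "s \<in> carrier (sections Z U)"
    and V: "openin (pts Z) V" "P \<in> V" "t \<in> carrier (sections Z V)"
    and W: "openin (pts Z) W" "P \<in> W" "W \<subseteq> U \<inter> V" "restr Z U W s = restr Z V W t"
  shows "germ Z P U s = germ Z P V t"
proof -
  have sub: "germ Z P U s \<subseteq> germ Z P V t"
    if U: "openin (pts Z) U" "s \<in> carrier (sections Z U)"
      and V: "openin (pts Z) V" "t \<in> carrier (sections Z V)"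
      and W: "openin (pts Z) W" "P \<in> W" "W \<subseteq> U \<inter> V" "restr Z U W s = restr Z V W t" for U s V t
  proof
    fix z assume "z \<in> germ Z P U s"
    then obtain V' t' W' where z: "z = (V', t')" "openin (pts Z) V'" "P \<in> V'" "t' \<in> carrier (sections Z V')"
      "openin (pts Z) W'" "P \<in> W'" "W' \<subseteq> U \<inter> V'" "restr Z U W' s = restr Z V' W' t'"
      unfolding germ_def by (elim CollectE case_prodE conjE exE)
    let ?W = "W \<inter> W'"
    have o: "openin (pts Z) ?W" using W(1) z(5) by (rule openin_Int)
    have "restr Z V ?W t = restr Z W ?W (restr Z V W t)"
      using V W o by (intro restr_trans[symmetric]) auto
    also have "\<dots> = restr Z W ?W (restr Z U W s)" using W(4) by simp
    also have "\<dots> = restr Z U ?W s" using U W o by (intro restr_trans) auto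
    also have "\<dots> = restr Z W' ?W (restr Z U W' s)" using U z o by (intro restr_trans[symmetric]) auto
    also have "\<dots> = restr Z W' ?W (restr Z V' W' t')" using z(8) by simp
    also have "\<dots> = restr Z V' ?W t'" using z o by (intro restr_trans) auto
    finally have e: "restr Z V ?W t = restr Z V' ?W t'" .
    show "z \<in> germ Z P V t"
      unfolding germ_def z(1) using z(2-4) o W z(6,7) e
      by (intro CollectI case_prodI conjI exI[of _ ?W]) auto
  qed
  show ?thesis
    using sub[OF U(1,3) V(1,3) W] sub[OF V(1,3) U(1,3) W(1,2) _ W(4)[symmetric]] W(3) by blast
qed

lemma germ_memD:
  assumes "(V, t) \<in> germ Z P U s"
  shows "openin (pts Z) V" "P \<in> V" "t \<in> carrier (sections Z V)"
    "\<exists>W. openin (pts Z) W \<and> P \<in> W \<and> W \<subseteq> U \<inter> V \<and> restr Z U W s = restr Z V W t"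
  using assms unfolding germ_def by simp_all

lemma germ_restr:
  assumes "openin (pts Z) U" "s \<in> carrier (sections Z U)" "openin (pts Z) V" "V \<subseteq> U" "P \<in> V"
  shows "germ Z P V (restr Z U V s) = germ Z P U s"
  using assms
  by (intro germ_eqI[where W = V]) (auto intro: restr_closed simp: restr_refl[OF _ restr_closed])

text \<open>Any two pairs of representatives agree with \<open>s\<close> and \<open>t\<close> on a
  smaller neighbourhood of \<open>P\<close>, so all members of the union are the same germ. The
  abstract operation \<open>f\<close> stands for addition and multiplication at once.\<close>

lemma stalk_operation:
  fixes f :: "'z set \<Rightarrow> 'b \<Rightarrow> 'b \<Rightarrow> 'b"
  assumes closed: "\<And>U a b. openin (pts Z) U \<Longrightarrow> a \<in> carrier (sections Z U) \<Longrightarrow>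
      b \<in> carrier (sections Z U) \<Longrightarrow> f U a b \<in> carrier (sections Z U)"
    and compat: "\<And>U V a b. openin (pts Z) U \<Longrightarrow> openin (pts Z) V \<Longrightarrow> V \<subseteq> U \<Longrightarrow>
      a \<in> carrier (sections Z U) \<Longrightarrow> b \<in> carrier (sections Z U) \<Longrightarrow>
      restr Z U V (f U a b) = f V (restr Z U V a) (restr Z U V b)"
    and U: "openin (pts Z) U" "P \<in> U" and st: "s \<in> carrier (sections Z U)" "t \<in> carrier (sections Z U)"
  shows "(\<Union>(V, a)\<in>germ Z P U s. \<Union>(W, b)\<in>germ Z P U t.
      germ Z P (V \<inter> W) (f (V \<inter> W) (restr Z V (V \<inter> W) a) (restr Z W (V \<inter> W) b))) = germ Z P U (f U s t)"
proof -
  have eq: "germ Z P (V \<inter> W) (f (V \<inter> W) (restr Z V (V \<inter> W) a) (restr Z W (V \<inter> W) b)) = germ Z P U (f U s t)"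
    if va: "(V, a) \<in> germ Z P U s" and wb: "(W, b) \<in> germ Z P U t" for V a W b
  proof -
    note va' = germ_memD[OF va] and wb' = germ_memD[OF wb]
    obtain V1 where V1: "openin (pts Z) V1" "P \<in> V1" "V1 \<subseteq> U \<inter> V" "restr Z U V1 s = restr Z V V1 a"
      using va'(4) by blast
    obtain W1 where W1: "openin (pts Z) W1" "P \<in> W1" "W1 \<subseteq> U \<inter> W" "restr Z U W1 t = restr Z W W1 b"
      using wb'(4) by blast
    let ?O = "V1 \<inter> W1"
    have o: "openin (pts Z) ?O" "openin (pts Z) (V \<inter> W)" using V1 W1 va' wb' by auto
    have rs: "restr Z U ?O s = restr Z V ?O a"
      using restr_trans[of U V1 ?O s] restr_trans[of V V1 ?O a] V1 va' U st o by auto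
    have rt: "restr Z U ?O t = restr Z W ?O b"
      using restr_trans[of U W1 ?O t] restr_trans[of W W1 ?O b] W1 wb' U st o by auto
    have cl: "restr Z V (V \<inter> W) a \<in> carrier (sections Z (V \<inter> W))" "restr Z W (V \<inter> W) b \<in> carrier (sections Z (V \<inter> W))"
      using va' wb' o by (auto intro!: restr_closed)
    show ?thesis
    proof (rule germ_eqI[where W = ?O])
      show "restr Z (V \<inter> W) ?O (f (V \<inter> W) (restr Z V (V \<inter> W) a) (restr Z W (V \<inter> W) b)) = restr Z U ?O (f U s t)"
      proof -
        have sub: "?O \<subseteq> V \<inter> W" "?O \<subseteq> U" using V1(3) W1(3) by auto
        have ra: "restr Z (V \<inter> W) ?O (restr Z V (V \<inter> W) a) = restr Z V ?O a"
          using va'(1,3) o sub by (intro restr_trans) auto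
        have rb: "restr Z (V \<inter> W) ?O (restr Z W (V \<inter> W) b) = restr Z W ?O b"
          using wb'(1,3) o sub by (intro restr_trans) auto
        show ?thesis
          unfolding compat[OF o(2,1) sub(1) cl] compat[OF U(1) o(1) sub(2) st] ra rb rs rt ..
      qed
    qed (use closed cl o U st V1 W1 va' wb' in auto)
  qed
  show ?thesis
  proof (intro equalityI subsetI)
    fix z assume "z \<in> (\<Union>(V, a)\<in>germ Z P U s. \<Union>(W, b)\<in>germ Z P U t.
      germ Z P (V \<inter> W) (f (V \<inter> W) (restr Z V (V \<inter> W) a) (restr Z W (V \<inter> W) b)))"
    then obtain V a W b where *: "(V, a) \<in> germ Z P U s" "(W, b) \<in> germ Z P U t"
      "z \<in> germ Z P (V \<inter> W) (f (V \<inter> W) (restr Z V (V \<inter> W) a) (restr Z W (V \<inter> W) b))"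
      unfolding UN_iff Bex_def split_paired_Ex prod.case by blast
    show "z \<in> germ Z P U (f U s t)" using *(3) unfolding eq[OF *(1,2)] .
  next
    fix z assume z: "z \<in> germ Z P U (f U s t)"
    have *: "(U, s) \<in> germ Z P U s" "(U, t) \<in> germ Z P U t" using germ_self[OF U] st by auto
    have "z \<in> germ Z P (U \<inter> U) (f (U \<inter> U) (restr Z U (U \<inter> U) s) (restr Z U (U \<inter> U) t))"
      using z unfolding eq[OF *] .
    then show "z \<in> (\<Union>(V, a)\<in>germ Z P U s. \<Union>(W, b)\<in>germ Z P U t.
      germ Z P (V \<inter> W) (f (V \<inter> W) (restr Z V (V \<inter> W) a) (restr Z W (V \<inter> W) b)))"
      by (intro UN_I[OF *(1)] UN_I[OF *(2)], simp only: prod.case) (intro UN_I[OF *(2)], simp only: prod.case)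
  qed
qed

lemma germ_hom:
  assumes U: "openin (pts Z) U" "P \<in> U"
  shows "germ Z P U \<in> ring_hom (sections Z U) (stalk Z P)"
proof (rule ring_hom_memI)
  have cr: "cring (sections Z V)" if "openin (pts Z) V" for V using sections_cring[OF that] .
  show "germ Z P U s \<in> carrier (stalk Z P)" if "s \<in> carrier (sections Z U)" for s
    unfolding stalk_def using U that by auto
  show "germ Z P U (s \<otimes>\<^bsub>sections Z U\<^esub> t) = germ Z P U s \<otimes>\<^bsub>stalk Z P\<^esub> germ Z P U t"
    if "s \<in> carrier (sections Z U)" "t \<in> carrier (sections Z U)" for s t
  proof -
    have "germ Z P U s \<otimes>\<^bsub>stalk Z P\<^esub> germ Z P U t = (\<Union>(V, a)\<in>germ Z P U s. \<Union>(W, b)\<in>germ Z P U t.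
      germ Z P (V \<inter> W) (restr Z V (V \<inter> W) a \<otimes>\<^bsub>sections Z (V \<inter> W)\<^esub> restr Z W (V \<inter> W) b))"
      by (simp add: stalk_def)
    also have "\<dots> = germ Z P U (s \<otimes>\<^bsub>sections Z U\<^esub> t)"
      by (rule stalk_operation[where f = "\<lambda>U. monoid.mult (sections Z U)", OF _ _ U that])
        (auto intro: cring.cring_simprules(5)[OF cr] ring_hom_mult[OF restr_hom])
    finally show ?thesis ..
  qed
  show "germ Z P U (s \<oplus>\<^bsub>sections Z U\<^esub> t) = germ Z P U s \<oplus>\<^bsub>stalk Z P\<^esub> germ Z P U t"
    if "s \<in> carrier (sections Z U)" "t \<in> carrier (sections Z U)" for s t
  proof -
    have "germ Z P U s \<oplus>\<^bsub>stalk Z P\<^esub> germ Z P U t = (\<Union>(V, a)\<in>germ Z P U s. \<Union>(W, b)\<in>germ Z P U t.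
      germ Z P (V \<inter> W) (restr Z V (V \<inter> W) a \<oplus>\<^bsub>sections Z (V \<inter> W)\<^esub> restr Z W (V \<inter> W) b))"
      by (simp add: stalk_def)
    also have "\<dots> = germ Z P U (s \<oplus>\<^bsub>sections Z U\<^esub> t)"
      by (rule stalk_operation[where f = "\<lambda>U. ring.add (sections Z U)", OF _ _ U that])
        (auto intro: cring.cring_simprules(1)[OF cr] ring_hom_add[OF restr_hom])
    finally show ?thesis ..
  qed
  have top: "openin (pts Z) (points Z)" "U \<subseteq> points Z" using openin_subset[OF U(1)] by auto
  have o: "\<one>\<^bsub>sections Z (points Z)\<^esub> \<in> carrier (sections Z (points Z))"
    by (rule cring.cring_simprules(6)[OF cr[OF top(1)]])
  have "germ Z P U (restr Z (points Z) U \<one>\<^bsub>sections Z (points Z)\<^esub>) = germ Z P (points Z) \<one>\<^bsub>sections Z (points Z)\<^esub>"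
    by (rule germ_restr[OF top(1) o U(1) top(2) U(2)])
  then show "germ Z P U \<one>\<^bsub>sections Z U\<^esub> = \<one>\<^bsub>stalk Z P\<^esub>"
    using ring_hom_one[OF restr_hom[OF top(1) U(1) top(2)]] by (simp add: stalk_def)
qed

end

section \<open>Zariski-open sets and sections given by fractions\<close>

lemma zariski_openin_iff:
  assumes A: "cring A"
  shows "openin (zariski_topology A) U \<longleftrightarrow> (\<exists>S\<subseteq>carrier A. U = {p. primeideal p A \<and> \<not> S \<subseteq> p})"
proof -
  interpret A: cring A by (rule A)
  let ?D = "\<lambda>S. {p. primeideal p A \<and> \<not> S \<subseteq> p}"
  \<comment> \<open>The constructor \<open>topology\<close> has the intended open sets only for a
    family satisfying the axioms. Intersections are described by the products of elements, which
    uses primality, and unions by the unions of the sets \<open>S\<close>.\<close>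
  have "istopology (\<lambda>U. \<exists>S\<subseteq>carrier A. U = ?D S)"
    unfolding istopology_def
  proof (intro conjI allI impI)
    fix U V assume "\<exists>S\<subseteq>carrier A. U = ?D S" "\<exists>S\<subseteq>carrier A. V = ?D S"
    then obtain S T where S: "S \<subseteq> carrier A" "U = ?D S" and T: "T \<subseteq> carrier A" "V = ?D T" by blast
    let ?P = "(\<lambda>q. fst q \<otimes>\<^bsub>A\<^esub> snd q) ` (S \<times> T)"
    have "?P \<subseteq> carrier A" using S(1) T(1) by (auto intro!: A.m_closed)
    moreover have "U \<inter> V = ?D ?P"
    proof (intro equalityI subsetI)
      fix p assume p: "p \<in> U \<inter> V"
      then interpret p: primeideal p A using S by blast
      obtain a b where ab: "a \<in> S" "a \<notin> p" "b \<in> T" "b \<notin> p" using p S T by blast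
      then have "a \<otimes>\<^bsub>A\<^esub> b \<notin> p" using p.I_prime[of a b] S T by blast
      moreover have "a \<otimes>\<^bsub>A\<^esub> b \<in> ?P" using ab by force
      ultimately show "p \<in> ?D ?P" using p.primeideal_axioms by blast
    next
      fix p assume p: "p \<in> ?D ?P"
      then interpret p: primeideal p A by blast
      obtain c where "c \<in> ?P" "c \<notin> p" using p by blast
      then obtain a b where ab: "a \<in> S" "b \<in> T" "a \<otimes>\<^bsub>A\<^esub> b \<notin> p" by auto
      then have "a \<notin> p" "b \<notin> p" using p.I_l_closed[of b a] p.I_r_closed[of a b] S T by blast+
      then show "p \<in> U \<inter> V" using ab S T p.primeideal_axioms by blast
    qed
    ultimately show "\<exists>S\<subseteq>carrier A. U \<inter> V = ?D S" by blast
  next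
    fix \<K> assume K: "\<forall>U\<in>\<K>. \<exists>S\<subseteq>carrier A. U = ?D S"
    then obtain S where S: "\<And>U. U \<in> \<K> \<Longrightarrow> S U \<subseteq> carrier A \<and> U = ?D (S U)" by metis
    have "\<Union>\<K> = ?D (\<Union>(S ` \<K>))"
    proof (intro equalityI subsetI)
      fix p assume "p \<in> \<Union>\<K>"
      then obtain U where U: "U \<in> \<K>" "p \<in> U" by blast
      have "p \<in> ?D (S U)" by (rule subst[OF conjunct2[OF S[OF U(1)]], of "\<lambda>A. p \<in> A", OF U(2)])
      then show "p \<in> ?D (\<Union>(S ` \<K>))" using U(1) by blast
    next
      fix p assume p: "p \<in> ?D (\<Union>(S ` \<K>))"
      then obtain U where U: "U \<in> \<K>" "\<not> S U \<subseteq> p" by blast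
      then have "p \<in> ?D (S U)" using p by blast
      then have "p \<in> U" unfolding conjunct2[OF S[OF U(1)], symmetric] .
      then show "p \<in> \<Union>\<K>" using U(1) by (rule UnionI[rotated])
    qed
    moreover have "\<Union>(S ` \<K>) \<subseteq> carrier A" using S by blast
    ultimately show "\<exists>S\<subseteq>carrier A. \<Union>\<K> = ?D S" by blast
  qed
  then show ?thesis unfolding zariski_topology_def by (simp only: topology_inverse')
qed

lemma zariski_openin_prime:
  "cring A \<Longrightarrow> openin (zariski_topology A) U \<Longrightarrow> q \<in> U \<Longrightarrow> primeideal q A"
  by (auto simp: zariski_openin_iff)

context primeideal
begin

text \<open>If \<open>v\<close> witnesses the equality of \<open>x / y\<close> and
  \<open>a / b\<close>, then \<open>v b\<close> witnesses the equality of \<open>x / y\<close> and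
  \<open>c / d\<close>; it avoids the ideal because the ideal is prime.\<close>

lemma fraction_eqI:
  assumes "a \<in> carrier R" "b \<in> carrier R - I" "c \<in> carrier R" "d \<in> carrier R - I"
    and "a \<otimes> d = c \<otimes> b"
  shows "fraction R I a b = fraction R I c d"
proof -
  have sub: "fraction R I a b \<subseteq> fraction R I c d"
    if abcd: "a \<in> carrier R" "b \<in> carrier R - I" "c \<in> carrier R" "d \<in> carrier R - I" "a \<otimes> d = c \<otimes> b" for a b c d
  proof
    fix z assume "z \<in> fraction R I a b"
    then obtain x y v where z: "z = (x, y)" "x \<in> carrier R" "y \<in> carrier R - I" "v \<in> carrier R - I"
      "v \<otimes> (a \<otimes> y) = v \<otimes> (x \<otimes> b)" unfolding fraction_def by blast
    have u: "v \<otimes> b \<in> carrier R - I" using I_prime[of v b] z(4) abcd(2) by blast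
    have c: "a \<in> carrier R" "b \<in> carrier R" "c \<in> carrier R" "d \<in> carrier R" "x \<in> carrier R" "y \<in> carrier R" "v \<in> carrier R"
      using abcd z by auto
    have "(v \<otimes> b) \<otimes> (c \<otimes> y) = v \<otimes> y \<otimes> (c \<otimes> b)" using c by (simp add: m_ac)
    also have "\<dots> = v \<otimes> y \<otimes> (a \<otimes> d)" using abcd(5) by simp
    also have "\<dots> = d \<otimes> (v \<otimes> (a \<otimes> y))" using c by (simp add: m_ac)
    also have "\<dots> = d \<otimes> (v \<otimes> (x \<otimes> b))" using z(5) by simp
    also have "\<dots> = (v \<otimes> b) \<otimes> (x \<otimes> d)" using c by (simp add: m_ac)
    finally show "z \<in> fraction R I c d" unfolding fraction_def using z(1-3) u by blast
  qed
  show ?thesis using sub[OF assms] sub[OF assms(3,4,1,2) assms(5)[symmetric]] by blast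
qed

lemma fraction_self: "a \<in> carrier R \<Longrightarrow> b \<in> carrier R - I \<Longrightarrow> (a, b) \<in> fraction R I a b"
  unfolding fraction_def by (intro CollectI case_prodI conjI bexI[of _ b]) auto

lemma local_fractions_mult:
  assumes ab: "a \<in> carrier R" "b \<in> carrier R - I" and cd: "c \<in> carrier R" "d \<in> carrier R - I"
  shows "fraction R I a b \<otimes>\<^bsub>local_fractions R I\<^esub> fraction R I c d = fraction R I (a \<otimes> c) (b \<otimes> d)"
proof -
  have eq: "fraction R I (x \<otimes> x') (y \<otimes> y') = fraction R I (a \<otimes> c) (b \<otimes> d)"
    if xy: "(x, y) \<in> fraction R I a b" and xy': "(x', y') \<in> fraction R I c d" for x y x' y'
  proof -
    obtain u where u: "x \<in> carrier R" "y \<in> carrier R - I" "u \<in> carrier R - I" "u \<otimes> (a \<otimes> y) = u \<otimes> (x \<otimes> b)"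
      using xy unfolding fraction_def by blast
    obtain v where v: "x' \<in> carrier R" "y' \<in> carrier R - I" "v \<in> carrier R - I" "v \<otimes> (c \<otimes> y') = v \<otimes> (x' \<otimes> d)"
      using xy' unfolding fraction_def by blast
    have cl: "a \<in> carrier R" "b \<in> carrier R" "c \<in> carrier R" "d \<in> carrier R" "x \<in> carrier R" "y \<in> carrier R"
      "x' \<in> carrier R" "y' \<in> carrier R" "u \<in> carrier R" "v \<in> carrier R" using ab cd u v by auto
    have uv: "u \<otimes> v \<in> carrier R - I" using I_prime[of u v] u v by blast
    have yy: "y \<otimes> y' \<in> carrier R - I" using I_prime[of y y'] u v by blast
    have bd: "b \<otimes> d \<in> carrier R - I" using I_prime[of b d] ab cd by blast
    have "(u \<otimes> v) \<otimes> ((x \<otimes> x') \<otimes> (b \<otimes> d)) = (u \<otimes> (x \<otimes> b)) \<otimes> (v \<otimes> (x' \<otimes> d))" using cl by (simp add: m_ac)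
    also have "\<dots> = (u \<otimes> (a \<otimes> y)) \<otimes> (v \<otimes> (c \<otimes> y'))" using u v by simp
    also have "\<dots> = (u \<otimes> v) \<otimes> ((a \<otimes> c) \<otimes> (y \<otimes> y'))" using cl by (simp add: m_ac)
    finally have e: "(u \<otimes> v) \<otimes> ((x \<otimes> x') \<otimes> (b \<otimes> d)) = (u \<otimes> v) \<otimes> ((a \<otimes> c) \<otimes> (y \<otimes> y'))" .
    \<comment> \<open>The cross-multiplied equation holds only up to the factor \<open>u v\<close>.
      Expanding the fraction by this factor makes it exact, as \<open>fraction_eqI\<close>
      demands.\<close>
    have "fraction R I (x \<otimes> x') (y \<otimes> y') = fraction R I ((u \<otimes> v) \<otimes> (x \<otimes> x')) ((u \<otimes> v) \<otimes> (y \<otimes> y'))"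
      using cl uv yy I_prime[of "u \<otimes> v" "y \<otimes> y'"] by (intro fraction_eqI) (auto simp: m_ac)
    also have "\<dots> = fraction R I (a \<otimes> c) (b \<otimes> d)"
    proof (rule fraction_eqI)
      show "(u \<otimes> v) \<otimes> (x \<otimes> x') \<otimes> (b \<otimes> d) = (a \<otimes> c) \<otimes> ((u \<otimes> v) \<otimes> (y \<otimes> y'))"
        using e cl by (simp add: m_ac)
      show "(u \<otimes> v) \<otimes> (y \<otimes> y') \<in> carrier R - I" using I_prime[of "u \<otimes> v" "y \<otimes> y'"] uv yy by blast
    qed (use cl bd in auto)
    finally show ?thesis .
  qed
  have "fraction R I a b \<otimes>\<^bsub>local_fractions R I\<^esub> fraction R I c d =
      (\<Union>(x, y)\<in>fraction R I a b. \<Union>(x', y')\<in>fraction R I c d. fraction R I (x \<otimes> x') (y \<otimes> y'))"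
    by (simp add: local_fractions_def)
  also have "\<dots> = fraction R I (a \<otimes> c) (b \<otimes> d)"
  proof (intro equalityI subsetI)
    fix z assume "z \<in> (\<Union>(x, y)\<in>fraction R I a b. \<Union>(x', y')\<in>fraction R I c d. fraction R I (x \<otimes> x') (y \<otimes> y'))"
    then obtain x y x' y' where *: "(x, y) \<in> fraction R I a b" "(x', y') \<in> fraction R I c d"
      "z \<in> fraction R I (x \<otimes> x') (y \<otimes> y')"
      unfolding UN_iff Bex_def split_paired_Ex prod.case by blast
    show "z \<in> fraction R I (a \<otimes> c) (b \<otimes> d)" using *(3) unfolding eq[OF *(1,2)] .
  next
    fix z assume z: "z \<in> fraction R I (a \<otimes> c) (b \<otimes> d)"
    show "z \<in> (\<Union>(x, y)\<in>fraction R I a b. \<Union>(x', y')\<in>fraction R I c d. fraction R I (x \<otimes> x') (y \<otimes> y'))"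
      by (rule UN_I[OF fraction_self[OF ab]], unfold prod.case, rule UN_I[OF fraction_self[OF cd]], unfold prod.case)
        (rule z)
  qed
  finally show ?thesis .
qed

end

text \<open>The function is restricted to \<open>W\<close> because sections of \<open>Spec A\<close>
  are required to be extensional on their open set.\<close>

definition frac_section :: "'a ring \<Rightarrow> 'a set set \<Rightarrow> 'a \<Rightarrow> 'a \<Rightarrow> 'a set \<Rightarrow> ('a \<times> 'a) set" where
  "frac_section A W a b = (\<lambda>q\<in>W. fraction A q a b)"

lemma frac_section_closed:
  assumes "openin (zariski_topology A) W" "a \<in> carrier A" "b \<in> carrier A" "\<And>q. q \<in> W \<Longrightarrow> b \<notin> q"
  shows "frac_section A W a b \<in> carrier (sections (Spec A) W)"
  unfolding Spec_def ringed_space.simps partial_object.simps frac_section_def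
  using assms by (intro CollectI conjI ballI exI[of _ W] exI[of _ a] exI[of _ b]) auto

lemma frac_section_mult:
  assumes A: "cring A" and W: "openin (zariski_topology A) W"
    and ab: "a \<in> carrier A" "b \<in> carrier A" "\<And>q. q \<in> W \<Longrightarrow> b \<notin> q"
    and cd: "c \<in> carrier A" "d \<in> carrier A" "\<And>q. q \<in> W \<Longrightarrow> d \<notin> q"
    and xy: "x \<in> carrier A" "y \<in> carrier A" "\<And>q. q \<in> W \<Longrightarrow> y \<notin> q"
    and eq: "a \<otimes>\<^bsub>A\<^esub> c \<otimes>\<^bsub>A\<^esub> y = x \<otimes>\<^bsub>A\<^esub> (b \<otimes>\<^bsub>A\<^esub> d)"
  shows "frac_section A W a b \<otimes>\<^bsub>sections (Spec A) W\<^esub> frac_section A W c d = frac_section A W x y"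
proof -
  have "fraction A q a b \<otimes>\<^bsub>local_fractions A q\<^esub> fraction A q c d = fraction A q x y" if q: "q \<in> W" for q
  proof -
    interpret q: primeideal q A by (rule zariski_openin_prime[OF A W q])
    have bd: "b \<otimes>\<^bsub>A\<^esub> d \<in> carrier A - q" using q.I_prime[of b d] ab(2) ab(3)[OF q] cd(2) cd(3)[OF q] by blast
    have "fraction A q a b \<otimes>\<^bsub>local_fractions A q\<^esub> fraction A q c d = fraction A q (a \<otimes>\<^bsub>A\<^esub> c) (b \<otimes>\<^bsub>A\<^esub> d)"
      using ab(1,2) ab(3)[OF q] cd(1,2) cd(3)[OF q] by (intro q.local_fractions_mult) auto
    also have "\<dots> = fraction A q x y"
      using ab(1,2) cd(1,2) xy(1,2) xy(3)[OF q] bd eq by (intro q.fraction_eqI) auto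
    finally show ?thesis .
  qed
  then show ?thesis unfolding Spec_def frac_section_def by (auto intro!: restrict_ext)
qed

lemma one_section: "\<one>\<^bsub>sections (Spec A) W\<^esub> = frac_section A W \<one>\<^bsub>A\<^esub> \<one>\<^bsub>A\<^esub>"
  by (simp add: Spec_def frac_section_def local_fractions_def)

lemma frac_section_restr:
  "W \<subseteq> V \<Longrightarrow> restr (Spec A) V W (frac_section A V a b) = frac_section A W a b"
  by (simp add: Spec_def frac_section_def Int_absorb1)

lemma section_restr_frac:
  assumes "t \<in> carrier (sections (Spec A) V)" "q \<in> V"
  shows "\<exists>W a b. openin (zariski_topology A) W \<and> q \<in> W \<and> W \<subseteq> V \<and> a \<in> carrier A \<and> b \<in> carrier A \<and>
    (\<forall>q\<in>W. b \<notin> q) \<and> restr (Spec A) V W t = frac_section A W a b"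
proof -
  have "\<forall>p\<in>V. \<exists>W a b. openin (zariski_topology A) W \<and> p \<in> W \<and> W \<subseteq> V \<and> a \<in> carrier A \<and> b \<in> carrier A \<and>
             (\<forall>q\<in>W. b \<notin> q \<and> t q = fraction A q a b)"
    using assms(1) by (simp add: Spec_def)
  from bspec[OF this assms(2)] obtain W a b where *: "openin (zariski_topology A) W" "q \<in> W" "W \<subseteq> V" "a \<in> carrier A" "b \<in> carrier A"
    "\<forall>q\<in>W. b \<notin> q \<and> t q = fraction A q a b"
    by (elim exE conjE) (rule that)
  have "restr (Spec A) V W t = frac_section A W a b"
    unfolding Spec_def frac_section_def ringed_space.simps by (rule restrict_ext) (simp add: *(6))
  moreover have "\<forall>q\<in>W. b \<notin> q" by (simp add: *(6))
  ultimately show ?thesis using *(1-5) by (intro exI[of _ W] exI[of _ a] exI[of _ b] conjI)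
qed

text \<open>Near \<open>P\<close> a section of the structure sheaf of \<open>Spec A\<close> is a
  fraction of two elements of \<open>A\<close>. These are sections over the whole spectrum, hence
  over \<open>U\<close>, and the denominator becomes invertible near \<open>P\<close>. Thus every
  germ is a fraction of germs of sections over \<open>U\<close>.\<close>

lemma (in ringed_space) affine_germ_fraction:
  assumes U: "affine_open Z U" "P \<in> U" and g: "g \<in> carrier (stalk Z P)"
  shows "\<exists>a\<in>carrier (sections Z U). \<exists>b\<in>carrier (sections Z U). \<exists>c\<in>carrier (stalk Z P).
    germ Z P U b \<otimes>\<^bsub>stalk Z P\<^esub> c = \<one>\<^bsub>stalk Z P\<^esub> \<and> g \<otimes>\<^bsub>stalk Z P\<^esub> germ Z P U b = germ Z P U a"
proof -
  have Uo: "openin (pts Z) U" using U(1) by (simp add: affine_open_def)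
  obtain A :: "'b ring" where A: "cring A" and iso: "ringed_space_iso (open_subspace Z U) (Spec A)"
    using U(1) unfolding affine_open_def by blast
  interpret A: cring A by (rule A)
  let ?zar = "zariski_topology A"
  have ptsS: "pts (Spec A) = ?zar" by (simp add: Spec_def)
  have ptsU: "pts (open_subspace Z U) = subtopology (pts Z) U"
    and secU: "sections (open_subspace Z U) = sections Z" and resU: "restr (open_subspace Z U) = restr Z"
    by (simp_all add: open_subspace_def)
  have topU: "points (open_subspace Z U) = U"
    unfolding ptsU topspace_subtopology using openin_subset[OF Uo] by blast
  have tsU: "topspace (subtopology (pts Z) U) = U" using topU unfolding ptsU .
  obtain h \<theta> where h: "homeomorphic_map (subtopology (pts Z) U) ?zar h"
    and \<theta>: "\<And>W. openin ?zar W \<Longrightarrow> \<theta> W \<in> ring_iso (sections (Spec A) W) (sections Z {y \<in> U. h y \<in> W})"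
    and \<theta>_restr: "\<And>V W s. openin ?zar V \<Longrightarrow> openin ?zar W \<Longrightarrow> W \<subseteq> V \<Longrightarrow> s \<in> carrier (sections (Spec A) V) \<Longrightarrow>
      \<theta> W (restr (Spec A) V W s) = restr Z {y \<in> U. h y \<in> V} {y \<in> U. h y \<in> W} (\<theta> V s)"
  proof -
    obtain h \<theta> where "homeomorphic_map (subtopology (pts Z) U) ?zar h \<and>
        (\<forall>W. openin ?zar W \<longrightarrow> \<theta> W \<in> ring_iso (sections (Spec A) W) (sections Z {y \<in> U. h y \<in> W})) \<and>
        (\<forall>V W. openin ?zar V \<longrightarrow> openin ?zar W \<longrightarrow> W \<subseteq> V \<longrightarrow> (\<forall>s\<in>carrier (sections (Spec A) V).
          \<theta> W (restr (Spec A) V W s) = restr Z {y \<in> U. h y \<in> V} {y \<in> U. h y \<in> W} (\<theta> V s)))"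
      using iso unfolding ringed_space_iso_def preimage_def topU ptsS ptsU tsU secU resU by (elim exE)
    then show ?thesis by (intro that[of h \<theta>]) simp_all
  qed
  let ?pre = "\<lambda>W. {y \<in> U. h y \<in> W}"
  have pre_open: "openin (pts Z) (?pre W)" if "openin ?zar W" for W
  proof -
    have "openin (subtopology (pts Z) U) {y \<in> U. h y \<in> W}"
      using homeomorphic_imp_continuous_map[OF h] that unfolding continuous_map_def tsU by blast
    then show ?thesis using openin_open_subtopology[OF Uo] by blast
  qed
  have hom: "\<theta> W \<in> ring_hom (sections (Spec A) W) (sections Z (?pre W))" if "openin ?zar W" for W
    using \<theta>[OF that] by (simp add: ring_iso_def)
  obtain V t where V: "openin (pts Z) V" "P \<in> V" "t \<in> carrier (sections Z V)" "g = germ Z P V t"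
    using g unfolding stalk_def by auto
  define V' where "V' = V \<inter> U"
  have V': "openin (pts Z) V'" "V' \<subseteq> V" "V' \<subseteq> U" "P \<in> V'"
    unfolding V'_def using V Uo U(2) by auto
  \<comment> \<open>The isomorphism acts on sections over open sets of \<open>Spec A\<close>, so the
    neighbourhood of \<open>P\<close> is carried there by \<open>h\<close>; injectivity of
    \<open>h\<close> on \<open>U\<close> recovers \<open>V'\<close> as the preimage.\<close>
  define W0 where "W0 = h ` V'"
  have W0: "openin ?zar W0"
    unfolding W0_def using homeomorphic_imp_open_map[OF h] V' unfolding open_map_def
    by (simp add: openin_open_subtopology[OF Uo])
  have injh: "inj_on h U" using homeomorphic_imp_injective_map[OF h] unfolding tsU .
  have preW0: "?pre W0 = V'"
  proof (intro equalityI subsetI)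
    show "y \<in> V'" if "y \<in> ?pre W0" for y
      using that inj_on_image_mem_iff[OF injh _ V'(3), of y] unfolding W0_def by simp
    show "y \<in> ?pre W0" if "y \<in> V'" for y
      using that V'(3) unfolding W0_def by auto
  qed
  define t' where "t' = restr Z V V' t"
  have t': "t' \<in> carrier (sections Z V')" unfolding t'_def by (rule restr_closed[OF V(1) V'(1,2) V(3)])
  have gt': "g = germ Z P V' t'" unfolding t'_def V(4) by (rule germ_restr[OF V(1,3) V'(1,2,4), symmetric])
  have "\<theta> W0 ` carrier (sections (Spec A) W0) = carrier (sections Z V')"
    using \<theta>[OF W0] unfolding preW0 ring_iso_def bij_betw_def by blast
  then obtain \<tau> where \<tau>: "\<tau> \<in> carrier (sections (Spec A) W0)" "t' = \<theta> W0 \<tau>" using t' by blast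
  obtain W a b where W: "openin ?zar W" "h P \<in> W" "W \<subseteq> W0" and ab: "a \<in> carrier A" "b \<in> carrier A"
    and bW: "\<forall>q\<in>W. b \<notin> q" and \<tau>W: "restr (Spec A) W0 W \<tau> = frac_section A W a b"
    using section_restr_frac[OF \<tau>(1), of "h P"] V'(4) unfolding W0_def by blast
  let ?T = "topspace ?zar"
  have T: "openin ?zar ?T" by (rule openin_topspace)
  have WT: "W \<subseteq> ?T" by (rule openin_subset[OF W(1)])
  have one: "\<one>\<^bsub>A\<^esub> \<notin> q" if "q \<in> V''" "openin ?zar V''" for q V''
  proof
    interpret q: primeideal q A by (rule zariski_openin_prime[OF A that(2,1)])
    assume "\<one>\<^bsub>A\<^esub> \<in> q"
    then show False using q.one_imp_carrier q.I_notcarr by blast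
  qed
  have preT: "?pre ?T = U"
    using homeomorphic_imp_continuous_map[OF h] unfolding continuous_map_def tsU by blast
  \<comment> \<open>Writing the elements as fractions with denominator \<open>1\<close> makes them
    global sections, to be compared with the local fraction after restriction to
    \<open>W\<close>.\<close>
  let ?fa = "frac_section A ?T a \<one>\<^bsub>A\<^esub>" and ?fb = "frac_section A ?T b \<one>\<^bsub>A\<^esub>"
  have fT: "?fa \<in> carrier (sections (Spec A) ?T)" "?fb \<in> carrier (sections (Spec A) ?T)"
    using ab one[OF _ T] by (auto intro!: frac_section_closed[OF T])
  let ?V1 = "?pre W"
  have V1: "openin (pts Z) ?V1" "?V1 \<subseteq> V'" "?V1 \<subseteq> U" "P \<in> ?V1"
    using pre_open[OF W(1)] W(2,3) U(2) preW0 by auto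
  have f1: "frac_section A W a b \<in> carrier (sections (Spec A) W)"
    "frac_section A W a \<one>\<^bsub>A\<^esub> \<in> carrier (sections (Spec A) W)"
    "frac_section A W b \<one>\<^bsub>A\<^esub> \<in> carrier (sections (Spec A) W)"
    "frac_section A W \<one>\<^bsub>A\<^esub> b \<in> carrier (sections (Spec A) W)"
    using ab bW one[OF _ W(1)] by (auto intro!: frac_section_closed[OF W(1)])
  have m1: "frac_section A W a b \<otimes>\<^bsub>sections (Spec A) W\<^esub> frac_section A W b \<one>\<^bsub>A\<^esub> = frac_section A W a \<one>\<^bsub>A\<^esub>"
    using ab bW one[OF _ W(1)] by (intro frac_section_mult[OF A W(1)]) auto
  have m2: "frac_section A W b \<one>\<^bsub>A\<^esub> \<otimes>\<^bsub>sections (Spec A) W\<^esub> frac_section A W \<one>\<^bsub>A\<^esub> b = frac_section A W \<one>\<^bsub>A\<^esub> \<one>\<^bsub>A\<^esub>"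
    using ab bW one[OF _ W(1)] by (intro frac_section_mult[OF A W(1)]) auto
  define \<alpha> where "\<alpha> = \<theta> ?T ?fa"
  define \<beta> where "\<beta> = \<theta> ?T ?fb"
  have \<alpha>\<beta>: "\<alpha> \<in> carrier (sections Z U)" "\<beta> \<in> carrier (sections Z U)"
    using ring_hom_closed[OF hom[OF T] fT(1)] ring_hom_closed[OF hom[OF T] fT(2)] unfolding \<alpha>_def \<beta>_def preT .
  have r\<alpha>: "\<theta> W (frac_section A W a \<one>\<^bsub>A\<^esub>) = restr Z U ?V1 \<alpha>"
    using \<theta>_restr[OF T W(1) WT fT(1)] unfolding frac_section_restr[OF WT] \<alpha>_def preT .
  have r\<beta>: "\<theta> W (frac_section A W b \<one>\<^bsub>A\<^esub>) = restr Z U ?V1 \<beta>"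
    using \<theta>_restr[OF T W(1) WT fT(2)] unfolding frac_section_restr[OF WT] \<beta>_def preT .
  have rt: "\<theta> W (frac_section A W a b) = restr Z V' ?V1 t'"
    using \<theta>_restr[OF W0 W(1,3) \<tau>(1)] unfolding \<tau>W \<tau>(2) preW0 .
  note gh = germ_hom[OF V1(1,4)]
  note hW = hom[OF W(1)]
  have g\<alpha>: "germ Z P ?V1 (\<theta> W (frac_section A W a \<one>\<^bsub>A\<^esub>)) = germ Z P U \<alpha>"
    unfolding r\<alpha> by (rule germ_restr[OF Uo \<alpha>\<beta>(1) V1(1,3,4)])
  have g\<beta>: "germ Z P ?V1 (\<theta> W (frac_section A W b \<one>\<^bsub>A\<^esub>)) = germ Z P U \<beta>"
    unfolding r\<beta> by (rule germ_restr[OF Uo \<alpha>\<beta>(2) V1(1,3,4)])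
  have gt: "germ Z P ?V1 (\<theta> W (frac_section A W a b)) = g"
    unfolding rt gt' by (rule germ_restr[OF V'(1) t' V1(1,2,4)])
  \<comment> \<open>The inverse of the germ of the denominator: the germ of \<open>1 / b\<close>,
    which exists on \<open>W\<close> because \<open>b\<close> avoids every prime in
    \<open>W\<close>.\<close>
  let ?c = "germ Z P ?V1 (\<theta> W (frac_section A W \<one>\<^bsub>A\<^esub> b))"
  have hc: "\<theta> W (frac_section A W a b) \<in> carrier (sections Z ?V1)"
    "\<theta> W (frac_section A W b \<one>\<^bsub>A\<^esub>) \<in> carrier (sections Z ?V1)"
    "\<theta> W (frac_section A W \<one>\<^bsub>A\<^esub> b) \<in> carrier (sections Z ?V1)"
    using f1 by (auto intro: ring_hom_closed[OF hW])
  have "g \<otimes>\<^bsub>stalk Z P\<^esub> germ Z P U \<beta> = germ Z P U \<alpha>"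
    unfolding gt[symmetric] g\<alpha>[symmetric] g\<beta>[symmetric] ring_hom_mult[OF gh hc(1,2), symmetric]
      ring_hom_mult[OF hW f1(1,3), symmetric] m1 ..
  moreover have "germ Z P U \<beta> \<otimes>\<^bsub>stalk Z P\<^esub> ?c = \<one>\<^bsub>stalk Z P\<^esub>"
    unfolding g\<beta>[symmetric] ring_hom_mult[OF gh hc(2,3), symmetric]
      ring_hom_mult[OF hW f1(3,4), symmetric] m2 one_section[symmetric] ring_hom_one[OF hW] ring_hom_one[OF gh] ..
  moreover have "?c \<in> carrier (stalk Z P)" by (rule ring_hom_closed[OF gh hc(3)])
  ultimately show ?thesis using \<alpha>\<beta> by blast
qed

lemma stalk_map_hom:
  assumes "scheme_over K Z \<kappa>" "P \<in> points Z"
  shows "stalk_map Z \<kappa> P \<in> ring_hom K (stalk Z P)"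
proof -
  interpret ringed_space Z using assms(1) by (simp add: scheme_over_def scheme_def)
  have "\<kappa> \<in> ring_hom K (sections Z (points Z))" using assms(1) by (simp add: scheme_over_def)
  from ring_hom_trans[OF this germ_hom[OF openin_topspace assms(2)]]
  show ?thesis unfolding stalk_map_def[abs_def] comp_def .
qed

text \<open>\<open>G\<close> consists of the germs of algebra generators of an affine neighbourhood
  \<open>U\<close>. The ring operations produce from \<open>K\<close> and \<open>G\<close> all germs
  of sections over \<open>U\<close>, and inverting units of the stalk then produces all fractions,
  hence every germ.\<close>

lemma stalk_finitely_generated:
  assumes R: "cring K" and Z: "scheme_over K Z \<kappa>" and ft: "finite_type K Z \<kappa>" and P: "P \<in> points Z"
  shows "\<exists>G. finite G \<and> G \<subseteq> carrier (stalk Z P) \<and>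
    (\<forall>S\<subseteq>carrier (stalk Z P). stalk_map Z \<kappa> P ` carrier K \<subseteq> S \<longrightarrow> G \<subseteq> S \<longrightarrow>
      (\<forall>u\<in>S. \<forall>v\<in>S. u \<oplus>\<^bsub>stalk Z P\<^esub> v \<in> S) \<longrightarrow> (\<forall>u\<in>S. \<forall>v\<in>S. u \<otimes>\<^bsub>stalk Z P\<^esub> v \<in> S) \<longrightarrow>
      (\<forall>u\<in>S. \<ominus>\<^bsub>stalk Z P\<^esub> u \<in> S) \<longrightarrow> (\<forall>u\<in>S. u \<in> Units (stalk Z P) \<longrightarrow> inv\<^bsub>stalk Z P\<^esub> u \<in> S) \<longrightarrow>
      carrier (stalk Z P) \<subseteq> S)"
proof -
  interpret ringed_space Z using Z by (simp add: scheme_over_def scheme_def)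
  let ?O = "stalk Z P"
  have "local_ring ?O" using Z P by (simp add: scheme_over_def scheme_def)
  then interpret O: cring ?O by (simp add: local_ring_def)
  have \<kappa>: "\<kappa> \<in> ring_hom K (sections Z (points Z))" using Z by (simp add: scheme_over_def)
  obtain U where U: "affine_open Z U" "P \<in> U"
    and fg: "finitely_generated_algebra K (sections Z U) (structure_map Z \<kappa> U)"
  proof -
    obtain \<U> where \<U>: "\<Union>\<U> = points Z" "\<forall>U\<in>\<U>. affine_open Z U \<and>
        finitely_generated_algebra K (sections Z U) (structure_map Z \<kappa> U)"
      using ft unfolding finite_type_def by (elim exE conjE)
    obtain U where "U \<in> \<U>" "P \<in> U" using P unfolding \<U>(1)[symmetric] by (rule UnionE)
    then show ?thesis using bspec[OF \<U>(2), of U] by (intro that[of U]) simp_all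
  qed
  have Uo: "openin (pts Z) U" using U(1) by (simp add: affine_open_def)
  interpret \<Gamma>: cring "sections Z U" by (rule sections_cring[OF Uo])
  obtain F where F: "finite F" "F \<subseteq> carrier (sections Z U)"
    "generate_ring (sections Z U) (structure_map Z \<kappa> U ` carrier K \<union> F) = carrier (sections Z U)"
    using fg unfolding finitely_generated_algebra_def by blast
  note gh = germ_hom[OF Uo U(2)]
  have germ_c: "germ Z P U (structure_map Z \<kappa> U c) = stalk_map Z \<kappa> P c" if "c \<in> carrier K" for c
    unfolding structure_map_def stalk_map_def
    by (rule germ_restr[OF openin_topspace ring_hom_closed[OF \<kappa> that] Uo openin_subset[OF Uo] U(2)])
  show ?thesis
  proof (intro exI[of _ "germ Z P U ` F"] conjI allI impI)
    show "finite (germ Z P U ` F)" using F(1) by simp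
    show "germ Z P U ` F \<subseteq> carrier ?O" using F(2) by (auto intro: ring_hom_closed[OF gh])
    fix S assume S: "S \<subseteq> carrier ?O" and K: "stalk_map Z \<kappa> P ` carrier K \<subseteq> S" and G: "germ Z P U ` F \<subseteq> S"
      and add: "\<forall>u\<in>S. \<forall>v\<in>S. u \<oplus>\<^bsub>?O\<^esub> v \<in> S" and mult: "\<forall>u\<in>S. \<forall>v\<in>S. u \<otimes>\<^bsub>?O\<^esub> v \<in> S"
      and neg: "\<forall>u\<in>S. \<ominus>\<^bsub>?O\<^esub> u \<in> S" and inv: "\<forall>u\<in>S. u \<in> Units ?O \<longrightarrow> inv\<^bsub>?O\<^esub> u \<in> S"
    have germ_neg: "germ Z P U (\<ominus>\<^bsub>sections Z U\<^esub> s) = \<ominus>\<^bsub>?O\<^esub> germ Z P U s" if "s \<in> carrier (sections Z U)" for s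
    proof -
      interpret g: ring_hom_ring "sections Z U" ?O "germ Z P U"
        by (rule ring_hom_ringI2[OF \<Gamma>.ring_axioms O.ring_axioms gh])
      show ?thesis using that by simp
    qed
    have gen: "germ Z P U s \<in> S"
      if "s \<in> generate_ring (sections Z U) (structure_map Z \<kappa> U ` carrier K \<union> F)" and one: "\<one>\<^bsub>?O\<^esub> \<in> S" for s
      using that(1)
    proof (induction s rule: generate_ring.induct)
      case one
      show ?case using \<open>\<one>\<^bsub>?O\<^esub> \<in> S\<close> ring_hom_one[OF gh] by simp
    next
      case (incl s)
      then consider c where "c \<in> carrier K" "s = structure_map Z \<kappa> U c" | "s \<in> F" by (elim UnE imageE)
      then show ?case
      proof cases
        case 1
        then show ?thesis using subsetD[OF K imageI[OF 1(1)]] germ_c[OF 1(1)] by simp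
      next
        case 2
        then show ?thesis by (intro subsetD[OF G] imageI)
      qed
    next
      case (a_inv s)
      then show ?case using neg germ_neg F(3) by simp
    next
      case (eng_add s t)
      then show ?case using add ring_hom_add[OF gh] F(3) by simp
    next
      case (eng_mult s t)
      then show ?case using mult ring_hom_mult[OF gh] F(3) by simp
    qed
    have one: "\<one>\<^bsub>?O\<^esub> \<in> S"
      using subsetD[OF K imageI[OF ring.ring_simprules(6)[OF cring.axioms(1)[OF R]]]]
      unfolding ring_hom_one[OF stalk_map_hom[OF Z P]] .
    show "carrier ?O \<subseteq> S"
    proof
      fix g assume g: "g \<in> carrier ?O"
      obtain a b c where abc: "a \<in> carrier (sections Z U)" "b \<in> carrier (sections Z U)" "c \<in> carrier ?O"
        "germ Z P U b \<otimes>\<^bsub>?O\<^esub> c = \<one>\<^bsub>?O\<^esub>" "g \<otimes>\<^bsub>?O\<^esub> germ Z P U b = germ Z P U a"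
        using affine_germ_fraction[OF U g] by (elim bexE conjE) (rule that)
      have b: "germ Z P U b \<in> carrier ?O" by (rule ring_hom_closed[OF gh abc(2)])
      have unit: "germ Z P U b \<in> Units ?O" using abc(3,4) b O.m_comm[OF b abc(3)]
        unfolding Units_def by (intro CollectI conjI bexI[of _ c]) simp_all
      have inS: "germ Z P U a \<in> S" "inv\<^bsub>?O\<^esub> (germ Z P U b) \<in> S"
        using gen[OF _ one] F(3) abc(1,2) mp[OF bspec[OF inv] unit] by simp_all
      have "g = germ Z P U a \<otimes>\<^bsub>?O\<^esub> inv\<^bsub>?O\<^esub> (germ Z P U b)"
        unfolding abc(5)[symmetric] using g b unit by (simp add: O.m_assoc)
      then show "g \<in> S" using mult inS by simp
    qed
  qed
qed

section \<open>The relative cotangent space\<close>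

text \<open>The maximal ideal is turned into a module by replacing the carrier of the ambient one.
  Sums and negatives are defined through the carrier, so their agreement requires proof; over
  infinite index sets both sums take the same default value.\<close>

lemma finsum_carrier_update:
  assumes M: "abelian_monoid M" "abelian_monoid (M\<lparr>carrier := H\<rparr>)" and H: "H \<subseteq> carrier M"
    and f: "f \<in> A \<rightarrow> H"
  shows "finsum (M\<lparr>carrier := H\<rparr>) f A = finsum M f A"
  using f
proof (induction A rule: infinite_finite_induct)
  case (infinite A)
  then show ?case by (simp add: finsum_def finprod_def)
next
  case empty
  show ?case
    by (simp add: abelian_monoid.finsum_empty[OF M(1)] abelian_monoid.finsum_empty[OF M(2)])
next
  case (insert j A)
  have "finsum (M\<lparr>carrier := H\<rparr>) f (insert j A) = f j \<oplus>\<^bsub>M\<^esub> finsum (M\<lparr>carrier := H\<rparr>) f A"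
    using abelian_monoid.finsum_insert[OF M(2) insert(1,2), of f] insert.prems by simp
  also have "\<dots> = finsum M f (insert j A)"
    by (subst abelian_monoid.finsum_insert[OF M(1) insert(1,2)])
      (use insert H in \<open>auto simp: Pi_iff\<close>)
  finally show ?case .
qed

lemma a_minus_carrier_update:
  assumes M: "abelian_group M" "abelian_group (M\<lparr>carrier := H\<rparr>)" and H: "H \<subseteq> carrier M"
    and xy: "x \<in> H" "y \<in> H"
  shows "x \<ominus>\<^bsub>M\<lparr>carrier := H\<rparr>\<^esub> y = x \<ominus>\<^bsub>M\<^esub> y"
proof -
  let ?y = "\<ominus>\<^bsub>M\<lparr>carrier := H\<rparr>\<^esub> y"
  have y: "?y \<in> H" using abelian_group.a_inv_closed[OF M(2)] xy by simp
  have "?y \<oplus>\<^bsub>M\<^esub> y = \<zero>\<^bsub>M\<^esub>" using abelian_group.l_neg[OF M(2)] xy by simp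
  then have "\<ominus>\<^bsub>M\<^esub> y = ?y" using abelian_group.minus_equality[OF M(1)] y xy H by blast
  then show ?thesis by (simp add: a_minus_def)
qed

text \<open>The families agree only below \<open>l\<close>, so one cannot be rewritten into the
  other; the comparison passes through the sums over \<open>{..<l}\<close>.\<close>

lemma (in module_with_submodule) module_basis_quotient_cong:
  fixes l :: nat
  assumes y: "\<And>i. i < l \<Longrightarrow> y i \<in> carrier M" and yz: "\<And>i. i < l \<Longrightarrow> y i = z i"
  shows "module_basis R Q l (\<lambda>i. N +>\<^bsub>M\<^esub> y i) \<longleftrightarrow> module_basis R Q l (\<lambda>i. N +>\<^bsub>M\<^esub> z i)"
proof -
  have z: "z i \<in> carrier M" if "i < l" for i using y[OF that] yz[OF that] by simp
  have sum: "(\<Oplus>\<^bsub>M\<^esub>i\<in>{..<l}. c i \<odot>\<^bsub>M\<^esub> y i) = (\<Oplus>\<^bsub>M\<^esub>i\<in>{..<l}. c i \<odot>\<^bsub>M\<^esub> z i)"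
    if "\<forall>i<l. c i \<in> carrier R" for c
    by (rule M.finsum_cong') (use that z yz in auto)
  show ?thesis
    by (simp only: module_basis_quotient_iff[of l y, OF y] module_basis_quotient_iff[of l z, OF z],
        intro all_cong1 imp_cong ball_cong ex_cong1 conj_cong refl)
      (simp_all only: sum)
qed

section \<open>The quotient \<open>n / D\<close> and the transfer of the basis hypothesis\<close>

context insep_residue
begin

abbreviation nM where "nM \<equiv> BM\<lparr>carrier := n\<rparr>"

lemma nM_module: "module L nM"
  by (rule submodule.submodule_is_module[OF n_submodule BM_module])

lemma nM_minus: "t \<in> n \<Longrightarrow> u \<in> n \<Longrightarrow> t \<ominus>\<^bsub>nM\<^esub> u = t \<ominus>\<^bsub>B\<^esub> u"
proof -
  interpret BM: module L BM by (rule BM_module)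
  interpret nM: module L nM by (rule nM_module)
  assume "t \<in> n" "u \<in> n"
  then show ?thesis
    using a_minus_carrier_update[OF BM.abelian_group_axioms nM.abelian_group_axioms BM.submoduleE(1)[OF n_submodule]]
    by (simp only: restrict_scalars_a_inv)
qed

lemma nM_finsum: "f \<in> A \<rightarrow> n \<Longrightarrow> finsum nM f A = finsum B f A"
proof -
  interpret BM: module L BM by (rule BM_module)
  interpret nM: module L nM by (rule nM_module)
  assume "f \<in> A \<rightarrow> n"
  then show ?thesis
    using finsum_carrier_update[OF BM.abelian_monoid_axioms nM.abelian_monoid_axioms BM.submoduleE(1)[OF n_submodule]]
    by (simp only: restrict_scalars_a_inv)
qed

lemma nM_add: "ring.add nM = ring.add B" and nM_carrier: "carrier nM = n"
  by (simp_all add: restrict_scalars_simps)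

lemma D_submodule_nM: "submodule D L nM"
proof -
  interpret BM: module L BM by (rule BM_module)
  interpret nM: module L nM by (rule nM_module)
  note D = BM.submoduleE[OF D_submodule]
  show ?thesis
  proof (rule nM.submoduleI)
    show "D \<subseteq> carrier nM" using D_subset_n by simp
    show "\<zero>\<^bsub>nM\<^esub> \<in> D" using submodule_zero_closed[OF D_submodule] by simp
    show "\<ominus>\<^bsub>nM\<^esub> t \<in> D" if t: "t \<in> D" for t
    proof -
      have n: "\<zero>\<^bsub>BM\<^esub> \<in> n" "t \<in> n" using submodule_zero_closed[OF n_submodule] D_subset_n t by auto
      have c: "\<ominus>\<^bsub>nM\<^esub> t \<in> carrier BM" "\<ominus>\<^bsub>BM\<^esub> t \<in> carrier BM"
        using nM.a_inv_closed[of t] n BM.submoduleE(1)[OF n_submodule] by auto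
      \<comment> \<open>The comparison lemma concerns differences, so the negative is treated as a
        difference from zero.\<close>
      have "\<zero>\<^bsub>BM\<^esub> \<ominus>\<^bsub>nM\<^esub> t = \<zero>\<^bsub>BM\<^esub> \<ominus>\<^bsub>BM\<^esub> t"
        by (rule a_minus_carrier_update[OF BM.abelian_group_axioms nM.abelian_group_axioms _ n])
          (use BM.submoduleE(1)[OF n_submodule] in blast)
      then show ?thesis using D(3)[OF t] c by (simp add: a_minus_def)
    qed
    show "t \<oplus>\<^bsub>nM\<^esub> u \<in> D" if "t \<in> D" "u \<in> D" for t u using D(5)[OF that] by simp
    show "c \<odot>\<^bsub>nM\<^esub> t \<in> D" if "c \<in> carrier L" "t \<in> D" for c t using D(4)[OF that] by simp
  qed
qed

sublocale cot: module_with_submodule L nM D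
  by (intro module_with_submodule.intro nM_module D_submodule_nM)

lemma cotangent_basis_iff:
  fixes l :: nat
  assumes y: "\<And>i. i < l \<Longrightarrow> y i \<in> n"
  shows "module_basis L cot.Q l (\<lambda>i. D +>\<^bsub>nM\<^esub> y i) \<longleftrightarrow>
    (\<forall>c. (\<forall>i<l. c i \<in> carrier L) \<longrightarrow> (\<Oplus>\<^bsub>B\<^esub>i\<in>{..<l}. s (c i) \<otimes>\<^bsub>B\<^esub> y i) \<in> D \<longrightarrow> (\<forall>i<l. c i = \<zero>\<^bsub>L\<^esub>)) \<and>
    (\<forall>t\<in>n. \<exists>c. (\<forall>i<l. c i \<in> carrier L) \<and> t \<ominus>\<^bsub>B\<^esub> (\<Oplus>\<^bsub>B\<^esub>i\<in>{..<l}. s (c i) \<otimes>\<^bsub>B\<^esub> y i) \<in> D)"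
proof -
  have cy: "s (c i) \<otimes>\<^bsub>B\<^esub> y i \<in> n" if "\<forall>i<l. c i \<in> carrier L" "i < l" for c i
    using n.I_l_closed[OF y[OF that(2)] s.hom_closed] that by blast
  have sum: "(\<Oplus>\<^bsub>nM\<^esub>i\<in>{..<l}. c i \<odot>\<^bsub>BM\<^esub> y i) = (\<Oplus>\<^bsub>B\<^esub>i\<in>{..<l}. s (c i) \<otimes>\<^bsub>B\<^esub> y i)"
    if "\<forall>i<l. c i \<in> carrier L" for c
    using nM_finsum[of "\<lambda>i. s (c i) \<otimes>\<^bsub>B\<^esub> y i" "{..<l}"] cy[OF that] by (simp add: restrict_scalars_simps)
  have sum_n: "(\<Oplus>\<^bsub>B\<^esub>i\<in>{..<l}. s (c i) \<otimes>\<^bsub>B\<^esub> y i) \<in> n" if "\<forall>i<l. c i \<in> carrier L" for c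
    by (rule n.finsum_mem) (use cy[OF that] in auto)
  have y': "y i \<in> carrier nM" if "i < l" for i using y[OF that] by simp
  show ?thesis
    by (simp only: cot.module_basis_quotient_iff[of l y, OF y'] partial_object.simps,
        intro all_cong1 imp_cong ball_cong ex_cong1 conj_cong refl)
      (simp_all add: sum nM_minus sum_n)
qed

text \<open>Since \<open>D\<close> lies in \<open>n\<close>, a coset occurring in
  \<open>n / D\<close> has all its representatives in \<open>n\<close>. This extracts from the basis
  hypothesis that each \<open>x i - a i\<close> lies in the maximal ideal.\<close>

lemma coset_closedD:
  assumes "y \<in> carrier B" "D +>\<^bsub>nM\<^esub> y \<in> carrier cot.Q"
  shows "y \<in> n"
proof -
  obtain t where t: "D +>\<^bsub>nM\<^esub> y = D +>\<^bsub>nM\<^esub> t" "t \<in> carrier nM"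
    using assms(2) unfolding cot.Q_carrier by (elim imageE) (rule that)
  have "\<zero>\<^bsub>B\<^esub> \<in> D" using submodule_zero_closed[OF D_submodule] by (simp only: restrict_scalars_simps)
  then have "y \<in> {d \<oplus>\<^bsub>nM\<^esub> y | d. d \<in> D}"
    using B.l_zero[OF assms(1)] by (intro CollectI exI[of _ "\<zero>\<^bsub>B\<^esub>"] conjI) (simp_all only: nM_add)
  then have "y \<in> {d \<oplus>\<^bsub>nM\<^esub> t | d. d \<in> D}" unfolding cot.coset_eq[symmetric] t(1) .
  then obtain d where "y = d \<oplus>\<^bsub>B\<^esub> t" "d \<in> D" unfolding nM_add by (elim CollectE exE conjE)
  then show ?thesis using n.a_closed[OF subsetD[OF D_subset_n], of d t] t(2) by (simp only: partial_object.simps nM_carrier)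
qed

text \<open>Subtracting \<open>\<delta> x\<close> leaves the image of the scalar
  \<open>r x - \<sigma> a\<close>, which lies in \<open>n\<close> and must therefore be zero;
  injectivity of \<open>\<sigma>\<close> does the rest.\<close>

lemma residue_eqI:
  assumes x: "x \<in> carrier Ob" and a: "a \<in> carrier k" and n: "\<iota> x \<ominus>\<^bsub>B\<^esub> s (\<sigma> a) \<in> n"
  shows "a = res x"
proof -
  have \<sigma>a: "\<sigma> a \<in> carrier L" by (rule ring_hom_closed[OF \<sigma> a])
  have rx: "r x \<in> carrier L" using x by simp
  have *: "(i \<ominus>\<^bsub>B\<^esub> u) \<ominus>\<^bsub>B\<^esub> (i \<ominus>\<^bsub>B\<^esub> v) = v \<ominus>\<^bsub>B\<^esub> u"
    if "i \<in> carrier B" "u \<in> carrier B" "v \<in> carrier B" for i u v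
    using that by algebra
  have "(\<iota> x \<ominus>\<^bsub>B\<^esub> s (\<sigma> a)) \<ominus>\<^bsub>B\<^esub> \<delta> x \<in> n"
    unfolding a_minus_def[of B "\<iota> x \<ominus>\<^bsub>B\<^esub> s (\<sigma> a)"] using n \<delta>_mem[OF x] by (intro n.a_closed n.a_inv_closed)
  also have "(\<iota> x \<ominus>\<^bsub>B\<^esub> s (\<sigma> a)) \<ominus>\<^bsub>B\<^esub> \<delta> x = s (r x) \<ominus>\<^bsub>B\<^esub> s (\<sigma> a)"
    unfolding \<delta>_def using x \<sigma>a rx by (intro *) simp_all
  also have "\<dots> = s (r x \<ominus>\<^bsub>L\<^esub> \<sigma> a)" using \<sigma>a rx by (simp add: a_minus_def)
  finally have "r x \<ominus>\<^bsub>L\<^esub> \<sigma> a = \<zero>\<^bsub>L\<^esub>" using s_mem_n_iff[of "r x \<ominus>\<^bsub>L\<^esub> \<sigma> a"] \<sigma>a rx by simp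
  then have "\<sigma> a = \<sigma> (res x)" using \<sigma>a rx unfolding r_def by simp
  then show ?thesis using inj_onD[OF \<sigma>_inj _ a ring_hom_closed[OF res_hom x]] by simp
qed

text \<open>Membership of the classes in the quotient, a part of \<open>module_basis\<close>,
  already forces \<open>a i = res (x i)\<close>. The given representatives then coincide with the
  elements \<open>\<delta> (x i)\<close>, and the basis property splits into the independence and
  spanning assumptions used before.\<close>

lemma residue_field_generated_and_basis_of_cotangent_basis:
  fixes l :: nat
  assumes x: "\<And>i. i < l \<Longrightarrow> x i \<in> carrier Ob" and a: "\<And>i. i < l \<Longrightarrow> a i \<in> carrier k"
    and basis: "module_basis L cot.Q l (\<lambda>i. D +>\<^bsub>nM\<^esub> (\<iota> (x i) \<ominus>\<^bsub>B\<^esub> s (\<sigma> (a i))))"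
    and G: "finite G" "G \<subseteq> carrier Ob"
    and fg: "\<And>S. S \<subseteq> carrier Ob \<Longrightarrow> \<phi> ` K \<subseteq> S \<Longrightarrow> G \<subseteq> S \<Longrightarrow>
      (\<And>u v. u \<in> S \<Longrightarrow> v \<in> S \<Longrightarrow> u \<oplus>\<^bsub>Ob\<^esub> v \<in> S) \<Longrightarrow> (\<And>u v. u \<in> S \<Longrightarrow> v \<in> S \<Longrightarrow> u \<otimes>\<^bsub>Ob\<^esub> v \<in> S) \<Longrightarrow>
      (\<And>u. u \<in> S \<Longrightarrow> \<ominus>\<^bsub>Ob\<^esub> u \<in> S) \<Longrightarrow> (\<And>u. u \<in> S \<Longrightarrow> u \<in> Units Ob \<Longrightarrow> inv\<^bsub>Ob\<^esub> u \<in> S) \<Longrightarrow>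
      carrier Ob \<subseteq> S"
  shows "carrier k = generate_field k (\<rho> ` K \<union> a ` {..<l})"
    and "module_basis k (kaehler_module KR k \<rho>) l (\<lambda>i. kaehler_d KR k \<rho> (a i))"
proof -
  let ?y = "\<lambda>i. \<iota> (x i) \<ominus>\<^bsub>B\<^esub> s (\<sigma> (a i))"
  have yB: "?y i \<in> carrier B" if "i < l" for i
    using x[OF that] ring_hom_closed[OF \<sigma> a[OF that]] by simp
  have y: "?y i \<in> n" if "i < l" for i
  proof (rule coset_closedD[OF yB[OF that]])
    show "D +>\<^bsub>nM\<^esub> ?y i \<in> carrier cot.Q"
      by (rule mp[OF spec[OF conjunct1[OF basis[unfolded module_basis_def]]] that])
  qed
  have ax: "a i = res (x i)" if "i < l" for i by (rule residue_eqI[OF x[OF that] a[OF that] y[OF that]])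
  have y\<delta>: "?y i = \<delta> (x i)" if "i < l" for i unfolding \<delta>_def r_def ax[OF that] ..
  have sum: "(\<Oplus>\<^bsub>B\<^esub>i\<in>{..<l}. s (c i) \<otimes>\<^bsub>B\<^esub> \<delta> (x i)) = (\<Oplus>\<^bsub>B\<^esub>i\<in>{..<l}. s (c i) \<otimes>\<^bsub>B\<^esub> ?y i)"
    if "\<forall>i<l. c i \<in> carrier L" for c
    by (rule B.finsum_cong') (use that yB y\<delta> in auto)
  have *: "(\<forall>c. (\<forall>i<l. c i \<in> carrier L) \<longrightarrow> (\<Oplus>\<^bsub>B\<^esub>i\<in>{..<l}. s (c i) \<otimes>\<^bsub>B\<^esub> ?y i) \<in> D \<longrightarrow> (\<forall>i<l. c i = \<zero>\<^bsub>L\<^esub>)) \<and>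
    (\<forall>t\<in>n. \<exists>c. (\<forall>i<l. c i \<in> carrier L) \<and> t \<ominus>\<^bsub>B\<^esub> (\<Oplus>\<^bsub>B\<^esub>i\<in>{..<l}. s (c i) \<otimes>\<^bsub>B\<^esub> ?y i) \<in> D)"
    by (rule iffD1[OF cotangent_basis_iff[of l ?y] basis]) (rule y)
  have indep: "\<forall>i<l. c i = \<zero>\<^bsub>L\<^esub>"
    if "\<forall>i<l. c i \<in> carrier L" "(\<Oplus>\<^bsub>B\<^esub>i\<in>{..<l}. s (c i) \<otimes>\<^bsub>B\<^esub> \<delta> (x i)) \<in> D" for c
    by (rule mp[OF mp[OF spec[OF conjunct1[OF *]] that(1)] that(2)[unfolded sum[OF that(1)]]])
  have span: "\<exists>c. (\<forall>i<l. c i \<in> carrier L) \<and> t \<ominus>\<^bsub>B\<^esub> (\<Oplus>\<^bsub>B\<^esub>i\<in>{..<l}. s (c i) \<otimes>\<^bsub>B\<^esub> \<delta> (x i)) \<in> D"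
    if t: "t \<in> n" for t
  proof -
    obtain c where c: "\<forall>i<l. c i \<in> carrier L" "t \<ominus>\<^bsub>B\<^esub> (\<Oplus>\<^bsub>B\<^esub>i\<in>{..<l}. s (c i) \<otimes>\<^bsub>B\<^esub> ?y i) \<in> D"
      using bspec[OF conjunct2[OF *] t] by (elim exE conjE)
    show ?thesis by (intro exI[of _ c] conjI c(1)) (use c in \<open>simp only: sum\<close>)
  qed
  note main = residue_field_generated_and_basis[of l x G, OF x indep span G fg]
  have im: "(\<lambda>i. res (x i)) ` {..<l} = a ` {..<l}" by (rule image_cong) (simp_all add: ax)
  show "carrier k = generate_field k (\<rho> ` K \<union> a ` {..<l})" by (rule main(1)[unfolded im])
  have "module_basis k (kaehler_module KR k \<rho>) l (\<lambda>i. kaehler_d KR k \<rho> (res (x i))) \<longleftrightarrow>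
      module_basis k (kaehler_module KR k \<rho>) l (\<lambda>i. kaehler_d KR k \<rho> (a i))"
    unfolding kaehler_module_def kaehler_d_def
    by (rule \<Omega>.QF.module_basis_quotient_cong) (simp_all add: ax[symmetric] a)
  then show "module_basis k (kaehler_module KR k \<rho>) l (\<lambda>i. kaehler_d KR k \<rho> (a i))"
    by (rule iffD1[OF _ main(2)])
qed

end

text \<open>Instantiates the abstract base change. The power condition is pure inseparability of
  \<open>L\<close> over \<open>K\<close>; the extension property is the universal property for the
  pairing of \<open>x\<close> and \<open>c\<close> to the product of \<open>g x\<close> and
  \<open>c\<close>, with \<open>L\<close> regarded as a \<open>K\<close>-module.\<close>

lemma insep_base_change_tensor_product:
  fixes L :: "('l, 'm) ring_scheme" and Ob :: "('a, 'n) ring_scheme" and K :: "'l set" and \<phi> :: "'l \<Rightarrow> 'a"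
  defines "KR \<equiv> L\<lparr>carrier := K\<rparr>"
  assumes L: "algebraic_closure L K" and p: "Factorial_Ring.prime p" "add_pow L p \<one>\<^bsub>L\<^esub> = \<zero>\<^bsub>L\<^esub>"
    and sep: "separably_closed_in L K" and Ob: "local_ring Ob" and \<phi>: "\<phi> \<in> ring_hom KR Ob"
  shows "insep_base_change L Ob (tensor_product KR Ob \<phi> L (\<lambda>c. c)) K p \<phi>
    (\<lambda>x. pure_tensor KR Ob \<phi> L (\<lambda>c. c) x \<one>\<^bsub>L\<^esub>) (\<lambda>c. pure_tensor KR Ob \<phi> L (\<lambda>c. c) \<one>\<^bsub>Ob\<^esub> c)"
proof -
  let ?t = "pure_tensor KR Ob \<phi> L (\<lambda>c. c)" and ?T = "tensor_product KR Ob \<phi> L (\<lambda>c. c)"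
  interpret L: algebraic_closure L K by (rule L)
  have K: "subfield K L" by (rule L.subfield_axioms)
  have KL: "K \<subseteq> carrier L" by (rule subfieldE(3)[OF K])
  have carrier_KR: "carrier KR = K" by (simp add: KR_def)
  have Ob_cring: "cring Ob" using Ob by (simp add: local_ring_def)
  interpret Ob: cring Ob by (rule Ob_cring)
  have KR: "cring KR"
    using L.subfield_iff(2)[OF K] unfolding KR_def field_def domain_def by blast
  have id: "(\<lambda>c. c) \<in> ring_hom KR L"
    by (rule ring_hom_memI) (use KL in \<open>auto simp: KR_def\<close>)
  interpret algebra_pair KR Ob L \<phi> "\<lambda>c. c"
    by (intro algebra_pair.intro algebra_pair_axioms.intro KR Ob_cring L.is_cring \<phi> id)
  have LM: "module KR (restrict_scalars L (\<lambda>c. c))"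
    by (rule module_restrict_scalars[OF KR L.is_cring id])
  show ?thesis
  proof (intro insep_base_change.intro insep_base_change_axioms.intro)
    show "field L" by (rule L.field_axioms)
    show "cring Ob" by (rule Ob_cring)
    show "cring ?T" by (rule T_cring)
    show "subfield K L" by (rule K)
    show "Factorial_Ring.prime p" "add_pow L p \<one>\<^bsub>L\<^esub> = \<zero>\<^bsub>L\<^esub>" by (rule p)+
    show "\<exists>n. c [^]\<^bsub>L\<^esub> (p ^ n) \<in> K" if "c \<in> carrier L" for c
      by (rule L.purely_inseparable[OF p sep that])
    show "local_ring Ob" by (rule Ob)
    show "\<phi> \<in> ring_hom (L\<lparr>carrier := K\<rparr>) Ob" using \<phi> unfolding KR_def .
    show "(\<lambda>x. ?t x \<one>\<^bsub>L\<^esub>) \<in> ring_hom Ob ?T" by (rule inl_hom)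
    show "(\<lambda>c. ?t \<one>\<^bsub>Ob\<^esub> c) \<in> ring_hom L ?T" by (rule inr_hom)
    show "?t (\<phi> c) \<one>\<^bsub>L\<^esub> = ?t \<one>\<^bsub>Ob\<^esub> c" if "c \<in> K" for c by (rule pure_scalar) (use that carrier_KR in simp)
    show "Q t" if t: "t \<in> carrier ?T" and Q: "Q \<zero>\<^bsub>?T\<^esub>"
      and step: "\<And>x c t. x \<in> carrier Ob \<Longrightarrow> c \<in> carrier L \<Longrightarrow> t \<in> carrier ?T \<Longrightarrow> Q t \<Longrightarrow>
        Q (?t x \<one>\<^bsub>L\<^esub> \<otimes>\<^bsub>?T\<^esub> (?t \<one>\<^bsub>Ob\<^esub> c) \<oplus>\<^bsub>?T\<^esub> t)" for t Q
      using t
    proof (induction t rule: tensor_induct)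
      case (add x c t)
      show ?case using step[OF add] unfolding pure_eq_mult[OF add(1,2), symmetric] .
    qed (rule Q)
    fix g assume g: "\<And>x. x \<in> carrier Ob \<Longrightarrow> g x \<in> carrier L"
      "\<And>x y. x \<in> carrier Ob \<Longrightarrow> y \<in> carrier Ob \<Longrightarrow> g (x \<oplus>\<^bsub>Ob\<^esub> y) = g x \<oplus>\<^bsub>L\<^esub> g y"
      "\<And>c x. c \<in> K \<Longrightarrow> x \<in> carrier Ob \<Longrightarrow> g (\<phi> c \<otimes>\<^bsub>Ob\<^esub> x) = c \<otimes>\<^bsub>L\<^esub> g x"
    have "\<exists>\<Phi>. (\<forall>t\<in>carrier ?T. \<Phi> t \<in> carrier (restrict_scalars L (\<lambda>c. c))) \<and>
      (\<forall>t\<in>carrier ?T. \<forall>u\<in>carrier ?T. \<Phi> (t \<oplus>\<^bsub>?T\<^esub> u) = \<Phi> t \<oplus>\<^bsub>restrict_scalars L (\<lambda>c. c)\<^esub> \<Phi> u) \<and>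
      (\<forall>x\<in>carrier Ob. \<forall>c\<in>carrier L. \<Phi> (?t x c) = g x \<otimes>\<^bsub>L\<^esub> c)"
    proof (rule tensor_universal[OF LM, where \<beta> = "\<lambda>x c. g x \<otimes>\<^bsub>L\<^esub> c"],
        unfold restrict_scalars_simps carrier_KR)
      fix c x d assume c: "c \<in> K" "x \<in> carrier Ob" "d \<in> carrier L"
      then have cL: "c \<in> carrier L" using KL by blast
      show "g (\<phi> c \<otimes>\<^bsub>Ob\<^esub> x) \<otimes>\<^bsub>L\<^esub> d = c \<otimes>\<^bsub>L\<^esub> (g x \<otimes>\<^bsub>L\<^esub> d)"
        using c cL g(1) by (simp add: g(3) L.m_assoc)
      show "g x \<otimes>\<^bsub>L\<^esub> (c \<otimes>\<^bsub>L\<^esub> d) = c \<otimes>\<^bsub>L\<^esub> (g x \<otimes>\<^bsub>L\<^esub> d)"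
        using c cL g(1) by (simp add: L.m_lcomm)
    qed (simp_all add: g(1,2) L.l_distr L.r_distr)
    then obtain \<Phi> where \<Phi>: "\<forall>t\<in>carrier ?T. \<Phi> t \<in> carrier L"
      "\<forall>t\<in>carrier ?T. \<forall>u\<in>carrier ?T. \<Phi> (t \<oplus>\<^bsub>?T\<^esub> u) = \<Phi> t \<oplus>\<^bsub>L\<^esub> \<Phi> u"
      "\<forall>x\<in>carrier Ob. \<forall>c\<in>carrier L. \<Phi> (?t x c) = g x \<otimes>\<^bsub>L\<^esub> c"
      unfolding restrict_scalars_simps by (elim exE conjE)
    have "\<Phi> (?t x \<one>\<^bsub>L\<^esub> \<otimes>\<^bsub>?T\<^esub> (?t \<one>\<^bsub>Ob\<^esub> c)) = g x \<otimes>\<^bsub>L\<^esub> c"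
      if "x \<in> carrier Ob" "c \<in> carrier L" for x c
      using bspec[OF bspec[OF \<Phi>(3) that(1)] that(2)] unfolding pure_eq_mult[OF that, symmetric] .
    then show "\<exists>\<Phi>. (\<forall>t\<in>carrier ?T. \<Phi> t \<in> carrier L) \<and>
        (\<forall>t\<in>carrier ?T. \<forall>u\<in>carrier ?T. \<Phi> (t \<oplus>\<^bsub>?T\<^esub> u) = \<Phi> t \<oplus>\<^bsub>L\<^esub> \<Phi> u) \<and>
        (\<forall>x\<in>carrier Ob. \<forall>c\<in>carrier L. \<Phi> (?t x \<one>\<^bsub>L\<^esub> \<otimes>\<^bsub>?T\<^esub> (?t \<one>\<^bsub>Ob\<^esub> c)) = g x \<otimes>\<^bsub>L\<^esub> c)"
      using \<Phi>(1,2) by (intro exI[of _ \<Phi>] conjI ballI) simp_all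
  qed
qed

theorem proposition3p3:
  fixes Kbar :: "'l ring" and K :: "'l set" and p :: nat
    and Z :: "('z, 'b) ringed_space" and \<kappa> :: "'l \<Rightarrow> 'b"
    and ZKbar :: "('y, 'c) ringed_space" and \<kappa>' :: "'l \<Rightarrow> 'c"
    and h :: "'y \<Rightarrow> 'z" and \<theta> :: "'z set \<Rightarrow> 'b \<Rightarrow> 'c"
    and P :: 'z and \<sigma> :: "('z set \<times> 'b) set set \<Rightarrow> 'l"
    and l :: nat and x :: "nat \<Rightarrow> ('z set \<times> 'b) set" and a :: "nat \<Rightarrow> ('z set \<times> 'b) set set"
  assumes "algebraic_closure Kbar K"
    and "Factorial_Ring.prime p" and "[p] \<cdot>\<^bsub>Kbar\<^esub> \<one>\<^bsub>Kbar\<^esub> = \<zero>\<^bsub>Kbar\<^esub>"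
    and "\<not> perfect_subfield Kbar p K"
    and "separably_closed_in Kbar K"
    and "scheme_over (Kbar\<lparr>carrier := K\<rparr>) Z \<kappa>"
    and "finite_type (Kbar\<lparr>carrier := K\<rparr>) Z \<kappa>"
    and "base_change (Kbar\<lparr>carrier := K\<rparr>) Z \<kappa> Kbar ZKbar \<kappa>' h \<theta>"
    and "integral_scheme ZKbar"
    and "closed_point Z P"
    and "residue_inclusion (Kbar\<lparr>carrier := K\<rparr>) Z \<kappa> Kbar P \<sigma>"
    and "\<forall>i<l. x i \<in> carrier (stalk Z P)"
    and "\<forall>i<l. a i \<in> carrier (residue_field (stalk Z P))"
    and "module_basis Kbar (relative_cotangent_space (Kbar\<lparr>carrier := K\<rparr>) Z \<kappa> Kbar P) l
           (\<lambda>i. cotangent_class (Kbar\<lparr>carrier := K\<rparr>) Z \<kappa> Kbar P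
                  (from_stalk (Kbar\<lparr>carrier := K\<rparr>) Z \<kappa> Kbar P (x i)
                   \<ominus>\<^bsub>bc_stalk (Kbar\<lparr>carrier := K\<rparr>) Z \<kappa> Kbar P\<^esub>
                   from_scalar (Kbar\<lparr>carrier := K\<rparr>) Z \<kappa> Kbar P (\<sigma> (a i))))"
  shows "carrier (residue_field (stalk Z P)) =
           generate_field (residue_field (stalk Z P)) (residue_field_map Z \<kappa> P ` K \<union> a ` {..<l})
       \<and> module_basis (residue_field (stalk Z P))
           (kaehler_module (Kbar\<lparr>carrier := K\<rparr>) (residue_field (stalk Z P)) (residue_field_map Z \<kappa> P)) l
           (\<lambda>i. kaehler_d (Kbar\<lparr>carrier := K\<rparr>) (residue_field (stalk Z P)) (residue_field_map Z \<kappa> P) (a i))"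
proof -
  let ?KR = "Kbar\<lparr>carrier := K\<rparr>"
  let ?\<iota> = "from_stalk ?KR Z \<kappa> Kbar P" and ?s = "from_scalar ?KR Z \<kappa> Kbar P"
  let ?B = "bc_stalk ?KR Z \<kappa> Kbar P" and ?\<phi> = "stalk_map Z \<kappa> P"
  have P: "P \<in> points Z" using assms(10) by (simp add: closed_point_def)
  have Ob: "local_ring (stalk Z P)" using assms(6) P by (simp add: scheme_over_def scheme_def)
  have bc: "insep_base_change Kbar (stalk Z P) ?B K p ?\<phi> ?\<iota> ?s"
    unfolding bc_stalk_def from_stalk_def[abs_def] from_scalar_def[abs_def]
    by (rule insep_base_change_tensor_product[OF assms(1,2,3,5) Ob stalk_map_hom[OF assms(6) P]])
  interpret insep_residue Kbar "stalk Z P" ?B K p ?\<phi> ?\<iota> ?s \<sigma>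
    using assms(11) unfolding residue_inclusion_def
    by (intro insep_residue.intro bc insep_residue_axioms.intro) simp_all
  \<comment> \<open>The cotangent space of the statement and the quotient \<open>cot.Q\<close> of
    the abstract setting coincide by unfolding definitions.\<close>
  have basis: "module_basis Kbar cot.Q l (\<lambda>i. D +>\<^bsub>nM\<^esub> (?\<iota> (x i) \<ominus>\<^bsub>?B\<^esub> ?s (\<sigma> (a i))))"
    using assms(14)
    unfolding relative_cotangent_space_def cotangent_class_def bc_max_ideal_module_def bc_denominator_def
      bc_module_def .
  obtain G where G: "finite G" "G \<subseteq> carrier (stalk Z P)"
    and fg: "\<forall>S\<subseteq>carrier (stalk Z P). ?\<phi> ` carrier ?KR \<subseteq> S \<longrightarrow> G \<subseteq> S \<longrightarrow>
      (\<forall>u\<in>S. \<forall>v\<in>S. u \<oplus>\<^bsub>stalk Z P\<^esub> v \<in> S) \<longrightarrow> (\<forall>u\<in>S. \<forall>v\<in>S. u \<otimes>\<^bsub>stalk Z P\<^esub> v \<in> S) \<longrightarrow>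
      (\<forall>u\<in>S. \<ominus>\<^bsub>stalk Z P\<^esub> u \<in> S) \<longrightarrow> (\<forall>u\<in>S. u \<in> Units (stalk Z P) \<longrightarrow> inv\<^bsub>stalk Z P\<^esub> u \<in> S) \<longrightarrow>
      carrier (stalk Z P) \<subseteq> S"
    using stalk_finitely_generated[OF KR_cring assms(6,7) P] by (elim exE conjE) (rule that)
  have x: "x i \<in> carrier (stalk Z P)" and a: "a i \<in> carrier k" if "i < l" for i
    using assms(12,13) that by simp_all
  have \<rho>: "residue_field_map Z \<kappa> P = \<rho>" by (intro ext) (rule residue_field_map_def)
  have fg': "carrier (stalk Z P) \<subseteq> S"
    if "S \<subseteq> carrier (stalk Z P)" "?\<phi> ` K \<subseteq> S" "G \<subseteq> S"
      "\<And>u v. u \<in> S \<Longrightarrow> v \<in> S \<Longrightarrow> u \<oplus>\<^bsub>stalk Z P\<^esub> v \<in> S" "\<And>u v. u \<in> S \<Longrightarrow> v \<in> S \<Longrightarrow> u \<otimes>\<^bsub>stalk Z P\<^esub> v \<in> S"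
      "\<And>u. u \<in> S \<Longrightarrow> \<ominus>\<^bsub>stalk Z P\<^esub> u \<in> S" "\<And>u. u \<in> S \<Longrightarrow> u \<in> Units (stalk Z P) \<Longrightarrow> inv\<^bsub>stalk Z P\<^esub> u \<in> S"
    for S
    using fg[rule_format, of S] that by simp
  show ?thesis
    unfolding \<rho>
    by (rule conjI; rule residue_field_generated_and_basis_of_cotangent_basis[of l x a G, OF x a basis G fg'])
qed

end
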